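(* Let $X \subset \mathbb{P}^n$ be a general cubic hypersurface over $\mathbb{C}$ of dimension $n-1$ at most $7$ (and at least $1$). Then there is an Ulrich sheaf of rank $9$ on $X$. (Equivalently: for each $n$ with $2 \le n \le 8$ there is a nonempty Zariski open subset $U$ of the projective space of nonzero cubic forms in $\mathbb{C}[x_0,\dots,x_n]$ modulo scalars such that for every $[f]\in U$ the hypersurface $X=V(f)\subset\mathbb{P}^n$ carries an Ulrich sheaf of rank $9$.)
   Context: The ground field is $\mathbb{C}$. Let $S=\mathbb{C}[x_0,\dots,x_n]$ be the homogeneous coordinate ring of $\mathbb{P}^n$, and let $X\subset\mathbb{P}^n$ be a connected projective variety. A coherent sheaf $\mathcal{E}$ supported on $X$ (a coherent $\mathcal{O}_X$-module) is called an Ulrich sheaf if its twisted section module $\Gamma_*(\mathcal{E})=\bigoplus_{j\in\mathbb{Z}}H^0(X,\mathcal{E}(j))$ is an Ulrich module, that is, its minimal graded free $S$-resolution $$0\to F_c\to\cdots\to F_1\to F_0\to\Gamma_*(\mathcal{E})\to 0$$ is completely linear: $F_i\simeq\bigoplus S(-i)$ is generated in degree $i$ for every $0\le i\le c=n-\dim X$. For a hypersurface, $c=1$. The rank of $\mathcal{E}$ is its rank as a sheaf of $\mathcal{O}_X$-modules on the integral variety $X$. "General" means: in a nonempty Zariski open subset of the parameter space of cubic forms. *)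

theory Defs
  imports
    "HOL-Library.Poly_Mapping"
    "HOL-Library.FuncSet"
    "HOL-Computational_Algebra.Factorial_Ring"
    "HOL-Analysis.Abstract_Topology"
    "HOL-Algebra.Module"
begin

section \<open>Polynomials and forms\<close>

text \<open>Polynomials over the complex numbers in variables indexed by \<^typ>\<open>'v\<close>: finitely supported
  functions from monomials to coefficients, a monomial being a finitely supported exponent
  function. The ring structure is that of \<^theory>\<open>HOL-Library.Poly_Mapping\<close>. The factors of a nonzero
  polynomial only involve its own variables, so that irreducibility in this ring and in
  $C[x_0, \ldots, x_n]$ agree.\<close>

type_synonym 'v mpoly = "('v \<Rightarrow>\<^sub>0 nat) \<Rightarrow>\<^sub>0 complex"

definition mdeg :: "('v \<Rightarrow>\<^sub>0 nat) \<Rightarrow> nat" where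
  "mdeg m = (\<Sum>v\<in>Poly_Mapping.keys m. Poly_Mapping.lookup m v)"

definition peval :: "'v mpoly \<Rightarrow> ('v \<Rightarrow> complex) \<Rightarrow> complex" where
  "peval p x = (\<Sum>m\<in>Poly_Mapping.keys p. Poly_Mapping.lookup p m *
     (\<Prod>v\<in>Poly_Mapping.keys m. x v ^ Poly_Mapping.lookup m v))"

definition monomials :: "'v set \<Rightarrow> nat \<Rightarrow> ('v \<Rightarrow>\<^sub>0 nat) set" where
  "monomials I d = {m. Poly_Mapping.keys m \<subseteq> I \<and> mdeg m = d}"

text \<open>Homogeneous polynomials of degree \<open>d\<close> in the variables from \<open>I\<close>, including 0.\<close>

definition forms :: "'v set \<Rightarrow> nat \<Rightarrow> 'v mpoly set" where
  "forms I d = {p. Poly_Mapping.keys p \<subseteq> monomials I d}"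

definition hcomp :: "nat \<Rightarrow> 'v mpoly \<Rightarrow> 'v mpoly" where
  "hcomp d p = (\<Sum>m\<in>{m \<in> Poly_Mapping.keys p. mdeg m = d}.
     Poly_Mapping.single m (Poly_Mapping.lookup p m))"

text \<open>The homogeneous coordinate ring $S = C[x_0, \ldots, x_n]$ of projective $n$-space.\<close>

definition coord_ring :: "nat \<Rightarrow> nat mpoly ring" where
  "coord_ring n = \<lparr>carrier = {p. \<forall>m\<in>Poly_Mapping.keys p. Poly_Mapping.keys m \<subseteq> {..n}},
     mult = (*), one = 1, zero = 0, add = (+)\<rparr>"


section \<open>Projective space and the Zariski topology\<close>

text \<open>A point of the projective space with homogeneous coordinates indexed by \<open>I\<close> is the set of all
  its coordinate vectors. Projective $n$-space is the case \<open>I = {..n}\<close>; the projective space of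
  nonzero forms of degree \<open>d\<close> modulo scalars is the case \<open>I = monomials {..n} d\<close>, a form being
  identified with its vector of coefficients.\<close>

type_synonym 'v point = "('v \<Rightarrow> complex) set"

definition proj_class :: "('v \<Rightarrow> complex) \<Rightarrow> 'v point" where
  "proj_class v = {(\<lambda>i. c * v i) |c. c \<noteq> 0}"

definition proj_space :: "'v set \<Rightarrow> 'v point set" where
  "proj_space I = proj_class ` {v. (\<exists>i. v i \<noteq> 0) \<and> (\<forall>i. i \<notin> I \<longrightarrow> v i = 0)}"

definition nonvanishing :: "'v set \<Rightarrow> 'v mpoly \<Rightarrow> 'v point set" where
  "nonvanishing I p = {P \<in> proj_space I. \<forall>v\<in>P. peval p v \<noteq> 0}"

definition zero_locus :: "'v set \<Rightarrow> 'v mpoly \<Rightarrow> 'v point set" where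
  "zero_locus I p = {P \<in> proj_space I. \<forall>v\<in>P. peval p v = 0}"

definition zariski :: "'v set \<Rightarrow> 'v point topology" where
  "zariski I = topology_generated_by {nonvanishing I p |p d. p \<in> forms I d}"

abbreviation zar_open :: "nat \<Rightarrow> nat point set \<Rightarrow> nat point set \<Rightarrow> bool" where
  "zar_open n X U \<equiv> openin (subtopology (zariski {..n}) X) U"

definition chart :: "nat \<Rightarrow> nat point set \<Rightarrow> nat \<Rightarrow> nat point set" where
  "chart n X i = {P \<in> X. \<forall>v\<in>P. v i \<noteq> 0}"


section \<open>Regular functions\<close>

text \<open>Functions on a subset \<open>U\<close> of projective space are extended by 0 outside \<open>U\<close>.\<close>

definition restrict0 :: "nat point set \<Rightarrow> (nat point \<Rightarrow> complex) \<Rightarrow> nat point \<Rightarrow> complex" where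
  "restrict0 U a = (\<lambda>P. if P \<in> U then a P else 0)"

text \<open>The function on \<open>U\<close> induced by a function of the homogeneous coordinates; used only for
  \<open>h\<close> that are homogeneous of degree 0, for which the choice of coordinates is irrelevant.\<close>

definition fun_on :: "nat point set \<Rightarrow> ((nat \<Rightarrow> complex) \<Rightarrow> complex) \<Rightarrow> nat point \<Rightarrow> complex" where
  "fun_on U h = restrict0 U (\<lambda>P. h (SOME v. v \<in> P))"

definition regular_on :: "nat \<Rightarrow> nat point set \<Rightarrow> nat point set \<Rightarrow> (nat point \<Rightarrow> complex) \<Rightarrow> bool" where
  "regular_on n X U a \<longleftrightarrow>
     (\<forall>P\<in>U. \<exists>V. zar_open n X V \<and> P \<in> V \<and> V \<subseteq> U \<and>
        (\<exists>d. \<exists>F\<in>forms {..n} d. \<exists>G\<in>forms {..n} d.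
           \<forall>Q\<in>V. \<forall>v\<in>Q. peval G v \<noteq> 0 \<and> a Q = peval F v / peval G v))"

text \<open>The ring of sections over \<open>U\<close> of the structure sheaf of \<open>X\<close>.\<close>

definition reg :: "nat \<Rightarrow> nat point set \<Rightarrow> nat point set \<Rightarrow> (nat point \<Rightarrow> complex) ring" where
  "reg n X U = \<lparr>carrier = {a. regular_on n X U a \<and> (\<forall>P. P \<notin> U \<longrightarrow> a P = 0)},
     mult = (\<lambda>a b P. a P * b P), one = restrict0 U (\<lambda>_. 1),
     zero = (\<lambda>_. 0), add = (\<lambda>a b P. a P + b P)\<rparr>"


section \<open>Sheaves of modules over the structure sheaf\<close>

record 'e modsheaf =
  sections :: "nat point set \<Rightarrow> (nat point \<Rightarrow> complex, 'e) module"
  restr :: "nat point set \<Rightarrow> nat point set \<Rightarrow> 'e \<Rightarrow> 'e"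

locale module_sheaf =
  fixes n :: nat and X :: "nat point set" and E :: "'e modsheaf"
  assumes sections_module:
      "zar_open n X U \<Longrightarrow> Module.module (reg n X U) (sections E U)"
    and restr_closed:
      "\<lbrakk>zar_open n X U; zar_open n X V; V \<subseteq> U; s \<in> carrier (sections E U)\<rbrakk>
       \<Longrightarrow> restr E U V s \<in> carrier (sections E V)"
    and restr_add:
      "\<lbrakk>zar_open n X U; zar_open n X V; V \<subseteq> U;
        s \<in> carrier (sections E U); t \<in> carrier (sections E U)\<rbrakk>
       \<Longrightarrow> restr E U V (s \<oplus>\<^bsub>sections E U\<^esub> t) = restr E U V s \<oplus>\<^bsub>sections E V\<^esub> restr E U V t"
    and restr_smult:
      "\<lbrakk>zar_open n X U; zar_open n X V; V \<subseteq> U;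
        a \<in> carrier (reg n X U); s \<in> carrier (sections E U)\<rbrakk>
       \<Longrightarrow> restr E U V (a \<odot>\<^bsub>sections E U\<^esub> s) = restrict0 V a \<odot>\<^bsub>sections E V\<^esub> restr E U V s"
    and restr_id:
      "\<lbrakk>zar_open n X U; s \<in> carrier (sections E U)\<rbrakk> \<Longrightarrow> restr E U U s = s"
    and restr_restr:
      "\<lbrakk>zar_open n X U; zar_open n X V; zar_open n X W; V \<subseteq> U; W \<subseteq> V;
        s \<in> carrier (sections E U)\<rbrakk>
       \<Longrightarrow> restr E V W (restr E U V s) = restr E U W s"
    and glue:
      "\<lbrakk>\<And>U. U \<in> C \<Longrightarrow> zar_open n X U;
        \<And>U. U \<in> C \<Longrightarrow> g U \<in> carrier (sections E U);
        \<And>U V. \<lbrakk>U \<in> C; V \<in> C\<rbrakk> \<Longrightarrow> restr E U (U \<inter> V) (g U) = restr E V (U \<inter> V) (g V)\<rbrakk>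
       \<Longrightarrow> \<exists>!s. s \<in> carrier (sections E (\<Union>C)) \<and> (\<forall>U\<in>C. restr E (\<Union>C) U s = g U)"

definition lincomb :: "('a, 'b) module \<Rightarrow> nat \<Rightarrow> (nat \<Rightarrow> 'a) \<Rightarrow> (nat \<Rightarrow> 'b) \<Rightarrow> 'b" where
  "lincomb M k a s = (\<Oplus>\<^bsub>M\<^esub>i\<in>{..<k}. a i \<odot>\<^bsub>M\<^esub> s i)"

text \<open>Finite type: around every point there are finitely many sections such that the induced
  morphism from a finite free sheaf is surjective (as a morphism of sheaves).\<close>

definition finite_type :: "nat \<Rightarrow> nat point set \<Rightarrow> 'e modsheaf \<Rightarrow> bool" where
  "finite_type n X E \<longleftrightarrow>
     (\<forall>P\<in>X. \<exists>U k s. zar_open n X U \<and> P \<in> U \<and> (\<forall>i<k. s i \<in> carrier (sections E U)) \<and>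
        (\<forall>V t Q. zar_open n X V \<and> V \<subseteq> U \<and> t \<in> carrier (sections E V) \<and> Q \<in> V \<longrightarrow>
           (\<exists>W a. zar_open n X W \<and> Q \<in> W \<and> W \<subseteq> V \<and> (\<forall>i<k. a i \<in> carrier (reg n X W)) \<and>
              restr E V W t = lincomb (sections E W) k a (\<lambda>i. restr E U W (s i)))))"

text \<open>The sheaf of relations between \<open>m\<close> sections \<open>s i\<close> of \<open>E\<close> over \<open>U\<close>, that is, the kernel of
  the induced morphism to \<open>E\<close> from the free sheaf of rank \<open>m\<close> on \<open>U\<close>.\<close>

definition relation_sheaf ::
  "nat \<Rightarrow> nat point set \<Rightarrow> 'e modsheaf \<Rightarrow> nat \<Rightarrow> (nat \<Rightarrow> 'e) \<Rightarrow> (nat \<Rightarrow> nat point \<Rightarrow> complex) modsheaf" where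
  "relation_sheaf n U E m s = \<lparr>
     sections = (\<lambda>V. \<lparr>
       carrier = {a \<in> {..<m} \<rightarrow>\<^sub>E carrier (reg n U V).
         lincomb (sections E V) m a (\<lambda>i. restr E U V (s i)) = \<zero>\<^bsub>sections E V\<^esub>},
       mult = undefined, one = undefined,
       zero = (\<lambda>i\<in>{..<m}. \<lambda>_. 0),
       add = (\<lambda>a b. \<lambda>i\<in>{..<m}. \<lambda>P. a i P + b i P),
       smult = (\<lambda>b a. \<lambda>i\<in>{..<m}. \<lambda>P. b P * a i P)\<rparr>),
     restr = (\<lambda>V W a. \<lambda>i\<in>{..<m}. restrict0 W (a i))\<rparr>"

definition coherent :: "nat \<Rightarrow> nat point set \<Rightarrow> 'e modsheaf \<Rightarrow> bool" where
  "coherent n X E \<longleftrightarrow> module_sheaf n X E \<and> finite_type n X E \<and>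
     (\<forall>U m s. zar_open n X U \<and> (\<forall>i<m. s i \<in> carrier (sections E U)) \<longrightarrow>
        finite_type n U (relation_sheaf n U E m s))"

text \<open>The rank on an irreducible \<open>X\<close>: the dimension of the generic stalk (the direct limit of
  \<open>E(V)\<close> over the nonempty open \<open>V\<close>) over the function field of \<open>X\<close>. The germs of
  \<open>s 0, \<dots>, s (r - 1)\<close> form a basis of this stalk.\<close>

definition has_rank :: "nat \<Rightarrow> nat point set \<Rightarrow> 'e modsheaf \<Rightarrow> nat \<Rightarrow> bool" where
  "has_rank n X E r \<longleftrightarrow>
     (\<exists>U s. zar_open n X U \<and> U \<noteq> {} \<and> (\<forall>i<r. s i \<in> carrier (sections E U)) \<and>
        (\<forall>V a. zar_open n X V \<and> V \<noteq> {} \<and> V \<subseteq> U \<and> (\<forall>i<r. a i \<in> carrier (reg n X V)) \<and>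
           lincomb (sections E V) r a (\<lambda>i. restr E U V (s i)) = \<zero>\<^bsub>sections E V\<^esub> \<longrightarrow>
           (\<forall>i<r. a i = \<zero>\<^bsub>reg n X V\<^esub>)) \<and>
        (\<forall>V t. zar_open n X V \<and> V \<noteq> {} \<and> t \<in> carrier (sections E V) \<longrightarrow>
           (\<exists>W a. zar_open n X W \<and> W \<noteq> {} \<and> W \<subseteq> U \<inter> V \<and> (\<forall>i<r. a i \<in> carrier (reg n X W)) \<and>
              restr E V W t = lincomb (sections E W) r a (\<lambda>i. restr E U W (s i)))))"


section \<open>Serre twists and the module of twisted sections\<close>

text \<open>Serre's definition of the twist \<open>E(d)\<close>: the restrictions of \<open>E\<close> to the charts
  $x_i \neq 0$ are glued along multiplication by $(x_j / x_i)^d$. So a section is a family of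
  sections $s_i$ over the charts with $s_i = (x_j / x_i)^d s_j$ on the overlaps.\<close>

definition twist :: "nat \<Rightarrow> nat point set \<Rightarrow> 'e modsheaf \<Rightarrow> int \<Rightarrow> (nat \<Rightarrow> 'e) modsheaf" where
  "twist n X E d = \<lparr>
     sections = (\<lambda>U. \<lparr>
       carrier = {s \<in> (\<Pi>\<^sub>E i\<in>{..n}. carrier (sections E (U \<inter> chart n X i))).
         \<forall>i\<le>n. \<forall>j\<le>n. let W = U \<inter> chart n X i \<inter> chart n X j in
           restr E (U \<inter> chart n X i) W (s i) =
           fun_on W (\<lambda>v. (v j / v i) powi d) \<odot>\<^bsub>sections E W\<^esub>
             restr E (U \<inter> chart n X j) W (s j)},
       mult = undefined, one = undefined,
       zero = (\<lambda>i\<in>{..n}. \<zero>\<^bsub>sections E (U \<inter> chart n X i)\<^esub>),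
       add = (\<lambda>s t. \<lambda>i\<in>{..n}. s i \<oplus>\<^bsub>sections E (U \<inter> chart n X i)\<^esub> t i),
       smult = (\<lambda>a s. \<lambda>i\<in>{..n}.
         restrict0 (U \<inter> chart n X i) a \<odot>\<^bsub>sections E (U \<inter> chart n X i)\<^esub> s i)\<rparr>),
     restr = (\<lambda>U V s. \<lambda>i\<in>{..n}. restr E (U \<inter> chart n X i) (V \<inter> chart n X i) (s i))\<rparr>"

abbreviation global_sections ::
  "nat \<Rightarrow> nat point set \<Rightarrow> 'e modsheaf \<Rightarrow> int \<Rightarrow> (nat point \<Rightarrow> complex, nat \<Rightarrow> 'e) module" where
  "global_sections n X E d \<equiv> sections (twist n X E d) X"

text \<open>Multiplication by a form \<open>F\<close> of degree \<open>e\<close>, mapping global sections of \<open>E(d)\<close> to global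
  sections of \<open>E(d + e)\<close>: on the chart $x_i \neq 0$ it is multiplication by $F / x_i^e$.\<close>

definition form_mult ::
  "nat \<Rightarrow> nat point set \<Rightarrow> 'e modsheaf \<Rightarrow> nat \<Rightarrow> nat mpoly \<Rightarrow> (nat \<Rightarrow> 'e) \<Rightarrow> (nat \<Rightarrow> 'e)" where
  "form_mult n X E e F s = (\<lambda>i\<in>{..n}.
     fun_on (chart n X i) (\<lambda>v. peval F v / v i ^ e) \<odot>\<^bsub>sections E (chart n X i)\<^esub> s i)"

record ('a, 'b) graded_module = "('a, 'b) module" +
  degcomp :: "int \<Rightarrow> 'b set"

text \<open>The graded module over \<open>coord_ring n\<close> given by the direct sum of all $H^0(X, E(j))$.\<close>

definition twisted_section_module ::
  "nat \<Rightarrow> nat point set \<Rightarrow> 'e modsheaf \<Rightarrow> (nat mpoly, int \<Rightarrow> nat \<Rightarrow> 'e) graded_module" where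
  "twisted_section_module n X E = (let
     C = {s. (\<forall>j. s j \<in> carrier (global_sections n X E j)) \<and>
             finite {j. s j \<noteq> \<zero>\<^bsub>global_sections n X E j\<^esub>}}
   in \<lparr>carrier = C, mult = undefined, one = undefined,
     zero = (\<lambda>j. \<zero>\<^bsub>global_sections n X E j\<^esub>),
     add = (\<lambda>s t j. s j \<oplus>\<^bsub>global_sections n X E j\<^esub> t j),
     smult = (\<lambda>p s j. \<Oplus>\<^bsub>global_sections n X E j\<^esub>e\<in>mdeg ` Poly_Mapping.keys p.
        form_mult n X E e (hcomp e p) (s (j - int e))),
     degcomp = (\<lambda>d. {s \<in> C. \<forall>j. j \<noteq> d \<longrightarrow> s j = \<zero>\<^bsub>global_sections n X E j\<^esub>})\<rparr>)"


section \<open>Minimal graded free resolutions and Ulrich sheaves\<close>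

text \<open>The graded free module $\bigoplus_k S(-a_k)$, with its $k$-th generator in degree $a_k$.\<close>

definition graded_free :: "nat \<Rightarrow> int list \<Rightarrow> (nat mpoly, nat \<Rightarrow> nat mpoly) graded_module" where
  "graded_free n a = (let C = {..<length a} \<rightarrow>\<^sub>E carrier (coord_ring n)
   in \<lparr>carrier = C, mult = undefined, one = undefined,
     zero = (\<lambda>k\<in>{..<length a}. 0),
     add = (\<lambda>v w. \<lambda>k\<in>{..<length a}. v k + w k),
     smult = (\<lambda>p v. \<lambda>k\<in>{..<length a}. p * v k),
     degcomp = (\<lambda>d. {v \<in> C. \<forall>k<length a. \<forall>m\<in>Poly_Mapping.keys (v k). int (mdeg m) = d - a ! k})\<rparr>)"

definition graded_hom ::
  "nat \<Rightarrow> (nat mpoly, 'b) graded_module \<Rightarrow> (nat mpoly, 'c) graded_module \<Rightarrow> ('b \<Rightarrow> 'c) \<Rightarrow> bool" where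
  "graded_hom n M N h \<longleftrightarrow>
     h \<in> carrier M \<rightarrow> carrier N \<and>
     (\<forall>x\<in>carrier M. \<forall>y\<in>carrier M. h (x \<oplus>\<^bsub>M\<^esub> y) = h x \<oplus>\<^bsub>N\<^esub> h y) \<and>
     (\<forall>p\<in>carrier (coord_ring n). \<forall>x\<in>carrier M. h (p \<odot>\<^bsub>M\<^esub> x) = p \<odot>\<^bsub>N\<^esub> h x) \<and>
     (\<forall>d. h ` degcomp M d \<subseteq> degcomp N d)"

text \<open>\<open>0 \<rightarrow> F c \<rightarrow> \<dots> \<rightarrow> F 1 \<rightarrow> F 0 \<rightarrow> M \<rightarrow> 0\<close> with augmentation \<open>aug\<close>, differentials
  \<open>\<phi> i\<close> from \<open>F i\<close> to \<open>F (i - 1)\<close> and \<open>F i = graded_free n (a i)\<close>. Minimality: \<open>\<phi> i\<close> maps \<open>F i\<close> into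
  the homogeneous maximal ideal times \<open>F (i - 1)\<close>, i.e. all constant coefficients vanish.\<close>

definition minimal_free_resolution ::
  "nat \<Rightarrow> (nat mpoly, 'b) graded_module \<Rightarrow> nat \<Rightarrow> (nat \<Rightarrow> int list) \<Rightarrow>
   ((nat \<Rightarrow> nat mpoly) \<Rightarrow> 'b) \<Rightarrow> (nat \<Rightarrow> (nat \<Rightarrow> nat mpoly) \<Rightarrow> (nat \<Rightarrow> nat mpoly)) \<Rightarrow> bool" where
  "minimal_free_resolution n M c a aug \<phi> \<longleftrightarrow> (let
     F = (\<lambda>i. graded_free n (a i));
     im = (\<lambda>i. if i < c then \<phi> (Suc i) ` carrier (F (Suc i)) else {\<zero>\<^bsub>F i\<^esub>})
   in
     graded_hom n (F 0) M aug \<and>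
     (\<forall>i\<in>{1..c}. graded_hom n (F i) (F (i - 1)) (\<phi> i)) \<and>
     aug ` carrier (F 0) = carrier M \<and>
     {v \<in> carrier (F 0). aug v = \<zero>\<^bsub>M\<^esub>} = im 0 \<and>
     (\<forall>i\<in>{1..c}. {v \<in> carrier (F i). \<phi> i v = \<zero>\<^bsub>F (i - 1)\<^esub>} = im i) \<and>
     (\<forall>i\<in>{1..c}. \<forall>v\<in>carrier (F i). \<forall>k<length (a (i - 1)). Poly_Mapping.lookup (\<phi> i v k) 0 = 0))"

definition ulrich_module :: "nat \<Rightarrow> nat \<Rightarrow> (nat mpoly, 'b) graded_module \<Rightarrow> bool" where
  "ulrich_module n c M \<longleftrightarrow>
     (\<exists>a aug \<phi>. minimal_free_resolution n M c a aug \<phi> \<and> (\<forall>i\<le>c. set (a i) \<subseteq> {int i}))"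

text \<open>Here \<open>c\<close> is the codimension of \<open>X\<close> in projective \<open>n\<close>-space; for a hypersurface \<open>c = 1\<close>.\<close>

definition ulrich_sheaf :: "nat \<Rightarrow> nat point set \<Rightarrow> nat \<Rightarrow> 'e modsheaf \<Rightarrow> bool" where
  "ulrich_sheaf n X c E \<longleftrightarrow> coherent n X E \<and> ulrich_module n c (twisted_section_module n X E)"

text \<open>Sheaves have to take their sections in a fixed type. A coherent sheaf has at most continuum
  many sections over each open set, so any type of at least that cardinality admits a copy of every
  coherent sheaf.\<close>

type_synonym section_type = "(nat \<Rightarrow> complex) \<Rightarrow> nat \<Rightarrow> complex"

end

theory Submission
  imports
    Defs
    "HOL-Analysis.Continuum_Not_Denumerable"
    "HOL-Analysis.Topology_Euclidean_Space"
    "HOL-Computational_Algebra.Polynomial"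
    "HOL-Computational_Algebra.Polynomial_Factorial"
    "HOL-Computational_Algebra.Field_as_Ring"
    "HOL-Computational_Algebra.Fundamental_Theorem_Algebra"
begin

text \<open>The cubic invariant \<open>cubic\<close> of the 27-dimensional representation of $E_6$ satisfies a
  matrix identity \<open>hess x * cofactor x = cubic x\<close> with linear and quadratic factors of size 27.
  A general cubic form in at most 9 variables is the pullback of \<open>cubic\<close> under a linear map: the
  differential of the parametrization is onto at one explicit map, so the image is dense, and
  by Chevalley's theorem it contains a nonempty open set. The pulled back factors \<open>A\<close>, \<open>B\<close>
  form a matrix factorization of \<open>f\<close>, and the sheaf of kernels of \<open>A\<close>, that is, of images of
  \<open>B\<close>, is an Ulrich sheaf. Along \<open>f = 0\<close> the product of \<open>B\<close> with a derivative of \<open>A\<close>, divided by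
  the derivative of \<open>f\<close>, is a projection onto this kernel; its trace, hence the rank, is 9.\<close>

text \<open>Cohomology and function fields are replaced by explicit algebra. Two further open
  conditions on the cubic make this possible. A term in the cube of \<open>x n\<close> makes the
  coordinate ring of the cone free over the polynomials in the other coordinates, with basis 1,
  \<open>x n\<close>, \<open>x n ^ 2\<close>. The absence of a certain line excludes a root of
  \<open>f\<close> in \<open>x n\<close> that is rational in the other coordinates; this gives
  irreducibility. By freeness \<open>x 0\<close> and \<open>x 1\<close> form a regular sequence, so
  that a function which becomes polynomial after multiplication by a power of either is itself
  polynomial; this computes all twisted global sections. From \<open>A B = B A = f\<close> the
  resolution 0 -> S(-1)^27 -> S^27 then follows by cancelling \<open>f\<close>. For the rank, a
  multiple of the projection is factored through as few coordinates as possible, with forms as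
  entries. The number 9 is 27/3: the determinant of \<open>A\<close> has degree 27 and divides a
  power of the irreducible cubic, so it is a constant times the ninth power of \<open>f\<close>; in
  the proof 9 appears as a trace.\<close>

abbreviation "keys \<equiv> Poly_Mapping.keys"
abbreviation "lookup \<equiv> Poly_Mapping.lookup"
abbreviation "single \<equiv> Poly_Mapping.single"


section \<open>Polynomials as functions on affine space\<close>

definition meval :: "('v \<Rightarrow>\<^sub>0 nat) => ('v => complex) => complex" where
 "meval m x = (\<Prod>v\<in>keys m. x v ^ lookup m v)"

lemma meval_superset:
 assumes "finite T" "keys m \<subseteq> T"
 shows "meval m x = (\<Prod>v\<in>T. x v ^ lookup m v)"
 unfolding meval_def using assms
 by (intro prod.mono_neutral_left) (auto simp: in_keys_iff)

lemma meval_zero [simp]: "meval 0 x = 1"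
 by (simp add: meval_def)

lemma meval_add: "meval (m + m') x = meval m x * meval m' x"
proof -
 define T where "T = keys m \<union> keys m'"
 have T: "finite T" by (simp add: T_def)
 show ?thesis
  using Poly_Mapping.keys_add[of m m']
  by (subst (1 2 3) meval_superset[OF T])
   (auto simp: T_def lookup_add power_add prod.distrib)
qed

lemma meval_single: "meval (single v k) x = x v ^ k"
 by (simp add: meval_def)

lemma peval_meval: "peval p x = (\<Sum>m\<in>keys p. lookup p m * meval m x)"
 by (simp add: peval_def meval_def)

lemma peval_superset:
 assumes "finite T" "keys p \<subseteq> T"
 shows "peval p x = (\<Sum>m\<in>T. lookup p m * meval m x)"
 unfolding peval_meval using assms
 by (intro sum.mono_neutral_left) (auto simp: in_keys_iff)

lemma peval_zero [simp]: "peval 0 x = 0"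
 by (simp add: peval_meval)

lemma peval_single [simp]: "peval (single m c) x = c * meval m x"
 by (subst peval_superset[of "{m}"]) auto

lemma peval_one [simp]: "peval 1 x = 1"
 by (simp flip: single_one)

lemma peval_add [simp]: "peval (p + q) x = peval p x + peval q x"
proof -
 define T where "T = keys p \<union> keys q"
 have T: "finite T" by (simp add: T_def)
 show ?thesis
  using Poly_Mapping.keys_add[of p q]
  by (subst (1 2 3) peval_superset[OF T])
   (auto simp: T_def lookup_add algebra_simps sum.distrib)
qed

lemma peval_sum: "peval (sum f A) x = (\<Sum>a\<in>A. peval (f a) x)"
 by (induction A rule: infinite_finite_induct) auto

lemma mpoly_eq_sum: "p = (\<Sum>m\<in>keys p. single m (lookup p m))"
proof (rule poly_mapping_eqI)
 fix k
 have "lookup (\<Sum>m\<in>keys p. single m (lookup p m)) k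
  = (\<Sum>m\<in>keys p. if k = m then lookup p m else 0)"
  by (auto simp: lookup_sum lookup_single when_def intro!: sum.cong)
 also have "\<dots> = lookup p k"
  by (auto simp: in_keys_iff sum.delta')
 finally show "lookup p k = lookup (\<Sum>m\<in>keys p. single m (lookup p m)) k" ..
qed

lemma peval_mult [simp]: "peval (p * q) x = peval p x * peval q x"
proof -
 have "p * q = (\<Sum>m\<in>keys p. \<Sum>m'\<in>keys q.
  single (m + m') (lookup p m * lookup q m'))"
  by (subst mpoly_eq_sum[of p], subst mpoly_eq_sum[of q])
   (simp add: sum_distrib_left sum_distrib_right mult_single, rule sum.swap)
 then show ?thesis
  by (simp add: peval_sum peval_meval[of p] peval_meval[of q] sum_product meval_add mult_ac)
qed

lemma peval_uminus [simp]: "peval (- p) x = - peval p x"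
proof -
 have "peval (- p) x + peval p x = 0"
  by (simp flip: peval_add)
 then show ?thesis by (simp add: add_eq_0_iff)
qed

lemma peval_diff [simp]: "peval (p - q) x = peval p x - peval q x"
 using peval_add[of p "- q" x] by simp

lemma peval_power [simp]: "peval (p ^ k) x = peval p x ^ k"
 by (induction k) auto

text \<open>The evaluations of monomials are distinct characters, hence linearly independent by the
 argument of Dedekind and Artin.\<close>

lemma meval_mult: "meval m (%v. x v * y v) = meval m x * meval m y"
 by (simp add: meval_def power_mult_distrib prod.distrib)

lemma meval_independent:
 assumes "finite T" "!!x. (\<Sum>m\<in>T. c m * meval m x) = 0" "m \<in> T"
 shows "c m = 0"
 using assms
proof (induction "card T" arbitrary: T c m)
 case 0
 then show ?case by auto
next
 case (Suc k)
 have *: "c m' = 0" if m': "m' \<in> T" "m0 \<in> T" "m' ~= m0" for m' m0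
 proof -
  obtain v where v: "lookup m' v ~= lookup m0 v"
   using m'(3) by (auto simp: poly_mapping_eq_iff fun_eq_iff)
  \<comment> \<open>The value 2 stands where the exponents of \<open>m'\<close> and
    \<open>m0\<close> differ, and 1 elsewhere; distinct powers of 2 tell the two characters
    apart.\<close>
  define y :: "'a => complex" where "y = (%_. 1)(v := 2)"
  have y: "meval m y = 2 ^ lookup m v" for m
  proof -
   have "meval m y = (\<Prod>w\<in>insert v (keys m). y w ^ lookup m w)"
    by (rule meval_superset) auto
   also have "\<dots> = y v ^ lookup m v *
     (\<Prod>w\<in>keys m - {v}. y w ^ lookup m w)"
    by (simp add: prod.insert_remove)
   also have "(\<Prod>w\<in>keys m - {v}. y w ^ lookup m w) = 1"
    by (rule prod.neutral) (auto simp: y_def)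
   finally show ?thesis by (simp add: y_def fun_upd_def)
  qed
  have ne: "meval m' y ~= meval m0 y"
  proof
   assume "meval m' y = meval m0 y"
   then have "of_nat (2 ^ lookup m' v) = (of_nat (2 ^ lookup m0 v) :: complex)"
    by (simp add: y)
   then show False using v unfolding of_nat_eq_iff by simp
  qed
  \<comment> \<open>The relation at the product of \<open>x\<close> and \<open>y\<close>, minus
    \<open>meval m0 y\<close> times the relation at \<open>x\<close>: the term of \<open>m0\<close>
    drops out and the induction hypothesis applies.\<close>
  have "(\<Sum>m\<in>T - {m0}. c m * (meval m y - meval m0 y) * meval m x) = 0" for x
  proof -
   have "(\<Sum>m\<in>T - {m0}. c m * (meval m y - meval m0 y) * meval m x)
    = (\<Sum>m\<in>T. c m * (meval m y - meval m0 y) * meval m x)"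
    using Suc.prems(1) by (intro sum.mono_neutral_left) auto
   also have "\<dots> = (\<Sum>m\<in>T. c m * meval m (%v. x v * y v)) - meval m0 y * (\<Sum>m\<in>T. c m * meval m x)"
    by (simp add: meval_mult sum_distrib_left algebra_simps sum_subtractf)
   finally show ?thesis using Suc.prems(2) by simp
  qed
  moreover have "k = card (T - {m0})" using Suc.hyps(2) m' Suc.prems(1) by simp
  ultimately have "c m' * (meval m' y - meval m0 y) = 0"
   using Suc.hyps(1)[of "T - {m0}" "%m. c m * (meval m y - meval m0 y)" m'] m' Suc.prems(1) by auto
  then show ?thesis using ne by simp
 qed
 show ?case
 proof (cases "T = {m}")
  case True
  then show ?thesis using Suc.prems(2)[of "%_. 1"] by (simp add: meval_def)
 next
  case False
  then obtain m0 where "m0 \<in> T" "m0 ~= m" using Suc.prems(3) by auto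
  then show ?thesis using * Suc.prems(3) by metis
 qed
qed

lemma peval_eq_0_iff: "(ALL x. peval p x = 0) \<longleftrightarrow> p = 0"
proof
 assume *: "ALL x. peval p x = 0"
 have "lookup p m = 0" if "m \<in> keys p" for m
  using meval_independent[of "keys p" "lookup p" m] that *
  by (simp add: peval_meval)
 then show "p = 0" by (intro poly_mapping_eqI) (metis in_keys_iff lookup_zero)
qed simp

lemma peval_inject: "(!!x. peval p x = peval q x) ==> p = q"
 using peval_eq_0_iff[of "p - q"] by auto

definition polys :: "'v set => 'v mpoly set" where
 "polys I = {p. \<forall>m\<in>keys p. keys m \<subseteq> I}"

abbreviation Const :: "complex => 'v mpoly" where
 "Const c \<equiv> single 0 c"

abbreviation Var :: "'v => 'v mpoly" where
 "Var v \<equiv> single (single v 1) 1"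

lemma polys_0 [simp]: "0 \<in> polys I" and polys_Const [simp]: "Const c \<in> polys I"
 and polys_Var: "v \<in> I ==> Var v \<in> polys I" and polys_1 [simp]: "1 \<in> polys I"
 by (auto simp: polys_def simp flip: single_one)

lemma polys_add: "p \<in> polys I ==> q \<in> polys I ==> p + q \<in> polys I"
 using Poly_Mapping.keys_add[of p q] by (fastforce simp: polys_def)

lemma polys_uminus: "p \<in> polys I ==> - p \<in> polys I"
 by (auto simp: polys_def)

lemma polys_diff: "p \<in> polys I ==> q \<in> polys I ==> p - q \<in> polys I"
 using polys_add[of p I "- q"] polys_uminus[of q I] by simp

lemma polys_mult: "p \<in> polys I ==> q \<in> polys I ==> p * q \<in> polys I"
proof -
 assume *: "p \<in> polys I" "q \<in> polys I"
 have "keys m \<subseteq> I" if "m \<in> keys (p * q)" for m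
 proof -
  obtain a b where "m = a + b" "a \<in> keys p" "b \<in> keys q"
   using \<open>m \<in> _\<close> keys_mult[of p q] by auto
  then show ?thesis using * Poly_Mapping.keys_add[of a b] by (fastforce simp: polys_def)
 qed
 then show ?thesis by (auto simp: polys_def)
qed

lemma polys_sum: "(!!a. a \<in> A ==> f a \<in> polys I) ==> sum f A \<in> polys I"
 by (induction A rule: infinite_finite_induct) (auto intro: polys_add)

lemma polys_mono: "I \<subseteq> J ==> polys I \<subseteq> polys J"
 by (auto simp: polys_def)

lemma meval_cong: "(!!v. v \<in> keys m ==> x v = y v) ==> meval m x = meval m y"
 by (simp add: meval_def)

lemma peval_cong: "p \<in> polys I ==> (!!v. v \<in> I ==> x v = y v) ==> peval p x = peval p y"
 unfolding peval_meval by (intro sum.cong refl arg_cong2[where f = "(*)"] meval_cong) (auto simp: polys_def)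

text \<open>Polynomial functions depending on the coordinates from \<open>I\<close> only.\<close>

definition polyfn :: "'v set => (('v => complex) => complex) => bool" where
 "polyfn I h \<longleftrightarrow> (\<exists>p\<in>polys I. h = peval p)"

lemma polyfnE:
 assumes "polyfn I h" obtains p where "p \<in> polys I" "h = peval p"
 using assms by (auto simp: polyfn_def)

lemma polyfn_peval: "p \<in> polys I ==> polyfn I (peval p)"
 by (auto simp: polyfn_def)

lemma polyfn_const [simp]: "polyfn I (%x. c)"
 unfolding polyfn_def by (intro bexI[of _ "Const c"]) (auto simp: fun_eq_iff)

lemma polyfn_var: "v \<in> I ==> polyfn I (%x. x v)"
 unfolding polyfn_def by (intro bexI[of _ "Var v"]) (auto simp: fun_eq_iff meval_single polys_Var simp del: One_nat_def)

lemma polyfn_add [intro]: "polyfn I g ==> polyfn I h ==> polyfn I (%x. g x + h x)"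
proof -
 assume "polyfn I g" "polyfn I h"
 then obtain p q where "p \<in> polys I" "g = peval p" "q \<in> polys I" "h = peval q"
  by (auto simp: polyfn_def)
 then show ?thesis unfolding polyfn_def by (intro bexI[of _ "p + q"]) (auto intro: polys_add)
qed

lemma polyfn_mult [intro]: "polyfn I g ==> polyfn I h ==> polyfn I (%x. g x * h x)"
proof -
 assume "polyfn I g" "polyfn I h"
 then obtain p q where "p \<in> polys I" "g = peval p" "q \<in> polys I" "h = peval q"
  by (auto simp: polyfn_def)
 then show ?thesis unfolding polyfn_def by (intro bexI[of _ "p * q"]) (auto intro: polys_mult)
qed

lemma polyfn_cmult [intro]: "polyfn I h ==> polyfn I (%x. c * h x)"
 by (rule polyfn_mult) auto

lemma polyfn_uminus [intro]: "polyfn I h ==> polyfn I (%x. - h x)"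
 using polyfn_cmult[of I h "-1"] by simp

lemma polyfn_diff [intro]: "polyfn I g ==> polyfn I h ==> polyfn I (%x. g x - h x)"
 using polyfn_add[of I g "%x. - h x"] by auto

lemma polyfn_power [intro]: "polyfn I h ==> polyfn I (%x. h x ^ k)"
 by (induction k) auto

lemma polyfn_sum [intro]: "(!!a. a \<in> A ==> polyfn I (f a)) ==> polyfn I (%x. \<Sum>a\<in>A. f a x)"
 by (induction A rule: infinite_finite_induct) auto

lemma polyfn_prod [intro]: "(!!a. a \<in> A ==> polyfn I (f a)) ==> polyfn I (%x. \<Prod>a\<in>A. f a x)"
 by (induction A rule: infinite_finite_induct) auto

lemma polyfn_mono: "polyfn I h ==> I \<subseteq> J ==> polyfn J h"
 unfolding polyfn_def using polys_mono by blast

lemma polyfn_cong: "polyfn I h ==> (!!v. v \<in> I ==> x v = y v) ==> h x = h y"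
 by (metis peval_cong polyfn_def)

text \<open>The coordinates generate the algebra of polynomial functions. The rule frees later
  proofs from sums over monomials; its own proof carries \<open>P\<close> and \<open>polyfn\<close>
  together, as the cases \<open>add\<close> and \<open>mult\<close> ask for both.\<close>

lemma polyfn_induct [consumes 1, case_names const var add mult]:
 assumes "polyfn I h"
  and "!!c. P (%x. c)" "!!v. v \<in> I ==> P (%x. x v)"
  and add: "!!g h. polyfn I g ==> polyfn I h ==> P g ==> P h ==> P (%x. g x + h x)"
  and mult: "!!g h. polyfn I g ==> polyfn I h ==> P g ==> P h ==> P (%x. g x * h x)"
 shows "P h"
proof -
 obtain p where p: "p \<in> polys I" "h = peval p" using assms(1) by (auto elim: polyfnE)
 have pow: "P (%x. x v ^ k) & polyfn I (%x. x v ^ k)" if "v \<in> I" for v k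
 proof (induction k)
  case (Suc k)
  then show ?case using mult[of "%x. x v" "%x. x v ^ k"] assms(3)[OF that] polyfn_var[OF that]
   by (auto intro!: polyfn_mult)
 qed (use assms(2)[of 1] in auto)
 have mon: "P (%x. \<Prod>v\<in>A. x v ^ k v) & polyfn I (%x. \<Prod>v\<in>A. x v ^ k v)"
  if "finite A" "A \<subseteq> I" for A and k :: "'a => nat"
  using that
 proof (induction A)
  case (insert v A)
  then show ?case using mult[of "%x. x v ^ k v" "%x. \<Prod>v\<in>A. x v ^ k v"] pow[of v "k v"]
   by (auto intro!: polyfn_mult)
 qed (use assms(2)[of 1] in auto)
 have "P (%x. \<Sum>m\<in>A. c m * meval m x) & polyfn I (%x. \<Sum>m\<in>A. c m * meval m x)"
  if "finite A" "!!m. m \<in> A ==> keys m \<subseteq> I" for A c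
  using that
 proof (induction A)
  case (insert m A)
  have m: "P (meval m) & polyfn I (meval m)"
   using mon[of "keys m" "lookup m"] insert.prems
   unfolding meval_def[abs_def] by auto
  have m': "P (%x. c m * meval m x) & polyfn I (%x. c m * meval m x)"
   using mult[of "%x. c m" "meval m"] m assms(2) by auto
  have A: "P (%x. \<Sum>m\<in>A. c m * meval m x) & polyfn I (%x. \<Sum>m\<in>A. c m * meval m x)"
   using insert by auto
  have e: "(%x. \<Sum>m\<in>insert m A. c m * meval m x) = (%x. c m * meval m x + (\<Sum>m\<in>A. c m * meval m x))"
   using insert by simp
  show ?case unfolding e using add m' A by auto
 qed (use assms(2)[of 0] in auto)
 then have "P (%x. \<Sum>m\<in>keys p. lookup p m * meval m x)"
  using p(1) by (auto simp: polys_def)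
 moreover have "h = (%x. \<Sum>m\<in>keys p. lookup p m * meval m x)"
  using p(2) peval_meval by blast
 ultimately show ?thesis by simp
qed

lemma polyfn_subst:
 assumes "polyfn I h" "!!v. v \<in> I ==> polyfn J (\<phi> v)"
 shows "polyfn J (%x. h (%v. \<phi> v x))"
 using assms(1)
proof (induction rule: polyfn_induct)
 case (var v)
 then show ?case using assms(2) by simp
qed (auto simp: polyfn_add polyfn_mult)

lemma polyfn_line:
 assumes "polyfn I h"
 obtains P where "!!s. h (%v. x v + s * u v) = poly P s"
proof -
 have "EX P. ALL s. h (%v. x v + s * u v) = poly P s"
  using assms
 proof (induction rule: polyfn_induct)
  case (const c)
  show ?case by (rule exI[of _ "[:c:]"]) simp
 next
  case (var v)
  show ?case by (rule exI[of _ "[:x v, u v:]"]) simp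
 next
  case (add g h)
  then show ?case by (metis poly_add)
 next
  case (mult g h)
  then show ?case by (metis poly_mult)
 qed
 then show ?thesis using that by blast
qed

text \<open>A polynomial function restricted to a line has finitely many zeros unless it vanishes.\<close>

lemma polyfn_line_finite:
 assumes "polyfn I h" "h (%v. x v + s0 * u v) ~= 0"
 shows "finite {s. h (%v. x v + s * u v) = 0}"
proof -
 obtain P where P: "!!s. h (%v. x v + s * u v) = poly P s"
  using polyfn_line[OF assms(1), of x u] by blast
 then have "P ~= 0" using assms(2) by auto
 then show ?thesis using poly_roots_finite[of P] by (simp add: P)
qed

text \<open>On the line from \<open>x\<close> to \<open>y\<close> the function \<open>g\<close> is
  nonzero at parameter 0 and \<open>h\<close> at parameter 1, so each has finitely many zeros there
  and some parameter avoids both sets.\<close>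

lemma polyfn_nonzero_common:
 assumes "polyfn I g" "polyfn J h" "g x ~= 0" "h y ~= 0"
 obtains s where "g (%v. x v + s * (y v - x v)) ~= 0" "h (%v. x v + s * (y v - x v)) ~= 0"
proof -
 let ?u = "%v. y v - x v"
 have "finite {s. g (%v. x v + s * ?u v) = 0}"
  by (rule polyfn_line_finite[OF assms(1), of _ 0]) (use assms(3) in simp)
 moreover have "finite {s. h (%v. x v + s * ?u v) = 0}"
  by (rule polyfn_line_finite[OF assms(2), of _ 1]) (use assms(4) in simp)
 ultimately have "finite ({s. g (%v. x v + s * ?u v) = 0} \<union> {s. h (%v. x v + s * ?u v) = 0})"
  by simp
 then obtain s where "s \<notin> {s. g (%v. x v + s * ?u v) = 0} \<union> {s. h (%v. x v + s * ?u v) = 0}"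
  using ex_new_if_finite[OF infinite_UNIV_char_0] by blast
 then show ?thesis using that by auto
qed

text \<open>Irreducibility of affine space, the source of all cancellations of nonzero polynomial
  factors below.\<close>

lemma polyfn_mult_eq_0:
 assumes "polyfn I g" "polyfn J h" "!!x. g x * h x = 0"
 shows "(ALL x. g x = 0) \<or> (ALL x. h x = 0)"
proof (rule ccontr)
 assume "\<not> ?thesis"
 then obtain x y where "g x ~= 0" "h y ~= 0" by auto
 then obtain s where "g (%v. x v + s * (y v - x v)) ~= 0" "h (%v. x v + s * (y v - x v)) ~= 0"
  using polyfn_nonzero_common[OF assms(1,2)] by blast
 then show False using assms(3) by (metis mult_eq_0_iff)
qed

text \<open>Families of univariate polynomials whose coefficients are polynomial functions.\<close>

definition polyfam :: "'v set => (('v => complex) => complex poly) => bool" where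
 "polyfam I C \<longleftrightarrow> (EX D. ALL x. degree (C x) \<le> D) & (ALL i. polyfn I (%x. poly.coeff (C x) i))"

lemma polyfam_add:
 assumes "polyfam I C" "polyfam I E" shows "polyfam I (%x. C x + E x)"
proof -
 obtain D D' where "!!x. degree (C x) \<le> D" "!!x. degree (E x) \<le> D'"
  using assms by (auto simp: polyfam_def)
 then have "degree (C x + E x) \<le> max D D'" for x
  by (meson degree_add_le le_max_iff_disj)
 then show ?thesis using assms by (auto simp: polyfam_def)
qed

lemma polyfam_mult:
 assumes "polyfam I C" "polyfam I E" shows "polyfam I (%x. C x * E x)"
proof -
 obtain D D' where "!!x. degree (C x) \<le> D" "!!x. degree (E x) \<le> D'"
  using assms by (auto simp: polyfam_def)
 then have "degree (C x * E x) \<le> D + D'" for x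
  by (meson add_mono degree_mult_le order_trans)
 moreover have "polyfn I (%x. poly.coeff (C x * E x) i)" for i
  unfolding coeff_mult using assms by (intro polyfn_sum polyfn_mult) (auto simp: polyfam_def)
 ultimately show ?thesis unfolding polyfam_def by blast
qed

lemma polyfam_pCons:
 assumes "polyfn I c" "polyfam I C" shows "polyfam I (%x. pCons (c x) (C x))"
proof -
 obtain D where "!!x. degree (C x) \<le> D"
  using assms by (auto simp: polyfam_def)
 then have "degree (pCons (c x) (C x)) \<le> Suc D" for x
  by (meson Suc_le_mono degree_pCons_le order_trans)
 moreover have "polyfn I (%x. poly.coeff (pCons (c x) (C x)) i)" for i
  using assms by (cases i) (auto simp: polyfam_def)
 ultimately show ?thesis unfolding polyfam_def by blast
qed

lemma polyfam_0 [simp]: "polyfam I (%x. 0)"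
 by (simp add: polyfam_def)

lemma polyfam_const: "polyfn I c ==> polyfam I (%x. [:c x:])"
 by (intro polyfam_pCons) auto

text \<open>One coordinate becomes the unknown of a univariate polynomial whose coefficients no
  longer involve it, so that a quantifier over this coordinate becomes a question on univariate
  polynomials.\<close>

lemma polyfn_split_var:
 assumes "polyfn I h"
 obtains C where "polyfam (I - {v}) C" "!!x t. h (x(v := t)) = poly (C x) t"
proof -
 have "EX C. polyfam (I - {v}) C & (ALL x t. h (x(v := t)) = poly (C x) t)"
  using assms
 proof (induction rule: polyfn_induct)
  case (const c)
  show ?case by (rule exI[of _ "%x. [:c:]"]) (simp add: polyfam_const)
 next
  case (var w)
  show ?case
  proof (cases "w = v")
   case True
   then show ?thesis by (intro exI[of _ "%x. [:0, 1:]"]) (auto intro!: polyfam_pCons)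
  next
   case False
   then show ?thesis using var by (intro exI[of _ "%x. [:x w:]"]) (auto intro!: polyfam_const polyfn_var)
  qed
 next
  case (add g h)
  then obtain C E where "polyfam (I - {v}) C" "ALL x t. g (x(v := t)) = poly (C x) t"
   "polyfam (I - {v}) E" "ALL x t. h (x(v := t)) = poly (E x) t" by blast
  then show ?case by (intro exI[of _ "%x. C x + E x"]) (auto intro: polyfam_add simp del: fun_upd_apply)
 next
  case (mult g h)
  then obtain C E where "polyfam (I - {v}) C" "ALL x t. g (x(v := t)) = poly (C x) t"
   "polyfam (I - {v}) E" "ALL x t. h (x(v := t)) = poly (E x) t" by blast
  then show ?case by (intro exI[of _ "%x. C x * E x"]) (auto intro: polyfam_mult simp del: fun_upd_apply)
 qed
 then show ?thesis using that by blast
qed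

lemma polyfn_poly: "polyfam I C ==> polyfn I t ==> polyfn I (%x. poly (C x) (t x))"
proof -
 assume *: "polyfam I C" "polyfn I t"
 then obtain D where D: "!!x. degree (C x) \<le> D" by (auto simp: polyfam_def)
 have e: "poly (C x) (t x) = (\<Sum>i\<le>D. poly.coeff (C x) i * t x ^ i)" for x
  unfolding poly_altdef using D[of x]
  by (intro sum.mono_neutral_left) (auto simp: coeff_eq_0)
 show ?thesis unfolding e using * by (intro polyfn_sum polyfn_mult polyfn_power) (auto simp: polyfam_def)
qed

subsection \<open>Forms\<close>

lemma mdeg_superset:
 "finite T ==> keys m \<subseteq> T ==> mdeg m = (\<Sum>v\<in>T. lookup m v)"
 unfolding mdeg_def by (intro sum.mono_neutral_left) (auto simp: in_keys_iff)

lemma mdeg_0 [simp]: "mdeg 0 = 0" by (simp add: mdeg_def)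

lemma mdeg_single [simp]: "mdeg (single v k) = k" by (simp add: mdeg_def)

lemma mdeg_add: "mdeg (m + m') = mdeg m + mdeg m'"
proof -
 define T where "T = keys m \<union> keys m'"
 have T: "finite T" by (simp add: T_def)
 show ?thesis
  using Poly_Mapping.keys_add[of m m']
  by (subst (1 2 3) mdeg_superset[OF T]) (auto simp: T_def lookup_add sum.distrib)
qed

lemma mdeg_eq_0_iff [simp]: "mdeg m = 0 \<longleftrightarrow> m = 0"
proof
 assume *: "mdeg m = 0"
 show "m = 0"
 proof (rule poly_mapping_eqI)
  fix k
  have "lookup m k = 0" if "k \<in> keys m"
   using * that by (simp add: mdeg_def)
  then show "lookup m k = lookup 0 k"
   by (cases "k \<in> keys m") (auto simp: in_keys_iff)
 qed
qed simp

lemma meval_scale: "meval m (%v. c * x v) = c ^ mdeg m * meval m x"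
 by (simp add: meval_def mdeg_def power_mult_distrib prod.distrib power_sum)

lemma forms_polys: "p \<in> forms I d ==> p \<in> polys I"
 by (auto simp: forms_def polys_def monomials_def)

lemma peval_scale: "p \<in> forms I d ==> peval p (%v. c * x v) = c ^ d * peval p x"
 unfolding peval_meval sum_distrib_left
 by (intro sum.cong refl) (auto simp: meval_scale forms_def monomials_def)

lemma forms_0 [simp]: "0 \<in> forms I d" and forms_Const [simp]: "Const c \<in> forms I 0"
 and forms_1 [simp]: "1 \<in> forms I 0"
 and forms_Var: "v \<in> I ==> Var v \<in> forms I 1"
 by (auto simp: forms_def monomials_def simp flip: single_one)

lemma forms_add: "p \<in> forms I d ==> q \<in> forms I d ==> p + q \<in> forms I d"
 using Poly_Mapping.keys_add[of p q] by (fastforce simp: forms_def)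

lemma forms_uminus: "p \<in> forms I d ==> - p \<in> forms I d"
 by (auto simp: forms_def)

lemma forms_diff: "p \<in> forms I d ==> q \<in> forms I d ==> p - q \<in> forms I d"
 using forms_add[of p I d "- q"] forms_uminus[of q I d] by simp

lemma forms_mult:
 assumes "p \<in> forms I d" "q \<in> forms I e" shows "p * q \<in> forms I (d + e)"
proof -
 have "m \<in> monomials I (d + e)" if "m \<in> keys (p * q)" for m
 proof -
  obtain a b where "m = a + b" "a \<in> keys p" "b \<in> keys q"
   using \<open>m \<in> _\<close> keys_mult[of p q] by auto
  then show ?thesis using assms Poly_Mapping.keys_add[of a b]
   by (fastforce simp: forms_def monomials_def mdeg_add)
 qed
 then show ?thesis by (auto simp: forms_def)
qed

lemma forms_cmult: "p \<in> forms I d ==> Const c * p \<in> forms I d"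
 using forms_mult[of "Const c" I 0 p d] by simp

lemma forms_power: "p \<in> forms I d ==> p ^ k \<in> forms I (k * d)"
 by (induction k) (auto intro: forms_mult)

lemma forms_sum: "(!!a. a \<in> A ==> f a \<in> forms I d) ==> sum f A \<in> forms I d"
 by (induction A rule: infinite_finite_induct) (auto intro: forms_add)

lemma forms_mono: "I \<subseteq> J ==> forms I d \<subseteq> forms J d"
 by (auto simp: forms_def monomials_def)

lemma lookup_hcomp: "lookup (hcomp d p) m = (if mdeg m = d then lookup p m else 0)"
proof -
 have "lookup (hcomp d p) m =
  (\<Sum>k\<in>{k \<in> keys p. mdeg k = d}. if m = k then lookup p k else 0)"
  unfolding hcomp_def by (auto simp: lookup_sum lookup_single when_def intro!: sum.cong)
 also have "\<dots> = (if mdeg m = d then lookup p m else 0)"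
  by (subst sum.delta') (auto simp: in_keys_iff)
 finally show ?thesis .
qed

lemma keys_hcomp: "keys (hcomp d p) = {m \<in> keys p. mdeg m = d}"
 by (auto simp: in_keys_iff lookup_hcomp split: if_splits)

lemma hcomp_forms: "p \<in> polys I ==> hcomp d p \<in> forms I d"
 by (auto simp: forms_def keys_hcomp polys_def monomials_def)

lemma hcomp_form: "p \<in> forms I d ==> hcomp e p = (if e = d then p else 0)"
 by (auto simp: poly_mapping_eq_iff fun_eq_iff lookup_hcomp forms_def monomials_def in_keys_iff)

lemma hcomp_add: "hcomp d (p + q) = hcomp d p + hcomp d q"
 by (auto simp: poly_mapping_eq_iff fun_eq_iff lookup_hcomp lookup_add)

lemma hcomp_zero [simp]: "hcomp d 0 = 0"
 by (simp add: hcomp_def)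

lemma hcomp_sum: "hcomp d (sum f A) = (\<Sum>a\<in>A. hcomp d (f a))"
 by (induction A rule: infinite_finite_induct) (auto simp: hcomp_add)

lemma sum_hcomp:
 assumes "finite T" "mdeg ` keys p \<subseteq> T" shows "(\<Sum>d\<in>T. hcomp d p) = p"
proof (rule poly_mapping_eqI)
 fix m
 have "lookup (\<Sum>d\<in>T. hcomp d p) m = (\<Sum>d\<in>T. if d = mdeg m then lookup p m else 0)"
  by (auto simp: lookup_sum lookup_hcomp intro!: sum.cong)
 then show "lookup (\<Sum>d\<in>T. hcomp d p) m = lookup p m"
  using assms by (cases "m \<in> keys p") (auto simp: in_keys_iff)
qed

lemma hcomp_eq_0: "d \<notin> mdeg ` keys p ==> hcomp d p = 0"
 unfolding hcomp_def by (rule sum.neutral) auto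

lemma hcomp_mult_form:
 assumes "p \<in> forms I d" shows "hcomp (d + e) (p * q) = p * hcomp e q"
proof -
 let ?T = "insert e (mdeg ` keys q)"
 have "p * q = (\<Sum>k\<in>?T. p * hcomp k q)"
  unfolding sum_distrib_left[symmetric] by (subst sum_hcomp) auto
 then have "hcomp (d + e) (p * q) = (\<Sum>k\<in>?T. hcomp (d + e) (p * hcomp k q))"
  by (simp add: hcomp_sum)
 also have "\<dots> = (\<Sum>k\<in>?T. if k = e then p * hcomp e q else 0)"
 proof (rule sum.cong)
  fix k
  have "p * hcomp k q \<in> forms UNIV (d + k)"
   using assms hcomp_forms[of q UNIV k] forms_mono[of I UNIV d]
   by (intro forms_mult) (auto simp: polys_def)
  then show "hcomp (d + e) (p * hcomp k q) = (if k = e then p * hcomp e q else 0)"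
   by (subst hcomp_form) auto
 qed simp
 finally show ?thesis by simp
qed

text \<open>Along the ray through \<open>x\<close> the homogeneous components turn into
  coefficients, so information about scaled points passes to the single components.\<close>

lemma peval_poly_scale:
 obtains P where "!!c. peval p (%v. c * x v) = poly P c"
  "!!k. poly.coeff P k = peval (hcomp k p) x"
proof -
 let ?T = "mdeg ` keys p"
 define P where "P = (\<Sum>d\<in>?T. monom (peval (hcomp d p) x) d)"
 have "peval p (%v. c * x v) = poly P c" for c
 proof -
  have "peval p (%v. c * x v) = (\<Sum>d\<in>?T. peval (hcomp d p) (%v. c * x v))"
   using sum_hcomp[of ?T p] by (metis finite_imageI finite_keys order_refl peval_sum)
  also have "\<dots> = poly P c"
   unfolding P_def poly_sum poly_monom
  proof (rule sum.cong)
   fix d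
   have "hcomp d p \<in> forms UNIV d" by (rule hcomp_forms) (auto simp: polys_def)
   then show "peval (hcomp d p) (%v. c * x v) = peval (hcomp d p) x * c ^ d"
    by (simp add: peval_scale mult.commute)
  qed simp
  finally show ?thesis .
 qed
 moreover have "poly.coeff P k = peval (hcomp k p) x" for k
 proof -
  have "poly.coeff P k = (\<Sum>d\<in>?T. if d = k then peval (hcomp k p) x else 0)"
   by (auto simp: P_def coeff_sum intro!: sum.cong)
  then show ?thesis using hcomp_eq_0[of k p] by auto
 qed
 ultimately show ?thesis using that by blast
qed

section \<open>Linear systems and the weak Nullstellensatz\<close>

lemma homogeneous_system_nontrivial:
 fixes a :: "'i => 'j => complex"
 assumes "finite T" "finite L" "card T < card L"
 obtains c where "\<exists>l\<in>L. c l ~= 0" "!!m. m \<in> T ==> (\<Sum>l\<in>L. c l * a l m) = 0"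
proof -
 have "EX c. (\<exists>l\<in>L. c l ~= 0) & (\<forall>m\<in>T. (\<Sum>l\<in>L. c l * a l m) = 0)"
  using assms
 proof (induction T arbitrary: L a rule: finite_induct)
  case empty
  then show ?case by (intro exI[of _ "%_. 1"]) (auto simp: card_gt_0_iff)
 next
  case (insert m T)
  show ?case
  proof (cases "\<forall>l\<in>L. a l m = 0")
   case True
   obtain c where "\<exists>l\<in>L. c l ~= 0" "\<forall>m\<in>T. (\<Sum>l\<in>L. c l * a l m) = 0"
    using insert.IH[of L a] insert.hyps insert.prems by auto
   then show ?thesis using True by (intro exI[of _ c]) auto
  next
   case False
   then obtain l0 where l0: "l0 \<in> L" "a l0 m ~= 0" by auto
   \<comment> \<open>Gaussian elimination: the equation \<open>m\<close> is solved for the unknown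
     \<open>l0\<close>, and the solution is substituted in the other equations.\<close>
   define a' where "a' l k = a l k - a l m / a l0 m * a l0 k" for l k
   have "card T < card (L - {l0})" using insert.hyps insert.prems l0 by simp
   then obtain c' where c': "\<exists>l\<in>L - {l0}. c' l ~= 0"
    "\<forall>m\<in>T. (\<Sum>l\<in>L - {l0}. c' l * a' l m) = 0"
    using insert.IH[of "L - {l0}" a'] insert.prems by auto
   define z where "z = - (\<Sum>l\<in>L - {l0}. c' l * a l m) / a l0 m"
   define c where "c = c'(l0 := z)"
   have split: "(\<Sum>l\<in>L. c l * a l k) = z * a l0 k + (\<Sum>l\<in>L - {l0}. c' l * a l k)" for k
    using insert.prems l0 by (subst sum.remove[of _ l0]) (auto simp: c_def)
   have "(\<Sum>l\<in>L. c l * a l k) = 0" if "k \<in> insert m T" for k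
   proof (cases "k = m")
    case True
    then show ?thesis using l0 unfolding split by (simp add: z_def)
   next
    case False
    then have "0 = (\<Sum>l\<in>L - {l0}. c' l * a' l k)" using c' that by auto
    also have "\<dots> = (\<Sum>l\<in>L - {l0}. c' l * a l k - c' l * a l m * (a l0 k / a l0 m))"
     by (intro sum.cong refl) (simp add: a'_def right_diff_distrib)
    also have "\<dots> = (\<Sum>l\<in>L - {l0}. c' l * a l k) - (\<Sum>l\<in>L - {l0}. c' l * a l m) * (a l0 k / a l0 m)"
     by (simp only: sum_subtractf sum_distrib_right)
    also have "\<dots> = (\<Sum>l\<in>L. c l * a l k)"
     unfolding split by (simp add: z_def)
    finally show ?thesis by simp
   qed
   moreover have "\<exists>l\<in>L. c l ~= 0" using c' by (auto simp: c_def)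
   ultimately show ?thesis by blast
  qed
 qed
 then show ?thesis using that by blast
qed

lemma finite_bounded_monomials:
 assumes "finite I"
 shows "finite {m :: 'v \<Rightarrow>\<^sub>0 nat. keys m \<subseteq> I & (ALL v. lookup m v \<le> D)}" (is "finite ?S")
proof -
 let ?F = "{f :: 'v => nat. ALL v. (v \<in> I --> f v \<in> {..D}) & (v \<notin> I --> f v = 0)}"
 have "finite ?F"
  using assms finite_atMost by (rule finite_set_of_finite_funs)
 moreover have "lookup ` ?S \<subseteq> ?F"
 proof (rule image_subsetI)
  fix m :: "'v \<Rightarrow>\<^sub>0 nat" assume m: "m \<in> ?S"
  have "lookup m v = 0" if "v \<notin> I" for v
   using m that in_keys_iff[of v m] by blast
  then show "lookup m \<in> ?F" using m by simp
 qed
 ultimately have "finite (lookup ` ?S)" by (rule rev_finite_subset)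
 moreover have "inj_on lookup ?S" unfolding inj_on_def poly_mapping_eq_iff by blast
 ultimately show ?thesis by (simp only: finite_image_iff)
qed

lemma lookup_le_mdeg: "lookup m v \<le> mdeg m"
proof (cases "v \<in> keys m")
 case True
 show ?thesis unfolding mdeg_def using True by (intro member_le_sum) simp_all
next
 case False
 then have "lookup m v = 0" by (simp add: in_keys_iff)
 then show ?thesis by (simp only: le0)
qed

lemma finite_monomials:
 assumes "finite I" shows "finite (monomials I d)"
proof (rule finite_subset[OF _ finite_bounded_monomials[OF assms, of d]], rule subsetI)
 fix m assume "m \<in> monomials I d"
 then have "keys m \<subseteq> I" "mdeg m = d" unfolding monomials_def by blast+
 then show "m \<in> {m. keys m \<subseteq> I & (ALL v. lookup m v \<le> d)}"
  using lookup_le_mdeg[of m] by blast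
qed

text \<open>Ideals consist of functions instead of elements of \<open>mpoly\<close>: evaluation is
  injective, and membership then rests on equations between functions.\<close>

definition is_ideal :: "'v set => (('v => complex) => complex) set => bool" where
 "is_ideal I J \<longleftrightarrow> J \<subseteq> Collect (polyfn I) & (%_. 0) \<in> J &
  (\<forall>g\<in>J. \<forall>h\<in>J. (%x. g x + h x) \<in> J) & (ALL g h. polyfn I g --> h \<in> J --> (%x. g x * h x) \<in> J)"

lemma is_ideal_add: "is_ideal I J ==> g \<in> J ==> h \<in> J ==> (%x. g x + h x) \<in> J"
 and is_ideal_mult: "is_ideal I J ==> polyfn I g ==> h \<in> J ==> (%x. g x * h x) \<in> J"
 and is_ideal_zero: "is_ideal I J ==> (%_. 0) \<in> J"
 by (simp_all add: is_ideal_def)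

lemma is_ideal_diff:
 assumes "is_ideal I J" "g \<in> J" "h \<in> J" shows "(%x. g x - h x) \<in> J"
proof -
 have "(%x. (-1) * h x) \<in> J" by (rule is_ideal_mult[OF assms(1) _ assms(3)]) simp
 from is_ideal_add[OF assms(1,2) this] show ?thesis by simp
qed

lemma is_ideal_sum:
 assumes "is_ideal I J" "!!a. a \<in> A ==> f a \<in> J" shows "(%x. \<Sum>a\<in>A. f a x) \<in> J"
 using assms(2)
proof (induction A rule: infinite_finite_induct)
 case (insert a A)
 have "(%x. f a x + (\<Sum>a\<in>A. f a x)) \<in> J"
  by (rule is_ideal_add[OF assms(1)]) (use insert in auto)
 then show ?case using insert by simp
qed (use is_ideal_zero[OF assms(1)] in auto)

text \<open>Zorn's lemma: two members of the union of a chain already lie in one ideal of the chain,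
  and the union still omits 1.\<close>

lemma maximal_ideal_exists:
 assumes "is_ideal I J" "(%_. 1) \<notin> J"
 obtains M where "is_ideal I M" "J \<subseteq> M" "(%_. 1) \<notin> M"
  "!!M'. is_ideal I M' ==> M \<subseteq> M' ==> (%_. 1) \<notin> M' ==> M' = M"
proof -
 define A where "A = {M. is_ideal I M & J \<subseteq> M & (%_. 1) \<notin> M}"
 have "\<Union>C \<in> A" if C: "C ~= {}" "subset.chain A C" for C
 proof -
  have CA: "!!M. M \<in> C ==> M \<in> A" using C by (auto simp: subset.chain_def)
  have two: "\<exists>M\<in>C. g \<in> M & h \<in> M" if gh: "g \<in> \<Union>C" "h \<in> \<Union>C" for g h
  proof -
   obtain M M' where M: "M \<in> C" "g \<in> M" "M' \<in> C" "h \<in> M'" using gh by blast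
   then have "M \<subseteq> M' \<or> M' \<subseteq> M" using C(2) by (auto simp: subset.chain_def)
   then show ?thesis using M by blast
  qed
  have "is_ideal I (\<Union>C)"
   unfolding is_ideal_def
  proof (intro conjI ballI allI impI)
   show "\<Union>C \<subseteq> Collect (polyfn I)" using CA unfolding A_def is_ideal_def by fast
   show "(%_. 0) \<in> \<Union>C" using CA C(1) by (fastforce simp: A_def is_ideal_def)
   fix g h assume "g \<in> \<Union>C" "h \<in> \<Union>C"
   then obtain M where M: "M \<in> C" "g \<in> M" "h \<in> M" using two by blast
   then have "is_ideal I M" using CA by (auto simp: A_def)
   then have "(%x. g x + h x) \<in> M" using M(2,3) by (rule is_ideal_add)
   then show "(%x. g x + h x) \<in> \<Union>C" using M(1) by blast
  next
   fix g h assume g: "polyfn I g" and "h \<in> \<Union>C"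
   then obtain M where M: "M \<in> C" "h \<in> M" by blast
   then have "is_ideal I M" using CA by (auto simp: A_def)
   then have "(%x. g x * h x) \<in> M" using g M(2) by (rule is_ideal_mult)
   then show "(%x. g x * h x) \<in> \<Union>C" using M(1) by blast
  qed
  then show ?thesis using CA C(1) by (fastforce simp: A_def)
 qed
 moreover have "A ~= {}" using assms by (auto simp: A_def)
 ultimately obtain M where M: "M \<in> A" "\<forall>X\<in>A. M \<subseteq> X --> X = M"
  using subset_Zorn_nonempty[of A] by auto
 then show ?thesis using that[of M] by (auto simp: A_def)
qed

text \<open>Over an uncountable field the weak Nullstellensatz follows by counting: were no
 \<open>x v - c\<close> contained in a maximal ideal, the uncountably many inverses of the classes of
 \<open>x v - c\<close> would be linearly independent in an algebra of countable dimension.\<close>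

lemma maximal_ideal_contains_linear:
 assumes "finite I" "is_ideal I M" "(%_. 1) \<notin> M"
  "!!M'. is_ideal I M' ==> M \<subseteq> M' ==> (%_. 1) \<notin> M' ==> M' = M" "v \<in> I"
 obtains c where "(%x. x v - c) \<in> M"
proof (rule ccontr)
 assume "\<not> thesis"
 then have no: "(%x. x v - c) \<notin> M" for c using that by blast
 have mult: "(%x. g x * h x) \<in> M" if "polyfn I g" "h \<in> M" for g h
  using assms(2) that by (rule is_ideal_mult)
 have lin: "polyfn I (%x. x v - c)" for c using assms(5) by (intro polyfn_diff polyfn_var) auto
 have "\<exists>p\<in>polys I. (%x. peval p x * (x v - c) - 1) \<in> M" for c
 proof -
  \<comment> \<open>The ideal generated by \<open>M\<close> and \<open>x v - c\<close>. It is larger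
    than \<open>M\<close>, so it contains 1, and this exhibits an inverse of \<open>x v - c\<close>
    modulo \<open>M\<close>.\<close>
  define M' where "M' = {h. \<exists>m\<in>M. EX q. polyfn I q & h = (%x. m x + q x * (x v - c))}"
  have M': "is_ideal I M'"
   unfolding is_ideal_def
  proof (intro conjI ballI allI impI)
   show "M' \<subseteq> Collect (polyfn I)"
    using assms(2) lin by (auto simp: M'_def is_ideal_def intro!: polyfn_add polyfn_mult)
   show "(%_. 0) \<in> M'"
    using assms(2) unfolding M'_def is_ideal_def
    by (intro CollectI bexI[of _ "%_. 0"] exI[of _ "%_. 0"]) auto
   fix g h assume "g \<in> M'" "h \<in> M'"
   then obtain m q m' q' where *: "m \<in> M" "polyfn I q" "g = (%x. m x + q x * (x v - c))"
    "m' \<in> M" "polyfn I q'" "h = (%x. m' x + q' x * (x v - c))" unfolding M'_def by blast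
   have "(%x. m x + m' x) \<in> M" using assms(2) *(1,4) by (rule is_ideal_add)
   then show "(%x. g x + h x) \<in> M'" unfolding M'_def using *
    by (intro CollectI bexI[of _ "%x. m x + m' x"] exI[of _ "%x. q x + q' x"])
     (auto simp: algebra_simps)
  next
   fix g h assume g: "polyfn I g" and "h \<in> M'"
   then obtain m q where *: "m \<in> M" "polyfn I q" "h = (%x. m x + q x * (x v - c))"
    unfolding M'_def by blast
   show "(%x. g x * h x) \<in> M'" unfolding M'_def using * g mult[of g m]
    by (intro CollectI bexI[of _ "%x. g x * m x"] exI[of _ "%x. g x * q x"])
     (auto simp: algebra_simps)
  qed
  have sub: "M \<subseteq> M'"
  proof
   fix m assume "m \<in> M"
   then show "m \<in> M'" unfolding M'_def
    by (intro CollectI bexI[of _ m] exI[of _ "%_. 0"]) auto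
  qed
  have "(%x. x v - c) \<in> M'" unfolding M'_def
   using assms(2) by (intro CollectI bexI[of _ "%_. 0"] exI[of _ "%_. 1"]) (auto simp: is_ideal_def)
  then have "M' ~= M" using no by blast
  then have "(%_. 1) \<in> M'" using assms(4)[OF M' sub] by blast
  then obtain m q where *: "m \<in> M" "polyfn I q" "(%_. 1) = (%x. m x + q x * (x v - c))"
   unfolding M'_def by blast
  obtain p where p: "p \<in> polys I" "q = peval p" using *(2) by (auto simp: polyfn_def)
  have "(%x. q x * (x v - c) - 1) = (%x. (-1) * m x)"
  proof
   fix x show "q x * (x v - c) - 1 = (-1) * m x" proof -
    have e: "1 = m x + q x * (x v - c)" using fun_cong[OF *(3), of x] .
    show ?thesis by (subst e) simp
   qed
  qed
  moreover have "(%x. (-1) * m x) \<in> M" using mult[of "%_. -1" m] *(1) by simp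
  ultimately have "(%x. q x * (x v - c) - 1) \<in> M" by (simp only:)
  then show ?thesis using p by auto
 qed
 then obtain p where p: "!!c. p c \<in> polys I" "!!c. (%x. peval (p c) x * (x v - c) - 1) \<in> M"
  by metis
 \<comment> \<open>The inverses \<open>p c\<close> are uncountably many, the degree bounds
   \<open>D\<close> only countably many. Hence infinitely many inverses lie in the span of a single
   finite set \<open>S D\<close> of monomials, and finitely many of them are linearly
   dependent.\<close>
 define S where "S D = {m. keys m \<subseteq> I & (ALL v. lookup m v \<le> D)}" for D :: nat
 have finS: "finite (S D)" for D unfolding S_def by (rule finite_bounded_monomials[OF assms(1)])
 have "EX D. keys (p c) \<subseteq> S D" for c
 proof -
  define D where "D = (\<Sum>m\<in>keys (p c). mdeg m)"
  have "lookup m w \<le> D" if "m \<in> keys (p c)" for m w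
  proof -
   have "mdeg m \<le> D" unfolding D_def using that by (intro member_le_sum) simp_all
   then show ?thesis using lookup_le_mdeg[of m w] by simp
  qed
  then show ?thesis using p(1)[of c] by (intro exI[of _ D]) (auto simp: S_def polys_def)
 qed
 then have "UNIV = (\<Union>D. {c. keys (p c) \<subseteq> S D})" by auto
 then have "\<not> (ALL D. countable {c. keys (p c) \<subseteq> S D})"
  using uncountable_UNIV_complex countable_UN[of UNIV "%D. {c. keys (p c) \<subseteq> S D}"] by auto
 then obtain D where "infinite {c. keys (p c) \<subseteq> S D}"
  using countable_finite by blast
 then obtain L where "finite L & card L = Suc (card (S D)) & L \<subseteq> {c. keys (p c) \<subseteq> S D}"
  using infinite_arbitrarily_large[of _ "Suc (card (S D))"] by blast
 then have L: "finite L" "card L = Suc (card (S D))" "!!c. c \<in> L ==> keys (p c) \<subseteq> S D"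
  by auto
 obtain k where k: "\<exists>l\<in>L. k l ~= 0" "!!m. m \<in> S D ==> (\<Sum>l\<in>L. k l * lookup (p l) m) = 0"
  using homogeneous_system_nontrivial[OF finS[of D] L(1), of "%l. lookup (p l)"] L(2) by auto
 have rel: "(\<Sum>l\<in>L. k l * peval (p l) x) = 0" for x
 proof -
  have "(\<Sum>l\<in>L. k l * peval (p l) x) = (\<Sum>l\<in>L. \<Sum>m\<in>S D. k l * lookup (p l) m * meval m x)"
   using L(3) by (intro sum.cong refl) (simp add: peval_superset[OF finS[of D]] sum_distrib_left mult.assoc)
  also have "\<dots> = (\<Sum>m\<in>S D. (\<Sum>l\<in>L. k l * lookup (p l) m) * meval m x)"
   by (subst sum.swap) (simp add: sum_distrib_right)
  finally show ?thesis using k(2) by simp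
 qed
 \<comment> \<open>Denominators are cleared: the dependency between the inverses is multiplied by
   the product of all \<open>x v - l\<close>. The resulting polynomial \<open>P\<close> in
   \<open>x v\<close> is nonzero, as its value at a root \<open>l0\<close> with
   \<open>k l0 ~= 0\<close> shows.\<close>
 define w where "w l = (\<Prod>\<mu>\<in>L - {l}. [:- \<mu>, 1:])" for l
 define P where "P = (\<Sum>l\<in>L. smult (k l) (w l))"
 have "P ~= 0"
 proof -
  obtain l0 where l0: "l0 \<in> L" "k l0 ~= 0" using k(1) by blast
  have "poly P l0 = (\<Sum>l\<in>L. if l = l0 then k l0 * poly (w l0) l0 else 0)"
   unfolding P_def poly_sum
  proof (rule sum.cong)
   fix l assume "l \<in> L"
   have "poly (w l) l0 = 0" if "l ~= l0"
    using that l0 L(1) by (auto simp: w_def poly_prod prod_zero_iff)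
   then show "poly (smult (k l) (w l)) l0 = (if l = l0 then k l0 * poly (w l0) l0 else 0)" by simp
  qed simp
  also have "\<dots> = k l0 * poly (w l0) l0" using l0 L(1) by simp
  also have "\<dots> ~= 0" using l0 L(1) by (auto simp: w_def poly_prod)
  finally show ?thesis by auto
 qed
 have pv: "polyfn I (%x. poly Q (x v))" for Q
  using polyfn_poly[of I "%_. Q" "%x. x v"] polyfn_var[OF assms(5)] by (auto simp: polyfam_def)
 \<comment> \<open>A nonzero polynomial in \<open>x v\<close> splits into linear factors, each
   invertible modulo \<open>M\<close>, and therefore lies outside \<open>M\<close>.\<close>
 have no_poly: "(%x. poly Q (x v)) \<notin> M" if "Q ~= 0" for Q
  using that
 proof (induction "degree Q" arbitrary: Q)
  case 0
  then obtain a where a: "Q = [:a:]" "a ~= 0" by (metis degree_eq_zeroE pCons_0_0)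
  show ?case
  proof
   assume "(%x. poly Q (x v)) \<in> M"
   then have "(%x. inverse a * poly Q (x v)) \<in> M" by (intro mult) auto
   then show False using a assms(3) by simp
  qed
 next
  case (Suc d)
  then obtain z where "poly Q z = 0"
   using fundamental_theorem_of_algebra[of Q] by (auto simp: constant_degree)
  then obtain Q' where Q': "Q = [:- z, 1:] * Q'" by (auto simp: poly_eq_0_iff_dvd dvd_def)
  then have "Q' ~= 0" using Suc.prems by auto
  have "degree ([:- z, 1:] * Q') = 1 + degree Q'"
   using \<open>Q' ~= 0\<close> by (subst degree_mult_eq) auto
  then have "d = degree Q'" using Suc.hyps(2) unfolding Q' by linarith
  then have IH: "(%x. poly Q' (x v)) \<notin> M" using Suc.hyps(1) \<open>Q' ~= 0\<close> by blast
  show ?case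
  proof
   assume "(%x. poly Q (x v)) \<in> M"
   then have "(%x. peval (p z) x * poly Q (x v)) \<in> M" by (intro mult polyfn_peval p(1))
   moreover have "(%x. poly Q' (x v) * (peval (p z) x * (x v - z) - 1)) \<in> M"
    by (intro mult p(2) pv)
   ultimately have "(%x. peval (p z) x * poly Q (x v) - poly Q' (x v) * (peval (p z) x * (x v - z) - 1)) \<in> M"
    by (rule is_ideal_diff[OF assms(2)])
   also have "(%x. peval (p z) x * poly Q (x v) - poly Q' (x v) * (peval (p z) x * (x v - z) - 1)) = (%x. poly Q' (x v))"
    by (rule ext) (simp add: Q' algebra_simps)
   finally show False using IH by simp
  qed
 qed
 \<comment> \<open>Since \<open>w l\<close> times \<open>x v - l\<close> is the full product, the
   terms containing \<open>p l\<close> add up to a multiple of the relation \<open>rel\<close>,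
   which is 0; what remains is \<open>P\<close>.\<close>
 have "(%x. \<Sum>l\<in>L. (- k l) * (poly (w l) (x v) * (peval (p l) x * (x v - l) - 1))) \<in> M"
  by (intro is_ideal_sum[OF assms(2)] mult p(2) pv polyfn_const)
 also have "(%x. \<Sum>l\<in>L. (- k l) * (poly (w l) (x v) * (peval (p l) x * (x v - l) - 1))) = (%x. poly P (x v))"
 proof
  fix x
  define W where "W = (\<Prod>\<mu>\<in>L. x v - \<mu>)"
  have W: "poly (w l) (x v) * (x v - l) = W" if "l \<in> L" for l
   unfolding W_def using prod.remove[OF L(1) that, of "%\<mu>. x v - \<mu>"]
   by (simp add: w_def poly_prod mult.commute)
  have "(\<Sum>l\<in>L. (- k l) * (poly (w l) (x v) * (peval (p l) x * (x v - l) - 1)))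
   = (\<Sum>l\<in>L. k l * poly (w l) (x v) - W * (k l * peval (p l) x))"
  proof (rule sum.cong)
   fix l assume l: "l \<in> L"
   have "(- k l) * (poly (w l) (x v) * (peval (p l) x * (x v - l) - 1))
    = k l * poly (w l) (x v) - (poly (w l) (x v) * (x v - l)) * (k l * peval (p l) x)"
    by (simp add: algebra_simps)
   then show "(- k l) * (poly (w l) (x v) * (peval (p l) x * (x v - l) - 1))
    = k l * poly (w l) (x v) - W * (k l * peval (p l) x)" unfolding W[OF l] .
  qed simp
  also have "\<dots> = poly P (x v) - W * (\<Sum>l\<in>L. k l * peval (p l) x)"
   by (simp add: P_def poly_sum sum_subtractf sum_distrib_left)
  finally show "(\<Sum>l\<in>L. (- k l) * (poly (w l) (x v) * (peval (p l) x * (x v - l) - 1))) = poly P (x v)"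
   by (simp add: rel)
 qed
 finally show False using no_poly[OF \<open>P ~= 0\<close>] by simp
qed

text \<open>A maximal ideal over \<open>J\<close> contains \<open>x v - c v\<close> for every
  \<open>v\<close>, so modulo it each function equals its value at \<open>c\<close>. A member of
  \<open>J\<close> that does not vanish at \<open>c\<close> would then put 1 into the maximal
  ideal.\<close>

theorem weak_nullstellensatz:
 assumes "finite I" "is_ideal I J" "!!x. \<exists>h\<in>J. h x ~= 0"
 shows "(%_. 1) \<in> J"
proof (rule ccontr)
 assume "(%_. 1) \<notin> J"
 then obtain M where M: "is_ideal I M" "J \<subseteq> M" "(%_. 1) \<notin> M"
  "!!M'. is_ideal I M' ==> M \<subseteq> M' ==> (%_. 1) \<notin> M' ==> M' = M"
  using maximal_ideal_exists[OF assms(2)] by blast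
 have "EX c. (%x. x v - c) \<in> M" if "v \<in> I" for v
  using maximal_ideal_contains_linear[OF assms(1) M(1,3,4) that] by blast
 then obtain c where c: "!!v. v \<in> I ==> (%x. x v - c v) \<in> M" by metis
 have mult: "(%x. g x * h x) \<in> M" if "polyfn I g" "h \<in> M" for g h
  using M(1) that by (rule is_ideal_mult)
 have add: "(%x. g x + h x) \<in> M" if "g \<in> M" "h \<in> M" for g h
  using M(1) that by (rule is_ideal_add)
 have val: "(%x. h x - h c) \<in> M" if "polyfn I h" for h
  using that
 proof (induction rule: polyfn_induct)
  case (const a)
  then show ?case using M(1) by (simp add: is_ideal_def)
 next
  case (var v)
  then show ?case using c by simp
 next
  case (add g h)
  then have "(%x. (g x - g c) + (h x - h c)) \<in> M"
   by (intro \<open>!!h g. g \<in> M ==> h \<in> M ==> (%x. g x + h x) \<in> M\<close>)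
  then show ?case by (simp add: algebra_simps)
 next
  case (mult g h)
  have "(%x. g x * (h x - h c)) \<in> M" "(%x. h c * (g x - g c)) \<in> M"
   using mult by (auto intro: \<open>!!h g. polyfn I g ==> h \<in> M ==> (%x. g x * h x) \<in> M\<close>)
  then have "(%x. g x * (h x - h c) + h c * (g x - g c)) \<in> M" by (rule add)
  then show ?case by (simp add: algebra_simps)
 qed
 obtain h where h: "h \<in> J" "h c ~= 0" using assms(3) by blast
 then have "polyfn I h" using assms(2) by (auto simp: is_ideal_def)
 then have "(%x. h x - (h x - h c)) \<in> M" using M(2) h by (intro is_ideal_diff[OF M(1)] val) auto
 then have "(%x. inverse (h c) * (h x - (h x - h c))) \<in> M" by (intro mult) auto
 then show False using h M(3) by simp
qed

section \<open>Constructible sets and Chevalley's theorem\<close>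

inductive constructible :: "'v set => (('v => complex) => bool) => bool" for I where
 zero: "polyfn I h ==> constructible I (%x. h x = 0)"
| neg: "constructible I A ==> constructible I (%x. \<not> A x)"
| conj: "constructible I A ==> constructible I B ==> constructible I (%x. A x & B x)"

lemma constructible_disj:
 assumes "constructible I A" "constructible I B" shows "constructible I (%x. A x \<or> B x)"
proof -
 have "constructible I (%x. \<not> (\<not> A x & \<not> B x))"
  by (intro constructible.neg constructible.conj assms)
 then show ?thesis by simp
qed

lemma constructible_const: "constructible I (%x. b)"
proof (cases b)
 case True
 then show ?thesis using constructible.zero[of I "%_. 0"] by simp
next
 case False
 then show ?thesis using constructible.zero[of I "%_. 1"] by simp
qed

lemma constructible_nonzero: "polyfn I h ==> constructible I (%x. h x ~= 0)"
 by (intro constructible.neg constructible.zero)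

lemma constructible_ball:
 "finite T ==> (!!k. k \<in> T ==> constructible I (A k)) ==> constructible I (%x. \<forall>k\<in>T. A k x)"
 by (induction T rule: finite_induct) (simp_all add: constructible_const constructible.conj)

lemma constructible_bex_list:
 "(!!k. k \<in> set T ==> constructible I (A k)) ==> constructible I (%x. \<exists>k\<in>set T. A k x)"
 by (induction T) (simp_all add: constructible_const constructible_disj)

text \<open>By irreducibility of affine space every constructible predicate is constant on some
  nonempty principal open set. A constructible set that meets every such open set therefore contains
  one of them.\<close>

lemma constructible_decided:
 assumes "constructible I A"
 obtains g where "polyfn I g" "EX x. g x ~= 0"
  "(ALL x. g x ~= 0 --> A x) \<or> (ALL x. g x ~= 0 --> \<not> A x)"
proof -
 have "EX g. polyfn I g & (EX x. g x ~= 0) & ((ALL x. g x ~= 0 --> A x) \<or> (ALL x. g x ~= 0 --> \<not> A x))"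
  using assms
 proof induction
  case (zero h)
  show ?case
  proof (cases "ALL x. h x = 0")
   case True
   then show ?thesis by (intro exI[of _ "%_. 1"]) auto
  next
   case False
   then show ?thesis using zero by (intro exI[of _ h]) auto
  qed
 next
  case (neg A)
  then show ?case by auto
 next
  case (conj A B)
  then obtain g h where g: "polyfn I g" "EX x. g x ~= 0" "(ALL x. g x ~= 0 --> A x) \<or> (ALL x. g x ~= 0 --> \<not> A x)"
   and h: "polyfn I h" "EX x. h x ~= 0" "(ALL x. h x ~= 0 --> B x) \<or> (ALL x. h x ~= 0 --> \<not> B x)" by auto
  have "EX x. g x * h x ~= 0" using polyfn_mult_eq_0[OF g(1) h(1)] g(2) h(2) by auto
  moreover have "(ALL x. g x * h x ~= 0 --> A x & B x) \<or> (ALL x. g x * h x ~= 0 --> \<not> (A x & B x))"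
   using g(3) h(3) by auto
  ultimately show ?case using polyfn_mult[OF g(1) h(1)] by (intro exI[of _ "%x. g x * h x"]) blast
 qed
 then show ?thesis using that by blast
qed

text \<open>A root of \<open>P\<close> has multiplicity at most the degree of \<open>P\<close>.
  Divisibility thus replaces a quantifier over the roots by a condition that pseudo-division can
  decide uniformly in parameters.\<close>

lemma dvd_power_degree_iff:
 fixes P q :: "complex poly"
 assumes "P ~= 0"
 shows "P dvd q ^ degree P \<longleftrightarrow> (ALL t. poly P t = 0 --> poly q t = 0)"
proof
 assume dvd: "P dvd q ^ degree P"
 show "ALL t. poly P t = 0 --> poly q t = 0"
 proof (intro allI impI)
  fix t assume "poly P t = 0"
  then have "poly (q ^ degree P) t = 0" using dvd by (metis poly_eq_0_iff_dvd dvd_trans)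
  then show "poly q t = 0" by (simp add: poly_power)
 qed
next
 assume "ALL t. poly P t = 0 --> poly q t = 0"
 then show "P dvd q ^ degree P" using assms
 proof (induction "degree P" arbitrary: P)
  case 0
  then have "is_unit P" by (metis is_unit_iff_degree)
  then show ?case by (rule unit_imp_dvd)
 next
  case (Suc d)
  then obtain z where z: "poly P z = 0"
   using fundamental_theorem_of_algebra[of P] by (auto simp: constant_degree)
  then obtain P' where P': "P = [:- z, 1:] * P'" by (auto simp: poly_eq_0_iff_dvd dvd_def)
  have "P' ~= 0" using P' Suc.prems by auto
  have "degree P = 1 + degree P'" unfolding P' using \<open>P' ~= 0\<close> by (subst degree_mult_eq) auto
  then have d: "d = degree P'" using Suc.hyps(2) by linarith
  have "ALL t. poly P' t = 0 --> poly q t = 0" using Suc.prems(1) by (simp add: P')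
  then have "P' dvd q ^ d" using Suc.hyps(1)[OF d] \<open>P' ~= 0\<close> d by simp
  moreover have "[:- z, 1:] dvd q" using Suc.prems(1) z by (simp add: poly_eq_0_iff_dvd)
  ultimately have "[:- z, 1:] * P' dvd q * q ^ d" by (rule mult_dvd_mono[rotated])
  then show ?case using Suc.hyps(2) P' by (metis power_Suc)
 qed
qed

text \<open>The bound \<open>d\<close> is a formal degree, uniform in the parameters: the
  coefficient of index \<open>d\<close> may vanish for some \<open>x\<close>, and elimination
  branches on this.\<close>

definition bfam :: "'v set => (('v => complex) => complex poly) => nat => bool" where
 "bfam J P d \<longleftrightarrow> polyfam J P & (ALL x. degree (P x) \<le> d)"

lemma polyfam_coeff: "polyfam J P ==> polyfn J (%x. poly.coeff (P x) i)"
 by (simp add: polyfam_def)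

lemma polyfam_monom:
 assumes "polyfn J c" shows "polyfam J (%x. monom (c x) k)"
 unfolding polyfam_def
proof (intro conjI exI allI)
 show "degree (monom (c x) k) \<le> k" for x by (rule degree_monom_le)
 show "polyfn J (%x. poly.coeff (monom (c x) k) i)" for i
  using assms by (cases "k = i") simp_all
qed

lemma polyfam_uminus: "polyfam J P ==> polyfam J (%x. - P x)"
 using polyfam_mult[OF polyfam_const[OF polyfn_const[of J "-1"]], of P] by simp

lemma polyfam_diff: "polyfam J P ==> polyfam J Q ==> polyfam J (%x. P x - Q x)"
 using polyfam_add[OF _ polyfam_uminus, of J P Q] by simp

lemma polyfam_power: "polyfam J P ==> polyfam J (%x. P x ^ k)"
proof (induction k)
 case 0
 have "polyfam J (%x. [:1:])" by (rule polyfam_const) simp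
 then show ?case by (simp add: one_pCons)
next
 case (Suc k)
 then show ?case using polyfam_mult[of J P "%x. P x ^ k"] by simp
qed

definition tail :: "nat => complex poly => complex poly" where
 "tail d P = P - monom (poly.coeff P d) d"

text \<open>A step of pseudo-division: the top terms cancel without division by the leading
  coefficient, so that all coefficients remain polynomial in the parameters.\<close>

definition cancel :: "nat => complex poly => nat => complex poly => complex poly" where
 "cancel d P e R = [:poly.coeff P d:] * R - monom (poly.coeff R e) (e - d) * P"

lemma bfam_tail: "bfam J P (Suc d) ==> bfam J (%x. tail (Suc d) (P x)) d"
 unfolding bfam_def tail_def
proof (intro conjI allI polyfam_diff polyfam_monom polyfam_coeff; (elim conjE)?)
 fix x assume "ALL x. degree (P x) \<le> Suc d"
 then have *: "degree (P x) \<le> Suc d" by blast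
 show "degree (P x - monom (poly.coeff (P x) (Suc d)) (Suc d)) \<le> d"
  by (rule degree_le) (use * coeff_eq_0[of "P x"] in \<open>auto simp: le_Suc_eq not_le Suc_lessI\<close>)
qed

lemma bfam_cancel:
 assumes "bfam J P d" "bfam J R (Suc e)" "d \<le> Suc e"
 shows "bfam J (%x. cancel d (P x) (Suc e) (R x)) e"
 unfolding bfam_def
proof (intro conjI allI)
 have "polyfam J P" "polyfam J R" using assms by (auto simp: bfam_def)
 then show "polyfam J (%x. cancel d (P x) (Suc e) (R x))"
  unfolding cancel_def by (intro polyfam_diff polyfam_mult polyfam_monom polyfam_const polyfam_coeff)
 fix x
 have *: "degree (P x) \<le> d" "degree (R x) \<le> Suc e" using assms by (auto simp: bfam_def)
 show "degree (cancel d (P x) (Suc e) (R x)) \<le> e"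
 proof (rule degree_le, intro allI impI)
  fix i assume i: "e < i"
  have "poly.coeff (monom (poly.coeff (R x) (Suc e)) (Suc e - d) * P x) i =
   (if Suc e - d \<le> i then poly.coeff (R x) (Suc e) * poly.coeff (P x) (i - (Suc e - d)) else 0)"
   by (simp add: coeff_monom_mult)
  also have "\<dots> = (if i = Suc e then poly.coeff (R x) (Suc e) * poly.coeff (P x) d else 0)"
  proof (cases "i = Suc e")
   case True
   then show ?thesis using assms(3) by simp
  next
   case False
   then have "degree (P x) < i - (Suc e - d)" using i * assms(3) by linarith
   then show ?thesis using False by (simp add: coeff_eq_0)
  qed
  finally show "poly.coeff (cancel d (P x) (Suc e) (R x)) i = 0"
   using i *(2) coeff_eq_0[of "R x" i] by (cases "i = Suc e") (auto simp: cancel_def)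
 qed
qed

lemma poly_cancel: "poly (cancel d P e R) t = poly.coeff P d * poly R t - poly.coeff R e * t ^ (e - d) * poly P t"
 by (simp add: cancel_def poly_monom)

lemma dvd_cancel:
 assumes "poly.coeff P d ~= 0" shows "P dvd cancel d P e R \<longleftrightarrow> P dvd R"
proof -
 have "P dvd cancel d P e R \<longleftrightarrow> P dvd [:poly.coeff P d:] * R"
  unfolding cancel_def by (rule dvd_diff_left_iff) simp
 also have "\<dots> \<longleftrightarrow> P dvd R" using assms by (simp add: dvd_smult_iff)
 finally show ?thesis .
qed

lemma constructible_zero_poly:
 assumes "bfam J Q e" shows "constructible J (%x. Q x = 0)"
proof -
 have "(%x. Q x = 0) = (%x. \<forall>i\<in>{..e}. poly.coeff (Q x) i = 0)"
 proof
  fix x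
  have "degree (Q x) \<le> e" using assms by (simp add: bfam_def)
  then show "(Q x = 0) = (\<forall>i\<in>{..e}. poly.coeff (Q x) i = 0)"
   by (metis atMost_iff coeff_0 leading_coeff_0_iff)
 qed
 then show ?thesis using assms
  by (auto simp: bfam_def intro!: constructible_ball constructible.zero polyfam_coeff)
qed

text \<open>While the leading coefficient of \<open>P\<close> is nonzero, pseudo-division preserves
  divisibility and lowers the formal degree of \<open>Q\<close>. Below the degree of
  \<open>P\<close>, divisibility means \<open>Q x = 0\<close>.\<close>

lemma constructible_dvd:
 assumes "bfam J P d" "bfam J Q e"
 shows "constructible J (%x. poly.coeff (P x) d ~= 0 & P x dvd Q x)"
 using assms(2)
proof (induction e arbitrary: Q rule: less_induct)
 case (less e)
 have P: "polyfam J P" "!!x. degree (P x) \<le> d" using assms(1) by (auto simp: bfam_def)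
 show ?case
 proof (cases "e < d")
  case True
  have "(P x dvd Q x) = (Q x = 0)" if "poly.coeff (P x) d ~= 0" for x
  proof
   assume *: "P x dvd Q x"
   have "degree (P x) = d" using P(2)[of x] that by (metis le_degree antisym)
   moreover have "degree (Q x) \<le> e" using less.prems by (simp add: bfam_def)
   ultimately show "Q x = 0" using True dvd_imp_degree_le[OF *] by linarith
  qed simp
  then have "(%x. poly.coeff (P x) d ~= 0 & P x dvd Q x) = (%x. poly.coeff (P x) d ~= 0 & Q x = 0)"
   by auto
  then show ?thesis using constructible_zero_poly[OF less.prems]
   by (simp add: constructible.conj constructible_nonzero polyfam_coeff P(1))
 next
  case False
  show ?thesis
  proof (cases e)
   case 0
   then have d: "d = 0" using False by simp
   have "P x dvd Q x" if "poly.coeff (P x) d ~= 0" for x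
   proof -
    have "degree (P x) = 0" "P x ~= 0" using P(2)[of x] d that by auto
    then have "is_unit (P x)" by (metis is_unit_iff_degree)
    then show ?thesis by (rule unit_imp_dvd)
   qed
   then have "(%x. poly.coeff (P x) d ~= 0 & P x dvd Q x) = (%x. poly.coeff (P x) d ~= 0)"
    by auto
   then show ?thesis by (simp add: constructible_nonzero polyfam_coeff P(1))
  next
   case (Suc e')
   have "(%x. poly.coeff (P x) d ~= 0 & P x dvd Q x) =
    (%x. poly.coeff (P x) d ~= 0 & P x dvd cancel d (P x) e (Q x))"
    using dvd_cancel by blast
   moreover have "bfam J (%x. cancel d (P x) e (Q x)) e'"
    using bfam_cancel[OF assms(1), of Q e'] less.prems False Suc by simp
   ultimately show ?thesis using less.IH[of e'] Suc by simp
  qed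
 qed
qed

text \<open>Euclid's algorithm with parameters. Of two equations the one with the larger bound is
  reduced by the other; where a leading coefficient vanishes, its polynomial is replaced by its tail
  or dropped. A single equation has a root off the zeros of \<open>q\<close> unless \<open>P\<close>
  divides a power of \<open>q\<close>.\<close>

lemma constructible_common_root:
 assumes "!!P d. (P, d) \<in> set L ==> bfam J P d" "bfam J q e"
 shows "constructible J (%x. EX t. (\<forall>(P, d)\<in>set L. poly (P x) t = 0) & poly (q x) t ~= 0)"
 using assms(1)
\<comment> \<open>Counting \<open>Suc d\<close> rather than \<open>d\<close> makes the measure fall
  also when an equation of formal degree 0 is dropped.\<close>
proof (induction "sum_list (map (%(P, d). Suc d) L)" arbitrary: L rule: less_induct)
 case less
 show ?case
 proof (cases L)
  case Nil
  have "(EX t. poly (q x) t ~= 0) \<longleftrightarrow> q x ~= 0" for x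
   using poly_all_0_iff_0[of "q x"] by blast
  then show ?thesis using constructible.neg[OF constructible_zero_poly[OF assms(2)]] by (simp add: Nil)
 next
  case (Cons Pd L')
  obtain P d where Pd: "Pd = (P, d)" by (cases Pd)
  have bP: "bfam J P d" using less.prems Cons Pd by auto
  then have P: "polyfam J P" "!!x. degree (P x) \<le> d" by (auto simp: bfam_def)
  let ?H = "%L x. EX t. (\<forall>(P, d)\<in>set L. poly (P x) t = 0) & poly (q x) t ~= 0"
  have degenerate: "constructible J (%x. poly.coeff (P x) d = 0 & ?H ((P, d) # L'') x)"
   if L'': "sum_list (map (%(P, d). Suc d) L'') + Suc d = sum_list (map (%(P, d). Suc d) L)"
    "!!P d. (P, d) \<in> set L'' ==> bfam J P d" "bfam J P d" for P d L''
  proof (cases d)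
   case 0
   have z: "P x = 0" if "poly.coeff (P x) d = 0" for x
   proof -
    have "degree (P x) = 0" using 0 L''(3) by (simp add: bfam_def)
    then show ?thesis using that 0 leading_coeff_0_iff[of "P x"] by simp
   qed
   have "(%x. poly.coeff (P x) d = 0 & ?H ((P, d) # L'') x) = (%x. poly.coeff (P x) d = 0 & ?H L'' x)"
    by (rule ext, rule conj_cong[OF refl]) (simp add: z)
   moreover have "constructible J (?H L'')" using L'' by (intro less.hyps) auto
   ultimately show ?thesis using L''(3)
    by (auto simp: bfam_def intro!: constructible.conj constructible.zero polyfam_coeff)
  next
   case (Suc d')
   have "(%x. poly.coeff (P x) d = 0 & ?H ((P, d) # L'') x)
    = (%x. poly.coeff (P x) d = 0 & ?H ((%x. tail (Suc d') (P x), d') # L'') x)"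
    by (rule ext, rule conj_cong[OF refl]) (simp add: tail_def Suc)
   moreover have "constructible J (?H ((%x. tail (Suc d') (P x), d') # L''))"
   proof (rule less.hyps)
    show "sum_list (map (%(P, d). Suc d) ((%x. tail (Suc d') (P x), d') # L''))
     < sum_list (map (%(P, d). Suc d) L)" using L''(1) Suc by simp
    have "bfam J (%x. tail (Suc d') (P x)) d'" using L''(3) Suc by (intro bfam_tail) simp
    then show "bfam J P2 d2" if "(P2, d2) \<in> set ((%x. tail (Suc d') (P x), d') # L'')" for P2 d2
     using that L''(2) by auto
   qed
   ultimately show ?thesis using L''(3)
    by (auto simp: bfam_def intro!: constructible.conj constructible.zero polyfam_coeff)
  qed
  have reduce: "constructible J (?H ((P, d) # (R, e) # L''))"
   if L'': "sum_list (map (%(P, d). Suc d) L'') + Suc d + Suc e = sum_list (map (%(P, d). Suc d) L)"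
    "!!P d. (P, d) \<in> set L'' ==> bfam J P d" "bfam J P d" "bfam J R e" "d \<le> e" for P d R e L''
  proof -
   have "constructible J (%x. poly.coeff (P x) d ~= 0 & ?H ((P, d) # (R, e) # L'') x)"
   proof (cases e)
    case 0
    have "\<not> ?H ((P, d) # (R, e) # L'') x" if "poly.coeff (P x) d ~= 0" for x
    proof -
     have "degree (P x) = 0" using 0 L''(3,5) by (simp add: bfam_def)
     then obtain a where "P x = [:a:]" by (rule degree_eq_zeroE)
     then show ?thesis using that 0 L''(5) by auto
    qed
    then have "(%x. poly.coeff (P x) d ~= 0 & ?H ((P, d) # (R, e) # L'') x) = (%x. False)" by blast
    then show ?thesis by (simp only: constructible_const)
   next
    case (Suc e')
    let ?R = "%x. cancel d (P x) (Suc e') (R x)"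
    have "(%x. poly.coeff (P x) d ~= 0 & ?H ((P, d) # (R, e) # L'') x)
     = (%x. poly.coeff (P x) d ~= 0 & ?H ((P, d) # (?R, e') # L'') x)"
     by (rule ext, rule conj_cong[OF refl]) (auto simp: poly_cancel Suc)
    moreover have "constructible J (?H ((P, d) # (?R, e') # L''))"
    proof (rule less.hyps)
     show "sum_list (map (%(P, d). Suc d) ((P, d) # (?R, e') # L''))
      < sum_list (map (%(P, d). Suc d) L)" using L''(1) Suc by simp
     have "bfam J ?R e'" using bfam_cancel[OF L''(3), of R e'] L'' Suc by simp
     then show "bfam J P2 d2" if "(P2, d2) \<in> set ((P, d) # (?R, e') # L'')" for P2 d2
      using that L''(2,3) by auto
    qed
    ultimately show ?thesis using L''(3)
     by (auto simp: bfam_def intro!: constructible.conj constructible_nonzero polyfam_coeff)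
   qed
   moreover have "constructible J (%x. poly.coeff (P x) d = 0 & ?H ((P, d) # (R, e) # L'') x)"
    by (rule degenerate) (use L'' in auto)
   ultimately have "constructible J (%x. (poly.coeff (P x) d ~= 0 & ?H ((P, d) # (R, e) # L'') x)
    \<or> (poly.coeff (P x) d = 0 & ?H ((P, d) # (R, e) # L'') x))" by (rule constructible_disj)
   moreover have "(%x. (poly.coeff (P x) d ~= 0 & ?H ((P, d) # (R, e) # L'') x)
    \<or> (poly.coeff (P x) d = 0 & ?H ((P, d) # (R, e) # L'') x)) = ?H ((P, d) # (R, e) # L'')"
    by blast
   ultimately show ?thesis by (simp only:)
  qed
  show ?thesis
  proof (cases L')
   case Nil
   obtain D where "bfam J (%x. q x ^ d) D"
    using assms(2) polyfam_power[of J q d] unfolding bfam_def polyfam_def by blast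
   then have "constructible J (%x. poly.coeff (P x) d ~= 0 & P x dvd q x ^ d)"
    by (rule constructible_dvd[OF bP])
   moreover have "(%x. poly.coeff (P x) d ~= 0 & ?H L x) =
    (%x. \<not> (poly.coeff (P x) d ~= 0 & P x dvd q x ^ d) & poly.coeff (P x) d ~= 0)"
   proof
    fix x
    show "(poly.coeff (P x) d ~= 0 & ?H L x) =
     (\<not> (poly.coeff (P x) d ~= 0 & P x dvd q x ^ d) & poly.coeff (P x) d ~= 0)"
    proof (cases "poly.coeff (P x) d = 0")
     case False
     then have "degree (P x) = d" using P(2)[of x] by (metis le_degree antisym)
     then have "P x dvd q x ^ d \<longleftrightarrow> (ALL t. poly (P x) t = 0 --> poly (q x) t = 0)"
      using dvd_power_degree_iff[of "P x" "q x"] False by auto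
     then show ?thesis using False by (auto simp: Cons Pd Nil)
    qed auto
   qed
   ultimately have "constructible J (%x. poly.coeff (P x) d ~= 0 & ?H L x)"
    using constructible.conj[OF constructible.neg constructible_nonzero[OF polyfam_coeff[OF P(1), of d]]]
    by (simp only:)
   moreover have "constructible J (%x. poly.coeff (P x) d = 0 & ?H L x)"
    using degenerate[of "[]" d P] bP by (simp add: Cons Pd Nil)
   ultimately have "constructible J (%x. (poly.coeff (P x) d ~= 0 & ?H L x) \<or> (poly.coeff (P x) d = 0 & ?H L x))"
    by (rule constructible_disj)
   moreover have "(%x. (poly.coeff (P x) d ~= 0 & ?H L x) \<or> (poly.coeff (P x) d = 0 & ?H L x)) = ?H L"
    by blast
   ultimately show ?thesis by (simp only:)
  next
   case L': (Cons Re L'')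
   obtain R e where Re: "Re = (R, e)" by (cases Re)
   have bR: "bfam J R e" and bL: "!!P d. (P, d) \<in> set L'' ==> bfam J P d"
    using less.prems Cons L' Re by auto
   show ?thesis
   proof (cases "d \<le> e")
    case True
    then have "constructible J (?H ((P, d) # (R, e) # L''))"
     using bP bR bL by (intro reduce) (auto simp: Cons Pd L' Re)
    then show ?thesis by (simp only: Cons Pd L' Re)
   next
    case False
    then have "constructible J (?H ((R, e) # (P, d) # L''))"
     using bP bR bL by (intro reduce) (auto simp: Cons Pd L' Re)
    moreover have "?H ((R, e) # (P, d) # L'') = ?H ((P, d) # (R, e) # L'')" by (auto simp: fun_eq_iff)
    ultimately show ?thesis by (simp only: Cons Pd L' Re)
   qed
  qed
 qed
qed

text \<open>Disjunctive normal form: a pair \<open>(L, q)\<close> stands for the equations from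
  \<open>L\<close> together with one inequation. One is enough, since several inequations are merged
  by multiplying them.\<close>

definition dnf_eval :: "((('v => complex) => complex poly) list \<times> (('v => complex) => complex poly)) list
  => ('v => complex) => complex => bool" where
 "dnf_eval M x t \<longleftrightarrow> (\<exists>(L, q)\<in>set M. (\<forall>P\<in>set L. poly (P x) t = 0) & poly (q x) t ~= 0)"

definition dnf :: "'v set => (('v => complex) => complex => bool) => bool" where
 "dnf J A \<longleftrightarrow> (EX M. (ALL L q. (L, q) \<in> set M --> polyfam J q & (\<forall>P\<in>set L. polyfam J P)) & A = dnf_eval M)"

lemma dnfE:
 assumes "dnf J A"
 obtains M where "ALL L q. (L, q) \<in> set M --> polyfam J q & (\<forall>P\<in>set L. polyfam J P)" "A = dnf_eval M"
 using assms unfolding dnf_def by blast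

lemma dnf_disj: assumes "dnf J A" "dnf J B" shows "dnf J (%x t. A x t \<or> B x t)"
proof -
 obtain M where M: "ALL L q. (L, q) \<in> set M --> polyfam J q & (\<forall>P\<in>set L. polyfam J P)"
  "A = dnf_eval M" using assms(1) by (rule dnfE)
 obtain N where N: "ALL L q. (L, q) \<in> set N --> polyfam J q & (\<forall>P\<in>set L. polyfam J P)"
  "B = dnf_eval N" using assms(2) by (rule dnfE)
 have "(%x t. A x t \<or> B x t) = dnf_eval (M @ N)"
  unfolding M(2) N(2) dnf_eval_def[abs_def] set_append bex_Un ..
 moreover have "ALL L q. (L, q) \<in> set (M @ N) --> polyfam J q & (\<forall>P\<in>set L. polyfam J P)"
  using M(1) N(1) by auto
 ultimately show ?thesis unfolding dnf_def by blast
qed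

lemma dnf_conj: assumes "dnf J A" "dnf J B" shows "dnf J (%x t. A x t & B x t)"
proof -
 obtain M where M: "ALL L q. (L, q) \<in> set M --> polyfam J q & (\<forall>P\<in>set L. polyfam J P)"
  "A = dnf_eval M" using assms(1) by (rule dnfE)
 obtain N where N: "ALL L q. (L, q) \<in> set N --> polyfam J q & (\<forall>P\<in>set L. polyfam J P)"
  "B = dnf_eval N" using assms(2) by (rule dnfE)
 define K where "K = concat (map (%a. map (%b. (fst a @ fst b, %x. snd a x * snd b x)) N) M)"
 have setK: "set K = (\<Union>a\<in>set M. (%b. (fst a @ fst b, %x. snd a x * snd b x)) ` set N)"
  by (simp add: K_def)
 have KI: "(L @ L', %x. q x * q' x) \<in> set K" if "(L, q) \<in> set M" "(L', q') \<in> set N" for L q L' q'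
  unfolding setK by (rule UN_I[OF that(1)], rule image_eqI[OF _ that(2)]) simp
 have KE: "EX L q L' q'. k = (L @ L', %x. q x * q' x) & (L, q) \<in> set M & (L', q') \<in> set N" if k: "k \<in> set K" for k
 proof -
  obtain a b where "a \<in> set M" "b \<in> set N" "k = (fst a @ fst b, %x. snd a x * snd b x)"
   using k unfolding setK by blast
  then show ?thesis
   by (intro exI[of _ "fst a"] exI[of _ "snd a"] exI[of _ "fst b"] exI[of _ "snd b"]) simp
 qed
 have "ALL L q. (L, q) \<in> set K --> polyfam J q & (\<forall>P\<in>set L. polyfam J P)"
 proof (intro allI impI)
  fix L2 q2 assume "(L2, q2) \<in> set K"
  then obtain L q L' q' where *: "(L2, q2) = (L @ L', %x. q x * q' x)" "(L, q) \<in> set M" "(L', q') \<in> set N"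
   using KE by blast
  then show "polyfam J q2 & (\<forall>P\<in>set L2. polyfam J P)"
   using polyfam_mult[of J q q'] M(1) N(1) by auto
 qed
 moreover have "(%x t. A x t & B x t) = dnf_eval K"
 proof (intro ext)
  fix x t
  show "(A x t & B x t) = dnf_eval K x t"
  proof
   assume "A x t & B x t"
   then obtain L q L' q' where *: "(L, q) \<in> set M" "\<forall>P\<in>set L. poly (P x) t = 0" "poly (q x) t ~= 0"
    "(L', q') \<in> set N" "\<forall>P\<in>set L'. poly (P x) t = 0" "poly (q' x) t ~= 0"
    unfolding M(2) N(2) dnf_eval_def by blast
   then have "(L @ L', %x. q x * q' x) \<in> set K" by (intro KI)
   then show "dnf_eval K x t" unfolding dnf_eval_def
    by (rule bexI[rotated]) (use * in auto)
  next
   assume "dnf_eval K x t"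
   then obtain k where k: "k \<in> set K" "case k of (L, q) => (\<forall>P\<in>set L. poly (P x) t = 0) & poly (q x) t ~= 0"
    unfolding dnf_eval_def by blast
   then obtain L q L' q' where *: "k = (L @ L', %x. q x * q' x)" "(L, q) \<in> set M" "(L', q') \<in> set N"
    using KE by blast
   have "\<forall>P\<in>set L. poly (P x) t = 0" "\<forall>P\<in>set L'. poly (P x) t = 0" "poly (q x) t ~= 0" "poly (q' x) t ~= 0"
    using k(2) unfolding *(1) by auto
   then show "A x t & B x t" unfolding M(2) N(2) dnf_eval_def using *(2,3) by blast
  qed
 qed
 ultimately show ?thesis unfolding dnf_def by blast
qed

lemma dnf_lits: assumes "polyfam J P"
 shows "dnf J (%x t. poly (P x) t = 0)" "dnf J (%x t. poly (P x) t ~= 0)"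
proof -
 have 1: "polyfam J (%_. 1)" using polyfam_power[OF polyfam_0, of J 0] by simp
 show "dnf J (%x t. poly (P x) t = 0)" unfolding dnf_def dnf_eval_def[abs_def]
  using assms 1 by (intro exI[of _ "[([P], %_. 1)]"]) simp
 show "dnf J (%x t. poly (P x) t ~= 0)" unfolding dnf_def dnf_eval_def[abs_def]
  using assms by (intro exI[of _ "[([], P)]"]) simp
qed

text \<open>The predicate and its negation are normalized together, because the induction passes
  through \<open>neg\<close>.\<close>

lemma constructible_dnf:
 assumes "constructible I A"
 shows "dnf (I - {v}) (%x t. A (x(v := t)))" "dnf (I - {v}) (%x t. \<not> A (x(v := t)))"
proof -
 have "dnf (I - {v}) (%x t. A (x(v := t))) & dnf (I - {v}) (%x t. \<not> A (x(v := t)))"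
  using assms
 proof induction
  case (zero h)
  obtain C where "polyfam (I - {v}) C" "!!x t. h (x(v := t)) = poly (C x) t"
   using polyfn_split_var[OF zero] by blast
  then show ?case using dnf_lits[of "I - {v}" C] by (simp del: fun_upd_apply)
 next
  case (neg A)
  then show ?case by simp
 next
  case (conj A B)
  then show ?case using dnf_conj[of "I - {v}" "%x t. A (x(v := t))" "%x t. B (x(v := t))"]
   dnf_disj[of "I - {v}" "%x t. \<not> A (x(v := t))" "%x t. \<not> B (x(v := t))"] by (simp del: fun_upd_apply)
 qed
 then show "dnf (I - {v}) (%x t. A (x(v := t)))" "dnf (I - {v}) (%x t. \<not> A (x(v := t)))" by auto
qed

lemma constructible_project_var:
 assumes "constructible I A"
 shows "constructible (I - {v}) (%x. EX t. A (x(v := t)))"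
proof -
 let ?J = "I - {v}"
 obtain M where M: "ALL L q. (L, q) \<in> set M --> polyfam ?J q & (\<forall>P\<in>set L. polyfam ?J P)"
  "(%x t. A (x(v := t))) = dnf_eval M"
  using constructible_dnf(1)[OF assms, of v] by (rule dnfE)
 have "constructible ?J (%x. \<exists>k\<in>set M. EX t. (\<forall>P\<in>set (fst k). poly (P x) t = 0) & poly (snd k x) t ~= 0)"
 proof (rule constructible_bex_list)
  fix k assume k: "k \<in> set M"
  obtain L q where Lq: "k = (L, q)" by (cases k)
  have "EX d. bfam ?J P d" if "P \<in> set L" for P
   using M(1) k that unfolding Lq bfam_def polyfam_def by blast
  then obtain d where d: "!!P. P \<in> set L ==> bfam ?J P (d P)" by metis
  obtain e where e: "bfam ?J q e"
   using M(1) k unfolding Lq bfam_def polyfam_def by blast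
  have "constructible ?J (%x. EX t. (\<forall>(P, d)\<in>set (map (%P. (P, d P)) L). poly (P x) t = 0) & poly (q x) t ~= 0)"
   by (rule constructible_common_root[OF _ e]) (use d in auto)
  then show "constructible ?J (%x. EX t. (\<forall>P\<in>set (fst k). poly (P x) t = 0) & poly (snd k x) t ~= 0)"
   by (simp add: Lq)
 qed
 moreover have "(%x. \<exists>k\<in>set M. EX t. (\<forall>P\<in>set (fst k). poly (P x) t = 0) & poly (snd k x) t ~= 0)
  = (%x. EX t. A (x(v := t)))"
 proof
  fix x
  have "A (x(v := t)) \<longleftrightarrow> (\<exists>k\<in>set M. (\<forall>P\<in>set (fst k). poly (P x) t = 0) & poly (snd k x) t ~= 0)" for t
   using fun_cong[OF fun_cong[OF M(2)], of x t] by (simp add: dnf_eval_def case_prod_beta del: fun_upd_apply)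
  then show "(\<exists>k\<in>set M. EX t. (\<forall>P\<in>set (fst k). poly (P x) t = 0) & poly (snd k x) t ~= 0) = (EX t. A (x(v := t)))"
   by blast
 qed
 ultimately show ?thesis by simp
qed

text \<open>Chevalley's theorem for coordinate projections, eliminating the variables from
  \<open>W\<close> one at a time.\<close>

theorem constructible_project:
 assumes "finite W" "constructible I A"
 shows "constructible (I - W) (%x. EX y. A (%v. if v \<in> W then y v else x v))"
 using assms
proof (induction W arbitrary: I A rule: finite_induct)
 case empty
 then show ?case by simp
next
 case (insert w W)
 have "constructible (I - {w} - W) (%x. EX y. EX t. A ((%v. if v \<in> W then y v else x v)(w := t)))"
  by (rule insert.IH) (rule constructible_project_var[OF insert.prems])
 moreover have "(EX y. EX t. A ((%v. if v \<in> W then y v else x v)(w := t)))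
  \<longleftrightarrow> (EX y. A (%v. if v \<in> insert w W then y v else x v))" for x
 proof
  assume "EX y. EX t. A ((%v. if v \<in> W then y v else x v)(w := t))"
  then obtain y t where "A ((%v. if v \<in> W then y v else x v)(w := t))" by blast
  moreover have "(%v. if v \<in> W then y v else x v)(w := t) = (%v. if v \<in> insert w W then (y(w := t)) v else x v)"
   by auto
  ultimately show "EX y. A (%v. if v \<in> insert w W then y v else x v)" by metis
 next
  assume "EX y. A (%v. if v \<in> insert w W then y v else x v)"
  then obtain y where "A (%v. if v \<in> insert w W then y v else x v)" by blast
  moreover have "(%v. if v \<in> insert w W then y v else x v) = (%v. if v \<in> W then y v else x v)(w := y w)"
   by auto
  ultimately show "EX y. EX t. A ((%v. if v \<in> W then y v else x v)(w := t))" by metis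
 qed
 moreover have "I - {w} - W = I - insert w W" by auto
 ultimately show ?case by simp
qed

section \<open>Dickson's lemma and Hilbert's basis theorem for submodules\<close>

lemma nat_seq_monotone_subseq:
 fixes s :: "nat => nat"
 shows "\<exists>r :: nat => nat. strict_mono r & (ALL j k. j \<le> k --> s (r j) \<le> s (r k))"
proof -
 \<comment> \<open>An index of a smallest value among all \<open>s i\<close> with
   \<open>k \<le> i\<close>. Passing on from one such index to the next gives a nondecreasing
   subsequence.\<close>
 define f where "f k = (ARG_MIN s i. k \<le> i)" for k
 have f: "k \<le> f k" "!!i. k \<le> i ==> s (f k) \<le> s i" for k
  using arg_min_nat_lemma[of "%i. k \<le> i" k s] unfolding f_def by auto
 define r where "r = rec_nat (f 0) (%_ i. f (Suc i))"
 have r: "r 0 = f 0" "r (Suc k) = f (Suc (r k))" for k by (simp_all add: r_def)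
 have "strict_mono r" unfolding strict_mono_Suc_iff
 proof
  fix k show "r k < r (Suc k)" using f(1)[of "Suc (r k)"] by (simp add: r)
 qed
 have *: "s (r k) \<le> s i" if "r k \<le> i" for k i
 proof (cases k)
  case 0
  then show ?thesis using f(2)[of 0 i] by (simp add: r)
 next
  case (Suc l)
  then show ?thesis using f(2)[of "Suc (r l)" i] f(1)[of "Suc (r l)"] that by (simp add: r)
 qed
 have "s (r j) \<le> s (r k)" if "j \<le> k" for j k
  using * \<open>strict_mono r\<close> that by (simp add: strict_mono_less_eq)
 then show ?thesis using \<open>strict_mono r\<close> by (intro exI[of _ r] conjI allI impI)
qed

lemma dickson_subseq:
 fixes t :: "nat => 'v => nat"
 assumes "finite V"
 shows "\<exists>r :: nat => nat. strict_mono r & (\<forall>v\<in>V. ALL j k. j \<le> k --> t (r j) v \<le> t (r k) v)"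
 using assms
 proof (induction V rule: finite_induct)
  case empty
  have "strict_mono (%k::nat. k)" by (rule strict_monoI)
  then show ?case by (intro exI[of _ "%k. k"] conjI) simp_all
 next
  case (insert v V)
  from insert.IH obtain r :: "nat => nat" where r: "strict_mono r" "\<forall>v\<in>V. ALL j k. j \<le> k --> t (r j) v \<le> t (r k) v"
   by (elim exE conjE)
  from nat_seq_monotone_subseq[of "%k. t (r k) v"]
  obtain q :: "nat => nat" where q: "strict_mono q" "ALL j k. j \<le> k --> t (r (q j)) v \<le> t (r (q k)) v"
   by (elim exE conjE)
  have "strict_mono (r \<circ> q)" using r(1) q(1) by (rule strict_mono_o)
  moreover have "\<forall>w\<in>insert v V. ALL j k. j \<le> k --> t ((r \<circ> q) j) w \<le> t ((r \<circ> q) k) w"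
   using r(2) q by (auto simp: strict_mono_less_eq)
  ultimately show ?case by (intro exI[of _ "r \<circ> q"] conjI)
 qed

text \<open>Nondecreasing subsequences are extracted for each variable in turn; any two terms of the
  last one are comparable in every exponent.\<close>

lemma dickson:
 fixes t :: "nat => 'v \<Rightarrow>\<^sub>0 nat"
 assumes "finite V" "!!k. keys (t k) \<subseteq> V"
 shows "EX j k. j < k & (ALL v. lookup (t j) v \<le> lookup (t k) v)"
proof -
 from dickson_subseq[OF assms(1), of "%k. lookup (t k)"]
 obtain r :: "nat => nat" where r: "strict_mono r"
  "\<forall>v\<in>V. ALL j k. j \<le> k --> lookup (t (r j)) v \<le> lookup (t (r k)) v"
  by (elim exE conjE)
 have "lookup (t (r 0)) v \<le> lookup (t (r 1)) v" for v
 proof (cases "v \<in> V")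
  case False
  then have "v \<notin> keys (t (r 0))" using assms(2) by blast
  then show ?thesis by (simp add: in_keys_iff)
 qed (use r(2) in simp)
 moreover have "r 0 < r 1" using r(1) by (simp add: strict_mono_less)
 ultimately show ?thesis by (intro exI[of _ "r 0"] exI[of _ "r 1"] conjI allI)
qed

lemma poly_mapping_minus_nat:
 assumes "!!v. lookup (a :: 'v \<Rightarrow>\<^sub>0 nat) v \<le> lookup b v"
 shows "(b - a) + a = b"
 by (rule poly_mapping_eqI) (use assms in \<open>simp add: lookup_add lookup_minus\<close>)

lemma poly_mapping_nat_nonneg: "0 \<le> (s :: 'v::linorder \<Rightarrow>\<^sub>0 nat)"
proof (rule ccontr)
 assume "\<not> 0 \<le> s"
 then have "s < 0" by simp
 then show False by (auto simp: less_poly_mapping.rep_eq less_fun_def)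
qed

text \<open>The order on exponent functions is lexicographic. It is compatible with addition and
  extends divisibility of monomials, so it can serve as a term order.\<close>

lemma poly_mapping_le_of_pointwise:
 assumes "!!v. lookup (a :: 'v::linorder \<Rightarrow>\<^sub>0 nat) v \<le> lookup b v"
 shows "a \<le> b"
 using add_right_mono[OF poly_mapping_nat_nonneg[of "b - a"], of a] poly_mapping_minus_nat[OF assms] by simp

text \<open>In an infinite descent Dickson's lemma would find an earlier exponent dividing a later
  one, although the later one is smaller.\<close>

lemma wf_monomials:
 assumes "finite (V :: 'v::linorder set)"
 shows "wf {(a, b :: 'v \<Rightarrow>\<^sub>0 nat). a < b & keys a \<subseteq> V & keys b \<subseteq> V}"
 unfolding wf_iff_no_infinite_down_chain
proof
 assume "EX t. ALL i. (t (Suc i), t i) \<in> {(a, b :: 'v \<Rightarrow>\<^sub>0 nat). a < b & keys a \<subseteq> V & keys b \<subseteq> V}"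
 then obtain t :: "nat => 'v \<Rightarrow>\<^sub>0 nat"
  where t0: "ALL i. (t (Suc i), t i) \<in> {(a, b). a < b & keys a \<subseteq> V & keys b \<subseteq> V}"
  by (elim exE)
 have t: "t (Suc i) < t i" "keys (t i) \<subseteq> V" for i
  using t0[rule_format, of i] by simp_all
 from dickson[of V t, OF assms t(2)]
 obtain j k where jk: "j < k" "ALL v. lookup (t j) v \<le> lookup (t k) v"
  by (elim exE conjE)
 have "t (j + Suc d) < t j" for d
 proof (induction d)
  case (Suc d)
  then show ?case using t(1)[of "j + Suc d"] by (simp only: add_Suc_right)
 qed (use t(1)[of j] in simp)
 then have "t k < t j" using jk(1) less_iff_Suc_add[of j k] by auto
 then show False using poly_mapping_le_of_pointwise[of "t j" "t k"] jk(2) by simp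
qed

text \<open>Submodules of a free module of rank \<open>m\<close> over the polynomials in \<open>x 0, \<dots>, x n\<close>. Terms of vectors
 are encoded as monomials, the component \<open>i\<close> as $x_{n+1}^i x_{n+2}^{m-i}$, so that divisibility
 of encoded terms forces equal components.\<close>

definition vterm :: "nat => nat => nat => (nat \<Rightarrow>\<^sub>0 nat) => (nat \<Rightarrow>\<^sub>0 nat)" where
 "vterm n m i mo = mo + single (n + 1) i + single (n + 2) (m - i)"

definition vterms :: "nat => nat => (nat => nat mpoly) => (nat \<Rightarrow>\<^sub>0 nat) set" where
 "vterms n m p = (\<Union>i<m. vterm n m i ` keys (p i))"

definition generated :: "nat => nat => (nat => nat mpoly) set => (nat => nat mpoly) => bool" where
 "generated n m G p \<longleftrightarrow> (EX c. (\<forall>g\<in>G. c g \<in> polys {..n}) & (\<forall>i<m. p i = (\<Sum>g\<in>G. c g * g i)))"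

text \<open>Otherwise an element not generated by the previous ones, with least leading term among
  these, can be chosen again and again. Some leading term divides a later one; subtracting a
  multiple lowers the later leading term, so the difference is generated by the earlier elements,
  and hence so is the later element.\<close>

theorem hilbert_basis:
 fixes M :: "(nat => nat mpoly) set"
 assumes polys: "!!p i. p \<in> M ==> i < m ==> p i \<in> polys {..n}"
  and closed: "!!p q c. p \<in> M ==> q \<in> M ==> c \<in> polys {..n} ==> (%i. p i - c * q i) \<in> M"
 obtains G where "finite G" "G \<subseteq> M" "!!p. p \<in> M ==> generated n m G p"
proof -
 have "EX G. finite G & G \<subseteq> M & (\<forall>p\<in>M. generated n m G p)"
 proof (rule ccontr)
 assume "\<nexists>G. finite G & G \<subseteq> M & (\<forall>p\<in>M. generated n m G p)"
 then have none: "\<exists>p\<in>M. \<not> generated n m G p" if "finite G" "G \<subseteq> M" for G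
  using that by blast
 define V where "V = {..n + 2}"
 have fin: "finite (vterms n m p)" for p by (simp add: vterms_def)
 have keysV: "keys t \<subseteq> V" if pt: "p \<in> M" "t \<in> vterms n m p" for p t
 proof -
  obtain i mo where i: "i < m" "mo \<in> keys (p i)" "t = vterm n m i mo"
   using pt(2) by (auto simp: vterms_def)
  have "keys mo \<subseteq> {..n}" using polys[OF pt(1) i(1)] i(2) by (auto simp: polys_def)
  moreover have "keys t \<subseteq> keys mo \<union> keys (single (n + 1) i)
   \<union> keys (single (n + 2) (m - i))"
   unfolding i(3) vterm_def
   using Poly_Mapping.keys_add[of "mo + single (n + 1) i" "single (n + 2) (m - i)"]
    Poly_Mapping.keys_add[of mo "single (n + 1) i"] by blast
  moreover have "keys (single (n + 1) i) \<subseteq> V"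
   "keys (single (n + 2) (m - i)) \<subseteq> V" by (auto simp: V_def)
  ultimately show ?thesis unfolding V_def by fastforce
 qed
 have nonempty: "vterms n m p ~= {}" if "\<not> generated n m G p" for G p
 proof
  assume "vterms n m p = {}"
  then have "p i = 0" if "i < m" for i using that by (auto simp: vterms_def)
  then have "generated n m G p" unfolding generated_def by (intro exI[of _ "%_. 0"]) simp
  then show False using that by simp
 qed
 define lt where "lt p = Max (vterms n m p)" for p
 have lt_in: "lt p \<in> vterms n m p" if "vterms n m p ~= {}" for p
  unfolding lt_def using fin that by (rule Max_in)
 have "EX p. p \<in> M & \<not> generated n m G p & (\<forall>q\<in>M. lt q < lt p --> generated n m G q)"
  if G: "finite G" "G \<subseteq> M" for G
 proof -
  let ?R = "{(a, b :: nat \<Rightarrow>\<^sub>0 nat). a < b & keys a \<subseteq> V & keys b \<subseteq> V}"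
  have wf: "wf ?R" by (rule wf_monomials) (simp add: V_def)
  let ?S = "lt ` {p \<in> M. \<not> generated n m G p}"
  obtain p0 where "p0 \<in> M" "\<not> generated n m G p0" using none[OF G] by (elim bexE)
  then have "lt p0 \<in> ?S" by (intro imageI CollectI conjI)
  then have "\<exists>z\<in>?S. ALL y. (y, z) \<in> ?R --> y \<notin> ?S"
   by (rule wf[unfolded wf_eq_minimal, rule_format])
  then obtain z where z: "z \<in> ?S" "ALL y. (y, z) \<in> ?R --> y \<notin> ?S"
   by (elim bexE)
  then obtain p where p: "p \<in> M" "\<not> generated n m G p" "z = lt p" by auto
  have "generated n m G q" if q: "q \<in> M" "lt q < lt p" for q
  proof (rule ccontr)
   assume ng: "\<not> generated n m G q"
   then have "(lt q, lt p) \<in> ?R"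
    using keysV[OF q(1) lt_in[OF nonempty[OF ng]]] keysV[OF p(1) lt_in[OF nonempty[OF p(2)]]] q(2) by simp
   then have "lt q \<notin> ?S" using z(2) p(3) by simp
   moreover have "lt q \<in> ?S" using ng q(1) by (intro imageI CollectI conjI)
   ultimately show False by contradiction
  qed
  then show ?thesis using p by (intro exI[of _ p]) simp
 qed
 then have "ALL G. EX p. finite G & G \<subseteq> M --> p \<in> M & \<not> generated n m G p & (\<forall>q\<in>M. lt q < lt p --> generated n m G q)"
  by auto
 then obtain pick where pick0: "ALL G. finite G & G \<subseteq> M --> pick G \<in> M & \<not> generated n m G (pick G)
   & (\<forall>q\<in>M. lt q < lt (pick G) --> generated n m G q)"
  by (rule choice[THEN exE])
 then have pick: "!!G. finite G ==> G \<subseteq> M ==> pick G \<in> M"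
  "!!G. finite G ==> G \<subseteq> M ==> \<not> generated n m G (pick G)"
  "!!G q. finite G ==> G \<subseteq> M ==> q \<in> M ==> lt q < lt (pick G) ==> generated n m G q" by auto
 define Gs where "Gs = rec_nat {} (%_ G. insert (pick G) G)"
 have Gs_Suc: "Gs (Suc k) = insert (pick (Gs k)) (Gs k)" for k by (simp add: Gs_def)
 have Gs: "finite (Gs k) & Gs k \<subseteq> M" for k
 proof (induction k)
  case (Suc k)
  then show ?case using pick(1) by (simp add: Gs_Suc)
 qed (simp add: Gs_def)
 have Gs_mono: "Gs j \<subseteq> Gs k" if "j \<le> k" for j k
  using that by (rule lift_Suc_mono_le[rotated]) (auto simp: Gs_Suc)
 define p where "p k = pick (Gs k)" for k
 have pM: "p k \<in> M" and png: "\<not> generated n m (Gs k) (p k)" for k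
  using pick(1,2) Gs by (auto simp: p_def)
 have "EX j k. j < k & (ALL v. lookup (lt (p j)) v \<le> lookup (lt (p k)) v)"
  by (rule dickson[of V "%k. lt (p k)"]) (use keysV[OF pM lt_in[OF nonempty[OF png]]] in \<open>simp_all add: V_def\<close>)
 then obtain j k where jk: "j < k" and le: "ALL v. lookup (lt (p j)) v \<le> lookup (lt (p k)) v"
  by (elim exE conjE)
 have pj: "p j \<in> Gs k"
  using Gs_mono[of "Suc j" k] jk by (auto simp: Gs_Suc p_def)
 obtain i mo where i: "i < m" "mo \<in> keys (p k i)" "lt (p k) = vterm n m i mo"
  using lt_in[OF nonempty[OF png[of k]]] by (auto simp: vterms_def)
 obtain i' mo' where i': "i' < m" "mo' \<in> keys (p j i')" "lt (p j) = vterm n m i' mo'"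
  using lt_in[OF nonempty[OF png[of j]]] by (auto simp: vterms_def)
 have mo_out: "lookup mo v = 0" "lookup mo' v = 0" if "n < v" for v
 proof -
  have "keys mo \<subseteq> {..n}" "keys mo' \<subseteq> {..n}"
   using polys[OF pM i(1)] polys[OF pM i'(1)] i(2) i'(2) by (auto simp: polys_def)
  then have "v \<notin> keys mo" "v \<notin> keys mo'" using that by auto
  then show "lookup mo v = 0" "lookup mo' v = 0" by (simp_all add: in_keys_iff)
 qed
 \<comment> \<open>The exponents of the two extra variables are \<open>i\<close> and
   \<open>m - i\<close>: divisibility in the one bounds the component from one side, in the other
   from the other side.\<close>
 have "i' \<le> i" using le[rule_format, of "n + 1"] mo_out[of "n + 1"]
  by (simp add: i(3) i'(3) vterm_def lookup_add lookup_single)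
 moreover have "m - i' \<le> m - i" using le[rule_format, of "n + 2"] mo_out[of "n + 2"]
  by (simp add: i(3) i'(3) vterm_def lookup_add lookup_single)
 ultimately have ii: "i' = i" using i(1) i'(1) by linarith
 define s where "s = mo - mo'"
 have "lookup mo' v \<le> lookup mo v" for v
  using le[rule_format, of v] by (simp add: i(3) i'(3) ii vterm_def lookup_add)
 then have s: "mo = s + mo'" unfolding s_def using poly_mapping_minus_nat[of mo' mo] by simp
 have s_polys: "single s c \<in> polys {..n}" for c
 proof -
  have "keys s \<subseteq> keys mo"
   unfolding s by (auto simp: in_keys_iff lookup_add)
  then show ?thesis using polys[OF pM i(1)] i(2) by (auto simp: polys_def)
 qed
 \<comment> \<open>The quotient of the two leading coefficients, so that the leading term cancels in
   \<open>q\<close>.\<close>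
 define c where "c = lookup (p k i) mo / lookup (p j i) mo'"
 define q where "q i = p k i - single s c * p j i" for i
 have qM: "q \<in> M" unfolding q_def using closed[OF pM[of k] pM[of j] s_polys] .
 have shift: "lookup (single s c * r) (s + u) = c * lookup r u" for r u
 proof -
  have e: "single s c * r = (\<Sum>w\<in>keys r. single (s + w) (c * lookup r w))"
   by (subst mpoly_eq_sum[of r]) (simp add: sum_distrib_left mult_single)
  have "lookup (single s c * r) (s + u) = (\<Sum>w\<in>keys r. if w = u then c * lookup r w else 0)"
   unfolding e by (auto simp: lookup_sum lookup_single when_def intro!: sum.cong)
  also have "\<dots> = c * lookup r u" by (simp add: in_keys_iff)
  finally show ?thesis .
 qed
 have terms: "t < lt (p k)" if t: "t \<in> vterms n m q" for t
 proof -
  obtain l w where l: "l < m" "w \<in> keys (q l)" "t = vterm n m l w"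
   using t by (auto simp: vterms_def)
  have "t ~= lt (p k)"
  proof
   assume eq: "t = lt (p k)"
   have w_out: "lookup w v = 0" if "n < v" for v
   proof -
    have "keys w \<subseteq> {..n}" using polys[OF qM l(1)] l(2) by (auto simp: polys_def)
    then have "v \<notin> keys w" using that by auto
    then show ?thesis by (simp add: in_keys_iff)
   qed
   have "lookup t (n + 1) = lookup (lt (p k)) (n + 1)" using eq by simp
   then have "l = i" using w_out[of "n + 1"] mo_out[of "n + 1"]
    by (simp add: l(3) i(3) vterm_def lookup_add lookup_single)
   then have "w = mo" using eq unfolding l(3) i(3) vterm_def by simp
   have "lookup (q i) mo = lookup (p k i) mo - c * lookup (p j i) mo'"
    unfolding q_def lookup_minus by (simp add: s shift)
   also have "\<dots> = 0" using i'(2) ii by (simp add: c_def in_keys_iff)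
   finally show False using l(2) \<open>l = i\<close> \<open>w = mo\<close> by (simp add: in_keys_iff)
  qed
  moreover have "t \<le> lt (p k)"
  proof (cases "w \<in> keys (p k l)")
   case True
   then have "t \<in> vterms n m (p k)" using l by (auto simp: vterms_def)
   then show ?thesis unfolding lt_def using fin by (intro Max_ge)
  next
   case False
   then have "w \<in> keys (single s c * p j l)"
    using l(2) by (auto simp: q_def in_keys_iff lookup_minus)
   then obtain w' where w': "w' \<in> keys (p j l)" "w = s + w'"
    using keys_mult[of "single s c" "p j l"] by (auto split: if_splits)
   have "vterm n m l w' \<in> vterms n m (p j)" using w' l by (auto simp: vterms_def)
   then have "vterm n m l w' \<le> lt (p j)" unfolding lt_def using fin by (intro Max_ge)
   then have "s + vterm n m l w' \<le> s + lt (p j)" by (rule add_left_mono)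
   moreover have "s + vterm n m l w' = t" by (simp add: l(3) w'(2) vterm_def add.assoc)
   moreover have "s + lt (p j) = lt (p k)" by (simp add: i(3) i'(3) ii s vterm_def add.assoc)
   ultimately show ?thesis by simp
  qed
  ultimately show ?thesis by simp
 qed
 \<comment> \<open>Either \<open>q\<close> has no terms at all, or its leading term lies below the
   least one among the elements that \<open>Gs k\<close> does not generate.\<close>
 have "generated n m (Gs k) q"
 proof (cases "vterms n m q = {}")
  case False
  then have "lt q < lt (p k)" using lt_in terms by blast
  then show ?thesis using pick(3)[of "Gs k" q] Gs qM by (simp add: p_def)
 qed (use nonempty in blast)
 then obtain d where d: "!!g. g \<in> Gs k ==> d g \<in> polys {..n}" "!!i. i < m ==> q i = (\<Sum>g\<in>Gs k. d g * g i)"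
  by (auto simp: generated_def)
 have "generated n m (Gs k) (p k)"
  unfolding generated_def
 proof (intro exI[of _ "d(p j := d (p j) + single s c)"] conjI ballI allI impI)
  fix g assume "g \<in> Gs k"
  then show "(d(p j := d (p j) + single s c)) g \<in> polys {..n}"
   using d(1) pj s_polys by (auto intro: polys_add)
 next
  fix i assume i: "i < m"
  have fG: "finite (Gs k)" using Gs by blast
  have "p k i = q i + single s c * p j i" by (simp add: q_def)
  also have "\<dots> = (\<Sum>g\<in>Gs k. d g * g i + (if g = p j then single s c * p j i else 0))"
   using pj fG by (simp add: d(2)[OF i] sum.distrib)
  also have "\<dots> = (\<Sum>g\<in>Gs k. (d(p j := d (p j) + single s c)) g * g i)"
   by (intro sum.cong refl) (simp add: distrib_right)
  finally show "p k i = (\<Sum>g\<in>Gs k. (d(p j := d (p j) + single s c)) g * g i)" .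
 qed
 then show False using png by blast
 qed
 then show thesis using that by blast
qed

section \<open>The cubic form of E6 and its matrix factorization\<close>

text \<open>The cubic invariant of the 27-dimensional representation of $E_6$ on triples $(A, B, C)$ of
 $3 \times 3$ matrices, $\det A + \det B + \det C - \mathrm{tr}(ABC)$, as the list of its 45 signed
 monomials; the entries of the three matrices are numbered row by row. The matrix \<open>hess x\<close> is
 the Hessian, \<open>sharp x\<close> the gradient.\<close>

definition cub :: "(int \<times> nat \<times> nat \<times> nat) list" where
 "cub = [
  (1, 0, 4, 8), (-1, 0, 5, 7), (-1, 1, 3, 8), (1, 1, 5, 6), (1, 2, 3, 7), (-1, 2, 4, 6), (1,
  9, 13, 17), (-1, 9, 14, 16), (-1, 10, 12, 17), (1, 10, 14, 15), (1, 11, 12, 16), (-1, 11,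
  13, 15), (1, 18, 22, 26), (-1, 18, 23, 25), (-1, 19, 21, 26), (1, 19, 23, 24), (1, 20, 21,
  25), (-1, 20, 22, 24), (-1, 0, 9, 18), (-1, 0, 10, 21), (-1, 0, 11, 24), (-1, 1, 12, 18),
  (-1, 1, 13, 21), (-1, 1, 14, 24), (-1, 2, 15, 18), (-1, 2, 16, 21), (-1, 2, 17, 24), (-1,
  3, 9, 19), (-1, 3, 10, 22), (-1, 3, 11, 25), (-1, 4, 12, 19), (-1, 4, 13, 22), (-1, 4, 14,
  25), (-1, 5, 15, 19), (-1, 5, 16, 22), (-1, 5, 17, 25), (-1, 6, 9, 20), (-1, 6, 10, 23),
  (-1, 6, 11, 26), (-1, 7, 12, 20), (-1, 7, 13, 23), (-1, 7, 14, 26), (-1, 8, 15, 20), (-1,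
  8, 16, 23), (-1, 8, 17, 26)]"

definition cubic :: "(nat => complex) => complex" where
 "cubic x = (\<Sum>(e, a, b, c)\<leftarrow>cub. of_int e * (x a * x b * x c))"

definition sharp :: "(nat => complex) => nat => complex" where
 "sharp x i = (\<Sum>(e, a, b, c)\<leftarrow>cub. of_int e *
  ((if i = a then x b * x c else 0) + (if i = b then x a * x c else 0) + (if i = c then x a * x b else 0)))"

definition hess :: "(nat => complex) => nat => nat => complex" where
 "hess x i j = (\<Sum>(e, a, b, c)\<leftarrow>cub. of_int e *
  ((if i = a & j = b \<or> i = b & j = a then x c else 0) + (if i = a & j = c \<or> i = c & j = a then x b else 0)
   + (if i = b & j = c \<or> i = c & j = b then x a else 0)))"

text \<open>Differentiating \<open>sharp (sharp x) = cubic x * x\<close> shows that the product of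
  the Hessians at \<open>sharp x\<close> and at \<open>x\<close> is \<open>cubic x\<close> times the
  identity plus the rank one matrix of \<open>x i * sharp x j\<close>. Since the Hessian at
  \<open>x\<close> maps \<open>x\<close> to \<open>2 * sharp x\<close>, subtracting
  \<open>x i * x j / 2\<close> removes exactly this extra term.\<close>

definition cofactor :: "(nat => complex) => nat => nat => complex" where
 "cofactor x i j = hess (sharp x) i j - x i * x j / 2"

text \<open>The polarization of the quadratic map \<open>sharp\<close>, normalized by
  \<open>sharp2 x x = 2 * sharp x\<close>; it is the Hessian at \<open>x\<close> applied to
  \<open>y\<close>.\<close>

definition sharp2 :: "(nat => complex) => (nat => complex) => nat => complex" where
 "sharp2 x y i = (\<Sum>(e, a, b, c)\<leftarrow>cub. of_int e *
  ((if i = a then x b * y c + x c * y b else 0) + (if i = b then x a * y c + x c * y a else 0)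
   + (if i = c then x a * y b + x b * y a else 0)))"

lemma cub_range: "(e, a, b, c) \<in> set cub ==> a < 27 & b < 27 & c < 27 & a ~= b & a ~= c & b ~= c"
 by (simp add: cub_def) (elim disjE conjE; simp)

lemma sum_list_eqI: "(!!e a b c. (e, a, b, c) \<in> set L ==> f e a b c = g e a b c) ==>
 (\<Sum>(e, a, b, c)\<leftarrow>L. f e a b c) = (\<Sum>(e, a, b, c)\<leftarrow>L. (g e a b c :: complex))"
 by (intro arg_cong[where f = sum_list] map_cong) auto

lemma hess_sym: "hess x i j = hess x j i"
 unfolding hess_def by (rule sum_list_eqI) (simp add: conj_commute disj_commute)

lemma cofactor_sym: "cofactor x i j = cofactor x j i"
 by (simp add: cofactor_def hess_sym[of _ i j] mult.commute)

lemma sharp_line: "sharp (%v. x v + s * y v) i = sharp x i + s * sharp2 x y i + s\<^sup>2 * sharp y i"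
proof -
 have "sharp x i + s * sharp2 x y i + s\<^sup>2 * sharp y i =
  (\<Sum>(e, a, b, c)\<leftarrow>cub. of_int e * ((if i = a then x b * x c else 0) + (if i = b then x a * x c else 0) + (if i = c then x a * x b else 0))
  + s * (of_int e * ((if i = a then x b * y c + x c * y b else 0) + (if i = b then x a * y c + x c * y a else 0)
   + (if i = c then x a * y b + x b * y a else 0)))
  + s\<^sup>2 * (of_int e * ((if i = a then y b * y c else 0) + (if i = b then y a * y c else 0) + (if i = c then y a * y b else 0))))"
  by (simp add: sharp_def sharp2_def sum_list_addf split_def sum_list_const_mult)
 also have "\<dots> = sharp (%v. x v + s * y v) i"
  unfolding sharp_def by (rule sum_list_eqI) (simp add: algebra_simps power2_eq_square)
 finally show ?thesis ..
qed

lemma sum_delta_pair: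
 assumes "a < (27::nat)" "b < 27" "a ~= b"
 shows "(\<Sum>j<27. (if i = a & j = b \<or> i = b & j = a then z else 0) * y j)
  = (if i = a then z * y b else 0) + (if i = b then z * y a else (0::complex))"
proof -
 have "(\<Sum>j<27. (if i = a & j = b \<or> i = b & j = a then z else 0) * y j)
  = (\<Sum>j<27. (if j = b then (if i = a then z * y b else 0) else 0) + (if j = a then (if i = b then z * y a else 0) else 0))"
  using assms by (intro sum.cong) auto
 also have "\<dots> = (if i = a then z * y b else 0) + (if i = b then z * y a else 0)"
  unfolding sum.distrib using assms(1,2) by simp
 finally show ?thesis .
qed

lemma sum_swap_list: "(\<Sum>j<n. (\<Sum>(e, a, b, c)\<leftarrow>L. f e a b c (j::nat))) = (\<Sum>(e, a, b, c)\<leftarrow>L. (\<Sum>j<n. (f e a b c j :: complex)))"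
 by (induction L) (auto simp: sum.distrib)

lemma hess_mult: "(\<Sum>j<27. hess x i j * y j) = sharp2 x y i"
proof -
 have "(\<Sum>j<27. hess x i j * y j) = (\<Sum>j<27. (\<Sum>(e, a, b, c)\<leftarrow>cub. of_int e *
  ((if i = a & j = b \<or> i = b & j = a then x c else 0) * y j + (if i = a & j = c \<or> i = c & j = a then x b else 0) * y j
   + (if i = b & j = c \<or> i = c & j = b then x a else 0) * y j)))"
  unfolding hess_def sum_list_mult_const[symmetric]
  by (intro sum.cong refl arg_cong[where f = sum_list] map_cong) (auto simp: algebra_simps)
 also have "\<dots> = (\<Sum>(e, a, b, c)\<leftarrow>cub. of_int e *
  ((\<Sum>j<27. (if i = a & j = b \<or> i = b & j = a then x c else 0) * y j)
   + (\<Sum>j<27. (if i = a & j = c \<or> i = c & j = a then x b else 0) * y j)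
   + (\<Sum>j<27. (if i = b & j = c \<or> i = c & j = b then x a else 0) * y j)))"
  unfolding sum_swap_list by (rule sum_list_eqI) (simp only: sum.distrib sum_distrib_left[symmetric])
 also have "\<dots> = sharp2 x y i"
  unfolding sharp2_def
 proof (rule sum_list_eqI)
  fix e a b c assume "(e, a, b, c) \<in> set cub"
  then have *: "a < 27" "b < 27" "c < 27" "a ~= b" "a ~= c" "b ~= c" using cub_range by auto
  show "of_int e *
  ((\<Sum>j<27. (if i = a & j = b \<or> i = b & j = a then x c else 0) * y j)
   + (\<Sum>j<27. (if i = a & j = c \<or> i = c & j = a then x b else 0) * y j)
   + (\<Sum>j<27. (if i = b & j = c \<or> i = c & j = b then x a else 0) * y j)) =
   of_int e * ((if i = a then x b * y c + x c * y b else 0) + (if i = b then x a * y c + x c * y a else 0)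
   + (if i = c then x a * y b + x b * y a else 0))"
   unfolding sum_delta_pair[OF *(1,2,4)] sum_delta_pair[OF *(1,3,5)] sum_delta_pair[OF *(2,3,6)]
   by (auto simp: algebra_simps)
 qed
 finally show ?thesis .
qed

lemma sharp_table:
 "sharp x 0 = x 4 * x 8 - x 5 * x 7 - x 9 * x 18 - x 10 * x 21 - x 11 * x 24"
 "sharp x 1 = - x 3 * x 8 + x 5 * x 6 - x 12 * x 18 - x 13 * x 21 - x 14 * x 24"
 "sharp x 2 = x 3 * x 7 - x 4 * x 6 - x 15 * x 18 - x 16 * x 21 - x 17 * x 24"
 "sharp x 3 = - x 1 * x 8 + x 2 * x 7 - x 9 * x 19 - x 10 * x 22 - x 11 * x 25"
 "sharp x 4 = x 0 * x 8 - x 2 * x 6 - x 12 * x 19 - x 13 * x 22 - x 14 * x 25"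
 "sharp x 5 = - x 0 * x 7 + x 1 * x 6 - x 15 * x 19 - x 16 * x 22 - x 17 * x 25"
 "sharp x 6 = x 1 * x 5 - x 2 * x 4 - x 9 * x 20 - x 10 * x 23 - x 11 * x 26"
 "sharp x 7 = - x 0 * x 5 + x 2 * x 3 - x 12 * x 20 - x 13 * x 23 - x 14 * x 26"
 "sharp x 8 = x 0 * x 4 - x 1 * x 3 - x 15 * x 20 - x 16 * x 23 - x 17 * x 26"
 "sharp x 9 = x 13 * x 17 - x 14 * x 16 - x 0 * x 18 - x 3 * x 19 - x 6 * x 20"
 "sharp x 10 = - x 12 * x 17 + x 14 * x 15 - x 0 * x 21 - x 3 * x 22 - x 6 * x 23"
 "sharp x 11 = x 12 * x 16 - x 13 * x 15 - x 0 * x 24 - x 3 * x 25 - x 6 * x 26"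
 "sharp x 12 = - x 10 * x 17 + x 11 * x 16 - x 1 * x 18 - x 4 * x 19 - x 7 * x 20"
 "sharp x 13 = x 9 * x 17 - x 11 * x 15 - x 1 * x 21 - x 4 * x 22 - x 7 * x 23"
 "sharp x 14 = - x 9 * x 16 + x 10 * x 15 - x 1 * x 24 - x 4 * x 25 - x 7 * x 26"
 "sharp x 15 = x 10 * x 14 - x 11 * x 13 - x 2 * x 18 - x 5 * x 19 - x 8 * x 20"
 "sharp x 16 = - x 9 * x 14 + x 11 * x 12 - x 2 * x 21 - x 5 * x 22 - x 8 * x 23"
 "sharp x 17 = x 9 * x 13 - x 10 * x 12 - x 2 * x 24 - x 5 * x 25 - x 8 * x 26"
 "sharp x 18 = x 22 * x 26 - x 23 * x 25 - x 0 * x 9 - x 1 * x 12 - x 2 * x 15"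
 "sharp x 19 = - x 21 * x 26 + x 23 * x 24 - x 3 * x 9 - x 4 * x 12 - x 5 * x 15"
 "sharp x 20 = x 21 * x 25 - x 22 * x 24 - x 6 * x 9 - x 7 * x 12 - x 8 * x 15"
 "sharp x 21 = - x 19 * x 26 + x 20 * x 25 - x 0 * x 10 - x 1 * x 13 - x 2 * x 16"
 "sharp x 22 = x 18 * x 26 - x 20 * x 24 - x 3 * x 10 - x 4 * x 13 - x 5 * x 16"
 "sharp x 23 = - x 18 * x 25 + x 19 * x 24 - x 6 * x 10 - x 7 * x 13 - x 8 * x 16"
 "sharp x 24 = x 19 * x 23 - x 20 * x 22 - x 0 * x 11 - x 1 * x 14 - x 2 * x 17"
 "sharp x 25 = - x 18 * x 23 + x 20 * x 21 - x 3 * x 11 - x 4 * x 14 - x 5 * x 17"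
 "sharp x 26 = x 18 * x 22 - x 19 * x 21 - x 6 * x 11 - x 7 * x 14 - x 8 * x 17"
 by (simp_all add: sharp_def cub_def)

lemma less_27_cases: "(i::nat) < 27 ==> (i = 0 \<or> i = 1 \<or> i = 2 \<or> i = 3 \<or> i = 4 \<or> i = 5 \<or> i = 6 \<or> i = 7 \<or> i = 8)
 \<or> (i = 9 \<or> i = 10 \<or> i = 11 \<or> i = 12 \<or> i = 13 \<or> i = 14 \<or> i = 15 \<or> i = 16 \<or> i = 17)
 \<or> (i = 18 \<or> i = 19 \<or> i = 20 \<or> i = 21 \<or> i = 22 \<or> i = 23 \<or> i = 24 \<or> i = 25 \<or> i = 26)"
proof -
 assume "i < 27"
 then have "i \<in> set [0..<27]" by simp
 moreover have "[0..<27::nat] = [0, 1, 2, 3, 4, 5, 6, 7, 8, 9, 10, 11, 12, 13, 14, 15, 16, 17, 18, 19, 20, 21, 22, 23, 24, 25, 26]"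
  by (simp add: upt_rec)
 ultimately show ?thesis by simp
qed

text \<open>Freudenthal's adjoint identity for the exceptional cubic form, verified in each of the
  27 coordinates by expansion into monomials.\<close>

lemma sharp_sharp: "i < 27 ==> sharp (sharp x) i = cubic x * x i"
 by (drule less_27_cases, elim disjE)
  (simp_all only: sharp_table, simp_all add: sharp_table cubic_def cub_def algebra_simps del: One_nat_def)

lemma sum_sharp_mult: "(\<Sum>i<27. sharp x i * y i) = (\<Sum>(e, a, b, c)\<leftarrow>cub. of_int e * (x b * x c * y a + x a * x c * y b + x a * x b * y c))"
proof -
 have "(\<Sum>i<27. sharp x i * y i) = (\<Sum>i<27. (\<Sum>(e, a, b, c)\<leftarrow>cub. of_int e *
 ((if i = a then x b * x c * y i else 0) + (if i = b then x a * x c * y i else 0) + (if i = c then x a * x b * y i else 0))))"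
  unfolding sharp_def sum_list_mult_const[symmetric]
  by (intro sum.cong refl arg_cong[where f = sum_list] map_cong) (auto simp: algebra_simps)
 also have "\<dots> = (\<Sum>(e, a, b, c)\<leftarrow>cub. of_int e * (x b * x c * y a + x a * x c * y b + x a * x b * y c))"
  unfolding sum_swap_list
 proof (rule sum_list_eqI)
  fix e a b c assume "(e, a, b, c) \<in> set cub"
  then have *: "a < 27" "b < 27" "c < 27" using cub_range by auto
  show "(\<Sum>i<27. of_int e * ((if i = a then x b * x c * y i else 0) + (if i = b then x a * x c * y i else 0) + (if i = c then x a * x b * y i else 0)))
   = of_int e * (x b * x c * y a + x a * x c * y b + x a * x b * y c)"
   unfolding sum_distrib_left[symmetric] sum.distrib using * by simp
 qed
 finally show ?thesis .
qed

lemma cubic_line: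
 "cubic (%v. x v + s * y v) = cubic x + s * (\<Sum>i<27. sharp x i * y i) + s\<^sup>2 * (\<Sum>i<27. sharp y i * x i) + s ^ 3 * cubic y"
proof -
 have "cubic x + s * (\<Sum>i<27. sharp x i * y i) + s\<^sup>2 * (\<Sum>i<27. sharp y i * x i) + s ^ 3 * cubic y =
  (\<Sum>(e, a, b, c)\<leftarrow>cub. of_int e * (x a * x b * x c) + s * (of_int e * (x b * x c * y a + x a * x c * y b + x a * x b * y c))
   + s\<^sup>2 * (of_int e * (y b * y c * x a + y a * y c * x b + y a * y b * x c)) + s ^ 3 * (of_int e * (y a * y b * y c)))"
  by (simp add: sum_sharp_mult cubic_def sum_list_addf split_def sum_list_const_mult)
 also have "\<dots> = cubic (%v. x v + s * y v)"
  unfolding cubic_def by (rule sum_list_eqI) (simp add: algebra_simps power2_eq_square power3_eq_cube)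
 finally show ?thesis ..
qed

lemma sharp2_linear: "sharp2 x (%k. y k + s * z k) i = sharp2 x y i + s * sharp2 x z i"
 unfolding hess_mult[symmetric] by (simp add: algebra_simps sum.distrib sum_distrib_left)

lemma sharp2_self: "sharp2 x x i = 2 * sharp x i"
proof -
 have "2 * sharp x i = (\<Sum>(e, a, b, c)\<leftarrow>cub. 2 * (of_int e *
  ((if i = a then x b * x c else 0) + (if i = b then x a * x c else 0) + (if i = c then x a * x b else 0))))"
  by (simp add: sharp_def sum_list_const_mult split_def)
 also have "\<dots> = sharp2 x x i"
  unfolding sharp2_def by (rule sum_list_eqI) (simp add: algebra_simps)
 finally show ?thesis ..
qed

text \<open>Comparing the coefficients of \<open>s\<close> is the way in which identities are
  differentiated here. Degree 4 is the degree of the double adjoint.\<close>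

lemma linear_coeff_eq:
 fixes a0 :: complex
 assumes "!!s. a0 + s * a1 + s\<^sup>2 * a2 + s ^ 3 * a3 + s ^ 4 * a4 = b0 + s * b1 + s\<^sup>2 * b2 + s ^ 3 * b3 + s ^ 4 * b4"
 shows "a1 = b1"
proof -
 have "poly [:a0, a1, a2, a3, a4:] = poly [:b0, b1, b2, b3, b4:]"
  using assms by (intro ext) (simp add: algebra_simps power2_eq_square power3_eq_cube power4_eq_xxxx)
 then show ?thesis by (simp add: poly_eq_poly_eq_iff)
qed

text \<open>Differentiating the adjoint identity \<open>sharp (sharp x) = cubic x * x\<close>.\<close>

lemma hess_sharp_mult_hess:
 assumes "i < 27" "j < 27"
 shows "(\<Sum>k<27. hess (sharp x) i k * hess x k j) = (if i = j then cubic x else 0) + x i * sharp x j"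
proof -
 define y where "y = (%k. if k = j then 1 else 0 :: complex)"
 have hy: "(\<Sum>l<27. h l * y l) = h j" for h
  using assms(2) by (simp add: y_def if_distrib[where f = "%z. h _ * z"] cong: if_cong)
 have "sharp2 (sharp x) (sharp2 x y) i = cubic x * y i + (\<Sum>k<27. sharp x k * y k) * x i"
 proof (rule linear_coeff_eq)
  fix s
  have 1: "sharp (%v. x v + s * y v) = (%k. sharp x k + s * (sharp2 x y k + s * sharp y k))"
   by (rule ext) (simp add: sharp_line algebra_simps power2_eq_square)
  have "sharp (sharp (%v. x v + s * y v)) i = sharp (sharp x) i + s * (sharp2 (sharp x) (sharp2 x y) i + s * sharp2 (sharp x) (sharp y) i)
   + s\<^sup>2 * (sharp (sharp2 x y) i + s * sharp2 (sharp2 x y) (sharp y) i + s\<^sup>2 * sharp (sharp y) i)"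
   unfolding 1 by (simp only: sharp_line[of "sharp x"] sharp_line[of "sharp2 x y"] sharp2_linear)
  moreover have "sharp (sharp (%v. x v + s * y v)) i = cubic (%v. x v + s * y v) * (x i + s * y i)"
   by (rule sharp_sharp[OF assms(1)])
  ultimately show "sharp (sharp x) i + s * sharp2 (sharp x) (sharp2 x y) i
    + s\<^sup>2 * (sharp2 (sharp x) (sharp y) i + sharp (sharp2 x y) i) + s ^ 3 * sharp2 (sharp2 x y) (sharp y) i
    + s ^ 4 * sharp (sharp y) i
   = cubic x * x i + s * (cubic x * y i + (\<Sum>k<27. sharp x k * y k) * x i)
    + s\<^sup>2 * ((\<Sum>k<27. sharp x k * y k) * y i + (\<Sum>k<27. sharp y k * x k) * x i)
    + s ^ 3 * ((\<Sum>k<27. sharp y k * x k) * y i + cubic y * x i) + s ^ 4 * (cubic y * y i)"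
   unfolding cubic_line by (simp add: algebra_simps power2_eq_square power3_eq_cube power4_eq_xxxx)
 qed
 moreover have "sharp2 (sharp x) (sharp2 x y) i = (\<Sum>k<27. hess (sharp x) i k * hess x k j)"
  unfolding hess_mult[symmetric] hy ..
 ultimately show ?thesis by (simp add: hy) (simp add: y_def)
qed

theorem cofactor_mult_hess:
 assumes "i < 27" "j < 27"
 shows "(\<Sum>k<27. cofactor x i k * hess x k j) = (if i = j then cubic x else 0)"
proof -
 have "(\<Sum>k<27. cofactor x i k * hess x k j) =
  (\<Sum>k<27. hess (sharp x) i k * hess x k j) - x i / 2 * (\<Sum>k<27. hess x j k * x k)"
 proof -
  have "(\<Sum>k<27. cofactor x i k * hess x k j) =
   (\<Sum>k<27. hess (sharp x) i k * hess x k j - x i / 2 * (hess x j k * x k))"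
   by (intro sum.cong refl) (simp add: cofactor_def hess_sym[of x j] algebra_simps)
  then show ?thesis by (simp only: sum_subtractf sum_distrib_left)
 qed
 also have "\<dots> = (if i = j then cubic x else 0)"
  unfolding hess_sharp_mult_hess[OF assms] hess_mult sharp2_self by simp
 finally show ?thesis .
qed

text \<open>Transposition of the previous identity, as both matrices are symmetric.\<close>

theorem hess_mult_cofactor:
 assumes "i < 27" "j < 27"
 shows "(\<Sum>k<27. hess x i k * cofactor x k j) = (if i = j then cubic x else 0)"
 using cofactor_mult_hess[OF assms(2,1), of x]
 by (simp add: hess_sym[of x _ i] cofactor_sym[of x j] mult.commute eq_commute)

text \<open>Two coordinates occur together in at most one monomial, so each Hessian entry needed
  here is a single signed coordinate. This reflects the 27 lines and 45 tritangent planes of a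
  smooth cubic surface, which match the coordinates and the monomials.\<close>

lemma hess_cub:
 assumes "(e, a, b, c) \<in> set cub"
 shows "hess y a b = of_int e * y c" "hess y a c = of_int e * y b" "hess y b c = of_int e * y a" "e * e = 1"
proof -
 have "list_all (%(e, a, b, c). hess y a b = of_int e * y c & hess y a c = of_int e * y b
   & hess y b c = of_int e * y a & e * e = 1) cub"
  unfolding hess_def by (simp add: cub_def del: One_nat_def)
 then show "hess y a b = of_int e * y c" "hess y a c = of_int e * y b" "hess y b c = of_int e * y a" "e * e = 1"
  using assms by (auto simp: list_all_iff)
qed

text \<open>Each coordinate lies in five of the 45 monomials, as each line lies in five tritangent
  planes.\<close>

lemma sum_cub_diagonal: "(\<Sum>(e, a, b, c)\<leftarrow>cub. w a * y a + w b * y b + w c * y c) = (5 * (\<Sum>i<27. w i * y i) :: complex)"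
 by (simp add: cub_def lessThan_nat_numeral algebra_simps del: One_nat_def) simp

lemma sum_hess_symmetric:
 assumes "!!i k. H i k = H k i"
 shows "(\<Sum>i<27. \<Sum>k<27. hess w i k * H i k) =
  (\<Sum>(e, a, b, c)\<leftarrow>cub. 2 * of_int e * (w c * H a b + w b * H a c + w a * H b c))"
proof -
 have "(\<Sum>i<27. \<Sum>k<27. hess w i k * H i k) = (\<Sum>i<27. sharp2 w (H i) i)"
  unfolding hess_mult ..
 also have "\<dots> = (\<Sum>(e, a, b, c)\<leftarrow>cub. (\<Sum>i<27. of_int e *
  ((if i = a then w b * H i c + w c * H i b else 0) + (if i = b then w a * H i c + w c * H i a else 0)
   + (if i = c then w a * H i b + w b * H i a else 0))))"
  unfolding sharp2_def by (rule sum_swap_list)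
 also have "\<dots> = (\<Sum>(e, a, b, c)\<leftarrow>cub. 2 * of_int e * (w c * H a b + w b * H a c + w a * H b c))"
 proof (rule sum_list_eqI)
  fix e a b c assume "(e, a, b, c) \<in> set cub"
  then have *: "a < 27" "b < 27" "c < 27" using cub_range by auto
  have "(\<Sum>i<27. of_int e *
  ((if i = a then w b * H i c + w c * H i b else 0) + (if i = b then w a * H i c + w c * H i a else 0)
   + (if i = c then w a * H i b + w b * H i a else 0))) =
   of_int e * ((w b * H a c + w c * H a b) + (w a * H b c + w c * H b a) + (w a * H c b + w b * H c a))"
   unfolding sum_distrib_left[symmetric] sum.distrib using * by simp
  then show "(\<Sum>i<27. of_int e *
  ((if i = a then w b * H i c + w c * H i b else 0) + (if i = b then w a * H i c + w c * H i a else 0)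
   + (if i = c then w a * H i b + w b * H i a else 0))) =
   2 * of_int e * (w c * H a b + w b * H a c + w a * H b c)"
   by (simp add: assms[of b a] assms[of c b] assms[of c a] algebra_simps)
 qed
 finally show ?thesis .
qed

text \<open>The constant is 10 - 1. Five monomials contain a given coordinate, and the remaining
  pair of each is counted in both orders, which yields 10 from the Hessian at
  \<open>sharp x\<close>; the rank one correction in \<open>cofactor\<close> takes away 1.\<close>

theorem trace_hess_cofactor:
 "(\<Sum>i<27. \<Sum>k<27. hess w i k * cofactor x k i) = 9 * (\<Sum>i<27. sharp x i * w i)"
proof -
 have 1: "(\<Sum>i<27. \<Sum>k<27. hess w i k * hess y i k) = 10 * (\<Sum>i<27. w i * y i)" for y
 proof -
  have "(\<Sum>i<27. \<Sum>k<27. hess w i k * hess y i k) = (\<Sum>(e, a, b, c)\<leftarrow>cub. 2 * (w a * y a + w b * y b + w c * y c))"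
   unfolding sum_hess_symmetric[of "hess y", OF hess_sym]
  proof (rule sum_list_eqI)
   fix e a b c assume *: "(e, a, b, c) \<in> set cub"
   have "of_int e * (of_int e :: complex) = 1" using hess_cub(4)[OF *] by (metis of_int_1 of_int_mult)
   then show "2 * of_int e * (w c * hess y a b + w b * hess y a c + w a * hess y b c) = 2 * (w a * y a + w b * y b + w c * y c)"
   proof -
    have "2 * E * (w c * (E * y c) + w b * (E * y b) + w a * (E * y a)) = 2 * (E * E) * (w a * y a + w b * y b + w c * y c)" for E
     by (simp add: algebra_simps)
    from this[of "of_int e"] show ?thesis unfolding hess_cub(1-3)[OF *] \<open>of_int e * of_int e = 1\<close> by simp
   qed
  qed
  also have "\<dots> = 2 * (\<Sum>(e, a, b, c)\<leftarrow>cub. w a * y a + w b * y b + w c * y c)"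
   by (simp add: sum_list_const_mult split_def del: distrib_left_numeral)
  finally show ?thesis unfolding sum_cub_diagonal by simp
 qed
 have 2: "(\<Sum>i<27. \<Sum>k<27. hess w i k * (x i * x k)) = 2 * (\<Sum>i<27. sharp x i * w i)"
 proof -
  have "(\<Sum>i<27. \<Sum>k<27. hess w i k * (x i * x k)) = (\<Sum>(e, a, b, c)\<leftarrow>cub. 2 * of_int e * (w c * (x a * x b) + w b * (x a * x c) + w a * (x b * x c)))"
   by (rule sum_hess_symmetric) (rule mult.commute)
  also have "\<dots> = (\<Sum>(e, a, b, c)\<leftarrow>cub. 2 * (of_int e * (x b * x c * w a + x a * x c * w b + x a * x b * w c)))"
   by (rule sum_list_eqI) (simp add: algebra_simps)
  also have "\<dots> = 2 * (\<Sum>i<27. sharp x i * w i)"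
   unfolding sum_sharp_mult by (simp add: sum_list_const_mult split_def)
  finally show ?thesis .
 qed
 have "(\<Sum>i<27. \<Sum>k<27. hess w i k * cofactor x k i) =
  (\<Sum>i<27. \<Sum>k<27. hess w i k * hess (sharp x) i k - hess w i k * (x i * x k) / 2)"
  by (intro sum.cong refl) (simp add: cofactor_def hess_sym[of "sharp x"] algebra_simps)
 also have "\<dots> = 10 * (\<Sum>i<27. w i * sharp x i) - 2 * (\<Sum>i<27. sharp x i * w i) / 2"
  unfolding 1[symmetric] 2[symmetric] by (simp only: sum_subtractf sum_divide_distrib)
 also have "\<dots> = 9 * (\<Sum>i<27. sharp x i * w i)"
  by (simp add: mult.commute)
 finally show ?thesis .
qed

section \<open>Surjectivity of the differential at the base point\<close>

text \<open>A sparse linear map from 9-space to 27-space: the coordinate \<open>k\<close> is the variable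
 \<open>point_map ! k\<close> or 0. At this map the differential of \<open>L \<mapsto> cubic \<circ> L\<close> is onto the cubic forms.
 In the order of \<open>certificate\<close>, each product of a partial derivative \<open>i\<close> with a variable \<open>j\<close>
 involves exactly one cubic monomial that has not been produced before.\<close>

definition point_map :: "nat option list" where
 "point_map = [
  None, Some 5, Some 4, None, Some 7, None, None, Some 1, None, Some 6, None, Some 8, Some 0,
  None, Some 7, Some 4, Some 3, Some 0, Some 6, Some 2, None, Some 2, Some 3, Some 1, Some 5,
  None, Some 8]"

definition certificate :: "(nat \<times> nat) list" where
 "certificate = [
  (4, 0), (7, 0), (9, 0), (11, 0), (15, 0), (17, 0), (22, 0), (23, 0), (4, 1), (7, 1), (9,
  1), (11, 1), (15, 1), (17, 1), (22, 1), (23, 1), (4, 2), (7, 2), (9, 2), (10, 2), (11, 2),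
  (15, 2), (17, 2), (20, 2), (22, 2), (23, 2), (7, 3), (9, 3), (10, 3), (11, 3), (15, 3),
  (17, 3), (20, 3), (22, 3), (1, 4), (3, 4), (4, 4), (7, 4), (11, 4), (15, 4), (17, 4), (20,
  4), (22, 4), (25, 4), (3, 5), (6, 5), (7, 5), (9, 5), (10, 5), (11, 5), (15, 5), (17, 5),
  (21, 5), (22, 5), (23, 5), (24, 5), (0, 6), (3, 6), (4, 6), (5, 6), (7, 6), (8, 6), (9, 6),
  (11, 6), (15, 6), (16, 6), (18, 6), (22, 6), (4, 7), (6, 7), (7, 7), (9, 7), (10, 7), (15,
  7), (16, 7), (20, 7), (23, 7), (3, 8), (4, 8), (6, 8), (10, 8), (11, 8), (12, 8), (17, 8),
  (22, 8), (26, 8), (16, 0), (18, 0), (19, 0), (20, 0), (2, 1), (10, 1), (18, 1), (2, 2), (6,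
  2), (21, 2), (24, 2), (2, 3), (5, 3), (8, 3), (14, 3), (12, 4), (18, 4), (24, 4), (26, 4),
  (2, 5), (13, 5), (18, 5), (2, 6), (10, 6), (19, 6), (25, 6), (1, 7), (2, 7), (3, 7), (13,
  7), (18, 7), (8, 8), (16, 8), (19, 8), (20, 8), (6, 0), (10, 0), (24, 0), (6, 1), (8, 1),
  (12, 1), (16, 1), (19, 1), (21, 1), (3, 2), (13, 2), (26, 2), (0, 3), (6, 4), (8, 4), (16,
  4), (21, 4), (12, 5), (19, 5), (12, 6), (25, 7), (5, 8), (13, 8), (14, 8), (13, 0), (20,
  1), (24, 1), (18, 2), (12, 3), (21, 3), (8, 5), (14, 5), (16, 5), (1, 6), (13, 6), (20, 6),
  (24, 6), (12, 7), (19, 7), (18, 8), (3, 1), (13, 1), (25, 1), (12, 2)]"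

definition base_point :: "(nat => complex) => nat => complex" where
 "base_point x k = (case point_map ! k of None => 0 | Some v => x v)"

text \<open>The partial derivatives of \<open>cubic\<close> at \<open>base_point x\<close>, as lists of signed quadratic monomials.\<close>

definition quadrics :: "(int \<times> nat \<times> nat) list list" where
 "quadrics = [
  [(-1, 6, 6), (-1, 5, 8)], [(-1, 0, 6), (-1, 5, 7)], [(-1, 4, 6), (-1, 2, 3), (-1, 0, 5)],
  [(1, 1, 4), (-1, 2, 6)], [(-1, 0, 2)], [(-1, 2, 4), (-1, 3, 3)], [(-1, 4, 7), (-1, 8, 8)],
  [(-1, 7, 8)], [(-1, 1, 3), (-1, 0, 8)], [(-1, 3, 7)], [(-1, 0, 0), (1, 4, 7)], [(1, 0, 3)],
  [(1, 3, 8), (-1, 5, 6), (-1, 2, 7)], [(1, 0, 6), (-1, 4, 8), (-1, 2, 5), (-1, 3, 7), (-1,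
  1, 1)], [(-1, 3, 6), (-1, 5, 5), (-1, 1, 8)], [(-1, 4, 6)], [(-1, 6, 7), (1, 0, 8), (-1, 2,
  4)], [(-1, 4, 5)], [(1, 3, 8), (-1, 0, 5), (-1, 4, 4)], [(-1, 2, 8), (1, 1, 5), (-1, 0,
  7)], [(-1, 3, 5), (-1, 0, 1)], [(-1, 2, 8), (-1, 3, 4)], [(1, 6, 8)], [(1, 2, 5)], [(1, 1,
  2), (-1, 5, 7), (-1, 0, 4)], [(-1, 1, 6), (-1, 7, 7)], [(1, 3, 6), (-1, 2, 2), (-1, 1, 7)]]"

lemma sharp_base_point:
 "i < 27 ==> sharp (base_point x) i = (\<Sum>(e, u, v)\<leftarrow>quadrics ! i. of_int e * (x u * x v))"
 by (drule less_27_cases, elim disjE)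
  (simp_all add: sharp_table base_point_def point_map_def quadrics_def algebra_simps del: One_nat_def)

text \<open>The product of a partial derivative with the variable \<open>j\<close>, a cubic monomial
  being the sorted list of its variables. The pairs in \<open>quadrics\<close> are sorted, so
  \<open>insort\<close> yields this normal form.\<close>

definition row :: "nat => nat => (int \<times> nat list) list" where
 "row i j = map (%(e, u, v). (e, insort j [u, v])) (quadrics ! i)"

text \<open>\<open>K\<close> lists the monomials obtained so far. A row with exactly one monomial
  outside \<open>K\<close>, with nonzero total coefficient, is solved for it; every other row leaves
  \<open>K\<close> as it is. A faulty certificate could therefore only make the final list
  incomplete.\<close>

definition new_monomial :: "nat list list => nat \<times> nat => nat list list" where
 "new_monomial K = (%(i, j). case filter (%(e, t). t \<notin> set K) (row i j) of [] => K
  | (e, t) # U => if list_all (%(e', t'). t' = t) U & e + sum_list (map fst U) ~= 0 then t # K else K)"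

text \<open>The image of the differential of the pullback: in the direction \<open>d\<close> the
  first order change of \<open>cubic\<close> is the sum of the linear forms with coefficients
  \<open>d i\<close> times the partial derivatives at the base point.\<close>

definition derived :: "((nat => complex) => complex) => bool" where
 "derived h \<longleftrightarrow> (EX d. ALL x. h x = (\<Sum>i<27. (\<Sum>j<9. d i j * x j) * sharp (base_point x) i))"

lemma derived_add: assumes "derived g" "derived h" shows "derived (%x. g x + h x)"
proof -
 obtain d where d: "!!x. g x = (\<Sum>i<27. (\<Sum>j<9. d i j * x j) * sharp (base_point x) i)"
  using assms(1) by (auto simp: derived_def)
 obtain d' where d': "!!x. h x = (\<Sum>i<27. (\<Sum>j<9. d' i j * x j) * sharp (base_point x) i)"
  using assms(2) by (auto simp: derived_def)
 show ?thesis unfolding derived_def d d'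
  by (intro exI[of _ "%i j. d i j + d' i j"]) (simp add: distrib_right sum.distrib)
qed

lemma derived_cmult: assumes "derived h" shows "derived (%x. c * h x)"
proof -
 obtain d where d: "!!x. h x = (\<Sum>i<27. (\<Sum>j<9. d i j * x j) * sharp (base_point x) i)"
  using assms by (auto simp: derived_def)
 show ?thesis unfolding derived_def d
  by (intro exI[of _ "%i j. c * d i j"]) (simp only: sum_distrib_left[symmetric] mult.assoc, simp)
qed

lemma derived_0: "derived (%x. 0)"
 unfolding derived_def by (intro exI[of _ "%_ _. 0"]) simp

lemma derived_sharp:
 assumes "i < 27" "j < 9" shows "derived (%x. x j * sharp (base_point x) i)"
 unfolding derived_def
proof (intro exI[of _ "%k l. if k = i & l = j then 1 else 0"] allI)
 fix x
 have "(\<Sum>k<27. (\<Sum>l<9. (if k = i & l = j then 1 else 0) * x l) * sharp (base_point x) k)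
  = (\<Sum>k<27. if k = i then x j * sharp (base_point x) i else 0)"
 proof (rule sum.cong)
  fix k
  have "(\<Sum>l<9. (if k = i & l = j then 1 else 0) * x l) = (\<Sum>l<9. if l = j then (if k = i then x j else 0) else 0)"
   by (rule sum.cong) auto
  then show "(\<Sum>l<9. (if k = i & l = j then 1 else 0) * x l) * sharp (base_point x) k
   = (if k = i then x j * sharp (base_point x) i else 0)" using assms(2) by simp
 qed simp
 then show "x j * sharp (base_point x) i =
  (\<Sum>k<27. (\<Sum>l<9. (if k = i & l = j then 1 else 0) * x l) * sharp (base_point x) k)"
  using assms(1) by simp
qed

definition tmon :: "nat list => (nat => complex) => complex" where
 "tmon t x = prod_list (map x t)"

lemma row_eval:
 assumes "i < 27" shows "(\<Sum>(e, t)\<leftarrow>row i j. of_int e * tmon t x) = x j * sharp (base_point x) i"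
proof -
 have *: "tmon (insort j [u, v]) x = x j * (x u * x v)" for u v
  by (simp add: tmon_def)
 have "(\<Sum>(e, t)\<leftarrow>row i j. of_int e * tmon t x) = (\<Sum>(e, u, v)\<leftarrow>quadrics ! i. x j * (of_int e * (x u * x v)))"
  unfolding row_def map_map
  by (intro arg_cong[where f = sum_list] map_cong refl) (auto simp: * simp del: insort_key.simps)
 then show ?thesis
  by (simp add: sharp_base_point[OF assms] sum_list_const_mult split_def)
qed

text \<open>The image of the differential is a linear space that contains the whole row and all
  monomials from \<open>K\<close>. The rest of the row is a nonzero multiple of the new
  monomial.\<close>

lemma new_monomial_derived:
 assumes "i < 27" "j < 9" "!!t. t \<in> set K ==> derived (tmon t)" "t \<in> set (new_monomial K (i, j))"
 shows "derived (tmon t)"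
proof (cases "t \<in> set K")
 case False
 let ?U = "filter (%(e, t). t \<notin> set K) (row i j)"
 obtain e t' U where U: "?U = (e, t') # U" "list_all (%(e', t''). t'' = t') U" "e + sum_list (map fst U) ~= 0" "t = t'"
  using assms(4) False by (auto simp: new_monomial_def split: list.splits if_splits)
 have known: "derived (%x. \<Sum>(e, t)\<leftarrow>filter (%(e, t). t \<in> set K) L. of_int e * tmon t x)" for L
 proof (induction L)
  case (Cons k L)
  then show ?case
   using assms(3) by (cases k) (auto intro!: derived_add derived_cmult simp: tmon_def[abs_def])
 qed (simp add: derived_0)
 have split: "(\<Sum>(e, t)\<leftarrow>L. of_int e * tmon t x) = (\<Sum>(e, t)\<leftarrow>filter (%(e, t). t \<notin> set K) L. of_int e * tmon t x)
  + (\<Sum>(e, t)\<leftarrow>filter (%(e, t). t \<in> set K) L. of_int e * tmon t x)" for L x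
  by (induction L) auto
 have "(\<Sum>(e, t)\<leftarrow>U. of_int e * tmon t x) = of_int (sum_list (map fst U)) * tmon t' x" for x
  using U(2) by (induction U) (auto simp: algebra_simps)
 then have unk: "(\<Sum>(e, t)\<leftarrow>?U. of_int e * tmon t x) = of_int (e + sum_list (map fst U)) * tmon t' x" for x
  unfolding U(1) by (simp add: algebra_simps)
 define s where "s = (of_int (e + sum_list (map fst U)) :: complex)"
 have s: "s ~= 0" using U(3) unfolding s_def of_int_eq_0_iff .
 have "tmon t x = inverse s * (x j * sharp (base_point x) i +
  (-1) * (\<Sum>(e, t)\<leftarrow>filter (%(e, t). t \<in> set K) (row i j). of_int e * tmon t x))" for x
 proof -
  have "x j * sharp (base_point x) i = s * tmon t x + (\<Sum>(e, t)\<leftarrow>filter (%(e, t). t \<in> set K) (row i j). of_int e * tmon t x)"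
   unfolding row_eval[OF assms(1), symmetric] split[where L = "row i j"] unk s_def U(4) ..
  then show ?thesis using s by simp
 qed
 then have e: "tmon t = (%x. inverse s * (x j * sharp (base_point x) i +
  (-1) * (\<Sum>(e, t)\<leftarrow>filter (%(e, t). t \<in> set K) (row i j). of_int e * tmon t x)))" by blast
 show ?thesis
  unfolding e by (intro derived_cmult derived_add derived_sharp assms(1,2) known)
qed (use assms(3) in auto)

lemma foldl_new_monomial_derived:
 assumes "list_all (%(i, j). i < 27 & j < 9) L" "!!t. t \<in> set K ==> derived (tmon t)"
  "t \<in> set (foldl new_monomial K L)"
 shows "derived (tmon t)"
 using assms
proof (induction L arbitrary: K)
 case (Cons k L)
 obtain i j where k: "k = (i, j)" by (cases k)
 show ?case
  by (rule Cons.IH[of "new_monomial K k"]) (use Cons.prems new_monomial_derived[of i j K] k in auto)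
qed auto

lemma certificate_range: "list_all (%(i, j). i < 27 & j < 9) certificate"
 by code_simp

definition triples :: "nat list list" where
 "triples = concat (map (%a. concat (map (%b. map (%c. [a, b, c]) [b..<9]) [a..<9])) [0..<9])"

text \<open>All 165 cubic monomials in nine variables are reached; this is checked by
  evaluation.\<close>

lemma certificate_complete:
 "let K = foldl new_monomial [] certificate in list_all (%t. List.member K t) triples"
 by code_simp

lemma polyfn_reindex:
 assumes "polyfn (Inl ` I) g" shows "polyfn I (%v. g (case_sum v (%_. 0)))"
proof -
 have "polyfn I (%x. g (%w. (%w x. case_sum x (%_. 0) w) w x))"
  by (rule polyfn_subst[OF assms]) (auto intro: polyfn_var)
 then show ?thesis by simp
qed

subsection \<open>Dominance\<close>

lemma mdeg_Suc_split:
 assumes "mdeg m = Suc d"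
 obtains v m' where "v \<in> keys m" "m = single v 1 + m'" "mdeg m' = d"
proof -
 have "m ~= 0" using assms by auto
 then have "keys m ~= {}" using keys_eq_empty by auto
 then obtain v where v: "v \<in> keys m" by blast
 define m' where "m' = m - single v 1"
 have "m = single v 1 + m'"
  by (rule poly_mapping_eqI) (use v in \<open>auto simp: m'_def lookup_add lookup_minus lookup_single in_keys_iff when_def\<close>)
 moreover from this have "mdeg m' = d" using assms mdeg_add[of "single v 1" m'] by simp
 ultimately show ?thesis using that v by blast
qed

lemma cubic_monomial:
 assumes "m \<in> monomials I 3"
 obtains a b c where "a \<in> I" "b \<in> I" "c \<in> I"
  "m = single a 1 + (single b 1 + single c 1)"
proof -
 have m: "keys m \<subseteq> I" "mdeg m = Suc 2" using assms by (auto simp: monomials_def)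
 obtain a m1 where a: "a \<in> keys m" "m = single a 1 + m1" "mdeg m1 = 2"
  using mdeg_Suc_split[OF m(2)] by metis
 obtain b m2 where b: "b \<in> keys m1" "m1 = single b 1 + m2" "mdeg m2 = 1"
  using mdeg_Suc_split[of m1 1] a(3) by (metis Suc_1)
 obtain c m3 where c: "c \<in> keys m2" "m2 = single c 1 + m3" "mdeg m3 = 0"
  using mdeg_Suc_split[of m2 0] b(3) by (metis One_nat_def)
 have "m3 = 0" using c(3) by simp
 have k: "keys m1 \<subseteq> keys m" "keys m2 \<subseteq> keys m1"
  by (auto simp: a(2) b(2) in_keys_iff lookup_add)
 show ?thesis
  by (rule that[of a b c]) (use a b c k m \<open>m3 = 0\<close> in auto)
qed

lemma derived_cubic:
 assumes "a < 9" "b < 9" "c < 9" shows "derived (%x. x a * (x b * x c))"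
proof -
 have *: "derived (%x. x a * (x b * x c))" if "a \<le> b" "b \<le> c" "c < 9" for a b c
 proof -
  have "[a, b, c] \<in> set triples" using that
   by (simp add: triples_def, intro bexI[of _ a] bexI[of _ b] image_eqI[of _ _ c]) auto
  then have "[a, b, c] \<in> set (foldl new_monomial [] certificate)"
   using certificate_complete by (simp add: Let_def list_all_iff)
  then have "derived (tmon [a, b, c])"
   by (rule foldl_new_monomial_derived[OF certificate_range, rotated]) simp
  moreover have "tmon [a, b, c] = (%x. x a * (x b * x c))" by (simp add: tmon_def fun_eq_iff)
  ultimately show ?thesis by simp
 qed
 consider "a \<le> b" "b \<le> c" | "a \<le> c" "c \<le> b" | "b \<le> a" "a \<le> c" | "b \<le> c" "c \<le> a" | "c \<le> a" "a \<le> b" | "c \<le> b" "b \<le> a"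
  by linarith
 then show ?thesis
 proof cases
  case 1 then show ?thesis using *[of a b c] assms by simp
 next
  case 2 then show ?thesis using *[of a c b] assms by (simp add: mult_ac)
 next
  case 3 then show ?thesis using *[of b a c] assms by (simp add: mult_ac)
 next
  case 4 then show ?thesis using *[of b c a] assms by (simp add: mult_ac)
 next
  case 5 then show ?thesis using *[of c a b] assms by (simp add: mult_ac)
 next
  case 6 then show ?thesis using *[of c b a] assms by (simp add: mult_ac)
 qed
qed

definition linmap :: "nat => (nat => nat => complex) => (nat => complex) => nat => complex" where
 "linmap n L x k = (\<Sum>a\<le>n. L k a * x a)"

text \<open>The coefficient of \<open>m\<close> in the pullback of the trilinear form that gives the
  first, second and third factor of each listed monomial to the first, second and third linear map.
  It is not symmetrized, so the linear term of an expansion consists of three such values.\<close>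

definition trilin :: "nat => (nat => nat => complex) => (nat => nat => complex) => (nat => nat => complex) => (nat \<Rightarrow>\<^sub>0 nat) => complex" where
 "trilin n L M K m = (\<Sum>(e, i, j, k)\<leftarrow>cub. \<Sum>a\<le>n. \<Sum>b\<le>n. \<Sum>c\<le>n. of_int e * (L i a * M j b * K k c) *
  (if single a 1 + (single b 1 + single c 1) = m then 1 else 0))"

lemma sum_list_sum: "(\<Sum>m\<in>T. (\<Sum>y\<leftarrow>ys. f y m)) = (\<Sum>y\<leftarrow>ys. (\<Sum>m\<in>T. (f y m :: complex)))"
 by (induction ys) (auto simp: sum.distrib)

lemma trilin_eval:
 "(\<Sum>m\<in>monomials {..n} 3. trilin n L L L m * meval m x) = cubic (linmap n L x)"
proof -
 let ?M = "monomials {..n} 3"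
 let ?s = "%a b c. single a 1 + (single b 1 + single c 1) :: nat \<Rightarrow>\<^sub>0 nat"
 have fin: "finite ?M" by (rule finite_monomials) simp
 have s: "?s a b c \<in> ?M" if "a \<le> n" "b \<le> n" "c \<le> n" for a b c
  using that Poly_Mapping.keys_add[of "single a 1" "single b 1 + single c (1::nat)"]
   Poly_Mapping.keys_add[of "single b 1" "single c (1::nat)"]
  by (fastforce simp: monomials_def mdeg_add)
 have one: "(\<Sum>m\<in>?M. z * (if ?s a b c = m then 1 else 0) * meval m x) = z * (x a * x b * x c)"
  if "a \<le> n" "b \<le> n" "c \<le> n" for a b c z
 proof -
  have "(\<Sum>m\<in>?M. z * (if ?s a b c = m then 1 else 0) * meval m x) = (\<Sum>m\<in>?M. if ?s a b c = m then z * meval (?s a b c) x else 0)"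
   by (intro sum.cong refl) auto
  also have "\<dots> = z * meval (?s a b c) x" using fin s[OF that] by simp
  finally show ?thesis by (simp only: meval_add meval_single power_one_right mult.assoc)
 qed
 have "(\<Sum>m\<in>?M. trilin n L L L m * meval m x) = (\<Sum>m\<in>?M. (\<Sum>(e, i, j, k)\<leftarrow>cub. \<Sum>a\<le>n. \<Sum>b\<le>n. \<Sum>c\<le>n.
  of_int e * (L i a * L j b * L k c) * (if ?s a b c = m then 1 else 0) * meval m x))"
  unfolding trilin_def sum_list_mult_const[symmetric] by (simp add: split_def sum_distrib_right)
 also have "\<dots> = (\<Sum>(e, i, j, k)\<leftarrow>cub. \<Sum>a\<le>n. \<Sum>b\<le>n. \<Sum>c\<le>n.
  of_int e * (L i a * L j b * L k c) * (x a * x b * x c))"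
  unfolding sum_list_sum
 proof (intro arg_cong[where f = sum_list] map_cong refl)
  fix y assume "y \<in> set cub"
  obtain e i j k where y: "y = (e, i, j, k)" by (cases y)
  let ?g = "%m a b c. of_int e * (L i a * L j b * L k c) * (if ?s a b c = m then 1 else 0) * meval m x"
  have "(\<Sum>m\<in>?M. \<Sum>a\<le>n. \<Sum>b\<le>n. \<Sum>c\<le>n. ?g m a b c) = (\<Sum>a\<le>n. \<Sum>m\<in>?M. \<Sum>b\<le>n. \<Sum>c\<le>n. ?g m a b c)"
   by (rule sum.swap)
  also have "\<dots> = (\<Sum>a\<le>n. \<Sum>b\<le>n. \<Sum>m\<in>?M. \<Sum>c\<le>n. ?g m a b c)"
   by (intro sum.cong refl sum.swap)
  also have "\<dots> = (\<Sum>a\<le>n. \<Sum>b\<le>n. \<Sum>c\<le>n. \<Sum>m\<in>?M. ?g m a b c)"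
   by (intro sum.cong refl sum.swap)
  also have "\<dots> = (\<Sum>a\<le>n. \<Sum>b\<le>n. \<Sum>c\<le>n. of_int e * (L i a * L j b * L k c) * (x a * x b * x c))"
   by (intro sum.cong refl one) auto
  finally show "(\<Sum>m\<in>?M. case y of (e, i, j, k) => \<Sum>a\<le>n. \<Sum>b\<le>n. \<Sum>c\<le>n. of_int e * (L i a * L j b * L k c) * (if ?s a b c = m then 1 else 0) * meval m x)
   = (case y of (e, i, j, k) => \<Sum>a\<le>n. \<Sum>b\<le>n. \<Sum>c\<le>n. of_int e * (L i a * L j b * L k c) * (x a * x b * x c))"
   by (simp only: y prod.case)
 qed
 also have "\<dots> = cubic (linmap n L x)"
  unfolding cubic_def
 proof (rule sum_list_eqI)
  fix e i j k
  have "linmap n L x i * linmap n L x j * linmap n L x k = (\<Sum>a\<le>n. \<Sum>b\<le>n. \<Sum>c\<le>n. L i a * x a * (L j b * x b) * (L k c * x c))"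
   unfolding linmap_def by (simp only: sum_distrib_left[symmetric] sum_distrib_right[symmetric])
  then show "(\<Sum>a\<le>n. \<Sum>b\<le>n. \<Sum>c\<le>n. of_int e * (L i a * L j b * L k c) * (x a * x b * x c))
   = of_int e * (linmap n L x i * linmap n L x j * linmap n L x k)"
   by (simp add: sum_distrib_left mult_ac)
 qed
 finally show ?thesis .
qed

lemma trilin_line:
 "trilin n (%i a. L i a + s * D i a) (%i a. L i a + s * D i a) (%i a. L i a + s * D i a) m =
  trilin n L L L m + s * (trilin n D L L m + trilin n L D L m + trilin n L L D m)
  + s\<^sup>2 * (trilin n D D L m + trilin n D L D m + trilin n L D D m) + s ^ 3 * trilin n D D D m"
proof -
 have "trilin n L L L m + s * (trilin n D L L m + trilin n L D L m + trilin n L L D m)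
  + s\<^sup>2 * (trilin n D D L m + trilin n D L D m + trilin n L D D m) + s ^ 3 * trilin n D D D m
  = (\<Sum>(e, i, j, k)\<leftarrow>cub. \<Sum>a\<le>n. \<Sum>b\<le>n. \<Sum>c\<le>n. of_int e *
  (L i a * L j b * L k c + s * (D i a * L j b * L k c + L i a * D j b * L k c + L i a * L j b * D k c)
   + s\<^sup>2 * (D i a * D j b * L k c + D i a * L j b * D k c + L i a * D j b * D k c) + s ^ 3 * (D i a * D j b * D k c)) *
  (if single a 1 + (single b 1 + single c 1) = m then 1 else 0))"
  unfolding trilin_def sum_list_addf[symmetric] sum_list_const_mult[symmetric] sum_distrib_left split_def
   sum.distrib[symmetric] distrib_left distrib_right
  by (simp only: mult_ac)
 also have "\<dots> = trilin n (%i a. L i a + s * D i a) (%i a. L i a + s * D i a) (%i a. L i a + s * D i a) m"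
  unfolding trilin_def
  by (intro sum_list_eqI sum.cong refl arg_cong2[where f = "(*)"]) (simp add: algebra_simps power2_eq_square power3_eq_cube)
 finally show ?thesis ..
qed

lemma derived_monomial:
 assumes "m \<in> monomials {..n} 3" "n \<le> 8" shows "derived (meval m)"
proof -
 obtain a b c where abc: "a \<in> {..n}" "b \<in> {..n}" "c \<in> {..n}"
  "m = single a 1 + (single b 1 + single c 1)"
  using cubic_monomial[OF assms(1)] by metis
 have "derived (%x. x a * (x b * x c))" by (rule derived_cubic) (use abc assms(2) in auto)
 moreover have "meval m = (%x. x a * (x b * x c))"
  unfolding abc(4) by (rule ext) (simp only: meval_add meval_single power_one_right)
 ultimately show ?thesis by simp
qed

lemma derived_sum: "finite T ==> (!!m. m \<in> T ==> derived (h m)) ==> derived (%x. \<Sum>m\<in>T. h m x)"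
 by (induction T rule: finite_induct) (auto intro: derived_0 derived_add)

lemma sum_cubic_polynomial:
 "(\<Sum>m\<in>M. (c0 m + s * c1 m + s\<^sup>2 * c2 m + s ^ 3 * c3 m) * h m) =
 (\<Sum>m\<in>M. c0 m * h m) + s * (\<Sum>m\<in>M. c1 m * h m) + s\<^sup>2 * (\<Sum>m\<in>M. c2 m * h m) + s ^ 3 * (\<Sum>m\<in>M. c3 m * (h m :: complex))"
 by (simp add: distrib_right sum.distrib sum_distrib_left mult.assoc)

definition base_map :: "nat => nat => complex" where
 "base_map = (%i a. if point_map ! i = Some a then 1 else 0)"

text \<open>The linear term in \<open>s\<close> of the pullback along
  \<open>base_map + s * D\<close> is computed twice: by coefficients with
  \<open>trilin_line\<close>, and as a function with \<open>cubic_line\<close>. The function is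
  prescribed by \<open>derived_monomial\<close>, and independence of monomials returns to the
  coefficients.\<close>

lemma tangent_onto:
 assumes "n \<le> 8"
 shows "EX D. \<forall>m\<in>monomials {..n} 3. trilin n D base_map base_map m + trilin n base_map D base_map m
  + trilin n base_map base_map D m = h m"
proof -
 let ?M = "monomials {..n} 3"
 have fin: "finite ?M" by (rule finite_monomials) simp
 have "derived (%x. \<Sum>m\<in>?M. h m * meval m x)"
  by (rule derived_sum[OF fin], rule derived_cmult, rule derived_monomial[OF _ assms])
 then obtain D where D: "ALL x. (\<Sum>m\<in>?M. h m * meval m x) = (\<Sum>i<27. (\<Sum>j<9. D i j * x j) * sharp (base_point x) i)"
  unfolding derived_def by (elim exE)
 let ?c = "%m. trilin n D base_map base_map m + trilin n base_map D base_map m + trilin n base_map base_map D m"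
 have "(\<Sum>m\<in>?M. (?c m - h m) * meval m x) = 0" for x
 proof -
  \<comment> \<open>The certificate concerns nine variables; setting those beyond \<open>n\<close>
    to 0 settles all smaller \<open>n\<close>.\<close>
  define y where "y = (%i. if i \<le> n then x i else 0)"
  have my: "meval m x = meval m y" if "m \<in> ?M" for m
   by (rule meval_cong) (use that in \<open>auto simp: monomials_def y_def\<close>)
  have Ly: "linmap n base_map y = base_point y"
  proof
   fix k
   show "linmap n base_map y k = base_point y k"
   proof (cases "point_map ! k")
    case None
    then show ?thesis by (simp add: linmap_def base_map_def base_point_def)
   next
    case (Some v)
    have "linmap n base_map y k = (\<Sum>a\<le>n. if a = v then y v else 0)"
     unfolding linmap_def base_map_def Some by (rule sum.cong) auto
    then show ?thesis by (simp add: base_point_def Some y_def)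
   qed
  qed
  have Dy: "linmap n D y i = (\<Sum>j<9. D i j * y j)" for i
   unfolding linmap_def using assms by (intro sum.mono_neutral_left) (auto simp: y_def)
  have "(\<Sum>m\<in>?M. ?c m * meval m y) = (\<Sum>i<27. sharp (base_point y) i * linmap n D y i)"
  proof (rule linear_coeff_eq)
   fix s
   have e: "linmap n (%i a. base_map i a + s * D i a) y = (%v. linmap n base_map y v + s * linmap n D y v)"
    by (rule ext) (simp add: linmap_def distrib_right sum.distrib sum_distrib_left mult.assoc)
   have "(\<Sum>m\<in>?M. trilin n (%i a. base_map i a + s * D i a) (%i a. base_map i a + s * D i a) (%i a. base_map i a + s * D i a) m * meval m y)
    = cubic (%v. linmap n base_map y v + s * linmap n D y v)"
    unfolding trilin_eval e ..
   then show "(\<Sum>m\<in>?M. trilin n base_map base_map base_map m * meval m y) + s * (\<Sum>m\<in>?M. ?c m * meval m y)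
    + s\<^sup>2 * (\<Sum>m\<in>?M. (trilin n D D base_map m + trilin n D base_map D m + trilin n base_map D D m) * meval m y)
    + s ^ 3 * (\<Sum>m\<in>?M. trilin n D D D m * meval m y) + s ^ 4 * 0
    = cubic (linmap n base_map y) + s * (\<Sum>i<27. sharp (base_point y) i * linmap n D y i)
    + s\<^sup>2 * (\<Sum>i<27. sharp (linmap n D y) i * linmap n base_map y i) + s ^ 3 * cubic (linmap n D y) + s ^ 4 * 0"
    unfolding trilin_line cubic_line Ly sum_cubic_polynomial by simp
  qed
  also have "\<dots> = (\<Sum>m\<in>?M. h m * meval m y)"
   unfolding D[rule_format] Dy by (simp only: mult.commute)
  finally have "(\<Sum>m\<in>?M. (?c m - h m) * meval m y) = 0"
   by (simp only: left_diff_distrib sum_subtractf) simp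
  then show ?thesis using my by (simp cong: sum.cong)
 qed
 then have "?c m - h m = 0" if "m \<in> ?M" for m
  by (intro meval_independent[OF fin, of "%m. ?c m - h m"] that)
 then show ?thesis by (intro exI[of _ D] ballI) simp
qed

text \<open>A nonzero polynomial vanishing on the image would, at the image of the base point, have a
 nonzero form of lowest degree, and this form would vanish on the image of the differential.\<close>

lemma polyfn_image_nonzero:
 assumes "n \<le> 8" "polyfn (monomials {..n} 3) g" "g y ~= 0"
 shows "EX L. g (trilin n L L L) ~= 0"
proof (rule ccontr)
 assume "\<nexists>L. g (trilin n L L L) ~= 0"
 then have vanish: "g (trilin n L L L) = 0" for L by simp
 let ?M = "monomials {..n} 3"
 define L where "L = base_map"
 let ?z = "trilin n L L L"
 have "polyfn ?M (%x. g (%v. ?z v + x v))"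
  by (rule polyfn_subst[OF assms(2)]) (auto intro: polyfn_var)
 then obtain p where p0: "p \<in> polys ?M" "(%x. g (%v. ?z v + x v)) = peval p"
  unfolding polyfn_def by (elim bexE)
 have p: "p \<in> polys ?M" "!!x. g (%v. ?z v + x v) = peval p x"
  using p0(1) fun_cong[OF p0(2)] by auto
 have "p ~= 0" using p(2)[of "%v. y v - ?z v"] assms(3) by auto
 have "EX k. hcomp k p ~= 0"
 proof (rule ccontr)
  assume "\<nexists>k. hcomp k p ~= 0"
  then have "p = 0" using sum_hcomp[of "mdeg ` keys p" p] by simp
  then show False using \<open>p ~= 0\<close> by simp
 qed
 then obtain k where k: "hcomp k p ~= 0" "!!j. j < k ==> hcomp j p = 0"
  using exists_least_iff[of "%k. hcomp k p ~= 0"] by auto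
 have "peval (hcomp k p) h = 0" for h
 proof -
  obtain D where D: "\<forall>m\<in>?M. trilin n D L L m + trilin n L D L m + trilin n L L D m = h m"
   using tangent_onto[OF assms(1), of h] unfolding L_def by (elim exE)
  \<comment> \<open>At \<open>base_map + s * D\<close> the coefficient vector is
    \<open>?z + s * r\<close> by the choice of \<open>D\<close>, and \<open>r\<close> takes the
    value \<open>h\<close> at \<open>s = 0\<close>.\<close>
  define r where "r m s = h m + s * (trilin n D D L m + trilin n D L D m + trilin n L D D m) + s\<^sup>2 * trilin n D D D m" for m s
  define J where "J = mdeg ` keys p"
  have fJ: "finite J" by (simp add: J_def)
  have J: "j \<ge> k" if "j \<in> J" for j
  proof (rule ccontr)
   assume "\<not> k \<le> j"
   then have "hcomp j p = 0" using k(2) by simp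
   moreover have "hcomp j p ~= 0" using that keys_hcomp[of j p] unfolding J_def by auto
   ultimately show False by simp
  qed
  \<comment> \<open>The value of \<open>p\<close> along this curve divided by \<open>s ^ k\<close>,
    where \<open>s\<close> is the coordinate \<open>x 0\<close>. Being a polynomial function it may
    be evaluated at \<open>s = 0\<close> after cancelling the power, and only the lowest form, at
    \<open>h\<close>, survives there.\<close>
  define \<Phi> where "\<Phi> x = (\<Sum>j\<in>J. x (0::nat) ^ (j - k) * peval (hcomp j p) (%m. r m (x 0)))" for x :: "nat => complex"
  have "polyfn {0} \<Phi>"
   unfolding \<Phi>_def
  proof (intro polyfn_sum polyfn_mult polyfn_power)
   show "polyfn {0} (%x::nat => complex. x 0)" by (rule polyfn_var) simp
   fix j assume "j \<in> J"
   have "hcomp j p \<in> polys ?M" using hcomp_forms[OF p(1)] forms_polys by blast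
   then have "polyfn ?M (peval (hcomp j p))" by (rule polyfn_peval)
   then show "polyfn {0} (%x::nat => complex. peval (hcomp j p) (%m. r m (x 0)))"
    unfolding r_def
    by (rule polyfn_subst) (intro polyfn_add polyfn_mult polyfn_power polyfn_const polyfn_var; simp)
  qed
  moreover have "x 0 ^ k * \<Phi> x = 0" for x
  proof -
   define s where "s = x 0"
   have "g (trilin n (%i a. L i a + s * D i a) (%i a. L i a + s * D i a) (%i a. L i a + s * D i a)) = 0"
    by (rule vanish)
   also have "g (trilin n (%i a. L i a + s * D i a) (%i a. L i a + s * D i a) (%i a. L i a + s * D i a))
    = g (%v. ?z v + s * r v s)"
   proof (rule polyfn_cong[OF assms(2)])
    fix v assume v: "v \<in> ?M"
    show "trilin n (%i a. L i a + s * D i a) (%i a. L i a + s * D i a) (%i a. L i a + s * D i a) v = ?z v + s * r v s"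
     unfolding trilin_line r_def D[rule_format, OF v, symmetric] by (simp add: algebra_simps power2_eq_square power3_eq_cube)
   qed
   finally have "peval p (%v. s * r v s) = 0" using p(2) by simp
   then have "(\<Sum>j\<in>J. peval (hcomp j p) (%v. s * r v s)) = 0"
    using sum_hcomp[OF fJ, of p] by (simp add: J_def flip: peval_sum)
   moreover have "peval (hcomp j p) (%v. s * r v s) = s ^ k * (s ^ (j - k) * peval (hcomp j p) (%v. r v s))" if "j \<in> J" for j
    using peval_scale[OF hcomp_forms[OF p(1), of j], of s "%v. r v s"] J[OF that]
    by (simp flip: power_add mult.assoc)
   ultimately show ?thesis unfolding \<Phi>_def s_def by (simp add: sum_distrib_left)
  qed
  ultimately have "(\<forall>x::nat => complex. x 0 ^ k = 0) \<or> (ALL x. \<Phi> x = 0)"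
   by (intro polyfn_mult_eq_0[of "{0}" _ "{0}"]) (auto intro: polyfn_power polyfn_var)
  then have "\<Phi> (%_. 0) = 0" by (metis power_one zero_neq_one)
  moreover have "\<Phi> (%_. 0) = (\<Sum>j\<in>J. if j = k then peval (hcomp k p) h else 0)"
   unfolding \<Phi>_def by (intro sum.cong refl) (use J in \<open>auto simp: r_def power_0_left dest: J\<close>)
  moreover have "k \<in> J" using k(1) hcomp_eq_0[of k p] unfolding J_def by blast
  ultimately show ?thesis using fJ by simp
 qed
 then show False using k(1) peval_eq_0_iff[of "hcomp k p"] by blast
qed

section \<open>Limits of cubic forms and of their roots\<close>

definition formval :: "nat => ((nat \<Rightarrow>\<^sub>0 nat) => complex) => (nat => complex) => complex" where
 "formval n z x = (\<Sum>m\<in>monomials {..n} 3. z m * meval m x)"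

lemma finite_cubic_monomials [simp]: "finite (monomials {..n::nat} 3)"
 by (rule finite_monomials) simp

lemma peval_formval: "f \<in> forms {..n} 3 ==> peval f x = formval n (lookup f) x"
 unfolding formval_def by (rule peval_superset) (simp_all add: forms_def)

lemma single_cubic_monomial: "i \<le> n ==> single i 3 \<in> monomials {..n} 3"
 by (simp add: monomials_def del: single_numeral)

lemma formval_scale: "formval n z (%i. c * x i) = c ^ 3 * formval n z x"
 unfolding formval_def sum_distrib_left
 by (intro sum.cong refl) (simp add: meval_scale monomials_def)

lemma formval_tendsto:
 assumes "!!m. m \<in> monomials {..n} 3 ==> (%k. Z k m) \<longlonglongrightarrow> Zl m" "!!i. (%k. X k i) \<longlonglongrightarrow> Xl i"
 shows "(%k. formval n (Z k) (X k)) \<longlonglongrightarrow> formval n Zl Xl"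
 unfolding formval_def meval_def
 by (intro tendsto_sum tendsto_mult tendsto_prod tendsto_power assms)

lemma formval_last:
 assumes "!!i. i ~= n ==> x i = 0"
 shows "formval n z x = z (single n 3) * x n ^ 3"
proof -
 have "formval n z x = (\<Sum>m\<in>monomials {..n} 3. if m = single n 3 then z m * x n ^ 3 else 0)"
  unfolding formval_def
 proof (rule sum.cong)
  fix m assume m: "m \<in> monomials {..n} 3"
  show "z m * meval m x = (if m = single n 3 then z m * x n ^ 3 else 0)"
  proof (cases "keys m \<subseteq> {n}")
   case True
   have "m = single n (lookup m n)"
   proof (rule poly_mapping_eqI)
    fix i
    have "i ~= n ==> i \<notin> keys m" using True by blast
    then show "lookup m i = lookup (single n (lookup m n)) i"
     by (cases "i = n") (auto simp: lookup_single in_keys_iff)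
   qed
   moreover from this have "lookup m n = 3"
    using m mdeg_single[of n "lookup m n"] by (simp add: monomials_def)
   ultimately have "m = single n 3" by simp
   then show ?thesis by (simp add: meval_single)
  next
   case False
   then obtain i where i: "i \<in> keys m" "i ~= n" by blast
   then have "x i ^ lookup m i = 0" using assms by (simp add: in_keys_iff power_0_left)
   then have "meval m x = 0" unfolding meval_def using i(1) by (intro prod_zero) auto
   moreover have "m ~= single n 3" using i by auto
   ultimately show ?thesis by simp
  qed
 qed simp
 also have "\<dots> = z (single n 3) * x n ^ 3"
  using single_cubic_monomial[of n n] by (subst sum.delta) simp_all
 finally show ?thesis .
qed

text \<open>Roots of a convergent family of cubics with nonvanishing leading coefficient subconverge:
 scale the points into the unit ball and use compactness.\<close>

lemma root_subseq:
 assumes Z: "!!m. m \<in> monomials {..n} 3 ==> (%k. Z k m) \<longlonglongrightarrow> Zl m"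
  and X: "!!i. (%k. X k i) \<longlonglongrightarrow> Xl i"
  and root: "!!k. formval n (Z k) ((X k)(n := t k)) = 0"
  and nz: "Zl (single n 3) ~= 0"
 shows "\<exists>r \<tau>. strict_mono (r :: nat => nat) & (%k. t (r k)) \<longlonglongrightarrow> \<tau>"
proof -
 define \<rho> where "\<rho> k = max 1 (norm (t k))" for k
 define \<sigma> where "\<sigma> k = complex_of_real (1 / \<rho> k)" for k
 define u where "u k = \<sigma> k * t k" for k
 have \<rho>: "\<rho> k \<ge> 1" "\<rho> k \<ge> norm (t k)" for k by (auto simp: \<rho>_def)
 have n\<sigma>: "norm (\<sigma> k) = 1 / \<rho> k" for k using \<rho>(1)[of k] by (simp add: \<sigma>_def norm_divide)
 have nu: "norm (u k) = norm (t k) / \<rho> k" for k by (simp add: u_def norm_mult n\<sigma>)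
 have "norm (u k) \<le> 1" "norm (\<sigma> k) \<le> 1" for k using \<rho>[of k] by (simp_all add: nu n\<sigma>)
 then have "norm (u k, \<sigma> k) \<le> 2" for k
  using norm_Pair_le[of "u k" "\<sigma> k"] by (smt (verit))
 then have "bounded (range (%k. (u k, \<sigma> k)))"
  unfolding bounded_iff by (intro exI[of _ 2]) auto
 then obtain l and r :: "nat => nat" where r: "strict_mono r" "((%k. (u k, \<sigma> k)) \<circ> r) \<longlonglongrightarrow> l"
  using bounded_imp_convergent_subsequence[of "%k. (u k, \<sigma> k)"] by metis
 have u0: "(%k. u (r k)) \<longlonglongrightarrow> fst l" and \<sigma>0: "(%k. \<sigma> (r k)) \<longlonglongrightarrow> snd l"
  using tendsto_fst[OF r(2)] tendsto_snd[OF r(2)] by (simp_all add: o_def)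
 define w where "w k = (%i. \<sigma> k * ((X k)(n := t k)) i)" for k
 define w0 where "w0 = (%i. if i = n then fst l else snd l * Xl i)"
 have Xr: "(%k. X (r k) i) \<longlonglongrightarrow> Xl i" for i
  using LIMSEQ_subseq_LIMSEQ[OF X[of i] r(1)] by (simp add: o_def)
 have Zr: "(%k. Z (r k) m) \<longlonglongrightarrow> Zl m" if "m \<in> monomials {..n} 3" for m
  using LIMSEQ_subseq_LIMSEQ[OF Z[OF that] r(1)] by (simp add: o_def)
 have wr: "(%k. w (r k) i) \<longlonglongrightarrow> w0 i" for i
 proof (cases "i = n")
  case True
  then show ?thesis using u0 by (simp add: w_def w0_def u_def)
 next
  case False
  then show ?thesis using tendsto_mult[OF \<sigma>0 Xr[of i]] by (simp add: w_def w0_def)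
 qed
 have "(%k. formval n (Z (r k)) (w (r k))) \<longlonglongrightarrow> formval n Zl w0"
  by (rule formval_tendsto[OF Zr wr])
 moreover have "formval n (Z (r k)) (w (r k)) = 0" for k
  unfolding w_def formval_scale using root[of "r k"] by (simp del: fun_upd_apply)
 ultimately have z0: "formval n Zl w0 = 0"
  using LIMSEQ_unique[OF _ tendsto_const] by fastforce
 \<comment> \<open>Were the limit of the scaling factors 0, the scaled points would converge to a
   multiple of the last coordinate vector, of norm 1; there the limit form has the value
   \<open>Zl (single n 3)\<close> times a nonzero cube.\<close>
 have "snd l ~= 0"
 proof
  assume s0: "snd l = 0"
  have "(%k. norm (\<sigma> (r k))) \<longlonglongrightarrow> 0" using tendsto_norm[OF \<sigma>0] s0 by simp
  then have "eventually (%k. norm (\<sigma> (r k)) < 1) sequentially"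
   by (rule order_tendstoD(2)) simp
  then have "eventually (%k. norm (u (r k)) = 1) sequentially"
  proof (rule eventually_mono)
   fix k assume "norm (\<sigma> (r k)) < 1"
   then have "\<rho> (r k) > 1" using \<rho>(1)[of "r k"] by (simp add: n\<sigma> divide_less_eq)
   then have "\<rho> (r k) = norm (t (r k))" by (simp add: \<rho>_def max_def split: if_splits)
   then show "norm (u (r k)) = 1" using \<rho>(1)[of "r k"] by (auto simp: nu)
  qed
  then have "(%k. norm (u (r k))) \<longlonglongrightarrow> 1" by (rule tendsto_eventually)
  then have "norm (fst l) = 1" using LIMSEQ_unique[OF tendsto_norm[OF u0]] by blast
  moreover have "Zl (single n 3) * fst l ^ 3 = 0"
   using z0 formval_last[of n w0 Zl] s0 by (simp add: w0_def)
  ultimately show False using nz by auto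
 qed
 have \<sigma>ne: "\<sigma> k ~= 0" for k using n\<sigma>[of k] \<rho>(1)[of k] by auto
 have "(%k. u (r k) / \<sigma> (r k)) \<longlonglongrightarrow> fst l / snd l"
  by (rule tendsto_divide[OF u0 \<sigma>0 \<open>snd l ~= 0\<close>])
 moreover have "u k / \<sigma> k = t k" for k using \<sigma>ne[of k] by (simp add: u_def)
 ultimately show ?thesis using r(1) by auto
qed

text \<open>The cubic form with coefficients \<open>z\<close>, restricted to the line \<open>p + s e 1\<close> in the hyperplane
 $x_n = 0$, has a root of degree at most 1 in \<open>s\<close>; four values of \<open>s\<close> suffice as the degree
 is 3.\<close>

definition has_line :: "nat => ((nat \<Rightarrow>\<^sub>0 nat) => complex) => (nat => complex) => bool" where
 "has_line n z p \<longleftrightarrow> (EX a b. \<forall>s\<in>{0, 1, 2, 3}. formval n z (p(1 := p 1 + s, n := a + b * s)) = 0)"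

text \<open>The numbers \<open>a\<close> and \<open>a + b\<close> are roots at \<open>s = 0\<close>
  and \<open>s = 1\<close>, so both subconverge by \<open>root_subseq\<close>. The equations for all
  four values of \<open>s\<close> then pass to the limit.\<close>

lemma has_line_closed:
 assumes Z: "!!m. m \<in> monomials {..n} 3 ==> (%k. Z k m) \<longlonglongrightarrow> Zl m"
  and X: "!!i. (%k. X k i) \<longlonglongrightarrow> Xl i"
  and line: "!!k. has_line n (Z k) (X k)"
  and nz: "Zl (single n 3) ~= 0" and n: "2 \<le> n"
 shows "has_line n Zl Xl"
proof -
 have "ALL k. EX ab. \<forall>s\<in>{0, 1, 2, 3}. formval n (Z k) ((X k)(1 := X k 1 + s, n := fst ab + snd ab * s)) = 0"
  using line unfolding has_line_def by simp
 then obtain ab where ab: "ALL k. \<forall>s\<in>{0, 1, 2, 3}. formval n (Z k) ((X k)(1 := X k 1 + s, n := fst (ab k) + snd (ab k) * s)) = 0"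
  by (rule choice[THEN exE])
 define a b where "a k = fst (ab k)" and "b k = snd (ab k)" for k
 have root: "formval n (Z k) ((X k)(1 := X k 1 + s, n := a k + b k * s)) = 0" if "s \<in> {0, 1, 2, 3}" for k s
  using ab that unfolding a_def b_def by blast
 have Xs: "(%k. ((X k)(1 := X k 1 + s)) i) \<longlonglongrightarrow> (Xl(1 := Xl 1 + s)) i" for s i
  by (cases "i = 1") (auto intro!: tendsto_add X tendsto_const)
 have "\<exists>r \<tau>. strict_mono (r :: nat => nat) & (%k. a (r k) + b (r k) * 0) \<longlonglongrightarrow> \<tau>"
  by (rule root_subseq[where Z = Z and Zl = Zl and X = "%k. (X k)(1 := X k 1 + 0)"
   and Xl = "Xl(1 := Xl 1 + 0)" and t = "%k. a k + b k * 0", OF Z Xs root nz]) auto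
 then obtain r \<alpha> where r: "strict_mono (r :: nat => nat)" "(%k. a (r k) + b (r k) * 0) \<longlonglongrightarrow> \<alpha>"
  by (elim exE conjE)
 have "\<exists>q \<tau>. strict_mono (q :: nat => nat) & (%k. a (r (q k)) + b (r (q k)) * 1) \<longlonglongrightarrow> \<tau>"
 proof (rule root_subseq[where Z = "%k. Z (r k)" and Zl = Zl and X = "%k. (X (r k))(1 := X (r k) 1 + 1)"
   and Xl = "Xl(1 := Xl 1 + 1)" and t = "%k. a (r k) + b (r k) * 1", OF _ _ root nz])
  show "(%k. Z (r k) m) \<longlonglongrightarrow> Zl m" if "m \<in> monomials {..n} 3" for m
   using LIMSEQ_subseq_LIMSEQ[OF Z[OF that] r(1)] by (simp add: o_def)
  show "(%k. ((X (r k))(1 := X (r k) 1 + 1)) i) \<longlonglongrightarrow> (Xl(1 := Xl 1 + 1)) i" for i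
   using LIMSEQ_subseq_LIMSEQ[OF Xs[of 1 i] r(1)] by (simp add: o_def del: fun_upd_apply)
 qed simp
 then obtain q \<beta> where q: "strict_mono (q :: nat => nat)" "(%k. a (r (q k)) + b (r (q k)) * 1) \<longlonglongrightarrow> \<beta>"
  by (elim exE conjE)
 define h where "h k = r (q k)" for k
 have h: "strict_mono h" using strict_mono_o[OF r(1) q(1)] by (simp add: h_def[abs_def] o_def)
 have a: "(%k. a (h k)) \<longlonglongrightarrow> \<alpha>"
  using LIMSEQ_subseq_LIMSEQ[OF r(2) q(1)] by (simp add: o_def h_def)
 have b: "(%k. b (h k)) \<longlonglongrightarrow> \<beta> - \<alpha>"
  using tendsto_diff[OF q(2) a] by (simp add: h_def)
 have "formval n Zl (Xl(1 := Xl 1 + s, n := \<alpha> + (\<beta> - \<alpha>) * s)) = 0" if s: "s \<in> {0, 1, 2, 3}" for s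
 proof -
  have "(%k. formval n (Z (h k)) ((X (h k))(1 := X (h k) 1 + s, n := a (h k) + b (h k) * s)))
   \<longlonglongrightarrow> formval n Zl (Xl(1 := Xl 1 + s, n := \<alpha> + (\<beta> - \<alpha>) * s))"
  proof (rule formval_tendsto)
   show "(%k. Z (h k) m) \<longlonglongrightarrow> Zl m" if "m \<in> monomials {..n} 3" for m
    using LIMSEQ_subseq_LIMSEQ[OF Z[OF that] h] by (simp add: o_def)
   show "(%k. ((X (h k))(1 := X (h k) 1 + s, n := a (h k) + b (h k) * s)) i)
    \<longlonglongrightarrow> (Xl(1 := Xl 1 + s, n := \<alpha> + (\<beta> - \<alpha>) * s)) i" for i
   proof (cases "i = n")
    case True
    then show ?thesis by (simp, intro tendsto_add tendsto_mult a b tendsto_const)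
   next
    case False
    then show ?thesis using LIMSEQ_subseq_LIMSEQ[OF Xs[of s i] h] by (simp add: o_def)
   qed
  qed
  then show ?thesis unfolding root[OF s] using LIMSEQ_unique[OF _ tendsto_const] by fastforce
 qed
 then show ?thesis unfolding has_line_def by blast
qed

text \<open>The sum of the cubes of \<open>x 0\<close>, \<open>x 1\<close> and \<open>x n\<close>,
  the witness that a cubic need not have a line in the sense of \<open>has_line\<close>.\<close>

definition fermat :: "nat => (nat \<Rightarrow>\<^sub>0 nat) => complex" where
 "fermat n m = (if m \<in> {single 0 3, single 1 3, single n 3} then 1 else 0)"

definition unit0 :: "nat => complex" where
 "unit0 = (%i. if i = 0 then 1 else 0)"

text \<open>The polynomial \<open>1 + s ^ 3 + (a + b * s) ^ 3\<close> of degree at most 3 would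
  vanish at four places, hence identically; then the cubes of \<open>a\<close> and \<open>b\<close>
  are both -1 although \<open>a * b\<^sup>2 = 0\<close>.\<close>

lemma not_has_line_fermat:
 assumes "2 \<le> n" shows "\<not> has_line n (fermat n) unit0"
proof
 assume "has_line n (fermat n) unit0"
 then obtain a b where ab: "\<forall>s\<in>{0, 1, 2, 3}. formval n (fermat n) (unit0(1 := unit0 1 + s, n := a + b * s)) = 0"
  unfolding has_line_def by (elim exE)
 let ?T = "{single 0 3, single 1 3, single n (3::nat)}"
 have dist: "single i (3::nat) ~= single j 3" if "i ~= j" for i j :: nat
 proof
  assume "single i (3::nat) = single j 3"
  then have "lookup (single i (3::nat)) i = lookup (single j 3) i" by simp
  then show False using that by (simp add: lookup_single)
 qed
 have val: "formval n (fermat n) x = x 0 ^ 3 + x 1 ^ 3 + x n ^ 3" for x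
 proof -
  have "formval n (fermat n) x = (\<Sum>m\<in>?T. meval m x)"
   unfolding formval_def
   by (rule sum.mono_neutral_cong_right[OF finite_cubic_monomials])
    (use assms single_cubic_monomial[of _ n] in \<open>auto simp: fermat_def simp del: single_numeral\<close>)
  also have "\<dots> = x 0 ^ 3 + x 1 ^ 3 + x n ^ 3"
   using dist[of 0 1] dist[of 0 n] dist[of 1 n] assms by (simp add: meval_single del: single_numeral)
  finally show ?thesis .
 qed
 have eq: "1 + s ^ 3 + (a + b * s) ^ 3 = 0" if "s \<in> {0, 1, 2, 3}" for s
  using ab[rule_format, OF that] assms unfolding val by (simp add: unit0_def)
 have e0: "1 + a ^ 3 = 0" using eq[of 0] by simp
 have e1: "1 + 1 + (a + b) ^ 3 = 0" using eq[of 1] by simp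
 have e2: "1 + 8 + (a + b * 2) ^ 3 = 0" using eq[of 2] by simp
 have e3: "1 + 27 + (a + b * 3) ^ 3 = 0" using eq[of 3] by simp
 \<comment> \<open>The third difference of the four values isolates the coefficient of
   \<open>s ^ 3\<close>; the second difference below isolates that of \<open>s ^ 2\<close>.\<close>
 have "6 * (1 + b ^ 3) = (1 + 27 + (a + b * 3) ^ 3) - 3 * (1 + 8 + (a + b * 2) ^ 3) + 3 * (1 + 1 + (a + b) ^ 3) - (1 + a ^ 3)"
  by (simp add: algebra_simps power3_eq_cube)
 then have "6 * (1 + b ^ 3) = 0" unfolding e0 e1 e2 e3 by (simp only: mult_zero_right diff_0_right add_0_right)
 then have b3: "1 + b ^ 3 = 0" by (simp only: mult_eq_0_iff) simp
 have "6 * (a * b\<^sup>2) + 6 * (1 + b ^ 3) = (1 + 8 + (a + b * 2) ^ 3) - 2 * (1 + 1 + (a + b) ^ 3) + (1 + a ^ 3)"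
  by (simp add: algebra_simps power3_eq_cube power2_eq_square)
 then have "a * b\<^sup>2 = 0" unfolding e0 e1 e2 b3 by simp
 then have "a = 0 \<or> b = 0" by simp
 then show False using e0 b3 by auto
qed

subsection \<open>The open set of good cubics\<close>

text \<open>The first condition supplies the matrix factorization. The other two supply the
  geometry: division by \<open>f\<close> with respect to \<open>x n\<close>, and no rational root in
  \<open>x n\<close>.\<close>

definition good :: "nat => ((nat \<Rightarrow>\<^sub>0 nat) => complex) => bool" where
 "good n z \<longleftrightarrow> (EX L. \<forall>m\<in>monomials {..n} 3. z m = trilin n L L L m) & \<not> has_line n z unit0
  & z (single n 3) ~= 0"

lemma polyfn_sum_list: "(!!y. y \<in> set ys ==> polyfn I (f y)) ==> polyfn I (%x. \<Sum>y\<leftarrow>ys. f y x)"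
 by (induction ys) auto

lemma polyfn_meval: "(!!i. i \<in> keys m ==> polyfn I (%x. \<phi> x i)) ==> polyfn I (%x. meval m (\<phi> x))"
 unfolding meval_def by (intro polyfn_prod polyfn_power)

lemma trilin_cong:
 assumes "!!i a. i < 27 ==> a \<le> n ==> L i a = L' i a" shows "trilin n L L L m = trilin n L' L' L' m"
 unfolding trilin_def
proof (rule sum_list_eqI)
 fix e i j k assume "(e, i, j, k) \<in> set cub"
 then have "i < 27" "j < 27" "k < 27" using cub_range by auto
 then show "(\<Sum>a\<le>n. \<Sum>b\<le>n. \<Sum>c\<le>n. of_int e * (L i a * L j b * L k c) *
  (if single a 1 + (single b 1 + single c 1) = m then 1 else 0)) =
  (\<Sum>a\<le>n. \<Sum>b\<le>n. \<Sum>c\<le>n. of_int e * (L' i a * L' j b * L' k c) *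
  (if single a 1 + (single b 1 + single c 1) = m then 1 else 0))"
  by (intro sum.cong refl) (simp add: assms)
qed

text \<open>Chevalley's theorem for the incidence of coefficient vectors, in the left summand of the
  index type, and linear maps, in the right one. The projection either contains or misses a nonempty
  principal open set, and \<open>polyfn_image_nonzero\<close> rules out the latter.\<close>

lemma generic_pullback:
 assumes "n \<le> 8"
 shows "EX g. polyfn (monomials {..n} 3) g & (EX z. g z ~= 0) &
  (ALL z. g z ~= 0 --> (EX L. \<forall>m\<in>monomials {..n} 3. z m = trilin n L L L m))"
proof -
 let ?M = "monomials {..n} 3"
 let ?W = "Inr ` ({..<27} \<times> {..n}) :: ((nat \<Rightarrow>\<^sub>0 nat) + (nat \<times> nat)) set"
 let ?I = "Inl ` ?M \<union> ?W"
 define Lz where "Lz z = (%i a. if i < 27 & a \<le> n then z (Inr (i, a)) else 0 :: complex)" for z :: "(nat \<Rightarrow>\<^sub>0 nat) + (nat \<times> nat) => complex"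
 define A where "A z \<longleftrightarrow> (\<forall>m\<in>?M. z (Inl m) - trilin n (Lz z) (Lz z) (Lz z) m = 0)" for z
 have PL: "polyfn ?I (%z. Lz z i a)" for i a
  unfolding Lz_def by (cases "i < 27 & a \<le> n") (auto intro!: polyfn_var)
 have "constructible ?I A"
  unfolding A_def[abs_def]
 proof (intro constructible_ball constructible.zero polyfn_diff)
  fix m assume "m \<in> ?M"
  then show "polyfn ?I (%z. z (Inl m))" by (intro polyfn_var) auto
  show "polyfn ?I (%z. trilin n (Lz z) (Lz z) (Lz z) m)"
   unfolding trilin_def
  proof (rule polyfn_sum_list)
   fix y assume "y \<in> set cub"
   obtain e i j k where y: "y = (e, i, j, k)" by (cases y)
   show "polyfn ?I (%z. case y of (e, i, j, k) => \<Sum>a\<le>n. \<Sum>b\<le>n. \<Sum>c\<le>n. of_int e * (Lz z i a * Lz z j b * Lz z k c) *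
    (if single a 1 + (single b 1 + single c 1) = m then 1 else 0))"
    unfolding y prod.case by (intro polyfn_sum polyfn_mult polyfn_const PL)
  qed
 qed simp
 then have "constructible (?I - ?W) (%z. EX y. A (%v. if v \<in> ?W then y v else z v))"
  by (rule constructible_project[rotated]) simp
 then obtain g where g0: "polyfn (?I - ?W) g" "EX z. g z ~= 0"
  "(ALL z. g z ~= 0 --> (EX y. A (%v. if v \<in> ?W then y v else z v))) \<or>
  (ALL z. g z ~= 0 --> \<not> (EX y. A (%v. if v \<in> ?W then y v else z v)))"
  by (rule constructible_decided)
 have g: "polyfn (Inl ` ?M) g" by (rule polyfn_mono[OF g0(1)]) auto
 define g' where "g' v = g (case_sum v (%_. 0))" for v
 have g': "polyfn ?M g'" unfolding g'_def[abs_def] by (rule polyfn_reindex[OF g])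
 obtain z1 where z1: "g z1 ~= 0" using g0(2) by blast
 have z1': "g' (%m. z1 (Inl m)) ~= 0"
 proof -
  have "g z1 = g (case_sum (%m. z1 (Inl m)) (%_. 0))" by (rule polyfn_cong[OF g]) auto
  then show ?thesis using z1 by (simp add: g'_def)
 qed
 have Anot: "A (%v. if v \<in> ?W then y v else case_sum z (%_. 0) v) \<longleftrightarrow>
  (\<forall>m\<in>?M. z m = trilin n (%i a. y (Inr (i, a))) (%i a. y (Inr (i, a))) (%i a. y (Inr (i, a))) m)" for y z
 proof -
  have "trilin n (Lz (%v. if v \<in> ?W then y v else case_sum z (%_. 0) v)) (Lz (%v. if v \<in> ?W then y v else case_sum z (%_. 0) v))
    (Lz (%v. if v \<in> ?W then y v else case_sum z (%_. 0) v)) m =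
   trilin n (%i a. y (Inr (i, a))) (%i a. y (Inr (i, a))) (%i a. y (Inr (i, a))) m" for m
   by (rule trilin_cong) (auto simp: Lz_def)
  then show ?thesis unfolding A_def by auto
 qed
 obtain L where L: "g' (trilin n L L L) ~= 0"
  using polyfn_image_nonzero[OF assms g' z1'] by blast
 have "A (%v. if v \<in> ?W then case_sum (%_. 0) (%(i, a). L i a) v else case_sum (trilin n L L L) (%_. 0) v)"
  unfolding Anot by simp
 then have "\<not> (ALL z. g z ~= 0 --> \<not> (EX y. A (%v. if v \<in> ?W then y v else z v)))"
  using L unfolding g'_def by blast
 then have pos: "ALL z. g z ~= 0 --> (EX y. A (%v. if v \<in> ?W then y v else z v))" using g0(3) by blast
 have "EX L. \<forall>m\<in>?M. z m = trilin n L L L m" if "g' z ~= 0" for z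
 proof -
  obtain y where "A (%v. if v \<in> ?W then y v else case_sum z (%_. 0) v)"
   using pos[rule_format, of "case_sum z (%_. 0)"] \<open>g' z ~= 0\<close> unfolding g'_def by blast
  then show ?thesis unfolding Anot by blast
 qed
 then show ?thesis using g' z1' by blast
qed

text \<open>Having a line is constructible as well. If it held on a nonempty principal open set,
  coefficient vectors from this set would approach \<open>fermat\<close> along a line, and by
  \<open>has_line_closed\<close> the Fermat cubic would have a line.\<close>

lemma generic_no_line:
 assumes "2 \<le> n"
 shows "EX g. polyfn (monomials {..n} 3) g & (EX z. g z ~= 0) & (ALL z. g z ~= 0 --> \<not> has_line n z unit0)"
proof -
 let ?M = "monomials {..n} 3"
 let ?W = "Inr ` {(0, 0), (0, 1)} :: ((nat \<Rightarrow>\<^sub>0 nat) + (nat \<times> nat)) set"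
 let ?I = "Inl ` ?M \<union> ?W"
 define A where "A z \<longleftrightarrow> (\<forall>s\<in>{0, 1, 2, 3}. formval n (%m. z (Inl m))
   (unit0(1 := unit0 1 + s, n := z (Inr (0, 0)) + z (Inr (0, 1)) * s)) = 0)"
  for z :: "(nat \<Rightarrow>\<^sub>0 nat) + (nat \<times> nat) => complex"
 have "constructible ?I A"
  unfolding A_def[abs_def] formval_def
 proof (intro constructible_ball constructible.zero polyfn_sum polyfn_mult polyfn_meval)
  fix m assume "m \<in> ?M"
  then show "polyfn ?I (%z. z (Inl m))" by (intro polyfn_var) auto
 next
  fix s i
  have "polyfn ?I (%z. z (Inr (0, 0)) + z (Inr (0, 1)) * s)"
   by (intro polyfn_add polyfn_mult polyfn_const polyfn_var) auto
  then show "polyfn ?I (%z. (unit0(1 := unit0 1 + s, n := z (Inr (0, 0)) + z (Inr (0, 1)) * s)) i)"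
   by (cases "i = n") auto
 qed simp
 then have "constructible (?I - ?W) (%z. EX y. A (%v. if v \<in> ?W then y v else z v))"
  by (rule constructible_project[rotated]) simp
 then obtain g where g0: "polyfn (?I - ?W) g" "EX z. g z ~= 0"
  "(ALL z. g z ~= 0 --> (EX y. A (%v. if v \<in> ?W then y v else z v))) \<or>
  (ALL z. g z ~= 0 --> \<not> (EX y. A (%v. if v \<in> ?W then y v else z v)))"
  by (rule constructible_decided)
 have g: "polyfn (Inl ` ?M) g" by (rule polyfn_mono[OF g0(1)]) auto
 define g' where "g' v = g (case_sum v (%_. 0))" for v
 have g': "polyfn ?M g'" unfolding g'_def[abs_def] by (rule polyfn_reindex[OF g])
 obtain z1 where z1: "g z1 ~= 0" using g0(2) by blast
 define y1 where "y1 m = z1 (Inl m)" for m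
 have z1': "g' y1 ~= 0"
 proof -
  have "g z1 = g (case_sum y1 (%_. 0))" by (rule polyfn_cong[OF g]) (auto simp: y1_def)
  then show ?thesis using z1 by (simp add: g'_def)
 qed
 have AE: "(EX y. A (%v. if v \<in> ?W then y v else case_sum z (%_. 0) v)) \<longleftrightarrow> has_line n z unit0" for z
 proof
  assume "EX y. A (%v. if v \<in> ?W then y v else case_sum z (%_. 0) v)"
  then obtain y where "A (%v. if v \<in> ?W then y v else case_sum z (%_. 0) v)" by (elim exE)
  then show "has_line n z unit0"
   unfolding A_def has_line_def by (intro exI[of _ "y (Inr (0, 0))"] exI[of _ "y (Inr (0, 1))"]) (simp add: image_iff del: fun_upd_apply)
 next
  assume "has_line n z unit0"
  then obtain a b where "\<forall>s\<in>{0, 1, 2, 3}. formval n z (unit0(1 := unit0 1 + s, n := a + b * s)) = 0"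
   unfolding has_line_def by (elim exE)
  then show "EX y. A (%v. if v \<in> ?W then y v else case_sum z (%_. 0) v)"
   unfolding A_def by (intro exI[of _ "%v. if v = Inr (0, 0) then a else b"]) (simp add: image_iff del: fun_upd_apply)
 qed
 have "\<not> (ALL z. g z ~= 0 --> (EX y. A (%v. if v \<in> ?W then y v else z v)))"
 proof
  assume all: "ALL z. g z ~= 0 --> (EX y. A (%v. if v \<in> ?W then y v else z v))"
  have bad: "has_line n z unit0" if "g' z ~= 0" for z
   using all[rule_format, of "case_sum z (%_. 0)"] that unfolding AE g'_def by blast
  define F where "F = {s. g' (%v. fermat n v + s * (y1 v - fermat n v)) = 0}"
  have "finite F" unfolding F_def by (rule polyfn_line_finite[OF g', of _ 1]) (use z1' in simp)
  \<comment> \<open>A null sequence, later shifted past the finitely many terms that fall into the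
    exceptional set \<open>F\<close>.\<close>
  define c where "c = (%k::nat. 1 / of_nat (Suc k) :: complex)"
  have "inj c" unfolding c_def by (auto simp: inj_def simp del: of_nat_Suc)
  then have "finite {k. c k \<in> F}" using \<open>finite F\<close> finite_vimageI[of F c] by (simp add: vimage_def)
  then obtain N where N: "\<forall>k\<in>{k. c k \<in> F}. k < N" using finite_nat_set_iff_bounded by blast
  define s where "s k = c (N + k)" for k
  have sF: "s k \<notin> F" for k using N unfolding s_def by fastforce
  have "c \<longlonglongrightarrow> 0" unfolding c_def by (rule LIMSEQ_Suc[OF lim_1_over_n])
  then have s0: "s \<longlonglongrightarrow> 0" unfolding s_def[abs_def] using LIMSEQ_ignore_initial_segment[of c 0 N] by (simp add: add.commute)
  have "has_line n (fermat n) unit0"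
  proof (rule has_line_closed[where Z = "%k v. fermat n v + s k * (y1 v - fermat n v)" and X = "%_. unit0"])
   show "(%k. fermat n m + s k * (y1 m - fermat n m)) \<longlonglongrightarrow> fermat n m" for m
    using tendsto_add[OF tendsto_const tendsto_mult[OF s0 tendsto_const], of "fermat n m" "y1 m - fermat n m"] by simp
   show "has_line n (%v. fermat n v + s k * (y1 v - fermat n v)) unit0" for k
    using sF[of k] bad unfolding F_def by simp
  qed (use assms in \<open>simp_all add: fermat_def del: single_numeral\<close>)
  then show False using not_has_line_fermat[OF assms] by contradiction
 qed
 then have neg: "ALL z. g z ~= 0 --> \<not> (EX y. A (%v. if v \<in> ?W then y v else z v))" using g0(3) by blast
 have "\<not> has_line n z unit0" if "g' z ~= 0" for z
  using neg[rule_format, of "case_sum z (%_. 0)"] that unfolding AE g'_def by blast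
 then show ?thesis using g' z1' by blast
qed

lemma cube_root_exists: obtains r :: complex where "r ^ 3 = c"
proof -
 have "EX r. poly [:- c, 0, 0, 1:] r = 0"
  by (intro fundamental_theorem_of_algebra) (simp add: constant_degree)
 then obtain r where "poly [:- c, 0, 0, 1:] r = 0" by (elim exE)
 then have "r ^ 3 = c" by (simp add: power3_eq_cube algebra_simps)
 then show ?thesis by (rule that)
qed

lemma trilin_scale: "trilin n (%i a. r * L i a) (%i a. r * L i a) (%i a. r * L i a) m = r ^ 3 * trilin n L L L m"
proof -
 have "r ^ 3 * trilin n L L L m = (\<Sum>(e, i, j, k)\<leftarrow>cub. r ^ 3 * (\<Sum>a\<le>n. \<Sum>b\<le>n. \<Sum>c\<le>n. of_int e * (L i a * L j b * L k c) *
  (if single a 1 + (single b 1 + single c 1) = m then 1 else 0)))"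
  by (simp add: trilin_def sum_list_const_mult split_def)
 also have "\<dots> = trilin n (%i a. r * L i a) (%i a. r * L i a) (%i a. r * L i a) m"
  unfolding trilin_def sum_distrib_left
  by (intro sum_list_eqI sum.cong refl) (simp add: power3_eq_cube)
 finally show ?thesis ..
qed

text \<open>A cube root of the inverse factor rescales the linear map; the other two conditions are
  homogeneous.\<close>

lemma good_scale:
 assumes "good n (%m. c * z m)" "c ~= 0" shows "good n z"
proof -
 obtain L where L: "\<forall>m\<in>monomials {..n} 3. c * z m = trilin n L L L m"
  and nl: "\<not> has_line n (%m. c * z m) unit0" and nz: "c * z (single n 3) ~= 0"
  using assms(1) unfolding good_def by blast
 obtain r where r: "r ^ 3 = inverse c" by (rule cube_root_exists)
 have "z m = trilin n (%i a. r * L i a) (%i a. r * L i a) (%i a. r * L i a) m" if "m \<in> monomials {..n} 3" for m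
  unfolding trilin_scale r L[rule_format, OF that, symmetric] using assms(2) by simp
 moreover have "formval n (%m. c * z m) x = c * formval n z x" for x
  by (simp add: formval_def sum_distrib_left mult.assoc)
 then have "\<not> has_line n z unit0" using nl by (simp add: has_line_def)
 ultimately show ?thesis using nz unfolding good_def by auto
qed

text \<open>The conditions hold off the zeros of a polynomial \<open>p\<close> that need not be
  homogeneous. A nonzero component of \<open>p\<close> does as well: where it is nonzero,
  \<open>p\<close> is nonzero at some multiple of \<open>z\<close>, and \<open>good\<close> does not
  change under scaling.\<close>

theorem generic_good_cubic:
 assumes "2 \<le> n" "n \<le> 8"
 obtains U where "openin (zariski (monomials {..n} 3)) U" "U ~= {}"
  "!!z. proj_class z \<in> U ==> good n z"
proof -
 let ?M = "monomials {..n} 3"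
 let ?m = "single n 3"
 obtain g where "polyfn ?M g & (EX z. g z ~= 0) &
  (ALL z. g z ~= 0 --> (EX L. \<forall>m\<in>?M. z m = trilin n L L L m))"
  using generic_pullback[OF assms(2)] by (elim exE)
 then have g: "polyfn ?M g" "EX z. g z ~= 0"
  "ALL z. g z ~= 0 --> (EX L. \<forall>m\<in>?M. z m = trilin n L L L m)" by simp_all
 obtain h where "polyfn ?M h & (EX z. h z ~= 0) & (ALL z. h z ~= 0 --> \<not> has_line n z unit0)"
  using generic_no_line[OF assms(1)] by (elim exE)
 then have h: "polyfn ?M h" "EX z. h z ~= 0" "ALL z. h z ~= 0 --> \<not> has_line n z unit0" by simp_all
 have lead: "polyfn ?M (%z. z ?m)" by (intro polyfn_var single_cubic_monomial) simp
 have gh: "polyfn ?M (%z. g z * h z)" by (rule polyfn_mult[OF g(1) h(1)])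
 have ghl: "polyfn ?M (%z. g z * h z * z ?m)" by (rule polyfn_mult[OF gh lead])
 have "\<not> (ALL z. g z * h z = 0)" using polyfn_mult_eq_0[OF g(1) h(1)] g(2) h(2) by blast
 moreover have "\<not> (\<forall>z :: (nat \<Rightarrow>\<^sub>0 nat) => complex. z ?m = 0)" by (auto intro!: exI[of _ "%_. 1"])
 ultimately have ne: "\<not> (ALL z. g z * h z * z ?m = 0)" using polyfn_mult_eq_0[OF gh lead] by blast
 obtain p where p: "p \<in> polys ?M" "(%z. g z * h z * z ?m) = peval p"
  using ghl unfolding polyfn_def by (elim bexE)
 have pgood: "good n z" if "peval p z ~= 0" for z
  using that g(3) h(3) unfolding p(2)[symmetric] good_def by auto
 have "p ~= 0" using ne p(2) by (metis peval_zero)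
 have "EX d. hcomp d p ~= 0"
 proof (rule ccontr)
  assume "\<nexists>d. hcomp d p ~= 0"
  then have "p = 0" using sum_hcomp[of "mdeg ` keys p" p] by simp
  then show False using \<open>p ~= 0\<close> by simp
 qed
 then obtain d where d: "hcomp d p ~= 0" by (elim exE)
 have q: "hcomp d p \<in> forms ?M d" by (rule hcomp_forms[OF p(1)])
 have qgood: "good n z" if z: "peval (hcomp d p) z ~= 0" for z
 proof -
  obtain P where P: "!!c. peval p (%v. c * z v) = poly P c" "!!k. poly.coeff P k = peval (hcomp k p) z"
   using peval_poly_scale[of p z] by metis
  have "P ~= 0" using P(2)[of d] z by auto
  then have "finite (insert 0 {c. poly P c = 0})" using poly_roots_finite by simp
  then obtain c where "c \<notin> insert 0 {c. poly P c = 0}"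
   using ex_new_if_finite[OF infinite_UNIV_char_0] by metis
  then have "c ~= 0" "peval p (%v. c * z v) ~= 0" using P(1) by auto
  then show ?thesis using pgood good_scale by blast
 qed
 define U where "U = nonvanishing ?M (hcomp d p)"
 have "openin (zariski ?M) U"
  unfolding zariski_def U_def by (rule topology_generated_by_Basis) (use q in blast)
 moreover have "U ~= {}"
 proof -
  have "\<not> (ALL z. peval (hcomp d p) z * z ?m = 0)"
   using polyfn_mult_eq_0[OF polyfn_peval[OF forms_polys[OF q]] lead] d peval_eq_0_iff[of "hcomp d p"]
    \<open>\<not> (ALL z. z ?m = 0)\<close> by blast
  then obtain z where z: "peval (hcomp d p) z ~= 0" "z ?m ~= 0" by auto
  define y where "y = (%m. if m \<in> ?M then z m else 0)"
  have y: "peval (hcomp d p) y ~= 0"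
   using z(1) peval_cong[OF forms_polys[OF q], of z y] by (simp add: y_def)
  have "y ?m ~= 0" using z(2) single_cubic_monomial[of n n] by (simp add: y_def)
  then have "proj_class y \<in> proj_space ?M"
   unfolding proj_space_def by (intro imageI CollectI conjI exI[of _ ?m]) (auto simp: y_def)
  moreover have "peval (hcomp d p) v ~= 0" if "v \<in> proj_class y" for v
   using that y by (auto simp: proj_class_def peval_scale[OF q])
  ultimately have "proj_class y \<in> U" by (simp add: U_def nonvanishing_def)
  then show ?thesis by blast
 qed
 moreover have "good n z" if "proj_class z \<in> U" for z
 proof (rule qgood)
  have "z \<in> proj_class z" unfolding proj_class_def by (intro CollectI exI[of _ 1]) simp
  then show "peval (hcomp d p) z ~= 0" using that by (simp add: U_def nonvanishing_def)
 qed
 ultimately show ?thesis by (rule that)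
qed

section \<open>Division by the cubic, and irreducibility\<close>

locale good_cubic =
 fixes n :: nat and f :: "nat mpoly"
 assumes n2: "2 \<le> n" and form: "f \<in> forms {..n} 3"
  and lead: "lookup f (single n 3) ~= 0"
  and no_line: "\<not> has_line n (lookup f) unit0"
begin

definition lc :: complex where "lc = lookup f (single n 3)"

text \<open>The coefficient of \<open>x n ^ i\<close> in \<open>f\<close>, as a function of the
  other coordinates.\<close>

definition part :: "nat => (nat => complex) => complex" where
 "part i x = (\<Sum>m\<in>{m \<in> monomials {..n} 3. lookup m n = i}. lookup f m *
  (\<Prod>v\<in>keys m - {n}. x v ^ lookup m v))"

lemma lc_nonzero: "lc ~= 0"
 using lead by (simp add: lc_def)

lemma polyfn_part: "polyfn {..<n} (part i)"
 unfolding part_def[abs_def]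
 by (intro polyfn_sum polyfn_mult polyfn_const polyfn_prod polyfn_power polyfn_var)
  (fastforce simp: monomials_def)

lemma part_3: "part 3 x = lc"
proof -
 have "{m \<in> monomials {..n} 3. lookup m n = 3} = {single n 3}"
 proof (intro equalityI subsetI)
  fix m assume "m \<in> {m \<in> monomials {..n} 3. lookup m n = 3}"
  then have m: "mdeg m = 3" "lookup m n = 3" by (auto simp: monomials_def)
  define m' where "m' = m - single n 3"
  have e: "m = single n 3 + m'"
   by (rule poly_mapping_eqI) (use m in \<open>auto simp: m'_def lookup_add lookup_minus lookup_single when_def simp del: single_numeral\<close>)
  then have "mdeg m' = 0" using m(1) mdeg_add[of "single n 3" m'] by (simp del: single_numeral)
  then show "m \<in> {single n 3}" using e by simp
 next
  fix m assume "m \<in> {single n (3::nat)}"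
  then show "m \<in> {m \<in> monomials {..n} 3. lookup m n = 3}"
   using single_cubic_monomial[of n n] by (simp del: single_numeral)
 qed
 then show ?thesis unfolding part_def lc_def by simp
qed

lemma f_expand: "peval f x = lc * x n ^ 3 + part 2 x * x n ^ 2 + part 1 x * x n + part 0 x"
proof -
 let ?M = "monomials {..n} 3"
 have le: "(%m. lookup m n) ` ?M \<subseteq> {..3}"
 proof (rule image_subsetI)
  fix m assume "m \<in> ?M"
  then show "lookup m n \<in> {..3}" using lookup_le_mdeg[of m n] by (simp add: monomials_def)
 qed
 have "peval f x = (\<Sum>m\<in>?M. lookup f m * meval m x)"
  using peval_formval[OF form] by (simp add: formval_def)
 also have "\<dots> = (\<Sum>i\<le>3. \<Sum>m\<in>{m \<in> ?M. lookup m n = i}. lookup f m * meval m x)"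
  using le by (intro sum.group[symmetric]) auto
 also have "\<dots> = (\<Sum>i\<le>3. part i x * x n ^ i)"
 proof (rule sum.cong)
  fix i
  have "lookup f m * meval m x = lookup f m *
    (\<Prod>v\<in>keys m - {n}. x v ^ lookup m v) * x n ^ i"
   if "lookup m n = i" for m
  proof -
   have "meval m x = (\<Prod>v\<in>insert n (keys m - {n}). x v ^ lookup m v)"
    by (rule meval_superset) auto
   then show ?thesis using that by (subst (asm) prod.insert) auto
  qed
  then show "(\<Sum>m\<in>{m \<in> ?M. lookup m n = i}. lookup f m * meval m x) = part i x * x n ^ i"
   unfolding part_def sum_distrib_right by (intro sum.cong refl) auto
 qed simp
 also have "\<dots> = lc * x n ^ 3 + part 2 x * x n ^ 2 + part 1 x * x n + part 0 x"
 proof -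
  have "{..3::nat} = {0, 1, 2, 3}" by auto
  then show ?thesis by (simp add: part_3)
 qed
 finally show ?thesis .
qed

lemma base_cong: "polyfn {..<n} h ==> h (x(n := t)) = h x"
 by (erule polyfn_cong) auto

lemma f_expand_upd: "peval f (x(n := t)) = lc * t ^ 3 + part 2 x * t ^ 2 + part 1 x * t + part 0 x"
 unfolding f_expand by (simp only: base_cong[OF polyfn_part] fun_upd_same)

lemma base_mono: "polyfn {..<n} h ==> polyfn {..n} h"
 by (erule polyfn_mono) auto

lemma polyfn_f: "polyfn {..n} (peval f)"
 using form by (intro polyfn_peval forms_polys)

text \<open>Division with remainder is possible since the leading coefficient of \<open>f\<close> in
  \<open>x n\<close> is a nonzero constant. The remainders are the elements of a free module with
  basis 1, \<open>x n\<close>, \<open>x n ^ 2\<close> over the polynomials in the other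
  coordinates.\<close>

lemma reduce:
 assumes "polyfn {..n} F"
 obtains Q r0 r1 r2 where "polyfn {..n} Q" "polyfn {..<n} r0" "polyfn {..<n} r1" "polyfn {..<n} r2"
  "!!x. F x = peval f x * Q x + (r0 x + r1 x * x n + r2 x * x n ^ 2)"
proof -
 define red where "red F \<longleftrightarrow> (EX Q r0 r1 r2. polyfn {..n} Q & polyfn {..<n} r0 & polyfn {..<n} r1 & polyfn {..<n} r2
  & (ALL x. F x = peval f x * Q x + (r0 x + r1 x * x n + r2 x * x n ^ 2)))" for F
 have redI: "red F" if "polyfn {..n} Q" "polyfn {..<n} r0" "polyfn {..<n} r1" "polyfn {..<n} r2"
  "!!x. F x = peval f x * Q x + (r0 x + r1 x * x n + r2 x * x n ^ 2)" for F Q r0 r1 r2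
  unfolding red_def using that by blast
 have pn: "polyfn {..n} (%x. x n)" by (rule polyfn_var) simp
 have "red F"
  using assms
 proof (induction rule: polyfn_induct)
  case (const c)
  show ?case by (rule redI[of "%_. 0" "%_. c" "%_. 0" "%_. 0"]) auto
 next
  case (var v)
  show ?case
  proof (cases "v = n")
   case True
   then show ?thesis by (intro redI[of "%_. 0" "%_. 0" "%_. 1" "%_. 0"]) auto
  next
   case False
   then have "polyfn {..<n} (%x. x v)" using var by (intro polyfn_var) auto
   then show ?thesis by (intro redI[of "%_. 0" "%x. x v" "%_. 0" "%_. 0"]) auto
  qed
 next
  case (add F G)
  obtain Q a0 a1 a2 where F: "polyfn {..n} Q" "polyfn {..<n} a0" "polyfn {..<n} a1" "polyfn {..<n} a2"
   "ALL x. F x = peval f x * Q x + (a0 x + a1 x * x n + a2 x * x n ^ 2)"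
   using add.IH(1) unfolding red_def by (elim exE conjE)
  obtain Q' b0 b1 b2 where G: "polyfn {..n} Q'" "polyfn {..<n} b0" "polyfn {..<n} b1" "polyfn {..<n} b2"
   "ALL x. G x = peval f x * Q' x + (b0 x + b1 x * x n + b2 x * x n ^ 2)"
   using add.IH(2) unfolding red_def by (elim exE conjE)
  show ?case
  proof (rule redI)
   show "polyfn {..n} (%x. Q x + Q' x)" "polyfn {..<n} (%x. a0 x + b0 x)" "polyfn {..<n} (%x. a1 x + b1 x)"
    "polyfn {..<n} (%x. a2 x + b2 x)" by (intro polyfn_add F G)+
   show "F x + G x = peval f x * (Q x + Q' x) + ((a0 x + b0 x) + (a1 x + b1 x) * x n + (a2 x + b2 x) * x n ^ 2)" for x
    by (simp only: F(5) G(5)) (simp add: algebra_simps)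
  qed
 next
  case (mult F G)
  obtain Q a0 a1 a2 where F: "polyfn {..n} Q" "polyfn {..<n} a0" "polyfn {..<n} a1" "polyfn {..<n} a2"
   "ALL x. F x = peval f x * Q x + (a0 x + a1 x * x n + a2 x * x n ^ 2)"
   using mult.IH(1) unfolding red_def by (elim exE conjE)
  obtain Q' b0 b1 b2 where G: "polyfn {..n} Q'" "polyfn {..<n} b0" "polyfn {..<n} b1" "polyfn {..<n} b2"
   "ALL x. G x = peval f x * Q' x + (b0 x + b1 x * x n + b2 x * x n ^ 2)"
   using mult.IH(2) unfolding red_def by (elim exE conjE)
  define q where "q = inverse lc"
  define u0 where "u0 = (%x. (- q) * part 0 x)"
  define u1 where "u1 = (%x. (- q) * part 1 x)"
  define u2 where "u2 = (%x. (- q) * part 2 x)"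
  have u: "polyfn {..<n} u0" "polyfn {..<n} u1" "polyfn {..<n} u2"
   unfolding u0_def u1_def u2_def by (rule polyfn_cmult[OF polyfn_part])+
  \<comment> \<open>The equation of \<open>f\<close> is solved for the cube of \<open>x n\<close>;
    together with its consequence for the fourth power this reduces a product of two
    remainders.\<close>
  have cube: "x n ^ 3 = peval f x * q + u0 x + u1 x * x n + u2 x * x n ^ 2" for x
  proof -
   have "peval f x * q + u0 x + u1 x * x n + u2 x * x n ^ 2 = (lc * q) * x n ^ 3"
    unfolding f_expand u0_def u1_def u2_def by (simp add: algebra_simps)
   then show ?thesis using lc_nonzero by (simp add: q_def)
  qed
  let ?e3 = "%x. a1 x * b2 x + a2 x * b1 x"
  let ?e4 = "%x. a2 x * b2 x"
  show ?case
  proof (rule redI)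
   show "polyfn {..n} (%x. peval f x * Q x * Q' x + Q x * (b0 x + b1 x * x n + b2 x * x n ^ 2)
     + Q' x * (a0 x + a1 x * x n + a2 x * x n ^ 2) + q * ?e3 x + (q * x n + u2 x * q) * ?e4 x)"
    by (intro polyfn_add polyfn_mult polyfn_power polyfn_f pn polyfn_const F(1) G(1) base_mono F(2-4) G(2-4) u)
   show "polyfn {..<n} (%x. a0 x * b0 x + ?e3 x * u0 x + ?e4 x * (u2 x * u0 x))"
    by (intro polyfn_add polyfn_mult F(2-4) G(2-4) u)
   show "polyfn {..<n} (%x. a0 x * b1 x + a1 x * b0 x + ?e3 x * u1 x + ?e4 x * (u0 x + u2 x * u1 x))"
    by (intro polyfn_add polyfn_mult F(2-4) G(2-4) u)
   show "polyfn {..<n} (%x. a0 x * b2 x + a1 x * b1 x + a2 x * b0 x + ?e3 x * u2 x + ?e4 x * (u1 x + u2 x * u2 x))"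
    by (intro polyfn_add polyfn_mult F(2-4) G(2-4) u)
   fix x
   have four: "x n ^ 4 = x n * (peval f x * q + u0 x + u1 x * x n) + u2 x * (peval f x * q + u0 x + u1 x * x n + u2 x * x n ^ 2)"
   proof -
    have "x n ^ 4 = x n * x n ^ 3" by (simp add: power4_eq_xxxx power3_eq_cube)
    also have "\<dots> = x n * (peval f x * q + u0 x + u1 x * x n) + u2 x * x n ^ 3"
     by (subst cube) (simp add: algebra_simps power3_eq_cube power2_eq_square)
    also have "\<dots> = x n * (peval f x * q + u0 x + u1 x * x n) + u2 x * (peval f x * q + u0 x + u1 x * x n + u2 x * x n ^ 2)"
     by (simp only: cube)
    finally show ?thesis .
   qed
   have "F x * G x = peval f x * (peval f x * Q x * Q' x + Q x * (b0 x + b1 x * x n + b2 x * x n ^ 2)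
     + Q' x * (a0 x + a1 x * x n + a2 x * x n ^ 2)) + (a0 x * b0 x + (a0 x * b1 x + a1 x * b0 x) * x n
     + (a0 x * b2 x + a1 x * b1 x + a2 x * b0 x) * x n ^ 2 + ?e3 x * x n ^ 3 + ?e4 x * x n ^ 4)"
    by (simp only: F(5) G(5)) (simp add: algebra_simps power2_eq_square power3_eq_cube power4_eq_xxxx)
   also have "\<dots> = peval f x * (peval f x * Q x * Q' x + Q x * (b0 x + b1 x * x n + b2 x * x n ^ 2)
     + Q' x * (a0 x + a1 x * x n + a2 x * x n ^ 2) + q * ?e3 x + (q * x n + u2 x * q) * ?e4 x)
     + (a0 x * b0 x + ?e3 x * u0 x + ?e4 x * (u2 x * u0 x)
     + (a0 x * b1 x + a1 x * b0 x + ?e3 x * u1 x + ?e4 x * (u0 x + u2 x * u1 x)) * x n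
     + (a0 x * b2 x + a1 x * b1 x + a2 x * b0 x + ?e3 x * u2 x + ?e4 x * (u1 x + u2 x * u2 x)) * x n ^ 2)"
    unfolding four cube by (simp add: algebra_simps power2_eq_square)
   finally show "F x * G x = peval f x * (peval f x * Q x * Q' x + Q x * (b0 x + b1 x * x n + b2 x * x n ^ 2)
     + Q' x * (a0 x + a1 x * x n + a2 x * x n ^ 2) + q * ?e3 x + (q * x n + u2 x * q) * ?e4 x)
     + (a0 x * b0 x + ?e3 x * u0 x + ?e4 x * (u2 x * u0 x)
     + (a0 x * b1 x + a1 x * b0 x + ?e3 x * u1 x + ?e4 x * (u0 x + u2 x * u1 x)) * x n
     + (a0 x * b2 x + a1 x * b1 x + a2 x * b0 x + ?e3 x * u2 x + ?e4 x * (u1 x + u2 x * u2 x)) * x n ^ 2)" .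
  qed
 qed
 then obtain Q r0 r1 r2 where *: "polyfn {..n} Q" "polyfn {..<n} r0" "polyfn {..<n} r1" "polyfn {..<n} r2"
  "ALL x. F x = peval f x * Q x + (r0 x + r1 x * x n + r2 x * x n ^ 2)"
  unfolding red_def by (elim exE conjE)
 show thesis by (rule that[OF *(1-4)]) (use *(5) in simp)
qed

lemma part_line:
 "EX P. degree P \<le> 3 - i & (ALL s. part i (%v. x v + s * u v) = poly P s)"
proof (intro exI conjI allI)
 let ?T = "{m \<in> monomials {..n} 3. lookup m n = i}"
 let ?P = "%m. \<Prod>v\<in>keys m - {n}. [:x v, u v:] ^ lookup m v"
 show "part i (%v. x v + s * u v) = poly (\<Sum>m\<in>?T. smult (lookup f m) (?P m)) s" for s
  by (simp add: part_def poly_sum poly_prod poly_power)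
 have "degree (?P m) \<le> 3 - i" if m: "m \<in> ?T" for m
 proof -
  have "degree (?P m) \<le> (\<Sum>v\<in>keys m - {n}. degree ([:x v, u v:] ^ lookup m v))"
   by (rule degree_prod_sum_le[unfolded o_def]) simp
  also have "\<dots> \<le> (\<Sum>v\<in>keys m - {n}. lookup m v)"
  proof (rule sum_mono)
   fix v
   have "degree ([:x v, u v:] ^ lookup m v) \<le> degree [:x v, u v:] * lookup m v"
    by (rule degree_power_le)
   also have "\<dots> \<le> 1 * lookup m v" by (intro mult_right_mono) auto
   finally show "degree ([:x v, u v:] ^ lookup m v) \<le> lookup m v" by simp
  qed
  also have "\<dots> = 3 - i"
  proof -
   have "mdeg m = lookup m n + (\<Sum>v\<in>keys m - {n}. lookup m v)"
   proof -
    have "mdeg m = (\<Sum>v\<in>insert n (keys m - {n}). lookup m v)"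
     by (rule mdeg_superset) auto
    also have "\<dots> = lookup m n + (\<Sum>v\<in>keys m - {n}. lookup m v)"
     by (rule sum.insert) auto
    finally show ?thesis .
   qed
   moreover have "mdeg m = 3" "lookup m n = i" using m by (auto simp: monomials_def)
   ultimately show ?thesis by arith
  qed
  finally show ?thesis .
 qed
 then show "degree (\<Sum>m\<in>?T. smult (lookup f m) (?P m)) \<le> 3 - i"
  by (intro degree_sum_le) (auto intro: order_trans[OF degree_smult_le])
qed

text \<open>\<open>resl a b\<close> is $a^3$ times the value of $f$ at $x_n = -b/a$.\<close>

definition resl :: "((nat => complex) => complex) => ((nat => complex) => complex) => (nat => complex) => complex" where
 "resl a b x = part 2 x * b x ^ 2 * a x - lc * b x ^ 3 - part 1 x * b x * a x ^ 2 + part 0 x * a x ^ 3"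

text \<open>The rational root theorem for \<open>- B / A\<close>: a denominator in lowest terms
  divides the constant \<open>c\<close>, so the root is a polynomial \<open>T\<close>. If its degree
  were at least 2, the term with \<open>T ^ 3\<close> would dominate all others.\<close>

lemma integral_root_linear:
 fixes A B :: "complex poly"
 assumes "A ~= 0" "degree F2 \<le> 1" "degree F1 \<le> 2" "degree F0 \<le> 3" "c ~= 0"
  "F2 * B ^ 2 * A - [:c:] * B ^ 3 - F1 * B * A ^ 2 + F0 * A ^ 3 = 0"
 shows "EX a b. ALL s. c * (a + b * s) ^ 3 + poly F2 s * (a + b * s) ^ 2 + poly F1 s * (a + b * s) + poly F0 s = 0"
proof -
 have "A dvd B"
 proof -
  define d where "d = gcd A B"
  have d: "d ~= 0" using assms(1) by (simp add: d_def)
  obtain A' where A': "A = d * A'" unfolding d_def using gcd_dvd1 by (metis dvdE)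
  obtain B' where B': "B = d * B'" unfolding d_def using gcd_dvd2 by (metis dvdE)
  have "coprime A' B'"
  proof -
   have "A div d = A'" unfolding A' using d by (rule nonzero_mult_div_cancel_left)
   moreover have "B div d = B'" unfolding B' using d by (rule nonzero_mult_div_cancel_left)
   ultimately have "A' = A div gcd A B" "B' = B div gcd A B" by (simp_all add: d_def)
   then show ?thesis using div_gcd_coprime[of A B] assms(1) by simp
  qed
  have "d ^ 3 * (F2 * B' ^ 2 * A' - [:c:] * B' ^ 3 - F1 * B' * A' ^ 2 + F0 * A' ^ 3) = 0"
   using assms(6) unfolding A' B' by (simp only: power_mult_distrib) (simp only: power2_eq_square power3_eq_cube algebra_simps)
  then have e: "F2 * B' ^ 2 * A' - [:c:] * B' ^ 3 - F1 * B' * A' ^ 2 + F0 * A' ^ 3 = 0" using d by simp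
  have "[:c:] * B' ^ 3 = A' * (F2 * B' ^ 2 - F1 * B' * A' + F0 * A' ^ 2)
   - (F2 * B' ^ 2 * A' - [:c:] * B' ^ 3 - F1 * B' * A' ^ 2 + F0 * A' ^ 3)"
   by (simp only: power2_eq_square power3_eq_cube algebra_simps)
  then have "A' dvd [:c:] * B' ^ 3" unfolding e by simp
  then have "A' dvd B' ^ 3" using assms(5) by (simp add: dvd_smult_iff)
  moreover have "coprime A' (B' ^ 3)" using \<open>coprime A' B'\<close> by simp
  ultimately have "is_unit A'" by (metis coprime_common_divisor dvd_refl)
  then have "A' dvd B'" by (rule unit_imp_dvd)
  then show ?thesis unfolding A' B' by (rule mult_dvd_mono[OF dvd_refl])
 qed
 then obtain R where R: "B = A * R" by (elim dvdE)
 define T where "T = - R"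
 have "A ^ 3 * (C * T ^ 3 + F2 * T ^ 2 + F1 * T + F0) = F2 * B ^ 2 * A - C * B ^ 3 - F1 * B * A ^ 2 + F0 * A ^ 3" for C
  unfolding R T_def by (simp add: power2_eq_square power3_eq_cube algebra_simps)
 from this[of "[:c:]"] have eq: "[:c:] * T ^ 3 + F2 * T ^ 2 + F1 * T + F0 = 0" using assms(1,6) by simp
 have "degree T \<le> 1"
 proof (rule ccontr)
  assume "\<not> degree T \<le> 1"
  then have d: "degree T \<ge> 2" by simp
  then have "T ~= 0" by auto
  then have e1: "degree ([:c:] * T ^ 3) = 3 * degree T" using assms(5) by (simp add: degree_power_eq)
  have e2: "[:c:] * T ^ 3 = - (F2 * T ^ 2 + F1 * T + F0)"
   using eq by (simp only: add.assoc eq_neg_iff_add_eq_0)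
  have "degree (F2 * T ^ 2 + F1 * T + F0) \<le> 2 * degree T + 1"
  proof (intro degree_add_le)
   have "degree (F2 * T ^ 2) \<le> degree F2 + degree (T ^ 2)" by (rule degree_mult_le)
   then show "degree (F2 * T ^ 2) \<le> 2 * degree T + 1" using assms(2) degree_power_le[of T 2] by linarith
   have "degree (F1 * T) \<le> degree F1 + degree T" by (rule degree_mult_le)
   then show "degree (F1 * T) \<le> 2 * degree T + 1" using assms(3) d by linarith
   show "degree F0 \<le> 2 * degree T + 1" using assms(4) d by linarith
  qed
  then show False using e1[unfolded e2 degree_minus] d by linarith
 qed
 then obtain a b where T: "T = [:a, b:]" by (metis degree1_coeffs degree_eq_zeroE pCons_0_0 less_one linorder_not_less le_neq_implies_less)
 have "c * (a + b * s) ^ 3 + poly F2 s * (a + b * s) ^ 2 + poly F1 s * (a + b * s) + poly F0 s = 0" for s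
 proof -
  have "poly ([:c:] * T ^ 3 + F2 * T ^ 2 + F1 * T + F0) s = 0" unfolding eq by simp
  moreover have "poly T s = a + b * s" by (simp add: T mult.commute)
  ultimately show ?thesis by (simp only: poly_add poly_mult poly_power) simp
 qed
 then show ?thesis by blast
qed

text \<open>Otherwise \<open>- b / a\<close> is a root of \<open>f\<close> in \<open>x n\<close>. On
  a line in the direction \<open>e1\<close>, through a point where \<open>a\<close> is nonzero, the
  root is a polynomial of degree at most 1, which gives a line in the sense of
  \<open>has_line\<close>. Such points approach \<open>unit0\<close>, so by closedness a line would
  exist there too.\<close>

lemma no_rational_root:
 assumes "polyfn {..<n} a" "polyfn {..<n} b" "a y ~= 0"
 shows "EX x. resl a b x ~= 0"
proof (rule ccontr)
 assume "\<nexists>x. resl a b x ~= 0"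
 then have zero: "resl a b x = 0" for x by simp
 define e1 where "e1 = (%i::nat. if i = 1 then 1 else 0 :: complex)"
 have line: "has_line n (lookup f) p" if p: "a p ~= 0" for p
 proof -
  obtain A where A: "!!s. a (%v. p v + s * e1 v) = poly A s" using polyfn_line[OF assms(1), of p e1] by metis
  obtain B where B: "!!s. b (%v. p v + s * e1 v) = poly B s" using polyfn_line[OF assms(2), of p e1] by metis
  have "EX P. ALL i. degree (P i) \<le> 3 - i & (ALL s. part i (%v. p v + s * e1 v) = poly (P i) s)"
   by (intro choice allI part_line)
  then obtain P where P: "!!i. degree (P i) \<le> 3 - i" "!!i s. part i (%v. p v + s * e1 v) = poly (P i) s" by blast
  have "A ~= 0" using A[of 0] p by auto
  moreover have "P 2 * B ^ 2 * A - [:lc:] * B ^ 3 - P 1 * B * A ^ 2 + P 0 * A ^ 3 = 0"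
  proof -
   have "poly (P 2 * B ^ 2 * A - [:lc:] * B ^ 3 - P 1 * B * A ^ 2 + P 0 * A ^ 3) s = 0" for s
    using zero[of "%v. p v + s * e1 v"] unfolding resl_def A B P(2) by (simp add: poly_power)
   then show ?thesis using poly_all_0_iff_0 by blast
  qed
  moreover have "degree (P 2) \<le> 1" "degree (P 1) \<le> 2" "degree (P 0) \<le> 3"
   using P(1)[of 2] P(1)[of 1] P(1)[of 0] by simp_all
  ultimately have "EX a b. ALL s. lc * (a + b * s) ^ 3 + poly (P 2) s * (a + b * s) ^ 2 + poly (P 1) s * (a + b * s) + poly (P 0) s = 0"
   using lc_nonzero by (intro integral_root_linear)
  then obtain c d where cd: "ALL s. lc * (c + d * s) ^ 3 + poly (P 2) s * (c + d * s) ^ 2 + poly (P 1) s * (c + d * s) + poly (P 0) s = 0"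
   by (elim exE)
  have "formval n (lookup f) (p(1 := p 1 + s, n := c + d * s)) = 0" for s
  proof -
   have "p(1 := p 1 + s) = (%v. p v + s * e1 v)" by (auto simp: e1_def)
   then have "peval f (p(1 := p 1 + s, n := c + d * s)) =
    lc * (c + d * s) ^ 3 + poly (P 2) s * (c + d * s) ^ 2 + poly (P 1) s * (c + d * s) + poly (P 0) s"
    unfolding f_expand_upd by (simp only: P(2))
   then show ?thesis using cd by (simp only: peval_formval[OF form])
  qed
  then show ?thesis unfolding has_line_def by blast
 qed
 define F where "F = {s. a (%v. unit0 v + s * (y v - unit0 v)) = 0}"
 have "finite F" unfolding F_def by (rule polyfn_line_finite[OF assms(1), of _ 1]) (use assms(3) in simp)
 define c where "c = (%k::nat. 1 / of_nat (Suc k) :: complex)"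
 have "inj c" unfolding c_def by (auto simp: inj_def simp del: of_nat_Suc)
 then have "finite {k. c k \<in> F}" using \<open>finite F\<close> finite_vimageI[of F c] by (simp add: vimage_def)
 then obtain N where N: "\<forall>k\<in>{k. c k \<in> F}. k < N" using finite_nat_set_iff_bounded by blast
 define s where "s k = c (N + k)" for k
 have sF: "s k \<notin> F" for k using N unfolding s_def by fastforce
 have "c \<longlonglongrightarrow> 0" unfolding c_def by (rule LIMSEQ_Suc[OF lim_1_over_n])
 then have s0: "s \<longlonglongrightarrow> 0" unfolding s_def[abs_def] using LIMSEQ_ignore_initial_segment[of c 0 N] by (simp add: add.commute)
 have "has_line n (lookup f) unit0"
 proof (rule has_line_closed[where Z = "%k. lookup f" and X = "%k v. unit0 v + s k * (y v - unit0 v)"])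
  show "(%k. unit0 i + s k * (y i - unit0 i)) \<longlonglongrightarrow> unit0 i" for i
   using tendsto_add[OF tendsto_const tendsto_mult[OF s0 tendsto_const], of "unit0 i" "y i - unit0 i"] by simp
  show "has_line n (lookup f) (%v. unit0 v + s k * (y v - unit0 v))" for k
   using sF[of k] line unfolding F_def by simp
 qed (use lead n2 in simp_all)
 then show False using no_line by contradiction
qed

text \<open>Modulo \<open>a * x n + b\<close>, the product of \<open>a ^ 3\<close> and
  \<open>f\<close> is \<open>resl a b\<close>; \<open>- U\<close> is the quotient. If
  \<open>a\<close> vanishes identically, \<open>b\<close> itself is the nonzero combination.\<close>

lemma bezout_linear:
 assumes "polyfn {..<n} a" "polyfn {..<n} b" "a y ~= 0 \<or> b y ~= 0"
 shows "\<exists>U V \<nu>. polyfn {..n} U & polyfn {..n} V & polyfn {..<n} \<nu> & (EX x. \<nu> x ~= 0)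
  & (ALL x. U x * (a x * x n + b x) + V x * peval f x = \<nu> x)"
proof (cases "ALL x. a x = 0")
 case True
 then show ?thesis using assms
  by (intro exI[of _ "%_. 1"] exI[of _ "%_. 0"] exI[of _ b]) auto
next
 case False
 then obtain z where "a z ~= 0" by blast
 have pn: "polyfn {..n} (%x. x n)" by (rule polyfn_var) simp
 define U where "U x = - (lc * ((a x * x n) ^ 2 - a x * x n * b x + b x ^ 2) + part 2 x * a x * (a x * x n - b x) + part 1 x * a x ^ 2)" for x
 have "polyfn {..n} U"
  unfolding U_def[abs_def]
  by (intro polyfn_uminus polyfn_add polyfn_mult polyfn_diff polyfn_power polyfn_const pn base_mono polyfn_part assms(1,2))
 moreover have "polyfn {..n} (%x. a x ^ 3)" by (intro polyfn_power base_mono assms(1))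
 moreover have "polyfn {..<n} (resl a b)"
  unfolding resl_def[abs_def]
  by (intro polyfn_add polyfn_mult polyfn_diff polyfn_power polyfn_const polyfn_part assms(1,2))
 moreover have "EX x. resl a b x ~= 0" by (rule no_rational_root[OF assms(1,2) \<open>a z ~= 0\<close>])
 moreover have "U x * (a x * x n + b x) + a x ^ 3 * peval f x = resl a b x" for x
  unfolding U_def resl_def f_expand by (simp add: algebra_simps power2_eq_square power3_eq_cube)
 ultimately show ?thesis by blast
qed

text \<open>A nonzero polynomial of degree at most 2 in \<open>x n\<close> is coprime to
  \<open>f\<close> over the rational functions of the other coordinates. Pseudo-division leads to
  the linear case unless the quadratic divides, and then the complementary linear factor would have
  a rational root.\<close>

lemma bezout:
 assumes "polyfn {..<n} r0" "polyfn {..<n} r1" "polyfn {..<n} r2" "r0 y ~= 0 \<or> r1 y ~= 0 \<or> r2 y ~= 0"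
 shows "\<exists>U V \<nu>. polyfn {..n} U & polyfn {..n} V & polyfn {..<n} \<nu> & (EX x. \<nu> x ~= 0)
  & (ALL x. U x * (r0 x + r1 x * x n + r2 x * x n ^ 2) + V x * peval f x = \<nu> x)"
proof (cases "ALL x. r2 x = 0")
 case True
 obtain U V \<nu> where *: "polyfn {..n} U" "polyfn {..n} V" "polyfn {..<n} \<nu>" "EX x. \<nu> x ~= 0"
  "ALL x. U x * (r1 x * x n + r0 x) + V x * peval f x = \<nu> x"
  using bezout_linear[OF assms(2,1), of y] assms(4) True by metis
 have "U x * (r0 x + r1 x * x n + r2 x * x n ^ 2) + V x * peval f x = \<nu> x" for x
  using *(5)[rule_format, of x] True by (simp add: add.commute)
 then show ?thesis using *(1-4) by blast
next
 case False
 then obtain z where z: "r2 z ~= 0" by blast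
 have pn: "polyfn {..n} (%x. x n)" by (rule polyfn_var) simp
 \<comment> \<open>Pseudo-division of \<open>f\<close> by the quadratic: after multiplication by
   \<open>r2 ^ 2\<close> the quotient is \<open>r2 * lc * x n + \<delta>\<close> and the remainder
   is \<open>a * x n + b\<close>.\<close>
 define \<delta> where "\<delta> x = r2 x * part 2 x - lc * r1 x" for x
 define a where "a x = r2 x * (r2 x * part 1 x - lc * r0 x) - \<delta> x * r1 x" for x
 define b where "b x = r2 x ^ 2 * part 0 x - \<delta> x * r0 x" for x
 have \<delta>: "polyfn {..<n} \<delta>" unfolding \<delta>_def[abs_def]
  by (intro polyfn_mult polyfn_diff polyfn_const polyfn_part assms)
 have ab: "polyfn {..<n} a" "polyfn {..<n} b" unfolding a_def[abs_def] b_def[abs_def]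
  by (intro polyfn_mult polyfn_diff polyfn_const polyfn_power polyfn_part assms \<delta>)+
 have rem: "a x * x n + b x = r2 x ^ 2 * peval f x - (r2 x * lc * x n + \<delta> x) * (r0 x + r1 x * x n + r2 x * x n ^ 2)" for x
  unfolding a_def b_def \<delta>_def f_expand by (simp add: algebra_simps power2_eq_square power3_eq_cube)
 show ?thesis
 proof (cases "EX w. a w ~= 0 \<or> b w ~= 0")
  case True
  then obtain w where w: "a w ~= 0 \<or> b w ~= 0" by blast
  obtain U V \<nu> where *: "polyfn {..n} U" "polyfn {..n} V" "polyfn {..<n} \<nu>" "EX x. \<nu> x ~= 0"
   "ALL x. U x * (a x * x n + b x) + V x * peval f x = \<nu> x"
   using bezout_linear[OF ab w] by metis
  define U' where "U' x = - (U x * (r2 x * lc * x n + \<delta> x))" for x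
  define V' where "V' x = V x + U x * r2 x ^ 2" for x
  have "polyfn {..n} U'" "polyfn {..n} V'" unfolding U'_def[abs_def] V'_def[abs_def]
   by (intro polyfn_uminus polyfn_add polyfn_mult polyfn_power polyfn_const pn base_mono *(1,2) \<delta> assms)+
  moreover have "U' x * (r0 x + r1 x * x n + r2 x * x n ^ 2) + V' x * peval f x = \<nu> x" for x
   unfolding *(5)[rule_format, of x, symmetric] rem U'_def V'_def by (simp add: algebra_simps)
  ultimately show ?thesis using *(3,4) by blast
 next
  case False
  then have zero: "r2 x ^ 2 * peval f x = (r2 x * lc * x n + \<delta> x) * (r0 x + r1 x * x n + r2 x * x n ^ 2)" for x
   using rem[of x] by simp
  \<comment> \<open>\<open>- \<delta> / c\<close> is the root of the quotient, hence a root of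
    \<open>f\<close> wherever \<open>r2\<close> is nonzero; this forces
    \<open>resl c \<delta>\<close> to vanish identically.\<close>
  define c where "c x = lc * r2 x" for x
  have c: "polyfn {..<n} c" unfolding c_def[abs_def] by (intro polyfn_cmult assms)
  have res: "polyfn {..<n} (resl c \<delta>)"
   unfolding resl_def[abs_def]
   by (intro polyfn_add polyfn_mult polyfn_diff polyfn_power polyfn_const polyfn_part c \<delta>)
  have "r2 x * resl c \<delta> x = 0" for x
  proof (cases "r2 x = 0")
   case False
   define t where "t = - \<delta> x / c x"
   have c0: "c x ~= 0" using False lc_nonzero by (simp add: c_def)
   have t: "c x * t + \<delta> x = 0" using c0 by (simp add: t_def)
   have "r2 x ^ 2 * peval f (x(n := t)) = 0"
    using zero[of "x(n := t)"] t
    by (simp only: base_cong[OF assms(3)] base_cong[OF \<delta>] fun_upd_same c_def) (simp add: mult.commute)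
   then have "peval f (x(n := t)) = 0" using False by simp
   then have "lc * t ^ 3 + part 2 x * t ^ 2 + part 1 x * t + part 0 x = 0" by (simp only: f_expand_upd)
   moreover have "resl c \<delta> x = c x ^ 3 * (lc * t ^ 3 + part 2 x * t ^ 2 + part 1 x * t + part 0 x)"
   proof -
    have d: "\<delta> x = - (c x * t)" using t by (simp add: add_eq_0_iff)
    show ?thesis unfolding resl_def d by (simp add: algebra_simps power2_eq_square power3_eq_cube)
   qed
   ultimately show ?thesis by simp
  qed simp
  then have "(ALL x. r2 x = 0) \<or> (ALL x. resl c \<delta> x = 0)" by (rule polyfn_mult_eq_0[OF assms(3) res])
  moreover have "c z ~= 0" using z lc_nonzero by (simp add: c_def)
  ultimately show ?thesis using z no_rational_root[OF c \<delta>, of z] by blast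
 qed
qed

text \<open>Coordinate vectors of points of the hypersurface, not necessarily supported on \<open>{..n}\<close>.\<close>

definition on_cone :: "(nat => complex) => bool" where
 "on_cone v \<longleftrightarrow> (\<exists>i\<le>n. v i ~= 0) & peval f v = 0"

lemma root_above: obtains t where "peval f (x(n := t)) = 0"
proof -
 have "EX t. poly [:part 0 x, part 1 x, part 2 x, lc:] t = 0"
  using lc_nonzero by (intro fundamental_theorem_of_algebra) (simp add: constant_degree)
 then obtain t where "poly [:part 0 x, part 1 x, part 2 x, lc:] t = 0" by (elim exE)
 then have "peval f (x(n := t)) = 0"
  unfolding f_expand_upd by (simp add: algebra_simps power2_eq_square power3_eq_cube)
 then show thesis by (rule that)
qed

text \<open>Every vector lies under a root of \<open>f\<close> in \<open>x n\<close>, so the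
  projection of the cone along \<open>x n\<close> is dense. The factor \<open>x 0\<close> keeps away
  from the zero vector, which is not counted to the cone.\<close>

lemma base_vanish:
 assumes "polyfn {..<n} \<nu>" "!!v. on_cone v ==> \<nu> v = 0" shows "\<nu> x = 0"
proof -
 have "x 0 * \<nu> x = 0" for x
 proof (cases "x 0 = 0")
  case False
  obtain t where t: "peval f (x(n := t)) = 0" by (rule root_above)
  have "on_cone (x(n := t))" unfolding on_cone_def using False t n2 by (intro conjI exI[of _ 0]) auto
  then show ?thesis using assms(2) base_cong[OF assms(1), of x t] by simp
 qed simp
 then have "(\<forall>x :: nat => complex. x 0 = 0) \<or> (ALL x. \<nu> x = 0)"
  by (intro polyfn_mult_eq_0[of "{..n}" "%x. x 0" "{..<n}"] assms(1)) (auto intro: polyfn_var)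
 moreover have "\<not> (\<forall>x :: nat => complex. x 0 = 0)" by (auto intro: exI[of _ "%_. 1"])
 ultimately show ?thesis by blast
qed

text \<open>If the remainder were nonzero, \<open>bezout\<close> would produce a nonzero polynomial
  in the other coordinates that vanishes on the cone.\<close>

lemma reduced_vanish:
 assumes "polyfn {..<n} r0" "polyfn {..<n} r1" "polyfn {..<n} r2"
  "!!v. on_cone v ==> r0 v + r1 v * v n + r2 v * v n ^ 2 = 0"
 shows "r0 x = 0 & r1 x = 0 & r2 x = 0"
proof (rule ccontr)
 assume "\<not> ?thesis"
 then have ne: "r0 x ~= 0 \<or> r1 x ~= 0 \<or> r2 x ~= 0" by blast
 obtain U V \<nu> where *: "polyfn {..<n} \<nu>" "EX x. \<nu> x ~= 0"
  "ALL x. U x * (r0 x + r1 x * x n + r2 x * x n ^ 2) + V x * peval f x = \<nu> x"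
  using bezout[OF assms(1-3) ne] by metis
 have "\<nu> v = 0" if "on_cone v" for v
  using *(3)[rule_format, of v] assms(4)[OF that] that by (simp add: on_cone_def)
 then show False using base_vanish[OF *(1)] *(2) by blast
qed

text \<open>The remainder of a function vanishing on the cone vanishes on the cone, hence
  identically: \<open>f\<close> generates the ideal of the hypersurface.\<close>

lemma vanish_dvd:
 assumes "polyfn {..n} F" "!!v. on_cone v ==> F v = 0"
 shows "EX Q. polyfn {..n} Q & (ALL x. F x = peval f x * Q x)"
proof -
 obtain Q r0 r1 r2 where *: "polyfn {..n} Q" "polyfn {..<n} r0" "polyfn {..<n} r1" "polyfn {..<n} r2"
  "!!x. F x = peval f x * Q x + (r0 x + r1 x * x n + r2 x * x n ^ 2)"
  using reduce[OF assms(1)] by metis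
 have "r0 v + r1 v * v n + r2 v * v n ^ 2 = 0" if "on_cone v" for v
  using *(5)[of v] assms(2)[OF that] that by (simp add: on_cone_def)
 then have "r0 x = 0 & r1 x = 0 & r2 x = 0" for x by (rule reduced_vanish[OF *(2-4)])
 then have "F x = peval f x * Q x" for x using *(5)[of x] by simp
 then show ?thesis using *(1) by blast
qed

text \<open>A function with nonzero remainder divides, modulo \<open>f\<close>, a nonzero polynomial
  \<open>\<nu>\<close> in the other coordinates. Multiplication by \<open>\<nu>\<close> is injective
  on remainders.\<close>

lemma cone_domain:
 assumes F: "polyfn {..n} F" and G: "polyfn {..n} G" and zero: "!!v. on_cone v ==> F v * G v = 0"
 shows "(ALL v. on_cone v --> F v = 0) \<or> (ALL v. on_cone v --> G v = 0)"
proof -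
 obtain Q r0 r1 r2 where *: "polyfn {..n} Q" "polyfn {..<n} r0" "polyfn {..<n} r1" "polyfn {..<n} r2"
  "!!x. F x = peval f x * Q x + (r0 x + r1 x * x n + r2 x * x n ^ 2)"
  using reduce[OF F] by metis
 obtain Q' s0 s1 s2 where s: "polyfn {..n} Q'" "polyfn {..<n} s0" "polyfn {..<n} s1" "polyfn {..<n} s2"
  "!!x. G x = peval f x * Q' x + (s0 x + s1 x * x n + s2 x * x n ^ 2)"
  using reduce[OF G] by metis
 show ?thesis
 proof (cases "EX y. r0 y ~= 0 \<or> r1 y ~= 0 \<or> r2 y ~= 0")
  case False
  then show ?thesis using *(5) by (auto simp: on_cone_def)
 next
  case True
  then obtain y where y: "r0 y ~= 0 \<or> r1 y ~= 0 \<or> r2 y ~= 0" by blast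
  obtain U V \<nu> where b: "polyfn {..<n} \<nu>" "EX x. \<nu> x ~= 0"
   "ALL x. U x * (r0 x + r1 x * x n + r2 x * x n ^ 2) + V x * peval f x = \<nu> x"
   using bezout[OF *(2-4) y] by metis
  have "\<nu> v * s0 v + \<nu> v * s1 v * v n + \<nu> v * s2 v * v n ^ 2 = 0" if v: "on_cone v" for v
  proof -
   have "\<nu> v = U v * F v" using b(3)[rule_format, of v] *(5)[of v] v by (simp add: on_cone_def)
   moreover have "G v = s0 v + s1 v * v n + s2 v * v n ^ 2" using s(5)[of v] v by (simp add: on_cone_def)
   ultimately have "\<nu> v * (s0 v + s1 v * v n + s2 v * v n ^ 2) = U v * (F v * G v)" by simp
   then show ?thesis using zero[OF v] by (simp add: algebra_simps)
  qed
  then have "\<nu> x * s0 x = 0 & \<nu> x * s1 x = 0 & \<nu> x * s2 x = 0" for x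
   by (intro reduced_vanish polyfn_mult b(1) s)
  then have "s0 x = 0 & s1 x = 0 & s2 x = 0" for x
   using polyfn_mult_eq_0[OF b(1) s(2)] polyfn_mult_eq_0[OF b(1) s(3)] polyfn_mult_eq_0[OF b(1) s(4)] b(2) by blast
  then show ?thesis using s(5) by (auto simp: on_cone_def)
 qed
qed

lemma f_nonzero: "f ~= 0"
 using lead by auto

lemma peval_f_nonzero: "EX x. peval f x ~= 0"
 using f_nonzero peval_eq_0_iff[of f] by blast

lemma polyfn_cancel_f:
 assumes "polyfn {..n} g" "!!x. peval f x * g x = 0" shows "g x = 0"
 using polyfn_mult_eq_0[OF polyfn_f assms(1)] assms(2) peval_f_nonzero by blast

text \<open>Along the line from the truncation of \<open>x\<close> to \<open>x\<close> the value of
  \<open>f\<close> does not change. Where it is nonzero, the restrictions of the two factors are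
  polynomials with constant product, hence constant.\<close>

lemma factor_polyfn:
 assumes "f = p * q" shows "polyfn {..n} (peval p)"
proof -
 define tr where "tr x = (%v. if v \<le> n then x v else 0 :: complex)" for x :: "nat => complex"
 have pU: "polyfn UNIV (peval r)" for r by (intro polyfn_peval) (simp add: polys_def)
 have ptr: "polyfn {..n} (%x. peval p (tr x))"
  unfolding tr_def
 proof (rule polyfn_subst[OF pU])
  fix v show "polyfn {..n} (%x. if v \<le> n then x v else 0)"
   by (cases "v \<le> n") (auto intro: polyfn_var)
 qed
 have tr: "polyfn UNIV (%x. peval p x - peval p (tr x))"
  by (rule polyfn_diff[OF pU polyfn_mono[OF ptr subset_UNIV]])
 have "peval f x * (peval p x - peval p (tr x)) = 0" for x
 proof (cases "peval f x = 0")
  case False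
  define u where "u v = x v - tr x v" for v
  obtain P where P: "!!s. peval p (%v. tr x v + s * u v) = poly P s" using polyfn_line[OF pU, of p "tr x" u] by metis
  obtain R where R: "!!s. peval q (%v. tr x v + s * u v) = poly R s" using polyfn_line[OF pU, of q "tr x" u] by metis
  have "poly (P * R) s = poly [:peval f x:] s" for s
  proof -
   have "poly (P * R) s = peval f (%v. tr x v + s * u v)" by (simp add: assms flip: P R)
   also have "\<dots> = peval f x" by (rule polyfn_cong[OF polyfn_f]) (simp add: tr_def u_def)
   finally show ?thesis by simp
  qed
  then have PR: "P * R = [:peval f x:]" unfolding poly_eq_poly_eq_iff[symmetric] by (rule ext)
  then have "P ~= 0" "R ~= 0" using False by auto
  then have "degree P + degree R = 0" using PR degree_mult_eq[of P R] by simp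
  then have "degree P = 0" by simp
  then obtain c where "P = [:c:]" by (rule degree_eq_zeroE)
  then have "peval p (%v. tr x v + 1 * u v) = peval p (%v. tr x v + 0 * u v)" unfolding P by simp
  then show ?thesis by (simp add: u_def)
 qed simp
 then have "(ALL x. peval f x = 0) \<or> (ALL x. peval p x - peval p (tr x) = 0)"
  by (rule polyfn_mult_eq_0[OF polyfn_f tr])
 then have "peval p = (%x. peval p (tr x))" using peval_f_nonzero by auto
 then show ?thesis using ptr by simp
qed

text \<open>One of two factors vanishes on the cone because the coordinate ring is a domain. It is
  then a multiple of \<open>f\<close>, and cancelling \<open>f\<close> shows that the other factor
  is a unit.\<close>

lemma irreducible_f: "irreducible f"
 unfolding irreducible_def
proof (intro conjI allI impI)
 show "f ~= 0" by (rule f_nonzero)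
 show "\<not> f dvd 1"
 proof
  assume "f dvd 1"
  then obtain g where "1 = f * g" by (elim dvdE)
  then have "peval f (%_. 0) * peval g (%_. 0) = 1" by (metis peval_mult peval_one)
  moreover have "peval f (%v. 0 * 0) = 0" using peval_scale[OF form, of 0 "%_. 0"] by simp
  ultimately show False by simp
 qed
 have one: "b dvd 1" if fab: "f = a * b" and z: "ALL v. on_cone v --> peval a v = 0" for a b
 proof -
  have pa: "polyfn {..n} (peval a)" by (rule factor_polyfn[OF fab])
  obtain Q where Q: "polyfn {..n} Q" "ALL x. peval a x = peval f x * Q x"
   using vanish_dvd[OF pa] z by blast
  obtain q where q: "Q = peval q" using Q(1) unfolding polyfn_def by blast
  have pb: "polyfn {..n} (peval b)" using factor_polyfn[of b a] fab by (simp add: mult.commute)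
  have "peval f x * (1 - Q x * peval b x) = 0" for x
  proof -
   have "peval f x = peval a x * peval b x" using peval_mult[of a b x] unfolding fab[symmetric] .
   then show ?thesis using Q(2)[rule_format, of x] by (simp add: algebra_simps)
  qed
  then have "1 - Q x * peval b x = 0" for x
   by (rule polyfn_cancel_f[rotated]) (intro polyfn_diff polyfn_mult polyfn_const Q(1) pb)
  then have "b * q = 1" by (intro peval_inject) (simp add: q mult.commute)
  then show "b dvd 1" by (metis dvdI)
 qed
 fix a b assume fab: "f = a * b"
 have "(ALL v. on_cone v --> peval a v = 0) \<or> (ALL v. on_cone v --> peval b v = 0)"
 proof (rule cone_domain)
  show "polyfn {..n} (peval a)" by (rule factor_polyfn[OF fab])
  show "polyfn {..n} (peval b)" using factor_polyfn[of b a] fab by (simp add: mult.commute)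
  show "peval a v * peval b v = 0" if "on_cone v" for v using that peval_mult[of a b v] unfolding on_cone_def fab[symmetric] by simp
 qed
 then show "a dvd 1 \<or> b dvd 1" using one[of a b] one[of b a] fab by (auto simp: mult.commute)
qed

end

section \<open>Projective points, cones and the Zariski topology\<close>

lemma proj_class_self: "v \<in> proj_class v"
 unfolding proj_class_def by (intro CollectI exI[of _ 1]) simp

lemma proj_class_scale: "c ~= 0 ==> proj_class (%i. c * v i) = proj_class v"
proof (intro equalityI subsetI)
 fix w assume c: "c ~= 0" and "w \<in> proj_class (%i. c * v i)"
 then obtain b where "b ~= 0" "w = (%i. b * (c * v i))" by (auto simp: proj_class_def)
 then show "w \<in> proj_class v" unfolding proj_class_def using c
  by (intro CollectI exI[of _ "b * c"]) (simp add: mult.assoc)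
next
 fix w assume c: "c ~= 0" and "w \<in> proj_class v"
 then obtain b where "b ~= 0" "w = (%i. b * v i)" by (auto simp: proj_class_def)
 then show "w \<in> proj_class (%i. c * v i)" unfolding proj_class_def using c
  by (intro CollectI exI[of _ "b / c"]) auto
qed

lemma proj_space_class:
 assumes "P \<in> proj_space I" "v \<in> P" shows "P = proj_class v" "\<exists>i\<in>I. v i ~= 0" "!!i. i \<notin> I ==> v i = 0"
proof -
 obtain w where w: "P = proj_class w" "EX i. w i ~= 0" "ALL i. i \<notin> I --> w i = 0"
  using assms(1) by (auto simp: proj_space_def)
 obtain c where c: "c ~= 0" "v = (%i. c * w i)" using assms(2) w(1) by (auto simp: proj_class_def)
 show "P = proj_class v" unfolding w(1) c(2) by (rule proj_class_scale[OF c(1), symmetric])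
 show "\<exists>i\<in>I. v i ~= 0" using w(2,3) c by auto
 show "!!i. i \<notin> I ==> v i = 0" using w(3) c by simp
qed

lemma proj_space_nonempty: "P \<in> proj_space I ==> EX v. v \<in> P"
 unfolding proj_space_def using proj_class_self by auto

definition cone :: "'v point set => ('v => complex) set" where
 "cone U = \<Union>U"

lemma coneI [intro]: "v \<in> P ==> P \<in> U ==> v \<in> cone U"
 by (auto simp: cone_def)

lemma coneE [elim]:
 assumes "v \<in> cone U" obtains P where "v \<in> P" "P \<in> U"
 using assms by (auto simp: cone_def)

text \<open>Products of forms show that nonvanishing sets are closed under intersection, so the
  generating sets are already a basis.\<close>

lemma zariski_basis:
 assumes "openin (zariski I) W" "P \<in> W"
 shows "EX K d. K \<in> forms I d & P \<in> nonvanishing I K & nonvanishing I K \<subseteq> W"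
proof -
 have "generate_topology_on {nonvanishing I p |p d. p \<in> forms I d} W"
  using assms(1) by (simp add: zariski_def openin_topology_generated_by_iff)
 then show ?thesis using assms(2)
 proof (induction rule: generate_topology_on.induct)
  case Empty
  then show ?case by simp
 next
  case (Int a b)
  then obtain K d K' d' where K: "K \<in> forms I d" "P \<in> nonvanishing I K" "nonvanishing I K \<subseteq> a"
   "K' \<in> forms I d'" "P \<in> nonvanishing I K'" "nonvanishing I K' \<subseteq> b"
  proof -
   from Int.IH Int.prems obtain K d where K: "K \<in> forms I d & P \<in> nonvanishing I K & nonvanishing I K \<subseteq> a" by auto
   from Int.IH Int.prems obtain K' d' where K': "K' \<in> forms I d' & P \<in> nonvanishing I K' & nonvanishing I K' \<subseteq> b" by auto
   show thesis by (rule that[of K d K' d']) (use K K' in simp_all)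
  qed
  have "nonvanishing I (K * K') = nonvanishing I K \<inter> nonvanishing I K'"
   by (auto simp: nonvanishing_def)
  then show ?case using K forms_mult[OF K(1,4)] by blast
 next
  case (UN C)
  then obtain S where S: "S \<in> C" "P \<in> S" by blast
  from UN.IH[OF S] obtain K d where K: "K \<in> forms I d & P \<in> nonvanishing I K & nonvanishing I K \<subseteq> S" by (elim exE)
  then show ?case using S(1) by (intro exI[of _ K] exI[of _ d]) auto
 next
  case (Basis s)
  then show ?case by blast
 qed
qed

context good_cubic
begin

definition X :: "nat point set" where "X = zero_locus {..n} f"

definition basic :: "nat mpoly => nat point set" where "basic K = {P \<in> X. \<forall>v\<in>P. peval K v ~= 0}"

lemma X_class: "P \<in> X ==> v \<in> P ==> P = proj_class v"
 unfolding X_def zero_locus_def using proj_space_class(1) by blast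

lemma class_eq: "v \<in> cone X ==> v \<in> P ==> P \<in> X ==> proj_class v = P"
 using X_class by blast

lemma cone_iff: "v \<in> cone X \<longleftrightarrow> on_cone v & (\<forall>i>n. v i = 0)"
proof
 assume "v \<in> cone X"
 then obtain P where P: "P \<in> proj_space {..n}" "v \<in> P" "peval f v = 0" by (auto simp: X_def zero_locus_def elim!: coneE)
 then show "on_cone v & (\<forall>i>n. v i = 0)"
  using proj_space_class(2,3)[OF P(1,2)] by (auto simp: on_cone_def)
next
 assume *: "on_cone v & (\<forall>i>n. v i = 0)"
 then have "proj_class v \<in> proj_space {..n}"
  unfolding proj_space_def on_cone_def by (intro imageI) auto
 moreover have "peval f w = 0" if "w \<in> proj_class v" for w
  using that * peval_scale[OF form] by (auto simp: proj_class_def on_cone_def)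
 ultimately have "proj_class v \<in> X" by (simp add: X_def zero_locus_def)
 then show "v \<in> cone X" using proj_class_self by blast
qed

lemma cone_f: "v \<in> cone X ==> peval f v = 0"
 by (simp add: cone_iff on_cone_def)

text \<open>\<open>on_cone\<close> leaves the coordinates beyond \<open>n\<close> free, while
  vectors of \<open>cone X\<close> are 0 there. Truncation passes from the former to the
  latter.\<close>

definition trunc :: "(nat => complex) => nat => complex" where
 "trunc v = (%i. if i \<le> n then v i else 0)"

lemma polyfn_trunc: "polyfn {..n} h ==> h (trunc v) = h v"
 by (erule polyfn_cong) (auto simp: trunc_def)

lemma trunc_cone: "on_cone v ==> trunc v \<in> cone X"
 unfolding cone_iff on_cone_def using polyfn_trunc[OF polyfn_f, of v] by (auto simp: trunc_def)

lemma on_cone_ball: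
 assumes "polyfn {..n} h" "!!v. v \<in> cone X ==> h v = 0" "on_cone v" shows "h v = 0"
 using assms(2)[OF trunc_cone[OF assms(3)]] polyfn_trunc[OF assms(1)] by simp

lemma cone_scale: "v \<in> cone X ==> c ~= 0 ==> (%i. c * v i) \<in> cone X"
 unfolding cone_iff on_cone_def using peval_scale[OF form, of c v] by auto

lemma class_in_X: "v \<in> cone X ==> proj_class v \<in> X"
 using X_class by blast

lemma class_in: "U \<subseteq> X ==> v \<in> cone U \<longleftrightarrow> v \<in> cone X & proj_class v \<in> U"
 using X_class proj_class_self by blast

lemma zar_open_subset: "zar_open n X U ==> U \<subseteq> X"
 using openin_imp_subset by blast

lemma zar_open_basis:
 assumes "zar_open n X V" "P \<in> V"
 shows "EX K d. K \<in> forms {..n} d & P \<in> basic K & basic K \<subseteq> V"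
proof -
 obtain W where W: "openin (zariski {..n}) W" "V = W \<inter> X"
  using assms(1) unfolding openin_subtopology by blast
 have "P \<in> W" using assms(2) W(2) by blast
 from zariski_basis[OF W(1) this] obtain K d where K: "K \<in> forms {..n} d" "P \<in> nonvanishing {..n} K" "nonvanishing {..n} K \<subseteq> W"
  by (elim exE conjE)
 have "basic K = nonvanishing {..n} K \<inter> X"
  by (auto simp: basic_def nonvanishing_def X_def zero_locus_def)
 then show ?thesis using K W(2) assms(2) by (intro exI[of _ K] exI[of _ d]) auto
qed

lemma zar_open_basic: "K \<in> forms {..n} d ==> zar_open n X (basic K)"
 unfolding openin_subtopology
proof (intro exI[of _ "nonvanishing {..n} K"] conjI)
 assume "K \<in> forms {..n} d"
 then show "openin (zariski {..n}) (nonvanishing {..n} K)"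
  unfolding zariski_def by (intro topology_generated_by_Basis) blast
 show "basic K = nonvanishing {..n} K \<inter> X"
  by (auto simp: basic_def nonvanishing_def X_def zero_locus_def)
qed

lemma form_nonzero_class:
 assumes "K \<in> forms {..n} d" "v \<in> cone X"
 shows "proj_class v \<in> basic K \<longleftrightarrow> peval K v ~= 0"
 using assms class_in_X[OF assms(2)] proj_class_self[of v]
 by (auto simp: basic_def proj_class_def peval_scale[OF assms(1)])

lemma zar_open_Int: "zar_open n X U ==> zar_open n X V ==> zar_open n X (U \<inter> V)"
 by (rule openin_Int)

lemma zar_open_X: "zar_open n X X"
proof -
 have "basic 1 = X" by (auto simp: basic_def)
 then show ?thesis using zar_open_basic[of 1 0] by simp
qed

lemma chart_basic: "i \<le> n ==> chart n X i = basic (Var i)"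
 by (auto simp: chart_def basic_def meval_single simp del: One_nat_def)

lemma zar_open_chart: "i \<le> n ==> zar_open n X (chart n X i)"
 unfolding chart_basic by (rule zar_open_basic[OF forms_Var]) simp

section \<open>Homogeneous regular functions on the cone\<close>

text \<open>Homogeneous functions of degree \<open>k\<close> on the cone over \<open>U\<close>, extended by 0, that are locally
 quotients of forms. Multiplying numerator and denominator by a form that vanishes on \<open>X - U\<close>
 makes the equation \<open>F = G h\<close> hold on the whole cone.\<close>

definition hreg :: "int => nat point set => ((nat => complex) => complex) => bool" where
 "hreg k U h \<longleftrightarrow> (ALL v. v \<notin> cone U --> h v = 0) &
  (\<forall>w\<in>cone U. EX d e F G. F \<in> forms {..n} e & G \<in> forms {..n} d & int e = int d + k & peval G w ~= 0 &
    basic G \<subseteq> U & (\<forall>v\<in>cone X. peval F v = peval G v * h v))"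

lemma hreg_out: "hreg k U h ==> v \<notin> cone U ==> h v = 0"
 by (simp add: hreg_def)

lemma hregE:
 assumes "hreg k U h" "w \<in> cone U"
 obtains d e F G where "F \<in> forms {..n} e" "G \<in> forms {..n} d" "int e = int d + k" "peval G w ~= 0"
  "basic G \<subseteq> U" "\<forall>v\<in>cone X. peval F v = peval G v * h v"
 using assms unfolding hreg_def by blast

lemma basic_mult: "basic (K * G) = basic K \<inter> basic G"
 by (auto simp: basic_def)

lemma hregI:
 assumes U: "U \<subseteq> X" and out: "!!v. v \<notin> cone U ==> h v = 0"
  and loc: "!!w. w \<in> cone U ==> EX V d e F G. zar_open n X V & w \<in> cone V & V \<subseteq> U & F \<in> forms {..n} e & G \<in> forms {..n} d &
   int e = int d + k & (\<forall>v\<in>cone V. peval G v ~= 0 & h v = peval F v / peval G v)"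
 shows "hreg k U h"
 unfolding hreg_def
proof (intro conjI allI impI ballI out)
 fix w assume w: "w \<in> cone U"
 from loc[OF this] obtain V d e F G where V: "zar_open n X V" "w \<in> cone V" "V \<subseteq> U" "F \<in> forms {..n} e" "G \<in> forms {..n} d"
  "int e = int d + k" "\<forall>v\<in>cone V. peval G v ~= 0 & h v = peval F v / peval G v" by (elim exE conjE)
 have wX: "w \<in> cone X" using w U by blast
 have VX: "V \<subseteq> X" by (rule zar_open_subset[OF V(1)])
 have "proj_class w \<in> V" using class_in[OF VX] V(2) by blast
 from zar_open_basis[OF V(1) this] obtain K c where K: "K \<in> forms {..n} c" "proj_class w \<in> basic K" "basic K \<subseteq> V"
  by (elim exE conjE)
 show "EX d e F G. F \<in> forms {..n} e & G \<in> forms {..n} d & int e = int d + k & peval G w ~= 0 &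
    basic G \<subseteq> U & (\<forall>v\<in>cone X. peval F v = peval G v * h v)"
 proof (intro exI conjI ballI)
  show "K * F \<in> forms {..n} (c + e)" "K * G \<in> forms {..n} (c + d)" by (intro forms_mult K V)+
  show "int (c + e) = int (c + d) + k" using V(6) by simp
  show "peval (K * G) w ~= 0" using V(7)[rule_format, OF V(2)] K(2) form_nonzero_class[OF K(1) wX] by simp
  show "basic (K * G) \<subseteq> U" using K(3) V(3) by (auto simp: basic_mult)
  fix v assume v: "v \<in> cone X"
  show "peval (K * F) v = peval (K * G) v * h v"
  proof (cases "peval K v = 0")
   case False
   then have "v \<in> cone V" using form_nonzero_class[OF K(1) v] K(3) class_in[OF VX] v by blast
   then show ?thesis using V(7) by simp
  qed simp
 qed
qed

lemma hreg_restrict: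
 assumes "hreg k U h" "zar_open n X V" "V \<subseteq> U" shows "hreg k V (%v. if v \<in> cone V then h v else 0)"
proof (rule hregI[OF zar_open_subset[OF assms(2)]])
 fix w assume w: "w \<in> cone V"
 then have "w \<in> cone U" using assms(3) by blast
 with assms(1) obtain d e F G where *: "F \<in> forms {..n} e" "G \<in> forms {..n} d" "int e = int d + k" "peval G w ~= 0"
  "basic G \<subseteq> U" "\<forall>v\<in>cone X. peval F v = peval G v * h v" by (rule hregE)
 have VX: "V \<subseteq> X" by (rule zar_open_subset[OF assms(2)])
 have wX: "w \<in> cone X" using w VX by blast
 show "EX V' d e F G. zar_open n X V' & w \<in> cone V' & V' \<subseteq> V & F \<in> forms {..n} e & G \<in> forms {..n} d &
   int e = int d + k & (\<forall>v\<in>cone V'. peval G v ~= 0 & (if v \<in> cone V then h v else 0) = peval F v / peval G v)"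
 proof (intro exI conjI ballI)
  show "zar_open n X (V \<inter> basic G)" by (intro zar_open_Int assms zar_open_basic[OF *(2)])
  have "proj_class w \<in> V \<inter> basic G" using class_in[OF VX, of w] w form_nonzero_class[OF *(2) wX] *(4) by simp
  then show "w \<in> cone (V \<inter> basic G)" using proj_class_self by blast
  show "F \<in> forms {..n} e" "G \<in> forms {..n} d" "int e = int d + k" by fact+
  fix v assume v: "v \<in> cone (V \<inter> basic G)"
  then show g: "peval G v ~= 0" by (auto simp: basic_def)
  have "v \<in> cone X" using v VX by blast
  then have "peval F v = peval G v * h v" using *(6) by blast
  moreover have "v \<in> cone V" using v by blast
  ultimately show "(if v \<in> cone V then h v else 0) = peval F v / peval G v"
   using g by simp
 qed blast
qed simp

lemma hreg_local:
 assumes "!!U. U \<in> C ==> zar_open n X U" "!!v. v \<notin> cone (\<Union>C) ==> h v = 0"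
  "!!U. U \<in> C ==> hreg k U (%v. if v \<in> cone U then h v else 0)"
 shows "hreg k (\<Union>C) h"
proof (rule hregI)
 show "\<Union>C \<subseteq> X" using assms(1) zar_open_subset by blast
 fix w assume "w \<in> cone (\<Union>C)"
 then obtain U where U: "U \<in> C" "w \<in> cone U" by blast
 from assms(3)[OF U(1)] U(2) obtain d e F G where *: "F \<in> forms {..n} e" "G \<in> forms {..n} d" "int e = int d + k" "peval G w ~= 0"
  "basic G \<subseteq> U" "\<forall>v\<in>cone X. peval F v = peval G v * (if v \<in> cone U then h v else 0)" by (rule hregE)
 have UX: "U \<subseteq> X" by (rule zar_open_subset[OF assms(1)[OF U(1)]])
 show "EX V d e F G. zar_open n X V & w \<in> cone V & V \<subseteq> \<Union>C & F \<in> forms {..n} e & G \<in> forms {..n} d &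
   int e = int d + k & (\<forall>v\<in>cone V. peval G v ~= 0 & h v = peval F v / peval G v)"
 proof (intro exI conjI ballI)
  show "zar_open n X (basic G)" by (rule zar_open_basic[OF *(2)])
  have "w \<in> cone X" using U UX by blast
  then show "w \<in> cone (basic G)" using form_nonzero_class[OF *(2)] *(4) proj_class_self by blast
  show "F \<in> forms {..n} e" "G \<in> forms {..n} d" "int e = int d + k" by fact+
  show "basic G \<subseteq> \<Union>C" using *(5) U(1) by blast
  fix v assume v: "v \<in> cone (basic G)"
  then show g: "peval G v ~= 0" by (auto simp: basic_def)
  have "v \<in> cone X" using v by (auto simp: basic_def)
  then have "peval F v = peval G v * (if v \<in> cone U then h v else 0)" using *(6) by blast
  moreover have "v \<in> cone U" using v *(5) by blast
  ultimately show "h v = peval F v / peval G v" using g by simp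
 qed
qed (use assms in auto)

lemma hreg_add:
 assumes "hreg k U g" "hreg k U h" shows "hreg k U (%v. g v + h v)"
 unfolding hreg_def
proof (intro conjI allI impI ballI)
 show "g v + h v = 0" if "v \<notin> cone U" for v using hreg_out[OF assms(1) that] hreg_out[OF assms(2) that] by simp
 fix w assume w: "w \<in> cone U"
 obtain d e F G where a: "F \<in> forms {..n} e" "G \<in> forms {..n} d" "int e = int d + k" "peval G w ~= 0"
  "basic G \<subseteq> U" "\<forall>v\<in>cone X. peval F v = peval G v * g v" using assms(1) w by (rule hregE)
 obtain d' e' F' G' where b: "F' \<in> forms {..n} e'" "G' \<in> forms {..n} d'" "int e' = int d' + k" "peval G' w ~= 0"
  "basic G' \<subseteq> U" "\<forall>v\<in>cone X. peval F' v = peval G' v * h v" using assms(2) w by (rule hregE)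
 have e: "e + d' = d + e'" using a(3) b(3) by linarith
 show "EX d e F G. F \<in> forms {..n} e & G \<in> forms {..n} d & int e = int d + k & peval G w ~= 0 &
    basic G \<subseteq> U & (\<forall>v\<in>cone X. peval F v = peval G v * (g v + h v))"
 proof (intro exI conjI ballI)
  show "F * G' + G * F' \<in> forms {..n} (e + d')"
   using forms_mult[OF a(1) b(2)] forms_mult[OF a(2) b(1)] unfolding e by (rule forms_add)
  show "G * G' \<in> forms {..n} (d + d')" by (intro forms_mult a b)
  show "int (e + d') = int (d + d') + k" using a(3) by simp
  show "peval (G * G') w ~= 0" using a(4) b(4) by simp
  show "basic (G * G') \<subseteq> U" using a(5) by (auto simp: basic_mult)
  show "peval (F * G' + G * F') v = peval (G * G') v * (g v + h v)" if "v \<in> cone X" for v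
   using a(6)[rule_format, OF that] b(6)[rule_format, OF that] by (simp add: algebra_simps)
 qed
qed

lemma hreg_mult:
 assumes "hreg k U g" "hreg l U h" shows "hreg (k + l) U (%v. g v * h v)"
 unfolding hreg_def
proof (intro conjI allI impI ballI)
 show "g v * h v = 0" if "v \<notin> cone U" for v using hreg_out[OF assms(1) that] by simp
 fix w assume w: "w \<in> cone U"
 obtain d e F G where a: "F \<in> forms {..n} e" "G \<in> forms {..n} d" "int e = int d + k" "peval G w ~= 0"
  "basic G \<subseteq> U" "\<forall>v\<in>cone X. peval F v = peval G v * g v" using assms(1) w by (rule hregE)
 obtain d' e' F' G' where b: "F' \<in> forms {..n} e'" "G' \<in> forms {..n} d'" "int e' = int d' + l" "peval G' w ~= 0"
  "basic G' \<subseteq> U" "\<forall>v\<in>cone X. peval F' v = peval G' v * h v" using assms(2) w by (rule hregE)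
 show "EX d e F G. F \<in> forms {..n} e & G \<in> forms {..n} d & int e = int d + (k + l) & peval G w ~= 0 &
    basic G \<subseteq> U & (\<forall>v\<in>cone X. peval F v = peval G v * (g v * h v))"
 proof (intro exI conjI ballI)
  show "F * F' \<in> forms {..n} (e + e')" "G * G' \<in> forms {..n} (d + d')" by (intro forms_mult a b)+
  show "int (e + e') = int (d + d') + (k + l)" using a(3) b(3) by simp
  show "peval (G * G') w ~= 0" using a(4) b(4) by simp
  show "basic (G * G') \<subseteq> U" using a(5) by (auto simp: basic_mult)
  show "peval (F * F') v = peval (G * G') v * (g v * h v)" if "v \<in> cone X" for v
   using a(6)[rule_format, OF that] b(6)[rule_format, OF that] by simp
 qed
qed

lemma hreg_quotient:
 assumes "zar_open n X U" "F \<in> forms {..n} e" "G \<in> forms {..n} d" "int e = int d + k"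
  "!!v. v \<in> cone U ==> peval G v ~= 0"
 shows "hreg k U (%v. if v \<in> cone U then peval F v / peval G v else 0)"
proof (rule hregI[OF zar_open_subset[OF assms(1)]])
 fix w assume "w \<in> cone U"
 then show "EX V d e F' G'. zar_open n X V & w \<in> cone V & V \<subseteq> U & F' \<in> forms {..n} e & G' \<in> forms {..n} d &
   int e = int d + k & (\<forall>v\<in>cone V. peval G' v ~= 0 & (if v \<in> cone U then peval F v / peval G v else 0) = peval F' v / peval G' v)"
  by (intro exI[of _ U] exI[of _ d] exI[of _ e] exI[of _ F] exI[of _ G]) (use assms in auto)
qed simp

lemma hreg_form:
 assumes "zar_open n X U" "F \<in> forms {..n} e"
 shows "hreg (int e) U (%v. if v \<in> cone U then peval F v else 0)"
 using hreg_quotient[OF assms forms_1, of "int e"] by (simp cong: if_cong)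

lemma hreg_zero: "zar_open n X U ==> hreg k U (%v. 0)"
proof -
 assume U: "zar_open n X U"
 have "hreg k U (%v. 0)" if "k \<ge> 0"
  using hreg_quotient[OF U forms_0[of _ "nat k"] forms_1, of k] that by (simp cong: if_cong)
 moreover have "hreg k U (%v. 0)" if "k < 0"
 proof (rule hregI[OF zar_open_subset[OF U]])
  fix w assume w: "w \<in> cone U"
  then have wX: "w \<in> cone X" using zar_open_subset[OF U] by blast
  then obtain i where i: "i \<le> n" "w i ~= 0" unfolding cone_iff on_cone_def by blast
  \<comment> \<open>In negative degree the zero function is still a quotient of forms: 0 in degree 0
    over a power of a coordinate that is nonzero near the point.\<close>
  let ?G = "Var i ^ nat (- k) :: nat mpoly"
  have G: "?G \<in> forms {..n} (nat (- k))" using forms_power[OF forms_Var, of i "{..n}" "nat (- k)"] i by simp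
  show "EX V d e F G. zar_open n X V & w \<in> cone V & V \<subseteq> U & F \<in> forms {..n} e & G \<in> forms {..n} d &
   int e = int d + k & (\<forall>v\<in>cone V. peval G v ~= 0 & 0 = peval F v / peval G v)"
  proof (intro exI conjI ballI)
   show "zar_open n X (U \<inter> basic ?G)" by (intro zar_open_Int U zar_open_basic[OF G])
   have "peval ?G w ~= 0" using i by (simp add: meval_single)
   then have "proj_class w \<in> U \<inter> basic ?G"
    using form_nonzero_class[OF G wX] class_in[OF zar_open_subset[OF U]] w by blast
   then show "w \<in> cone (U \<inter> basic ?G)" using proj_class_self by blast
   show "0 \<in> forms {..n} 0" "?G \<in> forms {..n} (nat (- k))" using G by auto
   show "int 0 = int (nat (- k)) + k" using that by simp
   show "peval ?G v ~= 0" if "v \<in> cone (U \<inter> basic ?G)" for v using that unfolding basic_def by blast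
   show "0 = peval 0 v / peval ?G v" for v by simp
  qed blast
 qed simp
 ultimately show ?thesis by (cases "k \<ge> 0") simp_all
qed

lemma hreg_cmult: assumes "hreg k U h" "zar_open n X U" shows "hreg k U (%v. c * h v)"
proof -
 have "hreg (0 + k) U (%v. (if v \<in> cone U then peval (Const c) v else 0) * h v)"
  using hreg_form[OF assms(2) forms_Const[of c]] assms(1) by (intro hreg_mult) simp_all
 moreover have "(%v. (if v \<in> cone U then peval (Const c) v else 0) * h v) = (%v. c * h v)"
  using hreg_out[OF assms(1)] by (auto simp: fun_eq_iff)
 ultimately show ?thesis by simp
qed

lemma hreg_sum:
 assumes "zar_open n X U" "!!a. a \<in> A ==> hreg k U (h a)" shows "hreg k U (%v. \<Sum>a\<in>A. h a v)"
 using assms(2)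
proof (induction A rule: infinite_finite_induct)
 case (insert a A)
 then have "hreg k U (%v. h a v + (\<Sum>a\<in>A. h a v))" by (intro hreg_add) auto
 then show ?case using insert by simp
qed (auto intro: hreg_zero[OF assms(1)])

lemma hreg_scale:
 assumes "hreg k U h" "v \<in> cone X" "U \<subseteq> X" "c ~= 0"
 shows "h (%i. c * v i) = c powi k * h v"
proof (cases "v \<in> cone U")
 case True
 obtain d e F G where *: "F \<in> forms {..n} e" "G \<in> forms {..n} d" "int e = int d + k" "peval G v ~= 0"
  "basic G \<subseteq> U" "\<forall>v\<in>cone X. peval F v = peval G v * h v" using assms(1) True by (rule hregE)
 have "c ^ e * peval F v = c ^ d * peval G v * h (%i. c * v i)"
  using *(6)[rule_format, OF cone_scale[OF assms(2,4)]] peval_scale[OF *(1), of c v] peval_scale[OF *(2), of c v] by simp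
 moreover have "peval F v = peval G v * h v" using *(6) assms(2) by blast
 ultimately have "c ^ e * h v = c ^ d * h (%i. c * v i)" using *(4) by simp
 moreover have "c ^ e = c ^ d * c powi k"
 proof -
  have "c ^ e = c powi (int d + k)" using *(3) by (metis power_int_of_nat)
  then show ?thesis using assms(4) by (simp add: power_int_add)
 qed
 ultimately show ?thesis using assms(4) by simp
next
 case False
 then have "(%i. c * v i) \<notin> cone U"
  using class_in[OF assms(3)] proj_class_scale[OF assms(4)] assms(2) by metis
 then show ?thesis using hreg_out[OF assms(1)] False by simp
qed

text \<open>Functions on points and functions on the cone.\<close>

definition lift :: "(nat point => complex) => (nat => complex) => complex" where
 "lift a v = (if v \<in> cone X then a (proj_class v) else 0)"

text \<open>Regular functions are the case of degree 0. This moves all computations with sections to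
  the cone, where no representative has to be chosen.\<close>

lemma reg_iff:
 assumes U: "zar_open n X U"
 shows "a \<in> carrier (reg n X U) \<longleftrightarrow> hreg 0 U (lift a) & (ALL P. P \<notin> U --> a P = 0)"
proof -
 have UX: "U \<subseteq> X" by (rule zar_open_subset[OF U])
 have "regular_on n X U a \<longleftrightarrow> hreg 0 U (lift a)" if out: "ALL P. P \<notin> U --> a P = 0"
 proof
  assume reg: "regular_on n X U a"
  show "hreg 0 U (lift a)"
  proof (rule hregI[OF UX])
   show "lift a v = 0" if "v \<notin> cone U" for v
    using that out class_in[OF UX] by (auto simp: lift_def)
   fix w assume "w \<in> cone U"
   then have w: "proj_class w \<in> U" "w \<in> cone X" using class_in[OF UX] by blast+
   from reg[unfolded regular_on_def, rule_format, OF w(1)] obtain V d F G where V: "zar_open n X V" "proj_class w \<in> V" "V \<subseteq> U"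
    "F \<in> forms {..n} d" "G \<in> forms {..n} d" "\<forall>Q\<in>V. \<forall>v\<in>Q. peval G v ~= 0 & a Q = peval F v / peval G v"
    by (elim exE conjE bexE)
   have VX: "V \<subseteq> X" using V(3) UX by blast
   show "EX V d e F G. zar_open n X V & w \<in> cone V & V \<subseteq> U & F \<in> forms {..n} e & G \<in> forms {..n} d &
    int e = int d + 0 & (\<forall>v\<in>cone V. peval G v ~= 0 & lift a v = peval F v / peval G v)"
   proof (intro exI conjI ballI)
    show "zar_open n X V" "V \<subseteq> U" "F \<in> forms {..n} d" "G \<in> forms {..n} d" by fact+
    show "w \<in> cone V" using V(2) proj_class_self by blast
    show "int d = int d + 0" by simp
    fix v assume "v \<in> cone V"
    then have v: "v \<in> cone X" "proj_class v \<in> V" using class_in[OF VX] by blast+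
    show "peval G v ~= 0" "lift a v = peval F v / peval G v"
     using V(6)[rule_format, OF v(2) proj_class_self] v(1) by (auto simp: lift_def)
   qed
  qed
 next
  assume h: "hreg 0 U (lift a)"
  show "regular_on n X U a"
   unfolding regular_on_def
  proof
   fix P assume P: "P \<in> U"
   obtain w where w: "w \<in> P" using P UX proj_space_nonempty unfolding X_def zero_locus_def by blast
   have wX: "w \<in> cone X" using P w UX by blast
   from h obtain d e F G where *: "F \<in> forms {..n} e" "G \<in> forms {..n} d" "int e = int d + 0" "peval G w ~= 0"
    "basic G \<subseteq> U" "\<forall>v\<in>cone X. peval F v = peval G v * lift a v" by (rule hregE) (use P w in blast)
   have "e = d" using *(3) by simp
   show "EX V. zar_open n X V & P \<in> V & V \<subseteq> U &
    (EX d. \<exists>F\<in>forms {..n} d. \<exists>G\<in>forms {..n} d. \<forall>Q\<in>V. \<forall>v\<in>Q. peval G v ~= 0 & a Q = peval F v / peval G v)"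
   proof -
    have "peval G v ~= 0 & a Q = peval F v / peval G v" if Q: "Q \<in> basic G" "v \<in> Q" for Q v
    proof
    show g: "peval G v ~= 0" using Q by (simp add: basic_def)
    have v: "v \<in> cone X" using Q by (auto simp: basic_def)
    have "proj_class v = Q" using class_eq[OF v Q(2)] Q(1) by (simp add: basic_def)
    then have "peval F v = peval G v * a Q" using *(6) v by (simp add: lift_def)
    then show "a Q = peval F v / peval G v" using g by simp
    qed
    moreover have "zar_open n X (basic G)" by (rule zar_open_basic[OF *(2)])
    moreover have "P \<in> basic G" using form_nonzero_class[OF *(2) wX] *(4) class_eq[OF wX w] P UX by auto
    moreover have "F \<in> forms {..n} d" using *(1) \<open>e = d\<close> by simp
    ultimately show ?thesis using *(2,5) by (intro exI[of _ "basic G"] conjI exI[of _ d]) auto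
   qed
  qed
 qed
 then show ?thesis by (auto simp: reg_def)
qed

end

section \<open>Global homogeneous functions are forms\<close>

lemma coeff_shift_eq: "poly P t = poly.coeff P 0 + t * poly (poly_shift 1 P) t"
proof -
 have "P = pCons (poly.coeff P 0) (poly_shift 1 P)"
  by (rule poly_eqI) (simp add: coeff_pCons coeff_poly_shift split: nat.split)
 then have "poly P t = poly (pCons (poly.coeff P 0) (poly_shift 1 P)) t" by simp
 then show ?thesis by simp
qed

lemma polyfn_factor_var:
 assumes "polyfn I r" "v \<in> I" "!!x. r (x(v := 0)) = 0"
 shows "EX r'. polyfn I r' & (ALL x. r x = x v * r' x)"
proof -
 obtain C where C: "polyfam (I - {v}) C" "!!x t. r (x(v := t)) = poly (C x) t"
  using polyfn_split_var[OF assms(1)] by metis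
 have "polyfam I (%x. poly_shift 1 (C x))"
  unfolding polyfam_def
 proof (intro conjI allI)
  obtain D where D: "!!x. degree (C x) \<le> D" using C(1) unfolding polyfam_def by blast
  have "degree (poly_shift 1 (C x)) \<le> D" for x
   by (rule degree_le) (use D[of x] in \<open>auto simp: coeff_poly_shift intro!: coeff_eq_0\<close>)
  then show "EX D. ALL x. degree (poly_shift 1 (C x)) \<le> D" by blast
  show "polyfn I (%x. poly.coeff (poly_shift 1 (C x)) i)" for i
   using polyfn_mono[OF polyfam_coeff[OF C(1), of "i + 1"], of I] by (simp add: coeff_poly_shift)
 qed
 then have "polyfn I (%x. poly (poly_shift 1 (C x)) (x v))"
  by (rule polyfn_poly) (rule polyfn_var[OF assms(2)])
 moreover have "r x = x v * poly (poly_shift 1 (C x)) (x v)" for x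
 proof -
  have "r x = poly (C x) (x v)" using C(2)[of x "x v"] by simp
  moreover have "poly.coeff (C x) 0 = 0" using C(2)[of x 0] assms(3)[of x] coeff_shift_eq[of "C x" 0] by simp
  ultimately show ?thesis using coeff_shift_eq[of "C x" "x v"] by simp
 qed
 ultimately show ?thesis by blast
qed

text \<open>Powers of two different variables are coprime: putting \<open>x v\<close> to 0 kills the
  right side, so \<open>r\<close> vanishes there and a factor \<open>x v\<close> can be split
  off.\<close>

lemma polyfn_power_divides:
 assumes "polyfn I r" "polyfn I s" "v \<in> I" "w \<in> I" "v ~= w" "!!x. x w ^ k * r x = x v ^ m * s x"
 shows "EX u. polyfn I u & (ALL x. r x = x v ^ m * u x)"
 using assms(1,6)
proof (induction m arbitrary: r)
 case 0
 then show ?case by auto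
next
 case (Suc m)
 have r0: "polyfn I (%x. r (x(v := 0)))"
 proof -
  have "polyfn I (%x. r (%i. (if i = v then (%_. 0) else (%x. x i)) x))"
   by (rule polyfn_subst[OF Suc.prems(1)]) (auto intro: polyfn_var)
  moreover have "(%x. r (%i. (if i = v then (%_. 0) else (%x. x i)) x)) = (%x. r (x(v := 0)))"
   by (intro ext arg_cong[where f = r]) auto
  ultimately show ?thesis by simp
 qed
 have "x w ^ k * r (x(v := 0)) = 0" for x :: "'a => complex"
 proof -
  have "(x(v := 0)) w = x w" "(x(v := 0)) v = 0" using assms(5) by simp_all
  then show ?thesis using Suc.prems(2)[of "x(v := 0)"] by (simp del: fun_upd_apply)
 qed
 moreover have "polyfn I (%x. x w ^ k)" by (intro polyfn_power polyfn_var assms)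
 ultimately have "(\<forall>x :: 'a => complex. x w ^ k = 0) \<or> (ALL x. r (x(v := 0)) = 0)"
  using polyfn_mult_eq_0[OF _ r0] by blast
 then have "r (x(v := 0)) = 0" for x :: "'a => complex"
 proof
  assume "\<forall>x :: 'a => complex. x w ^ k = 0"
  from this[rule_format, of "%_. 1"] show ?thesis by simp
 qed blast
 then obtain r' where r': "polyfn I r'" "ALL x. r x = x v * r' x"
  using polyfn_factor_var[OF Suc.prems(1) assms(3)] by blast
 have "x v * (x w ^ k * r' x - x v ^ m * s x) = 0" for x
  using Suc.prems(2)[of x] r'(2)[rule_format, of x] by (simp add: algebra_simps)
 moreover have "polyfn I (%x. x w ^ k * r' x - x v ^ m * s x)"
  by (intro polyfn_diff polyfn_mult polyfn_power polyfn_var assms r')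
 ultimately have "(\<forall>x :: 'a => complex. x v = 0) \<or> (ALL x. x w ^ k * r' x - x v ^ m * s x = 0)"
  using polyfn_mult_eq_0[OF polyfn_var[OF assms(3)]] by blast
 then have "x w ^ k * r' x = x v ^ m * s x" for x :: "'a => complex"
 proof
  assume "\<forall>x :: 'a => complex. x v = 0"
  from this[rule_format, of "%_. 1"] show ?thesis by simp
 qed simp
 then obtain u where u: "polyfn I u" "ALL x. r' x = x v ^ m * u x"
  using Suc.IH[OF r'(1)] by blast
 show ?case using u r'(2) by (intro exI[of _ u]) simp
qed

context good_cubic
begin

text \<open>By the Nullstellensatz, applied to the ideal of denominators of \<open>h\<close> together with
 $x_j - 1$, a power of $x_j$ is a denominator.\<close>

lemma coordinate_power_denominator:
 assumes h: "hreg k X h" and j: "j \<le> n"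
 shows "EX N F. polyfn {..n} F & (\<forall>v\<in>cone X. v j ^ N * h v = F v)"
proof -
 define I where "I = {G. polyfn {..n} G & (EX F. polyfn {..n} F & (\<forall>v\<in>cone X. F v = G v * h v))}"
 define J where "J = {%x. G x + b x * (x j - 1) |G b. G \<in> I & polyfn {..n} b}"
 have pj: "polyfn {..n} (%x. x j - 1)" using j by (intro polyfn_diff polyfn_var) auto
 have I0: "(%_. 0) \<in> I" unfolding I_def by (auto intro!: exI[of _ "%_. 0"])
 have Iadd: "(%x. G x + G' x) \<in> I" if GI: "G \<in> I" "G' \<in> I" for G G'
 proof -
  obtain F F' where "polyfn {..n} F" "\<forall>v\<in>cone X. F v = G v * h v" "polyfn {..n} F'" "\<forall>v\<in>cone X. F' v = G' v * h v"
   using GI unfolding I_def by blast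
  then show ?thesis using GI unfolding I_def
   by (intro CollectI conjI exI[of _ "%x. F x + F' x"]) (auto simp: algebra_simps)
 qed
 have Imult: "(%x. c x * G x) \<in> I" if cG: "polyfn {..n} c" "G \<in> I" for c G
 proof -
  obtain F where "polyfn {..n} F" "\<forall>v\<in>cone X. F v = G v * h v"
   using cG unfolding I_def by blast
  then show ?thesis using cG unfolding I_def
   by (intro CollectI conjI exI[of _ "%x. c x * F x"]) (auto simp: algebra_simps)
 qed
 have IJ: "G \<in> J" if "G \<in> I" for G unfolding J_def using that
  by (intro CollectI exI[of _ G] exI[of _ "%_. 0"]) simp
 have "is_ideal {..n} J"
  unfolding is_ideal_def
 proof (intro conjI ballI allI impI)
  show "J \<subseteq> Collect (polyfn {..n})" unfolding J_def I_def
   by (auto intro!: polyfn_add polyfn_mult pj)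
  show "(%_. 0) \<in> J" by (rule IJ[OF I0])
 next
  fix g g' assume "g \<in> J" "g' \<in> J"
  then obtain G b G' b' where *: "G \<in> I" "polyfn {..n} b" "g = (%x. G x + b x * (x j - 1))"
   "G' \<in> I" "polyfn {..n} b'" "g' = (%x. G' x + b' x * (x j - 1))" unfolding J_def by blast
  show "(%x. g x + g' x) \<in> J" unfolding J_def
   by (intro CollectI exI[of _ "%x. G x + G' x"] exI[of _ "%x. b x + b' x"] conjI Iadd polyfn_add *)
    (simp add: * algebra_simps)
 next
  fix c g assume c: "polyfn {..n} c" and "g \<in> J"
  then obtain G b where *: "G \<in> I" "polyfn {..n} b" "g = (%x. G x + b x * (x j - 1))" unfolding J_def by blast
  show "(%x. c x * g x) \<in> J" unfolding J_def
   by (intro CollectI exI[of _ "%x. c x * G x"] exI[of _ "%x. c x * b x"] conjI Imult polyfn_mult c *)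
    (simp add: * algebra_simps)
 qed
 moreover have "\<exists>g\<in>J. g x ~= 0" for x
 proof (cases "x j = 1")
  case False
  have "(%x. 0 + 1 * (x j - 1)) \<in> J" unfolding J_def
   by (intro CollectI exI[of _ "%_. 0"] exI[of _ "%_. 1"] conjI I0 refl) simp
  then show ?thesis using False by (intro bexI[of _ "%x. 0 + 1 * (x j - 1)"]) simp_all
 next
  case True
  show ?thesis
  proof (cases "peval f x = 0")
   case False
   have "peval f \<in> I" unfolding I_def
    by (intro CollectI conjI polyfn_f exI[of _ "%_. 0"]) (simp_all add: cone_f)
   then show ?thesis using False IJ by blast
  next
   case f0: True
   then have "on_cone x" unfolding on_cone_def using True j by (intro conjI exI[of _ j]) simp_all
   then have tX: "trunc x \<in> cone X" by (rule trunc_cone)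
   from h tX obtain d e F G where *: "F \<in> forms {..n} e" "G \<in> forms {..n} d" "peval G (trunc x) ~= 0"
    "\<forall>v\<in>cone X. peval F v = peval G v * h v" by (rule hregE)
   have "peval G \<in> I" unfolding I_def using *(4)
    by (intro CollectI conjI exI[of _ "peval F"] polyfn_peval forms_polys[OF *(1)] forms_polys[OF *(2)]) simp
   moreover have "peval G x ~= 0" using *(3) polyfn_trunc[OF polyfn_peval[OF forms_polys[OF *(2)]], of x] by simp
   ultimately show ?thesis using IJ by blast
  qed
 qed
 ultimately have "(%_. 1) \<in> J" by (intro weak_nullstellensatz[of "{..n}"]) simp_all
 then obtain G b where Gb: "G \<in> I" "(%_. 1) = (%x. G x + b x * (x j - 1))" unfolding J_def by blast
 have G1: "G x = 1" if "x j = 1" for x using fun_cong[OF Gb(2), of x] that by simp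
 obtain F where F: "polyfn {..n} F" "\<forall>v\<in>cone X. F v = G v * h v" using Gb(1) by (auto simp: I_def)
 obtain p where p: "p \<in> polys {..n}" "F = peval p" using F(1) by (auto simp: polyfn_def)
 define D where "D = Max (insert 0 (mdeg ` keys p))"
 have D: "e \<le> D" if "e \<in> mdeg ` keys p" for e unfolding D_def using that by (intro Max_ge) auto
 \<comment> \<open>The summand 1 makes \<open>K\<close> and \<open>N\<close> positive for every
   integer \<open>k\<close>, so that the two sides of the claim vanish where
   \<open>v j = 0\<close>.\<close>
 define K where "K = nat \<bar>k\<bar> + 1"
 define N where "N = nat (int (D + K) - k)"
 define Fh where "Fh x = x j ^ K * (\<Sum>e\<in>mdeg ` keys p. x j ^ (D - e) * peval (hcomp e p) x)" for x
 have "polyfn {..n} Fh" unfolding Fh_def[abs_def]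
  by (intro polyfn_mult polyfn_power polyfn_var polyfn_sum polyfn_peval forms_polys[OF hcomp_forms[OF p(1)]])
   (use j in auto)
 moreover have "\<forall>v\<in>cone X. v j ^ N * h v = Fh v"
 proof
  fix v assume v: "v \<in> cone X"
  show "v j ^ N * h v = Fh v"
 proof (cases "v j = 0")
  case True
  then have "v j ^ N = 0" "v j ^ K = 0" by (auto simp: N_def K_def power_0_left)
  then show ?thesis by (simp only: Fh_def mult_zero_left)
 next
  case False
  \<comment> \<open>The vector is scaled into the slice \<open>x j = 1\<close>, where the
    denominator \<open>G\<close> is 1 and \<open>h\<close> equals the polynomial
    \<open>F\<close>.\<close>
  define u where "u = (%i. inverse (v j) * v i)"
  have u: "u \<in> cone X" unfolding u_def using v False by (intro cone_scale) auto
  have "u j = 1" using False by (simp add: u_def)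
  then have "F u = h u" using F(2) u G1 by simp
  also have "h u = inverse (v j) powi k * h v" unfolding u_def using False by (intro hreg_scale[OF h v]) auto
  finally have hu: "inverse (v j) powi k * h v = F u" ..
  have "F u = (\<Sum>e\<in>mdeg ` keys p. inverse (v j) ^ e * peval (hcomp e p) v)"
  proof -
   have "F u = (\<Sum>e\<in>mdeg ` keys p. peval (hcomp e p) u)"
    unfolding p(2) by (subst sum_hcomp[of "mdeg ` keys p" p, symmetric]) (simp_all only: peval_sum finite_imageI finite_keys order_refl)
   then show ?thesis unfolding u_def by (simp add: peval_scale[OF hcomp_forms[OF p(1)]])
  qed
  then have "v j ^ (D + K) * F u = Fh v"
   unfolding Fh_def using D False
   by (simp add: sum_distrib_left power_add power_diff field_simps)
  have "v j ^ N = v j ^ (D + K) * inverse (v j) powi k"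
  proof -
   have "int N = int (D + K) - k" by (simp add: N_def K_def)
   then have "v j ^ N = v j powi (int (D + K) - k)" using power_int_of_nat[of "v j" N] by (simp only:)
   also have "\<dots> = v j ^ (D + K) * inverse (v j) powi k"
    using False power_int_diff[of "v j" "int (D + K)" k]
    by (simp only: power_int_of_nat power_int_inverse divide_inverse) simp
   finally show ?thesis .
  qed
  then have "v j ^ N * h v = v j ^ (D + K) * (inverse (v j) powi k * h v)" by (simp only: mult.assoc)
  then show ?thesis using hu \<open>v j ^ (D + K) * F u = Fh v\<close> by (simp only:)
 qed
 qed
 ultimately show ?thesis by (intro exI[of _ N] exI[of _ Fh] conjI)
qed

lemma coordinate_nonzero_on_cone: "EX v. on_cone v & v 0 ^ N ~= 0"
proof (rule ccontr)
 assume "\<nexists>v. on_cone v & v 0 ^ N ~= 0"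
 then have *: "v 0 ^ N = 0" if "on_cone v" for v using that by blast
 have "polyfn {..<n} (%v. v 0 ^ N)" using n2 by (intro polyfn_power polyfn_var) simp
 then have "(%_. 1 :: complex) 0 ^ N = 0" by (rule base_vanish[of "%v. v 0 ^ N"]) (rule *)
 then show False by simp
qed

text \<open>Powers of \<open>x 0\<close> and \<open>x 1\<close> are both denominators of
  \<open>h\<close>. Comparing remainders, the coefficients of the numerator over the power of
  \<open>x 0\<close> are divisible by that power, as powers of the two coordinates are coprime. Both
  have index below \<open>n\<close>, so they act on the three coefficients separately; this is the
  place where \<open>2 \<le> n\<close> matters.\<close>

theorem hreg_global_polynomial:
 assumes h: "hreg k X h"
 shows "EX T. polyfn {..n} T & (\<forall>v\<in>cone X. h v = T v)"
proof -
 obtain N F where F: "polyfn {..n} F" "\<forall>v\<in>cone X. v 0 ^ N * h v = F v"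
  using coordinate_power_denominator[OF h, of 0] by auto
 obtain M H where H: "polyfn {..n} H" "\<forall>v\<in>cone X. v 1 ^ M * h v = H v"
  using coordinate_power_denominator[OF h, of 1] n2 by auto
 obtain Q r0 r1 r2 where r: "polyfn {..n} Q" "polyfn {..<n} r0" "polyfn {..<n} r1" "polyfn {..<n} r2"
  "!!x. F x = peval f x * Q x + (r0 x + r1 x * x n + r2 x * x n ^ 2)" using reduce[OF F(1)] by metis
 obtain Q' s0 s1 s2 where s: "polyfn {..n} Q'" "polyfn {..<n} s0" "polyfn {..<n} s1" "polyfn {..<n} s2"
  "!!x. H x = peval f x * Q' x + (s0 x + s1 x * x n + s2 x * x n ^ 2)" using reduce[OF H(1)] by metis
 have vars: "polyfn {..<n} (%x. x 0)" "polyfn {..<n} (%x. x 1)" using n2 by (auto intro: polyfn_var)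
 have zero: "(v 1 ^ M * r0 v - v 0 ^ N * s0 v) + (v 1 ^ M * r1 v - v 0 ^ N * s1 v) * v n
  + (v 1 ^ M * r2 v - v 0 ^ N * s2 v) * v n ^ 2 = 0" if "on_cone v" for v
 proof (rule on_cone_ball[OF _ _ that])
  show "polyfn {..n} (%v. (v 1 ^ M * r0 v - v 0 ^ N * s0 v) + (v 1 ^ M * r1 v - v 0 ^ N * s1 v) * v n
  + (v 1 ^ M * r2 v - v 0 ^ N * s2 v) * v n ^ 2)"
   by (intro polyfn_add polyfn_mult polyfn_diff polyfn_power polyfn_var base_mono[OF r(2)] base_mono[OF r(3)] base_mono[OF r(4)]
    base_mono[OF s(2)] base_mono[OF s(3)] base_mono[OF s(4)]) (use n2 in auto)
  fix v assume v: "v \<in> cone X"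
  have "v 1 ^ M * F v = v 0 ^ N * H v"
   using F(2) H(2) v by (metis mult.left_commute)
  moreover have "F v = r0 v + r1 v * v n + r2 v * v n ^ 2" using r(5)[of v] cone_f[OF v] by simp
  moreover have "H v = s0 v + s1 v * v n + s2 v * v n ^ 2" using s(5)[of v] cone_f[OF v] by simp
  ultimately show "(v 1 ^ M * r0 v - v 0 ^ N * s0 v) + (v 1 ^ M * r1 v - v 0 ^ N * s1 v) * v n
  + (v 1 ^ M * r2 v - v 0 ^ N * s2 v) * v n ^ 2 = 0" by (simp add: algebra_simps)
 qed
 have eqs: "v 1 ^ M * r0 v - v 0 ^ N * s0 v = 0 & v 1 ^ M * r1 v - v 0 ^ N * s1 v = 0 & v 1 ^ M * r2 v - v 0 ^ N * s2 v = 0" for v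
 proof -
  have p: "polyfn {..<n} (%v. v 1 ^ M * r0 v - v 0 ^ N * s0 v)" "polyfn {..<n} (%v. v 1 ^ M * r1 v - v 0 ^ N * s1 v)"
   "polyfn {..<n} (%v. v 1 ^ M * r2 v - v 0 ^ N * s2 v)"
   by (intro polyfn_mult polyfn_diff polyfn_power r s vars)+
  show ?thesis using reduced_vanish[OF p, of v] zero by simp
 qed
 have mem: "0 \<in> {..<n}" "1 \<in> {..<n}" "(0::nat) ~= 1" using n2 by auto
 have "EX u. polyfn {..<n} u & (ALL x. r0 x = x 0 ^ N * u x)"
  by (rule polyfn_power_divides[OF r(2) s(2) mem, of M]) (use eqs in auto)
 then obtain u0 where u0: "polyfn {..<n} u0" "ALL x. r0 x = x 0 ^ N * u0 x" by blast
 have "EX u. polyfn {..<n} u & (ALL x. r1 x = x 0 ^ N * u x)"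
  by (rule polyfn_power_divides[OF r(3) s(3) mem, of M]) (use eqs in auto)
 then obtain u1 where u1: "polyfn {..<n} u1" "ALL x. r1 x = x 0 ^ N * u1 x" by blast
 have "EX u. polyfn {..<n} u & (ALL x. r2 x = x 0 ^ N * u x)"
  by (rule polyfn_power_divides[OF r(4) s(4) mem, of M]) (use eqs in auto)
 then obtain u2 where u2: "polyfn {..<n} u2" "ALL x. r2 x = x 0 ^ N * u2 x" by blast
 define T where "T x = u0 x + u1 x * x n + u2 x * x n ^ 2" for x
 have T: "polyfn {..n} T" unfolding T_def[abs_def]
  by (intro polyfn_add polyfn_mult polyfn_power polyfn_var base_mono[OF u0(1)] base_mono[OF u1(1)] base_mono[OF u2(1)]) auto
 have hT: "v 0 ^ N * h v = v 0 ^ N * T v" if v: "v \<in> cone X" for v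
 proof -
  have "v 0 ^ N * h v = F v" using F(2) v by blast
  also have "F v = v 0 ^ N * T v" using r(5)[of v] cone_f[OF v] u0(2) u1(2) u2(2)
   by (simp add: T_def algebra_simps)
  finally show ?thesis .
 qed
 \<comment> \<open>The equation is known after multiplication by a power of \<open>x 0\<close>. A
   local quotient for \<open>h\<close> turns it into a product of polynomials, from which the power
   is cancelled in the domain of functions on the cone.\<close>
 have "h w = T w" if w: "w \<in> cone X" for w
 proof -
  from h w obtain d e F' G' where *: "F' \<in> forms {..n} e" "G' \<in> forms {..n} d" "peval G' w ~= 0"
   "\<forall>v\<in>cone X. peval F' v = peval G' v * h v" by (rule hregE)
  have P0: "polyfn {..n} (%v. v 0 ^ N)" by (intro polyfn_power polyfn_var) simp
  have P1: "polyfn {..n} (%v. peval F' v - peval G' v * T v)"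
   by (intro polyfn_diff polyfn_mult T polyfn_peval forms_polys[OF *(1)] forms_polys[OF *(2)])
  have "v 0 ^ N * (peval F' v - peval G' v * T v) = 0" if "on_cone v" for v
  proof (rule on_cone_ball[OF polyfn_mult[OF P0 P1] _ that])
   fix v assume v: "v \<in> cone X"
   have "v 0 ^ N * (peval F' v - peval G' v * T v) = peval G' v * (v 0 ^ N * h v - v 0 ^ N * T v)"
    using *(4)[rule_format, OF v] by (simp add: algebra_simps)
   then show "v 0 ^ N * (peval F' v - peval G' v * T v) = 0" using hT[OF v] by simp
  qed
  then have "(ALL v. on_cone v --> v 0 ^ N = 0) \<or> (ALL v. on_cone v --> peval F' v - peval G' v * T v = 0)"
   by (rule cone_domain[OF P0 P1])
  then have "ALL v. on_cone v --> peval F' v - peval G' v * T v = 0"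
   using coordinate_nonzero_on_cone[of N] by blast
  then have "peval F' w - peval G' w * T w = 0" using w cone_iff by blast
  then show ?thesis using *(3) *(4)[rule_format, OF w] by simp
 qed
 then show ?thesis using T by blast
qed

text \<open>Homogeneity of \<open>h\<close> along rays selects the component of degree
  \<open>k\<close> of the polynomial found before; in negative degree nothing is left. These are the
  global sections of the twists of the structure sheaf.\<close>

theorem hreg_global:
 assumes h: "hreg k X h"
 shows "EX p. (k \<ge> 0 --> p \<in> forms {..n} (nat k)) & (k < 0 --> p = 0) & (\<forall>v\<in>cone X. h v = peval p v)"
proof -
 obtain T where T: "polyfn {..n} T" "\<forall>v\<in>cone X. h v = T v" using hreg_global_polynomial[OF h] by (elim exE conjE)
 obtain p where p: "p \<in> polys {..n}" "T = peval p" using T(1) by (auto simp: polyfn_def)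
 define p' where "p' = (if k \<ge> 0 then hcomp (nat k) p else 0)"
 have "h v = peval p' v" if v: "v \<in> cone X" for v
 proof -
  obtain P where P: "!!c. peval p (%i. c * v i) = poly P c" "!!j. poly.coeff P j = peval (hcomp j p) v"
   using peval_poly_scale[of p v] by metis
  have sc: "poly P c = c powi k * h v" if c: "c ~= 0" for c
  proof -
   have "poly P c = h (%i. c * v i)" using P(1)[of c] T(2) p(2) cone_scale[OF v c] by simp
   then show ?thesis using hreg_scale[OF h v _ c] by simp
  qed
  have inf: "infinite {c :: complex. c ~= 0}"
  proof -
   have "{c :: complex. c ~= 0} = UNIV - {0}" by auto
   then show ?thesis using infinite_UNIV_char_0 by (simp add: infinite_remove)
  qed
  have eq: "A = B" if "!!c. c ~= 0 ==> poly A c = poly B c" for A B :: "complex poly"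
  proof (rule ccontr)
   assume "A ~= B"
   then have "finite {c. poly (A - B) c = 0}" by (intro poly_roots_finite) simp
   moreover have "{c. c ~= 0} \<subseteq> {c. poly (A - B) c = 0}" using that by auto
   ultimately show False using inf finite_subset by blast
  qed
  show ?thesis
  proof (cases "k \<ge> 0")
   case True
   have "P = monom (h v) (nat k)"
   proof (rule eq)
    fix c :: complex assume "c ~= 0"
    have "c powi k = c ^ nat k" using True by (simp add: power_int_def)
    then show "poly P c = poly (monom (h v) (nat k)) c" using sc[OF \<open>c ~= 0\<close>] by (simp add: poly_monom)
   qed
   then have "h v = poly.coeff P (nat k)" by simp
   then show ?thesis using P(2) True by (simp add: p'_def)
  next
   case False
   have "monom 1 (nat (- k)) * P = [:h v:]"
   proof (rule eq)
    fix c :: complex assume c: "c ~= 0"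
    have "c powi k = inverse (c ^ nat (- k))" using False by (simp add: power_int_def power_inverse)
    then show "poly (monom 1 (nat (- k)) * P) c = poly [:h v:] c" using sc[OF c] c by (simp add: poly_monom)
   qed
   then have "poly [:h v:] 0 = poly (monom 1 (nat (- k)) * P) 0" by simp
   also have "\<dots> = 0" using False by (simp add: poly_monom power_0_left)
   finally show ?thesis using False by (simp add: p'_def)
  qed
 qed
 moreover have "k \<ge> 0 --> p' \<in> forms {..n} (nat k)" using hcomp_forms[OF p(1)] by (simp add: p'_def)
 moreover have "k < 0 --> p' = 0" by (simp add: p'_def)
 ultimately show ?thesis by blast
qed

end

subsection \<open>Matrix factorizations\<close>

definition formfn :: "nat => nat => ((nat => complex) => complex) => bool" where
 "formfn n d h \<longleftrightarrow> (\<exists>p\<in>forms {..n} d. h = peval p)"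

locale matrix_factorization = good_cubic +
 fixes A B :: "nat => nat => nat mpoly"
 assumes A_form: "!!i j. A i j \<in> forms {..n} 1" and B_form: "!!i j. B i j \<in> forms {..n} 2"
  and AB: "!!i j. i < 27 ==> j < 27 ==> (\<Sum>k<27. A i k * B k j) = (if i = j then f else 0)"
  and BA: "!!i j. i < 27 ==> j < 27 ==> (\<Sum>k<27. B i k * A k j) = (if i = j then f else 0)"
begin

definition mulvec :: "(nat => nat => nat mpoly) => (nat => nat mpoly) => nat => nat mpoly" where
 "mulvec M q i = (\<Sum>k<27. M i k * q k)"

lemma mulvec_AB: "i < 27 ==> mulvec A (mulvec B q) i = f * q i"
proof -
 assume i: "i < 27"
 have "mulvec A (mulvec B q) i = (\<Sum>k<27. \<Sum>j<27. A i k * B k j * q j)"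
  by (simp add: mulvec_def sum_distrib_left mult.assoc)
 also have "\<dots> = (\<Sum>j<27. (\<Sum>k<27. A i k * B k j) * q j)"
  by (subst sum.swap) (simp add: sum_distrib_right)
 also have "\<dots> = (\<Sum>j<27. if j = i then f * q i else 0)"
  by (intro sum.cong refl) (simp add: AB[OF i])
 finally show ?thesis using i by simp
qed

lemma mulvec_BA: "i < 27 ==> mulvec B (mulvec A q) i = f * q i"
proof -
 assume i: "i < 27"
 have "mulvec B (mulvec A q) i = (\<Sum>k<27. \<Sum>j<27. B i k * A k j * q j)"
  by (simp add: mulvec_def sum_distrib_left mult.assoc)
 also have "\<dots> = (\<Sum>j<27. (\<Sum>k<27. B i k * A k j) * q j)"
  by (subst sum.swap) (simp add: sum_distrib_right)
 also have "\<dots> = (\<Sum>j<27. if j = i then f * q i else 0)"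
  by (intro sum.cong refl) (simp add: BA[OF i])
 finally show ?thesis using i by simp
qed

lemma mulvec_cong: "(!!k. k < 27 ==> q k = q' k) ==> mulvec M q = mulvec M q'"
 by (simp add: mulvec_def fun_eq_iff)

lemma mulvec_scale: "mulvec M (%k. c * q k) i = c * mulvec M q i"
 by (simp add: mulvec_def sum_distrib_left mult.left_commute)

lemma polys_mulvec:
 assumes "!!i j. M i j \<in> forms {..n} d" "!!k. k < 27 ==> q k \<in> polys {..n}" shows "mulvec M q i \<in> polys {..n}"
 unfolding mulvec_def
proof (rule polys_sum)
 fix k :: nat assume "k \<in> {..<27}"
 then show "M i k * q k \<in> polys {..n}" using polys_mult[OF forms_polys[OF assms(1)] assms(2)] by simp
qed

lemma forms_mulvec:
 assumes "!!i j. M i j \<in> forms {..n} d" "!!k. k < 27 ==> q k \<in> forms {..n} e" shows "mulvec M q i \<in> forms {..n} (d + e)"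
 unfolding mulvec_def
proof (rule forms_sum)
 fix k :: nat assume "k \<in> {..<27}"
 then show "M i k * q k \<in> forms {..n} (d + e)" using forms_mult[OF assms(1) assms(2)] by simp
qed

lemma hcomp_mulvec:
 assumes "!!i j. M i j \<in> forms {..n} d"
 shows "hcomp (d + e) (mulvec M q i) = mulvec M (%k. hcomp e (q k)) i"
 unfolding mulvec_def hcomp_sum by (intro sum.cong refl hcomp_mult_form[OF assms])

lemma vanish_dvd_poly:
 assumes "p \<in> polys {..n}" "!!v. v \<in> cone X ==> peval p v = 0"
 shows "\<exists>q\<in>polys {..n}. p = f * q"
proof -
 have pf: "polyfn {..n} (peval p)" by (rule polyfn_peval[OF assms(1)])
 have van: "peval p v = 0" if v: "on_cone v" for v by (rule on_cone_ball[OF pf assms(2) v])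
 obtain Q where Q: "polyfn {..n} Q" "ALL x. peval p x = peval f x * Q x"
 proof -
  have "EX Q. polyfn {..n} Q & (ALL x. peval p x = peval f x * Q x)" by (rule vanish_dvd[OF pf van])
  then show thesis using that by (elim exE conjE)
 qed
 obtain q where q: "q \<in> polys {..n}" "Q = peval q" using Q(1) by (auto simp: polyfn_def)
 have "p = f * q" by (rule peval_inject) (use Q(2) q(2) in simp)
 then show ?thesis using q(1) by blast
qed

lemma mult_f_cancel: "f * a = f * b ==> a = b"
 using f_nonzero by simp

text \<open>If \<open>A t\<close> vanishes on the cone, it equals \<open>f q\<close>; then
  \<open>f t = B A t = f B q\<close>, and \<open>f\<close> is cancelled. With the counterpart for
  \<open>B\<close>, the two matrices form an exact periodic complex over the coordinate ring of the
  cone.\<close>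

lemma kernel_A_image_B:
 assumes "!!k. k < 27 ==> t k \<in> polys {..n}" "!!i v. i < 27 ==> v \<in> cone X ==> peval (mulvec A t i) v = 0"
 shows "EX q. (ALL k. q k \<in> polys {..n}) & (\<forall>i<27. t i = mulvec B q i)"
proof -
 have "EX q. q \<in> polys {..n} & (i < 27 --> mulvec A t i = f * q)" for i
 proof (cases "i < 27")
  case True
  have "mulvec A t i \<in> polys {..n}" by (rule polys_mulvec[OF A_form assms(1)])
  from vanish_dvd_poly[OF this assms(2)[OF True]] show ?thesis by (auto simp: Bex_def)
 qed (auto intro: exI[of _ 0])
 then have "ALL i. EX q. q \<in> polys {..n} & (i < 27 --> mulvec A t i = f * q)" by (rule allI)
 from choice[OF this] obtain q where q: "ALL i. q i \<in> polys {..n} & (i < 27 --> mulvec A t i = f * q i)" by (elim exE)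
 have "t i = mulvec B q i" if i: "i < 27" for i
 proof -
  have "f * t i = mulvec B (mulvec A t) i" by (rule mulvec_BA[OF i, symmetric])
  also have "\<dots> = mulvec B (%k. f * q k) i"
   by (rule arg_cong[where f = "%g. g i"], rule mulvec_cong) (rule q[rule_format, THEN conjunct2, rule_format])
  also have "\<dots> = f * mulvec B q i" by (rule mulvec_scale)
  finally show ?thesis by (rule mult_f_cancel)
 qed
 then show ?thesis using q by (intro exI[of _ q]) simp
qed

lemma kernel_B_image_A:
 assumes "!!k. k < 27 ==> q k \<in> polys {..n}" "!!i v. i < 27 ==> v \<in> cone X ==> peval (mulvec B q i) v = 0"
 shows "EX r. (ALL k. r k \<in> polys {..n}) & (\<forall>i<27. q i = mulvec A r i)"
proof -
 have "EX r. r \<in> polys {..n} & (i < 27 --> mulvec B q i = f * r)" for i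
 proof (cases "i < 27")
  case True
  have "mulvec B q i \<in> polys {..n}" by (rule polys_mulvec[OF B_form assms(1)])
  from vanish_dvd_poly[OF this assms(2)[OF True]] show ?thesis by (auto simp: Bex_def)
 qed (auto intro: exI[of _ 0])
 then have "ALL i. EX r. r \<in> polys {..n} & (i < 27 --> mulvec B q i = f * r)" by (rule allI)
 from choice[OF this] obtain r where r: "ALL i. r i \<in> polys {..n} & (i < 27 --> mulvec B q i = f * r i)" by (elim exE)
 have "q i = mulvec A r i" if i: "i < 27" for i
 proof -
  have "f * q i = mulvec A (mulvec B q) i" by (rule mulvec_AB[OF i, symmetric])
  also have "\<dots> = mulvec A (%k. f * r k) i"
   by (rule arg_cong[where f = "%g. g i"], rule mulvec_cong) (rule r[rule_format, THEN conjunct2, rule_format])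
  also have "\<dots> = f * mulvec A r i" by (rule mulvec_scale)
  finally show ?thesis by (rule mult_f_cancel)
 qed
 then show ?thesis using r by (intro exI[of _ r]) simp
qed

end

section \<open>The kernel sheaf and its coherence\<close>

lemma finsum_eval:
 fixes \<phi> :: "'b => complex"
 assumes "abelian_monoid M" "finite A" "!!i. i \<in> A ==> g i \<in> carrier M"
  "!!x y. x \<in> carrier M ==> y \<in> carrier M ==> \<phi> (x \<oplus>\<^bsub>M\<^esub> y) = \<phi> x + \<phi> y" "\<phi> \<zero>\<^bsub>M\<^esub> = 0"
 shows "\<phi> (\<Oplus>\<^bsub>M\<^esub>i\<in>A. g i) = (\<Sum>i\<in>A. \<phi> (g i))"
proof -
 interpret abelian_monoid M by fact
 show ?thesis using assms(2,3)
 proof (induction A rule: finite_induct)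
  case empty
  then show ?case using assms(5) by simp
 next
  case (insert a A)
  then have g: "g \<in> A \<rightarrow> carrier M" "g a \<in> carrier M" by auto
  have "(\<Oplus>\<^bsub>M\<^esub>i\<in>insert a A. g i) = g a \<oplus>\<^bsub>M\<^esub> (\<Oplus>\<^bsub>M\<^esub>i\<in>A. g i)"
   using insert.hyps g by (rule finsum_insert)
  then show ?case using assms(4)[OF g(2) finsum_closed[OF g(1)]] insert by simp
 qed
qed

lemma finsum_in:
 assumes "abelian_monoid M" "!!i. i \<in> A ==> g i \<in> carrier M"
 shows "(\<Oplus>\<^bsub>M\<^esub>i\<in>A. g i) \<in> carrier M"
 using abelian_monoid.finsum_closed[OF assms(1), of g A] assms(2) by auto

context good_cubic
begin

lemma proj_class_mem: "w \<in> proj_class v \<longleftrightarrow> (EX c. c ~= 0 & w = (%i. c * v i))"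
 by (auto simp: proj_class_def)

text \<open>\<open>fun_on\<close> evaluates at a representative taken by \<open>SOME\<close>; a
  function that is invariant under scaling does not depend on the choice.\<close>

lemma fun_on_eval:
 assumes "U \<subseteq> X" "v \<in> cone U" "!!c. c ~= 0 ==> h (%i. c * v i) = h v"
 shows "fun_on U h (proj_class v) = h v"
proof -
 have "(SOME w. w \<in> proj_class v) \<in> proj_class v" by (rule someI[of _ v]) (rule proj_class_self)
 then obtain c where "c ~= 0" "(SOME w. w \<in> proj_class v) = (%i. c * v i)" using proj_class_mem by blast
 then show ?thesis using assms(3) class_in[OF assms(1), of v] assms(2) by (simp add: fun_on_def restrict0_def)
qed

lemma fun_on_out: "P \<notin> U ==> fun_on U h P = 0"
 by (simp add: fun_on_def restrict0_def)

lemma lift_fun_on: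
 assumes U: "zar_open n X U" and h: "hreg 0 U h"
 shows "lift (fun_on U h) = h" "fun_on U h \<in> carrier (reg n X U)"
proof -
 have UX: "U \<subseteq> X" by (rule zar_open_subset[OF U])
 have "lift (fun_on U h) v = h v" for v
 proof (cases "v \<in> cone U")
  case True
  then have v: "v \<in> cone X" using UX by blast
  have "fun_on U h (proj_class v) = h v"
   by (rule fun_on_eval[OF UX True]) (use hreg_scale[OF h v UX] in simp)
  then show ?thesis using v by (simp add: lift_def)
 next
  case False
  then show ?thesis using class_in[OF UX, of v] hreg_out[OF h False] fun_on_out[of "proj_class v" U h]
   by (auto simp: lift_def)
 qed
 then show "lift (fun_on U h) = h" by (rule ext)
 then show "fun_on U h \<in> carrier (reg n X U)" unfolding reg_iff[OF U] using h fun_on_out by simp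
qed

lemma reg_hreg: "zar_open n X U ==> a \<in> carrier (reg n X U) ==> hreg 0 U (lift a)"
 using reg_iff by blast

lemma reg_out: "a \<in> carrier (reg n X U) ==> P \<notin> U ==> a P = 0"
 by (simp add: reg_def)

lemma point_cone: "P \<in> X ==> EX v. v \<in> cone X & P = proj_class v"
 using proj_space_nonempty[of P "{..n}"] class_eq unfolding X_def zero_locus_def by blast

lemma reg_eqI:
 assumes "U \<subseteq> X" "!!P. P \<notin> U ==> a P = 0" "!!P. P \<notin> U ==> b P = 0" "!!v. v \<in> cone U ==> a (proj_class v) = b (proj_class v)"
 shows "a = b"
proof
 fix P show "a P = b P"
 proof (cases "P \<in> U")
  case True
  then obtain v where v: "v \<in> cone X" "P = proj_class v" using point_cone assms(1) by blast
  then show ?thesis using assms(4)[of v] class_in[OF assms(1)] True by simp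
 qed (use assms in simp)
qed

lemma regI:
 assumes "zar_open n X U" "hreg 0 U g" "!!P. P \<notin> U ==> a P = 0" "!!v. v \<in> cone X ==> a (proj_class v) = g v"
 shows "a \<in> carrier (reg n X U)"
proof -
 have "lift a = g"
 proof
  fix v show "lift a v = g v"
  proof (cases "v \<in> cone X")
   case False
   then have "v \<notin> cone U" using zar_open_subset[OF assms(1)] by blast
   then show ?thesis using False hreg_out[OF assms(2)] by (simp add: lift_def)
  qed (simp add: lift_def assms(4))
 qed
 then show ?thesis unfolding reg_iff[OF assms(1)] using assms by simp
qed

lemma reg_simps:
 "\<one>\<^bsub>reg n Y U\<^esub> = restrict0 U (%_. 1)" "\<zero>\<^bsub>reg n Y U\<^esub> = (%_. 0)"
 "a \<oplus>\<^bsub>reg n Y U\<^esub> b = (%P. a P + b P)" "a \<otimes>\<^bsub>reg n Y U\<^esub> b = (%P. a P * b P)"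
 by (simp_all add: reg_def)

lemma cring_reg:
 assumes U: "zar_open n X U" shows "cring (reg n X U)"
proof (rule cringI)
 note h = reg_hreg[OF U]
 have add: "a \<oplus>\<^bsub>reg n X U\<^esub> b \<in> carrier (reg n X U)" if ab: "a \<in> carrier (reg n X U)" "b \<in> carrier (reg n X U)" for a b
  by (rule regI[OF U hreg_add[OF h[OF ab(1)] h[OF ab(2)]]]) (use reg_out[OF ab(1)] reg_out[OF ab(2)] in \<open>simp_all add: reg_def lift_def\<close>)
 have mult: "a \<otimes>\<^bsub>reg n X U\<^esub> b \<in> carrier (reg n X U)" if ab: "a \<in> carrier (reg n X U)" "b \<in> carrier (reg n X U)" for a b
  by (rule regI[OF U, of "%v. lift a v * lift b v"]) (use hreg_mult[OF h[OF ab(1)] h[OF ab(2)]] reg_out[OF ab(1)] in \<open>simp_all add: reg_def lift_def\<close>)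
 have one: "\<one>\<^bsub>reg n X U\<^esub> \<in> carrier (reg n X U)"
 proof (rule regI[OF U])
  show "hreg 0 U (%v. if v \<in> cone U then peval 1 v else 0)" using hreg_form[OF U forms_1] by simp
  show "\<one>\<^bsub>reg n X U\<^esub> P = 0" if "P \<notin> U" for P using that by (simp add: reg_def restrict0_def)
  show "\<one>\<^bsub>reg n X U\<^esub> (proj_class v) = (if v \<in> cone U then peval 1 v else 0)" if "v \<in> cone X" for v
   using class_in[OF zar_open_subset[OF U], of v] that by (auto simp: reg_def restrict0_def)
 qed
 show "abelian_group (reg n X U)"
 proof (rule abelian_groupI)
  show "\<zero>\<^bsub>reg n X U\<^esub> \<in> carrier (reg n X U)"
   by (rule regI[OF U hreg_zero[OF U]]) (simp_all add: reg_def)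
  fix a assume a: "a \<in> carrier (reg n X U)"
  have "(%P. - 1 * a P) \<in> carrier (reg n X U)"
   by (rule regI[OF U hreg_cmult[OF h[OF a] U, of "-1"]]) (use reg_out[OF a] in \<open>simp_all add: lift_def\<close>)
  then show "\<exists>b\<in>carrier (reg n X U). b \<oplus>\<^bsub>reg n X U\<^esub> a = \<zero>\<^bsub>reg n X U\<^esub>"
   by (rule bexI[rotated]) (simp add: reg_def fun_eq_iff)
 qed (use add in \<open>auto simp: reg_simps fun_eq_iff algebra_simps\<close>)
 show "Group.comm_monoid (reg n X U)"
  by (rule comm_monoidI) (use mult one reg_out[of _ U] in \<open>auto simp: reg_simps fun_eq_iff restrict0_def algebra_simps\<close>)
 show "(a \<oplus>\<^bsub>reg n X U\<^esub> b) \<otimes>\<^bsub>reg n X U\<^esub> c = a \<otimes>\<^bsub>reg n X U\<^esub> c \<oplus>\<^bsub>reg n X U\<^esub> b \<otimes>\<^bsub>reg n X U\<^esub> c" for a b c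
  by (simp add: reg_def fun_eq_iff algebra_simps)
qed

text \<open>Coherence asks for relation sheaves over \<open>U\<close> as ambient space. Here and in
  \<open>reg_in\<close>, open sets and regular functions on \<open>U\<close> are identified with
  those taken in \<open>X\<close>.\<close>

lemma zar_open_in:
 assumes "zar_open n X U" shows "zar_open n U W \<longleftrightarrow> zar_open n X W & W \<subseteq> U"
proof -
 have "subtopology (subtopology (zariski {..n}) X) U = subtopology (zariski {..n}) U"
  using zar_open_subset[OF assms] by (simp add: subtopology_subtopology Int_absorb1)
 then show ?thesis using openin_open_subtopology[OF assms, of W] by simp
qed

lemma reg_in:
 assumes U: "zar_open n X U" and "V \<subseteq> U" shows "reg n U V = reg n X V"
proof -
 have "regular_on n U V a \<longleftrightarrow> regular_on n X V a" for a
 proof -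
  have "zar_open n U W & P \<in> W & W \<subseteq> V & Q \<longleftrightarrow> zar_open n X W & P \<in> W & W \<subseteq> V & Q" for W P Q
   unfolding zar_open_in[OF U] using assms(2) by blast
  then show ?thesis unfolding regular_on_def by (simp only:)
 qed
 then show ?thesis by (simp add: reg_def)
qed

lemma common_denominator:
 assumes U: "zar_open n X U" and w: "w \<in> cone U" and "finite J" and h: "!!i. i \<in> J ==> hreg k U (h i)"
 shows "EX d G F. G \<in> forms {..n} d & peval G w ~= 0 & basic G \<subseteq> U &
  (\<forall>i\<in>J. EX e. F i \<in> forms {..n} e & int e = int d + k) & (\<forall>i\<in>J. \<forall>v\<in>cone X. peval (F i) v = peval G v * h i v)"
 using assms(3,4)
proof (induction J rule: finite_induct)
 case empty
 have wX: "w \<in> cone X" "proj_class w \<in> U" using w class_in[OF zar_open_subset[OF U]] by blast+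
 obtain K d where "K \<in> forms {..n} d" "proj_class w \<in> basic K" "basic K \<subseteq> U"
  using zar_open_basis[OF U wX(2)] by (elim exE conjE)
 then show ?case using form_nonzero_class[OF _ wX(1)] by (intro exI[of _ d] exI[of _ K]) simp
next
 case (insert i J)
 have "EX d G F. G \<in> forms {..n} d & peval G w ~= 0 & basic G \<subseteq> U &
  (\<forall>i\<in>J. EX e. F i \<in> forms {..n} e & int e = int d + k) & (\<forall>i\<in>J. \<forall>v\<in>cone X. peval (F i) v = peval G v * h i v)"
  by (rule insert.IH) (rule insert.prems, simp)
 then obtain d G F where *: "G \<in> forms {..n} d" "peval G w ~= 0" "basic G \<subseteq> U"
  "\<forall>i\<in>J. EX e. F i \<in> forms {..n} e & int e = int d + k" "\<forall>i\<in>J. \<forall>v\<in>cone X. peval (F i) v = peval G v * h i v"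
  by (elim exE conjE)
 have "hreg k U (h i)" by (rule insert.prems) simp
 then obtain d' e' F' G' where a: "F' \<in> forms {..n} e'" "G' \<in> forms {..n} d'" "int e' = int d' + k" "peval G' w ~= 0"
  "basic G' \<subseteq> U" "\<forall>v\<in>cone X. peval F' v = peval G' v * h i v" using w by (rule hregE)
 let ?F = "%j. if j = i then G * F' else F j * G'"
 show ?case
 proof (rule exI[of _ "d + d'"], rule exI[of _ "G * G'"], rule exI[of _ ?F], intro conjI ballI)
  show "G * G' \<in> forms {..n} (d + d')" by (intro forms_mult * a)
  show "peval (G * G') w ~= 0" using *(2) a(4) by simp
  show "basic (G * G') \<subseteq> U" using *(3) by (auto simp: basic_mult)
  fix j assume j: "j \<in> insert i J"
  show "EX e. ?F j \<in> forms {..n} e & int e = int (d + d') + k"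
  proof (cases "j = i")
   case True
   then show ?thesis using forms_mult[OF *(1) a(1)] a(3) by (intro exI[of _ "d + e'"]) simp
  next
   case False
   then obtain e where "F j \<in> forms {..n} e" "int e = int d + k" using *(4) j by blast
   then show ?thesis using forms_mult[OF _ a(2)] False by (intro exI[of _ "e + d'"]) simp
  qed
  fix v assume v: "v \<in> cone X"
  show "peval (?F j) v = peval (G * G') v * h j v"
   using *(5) a(6) j v by (cases "j = i") auto
 qed
qed

end

context matrix_factorization
begin

text \<open>The kernel of \<open>A\<close> on vectors of functions of degree 2. This is the degree
  of the entries of \<open>B\<close>, so the columns of \<open>B\<close> are sections and the module
  of twisted sections is generated in degree 0. The value 0 off the cone and from index 27 on makes
  sections with the same values equal.\<close>

definition Esec :: "nat point set => section_type set" where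
 "Esec U = {s. (ALL v i. 27 \<le> i --> s v i = 0) & (\<forall>i<27. hreg 2 U (%v. s v i)) &
  (ALL v. \<forall>i<27. (\<Sum>j<27. peval (A i j) v * s v j) = 0)}"

definition E :: "section_type modsheaf" where
 "E = \<lparr>sections = (%U. \<lparr>carrier = Esec U, mult = undefined, one = undefined, zero = (%_ _. 0),
  add = (%s t v i. s v i + t v i), module.smult = (%a s v i. a (proj_class v) * s v i)\<rparr>),
 restr = (%U V s v i. if v \<in> cone V then s v i else 0)\<rparr>"

lemma E_simps [simp]:
 "carrier (sections E U) = Esec U" "\<zero>\<^bsub>sections E U\<^esub> = (%_ _. 0)"
 "s \<oplus>\<^bsub>sections E U\<^esub> t = (%v i. s v i + t v i)"
 "a \<odot>\<^bsub>sections E U\<^esub> s = (%v i. a (proj_class v) * s v i)"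
 "restr E U V s = (%v i. if v \<in> cone V then s v i else 0)"
 by (simp_all add: E_def)

lemma EsecI:
 assumes "!!v i. 27 \<le> i ==> s v i = 0" "!!i. i < 27 ==> hreg 2 U (%v. s v i)"
  "!!v i. i < 27 ==> (\<Sum>j<27. peval (A i j) v * s v j) = 0"
 shows "s \<in> Esec U"
 using assms by (simp add: Esec_def)

lemma Esec_high: "s \<in> Esec U ==> 27 \<le> i ==> s v i = 0"
 and Esec_hreg: "s \<in> Esec U ==> i < 27 ==> hreg 2 U (%v. s v i)"
 and Esec_kernel: "s \<in> Esec U ==> i < 27 ==> (\<Sum>j<27. peval (A i j) v * s v j) = 0"
 by (simp_all add: Esec_def)

lemma Esec_out: "s \<in> Esec U ==> v \<notin> cone U ==> s v i = 0"
 using Esec_high hreg_out[OF Esec_hreg] by (cases "i < 27") auto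

lemma Esec_add: assumes "s \<in> Esec U" "t \<in> Esec U" shows "(%v i. s v i + t v i) \<in> Esec U"
proof (rule EsecI)
 show "s v i + t v i = 0" if "27 \<le> i" for v i using Esec_high[OF assms(1) that] Esec_high[OF assms(2) that] by simp
 show "hreg 2 U (%v. s v i + t v i)" if "i < 27" for i by (intro hreg_add Esec_hreg assms that)
 show "(\<Sum>j<27. peval (A i j) v * (s v j + t v j)) = 0" if "i < 27" for v i
  using Esec_kernel[OF assms(1) that, of v] Esec_kernel[OF assms(2) that, of v] by (simp add: distrib_left sum.distrib)
qed

lemma Esec_mult:
 assumes "s \<in> Esec U" "hreg 0 U g" shows "(%v i. g v * s v i) \<in> Esec U"
proof (rule EsecI)
 show "g v * s v i = 0" if "27 \<le> i" for v i using Esec_high[OF assms(1) that] by simp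
 show "hreg 2 U (%v. g v * s v i)" if "i < 27" for i
  using hreg_mult[OF assms(2) Esec_hreg[OF assms(1) that]] by simp
 show "(\<Sum>j<27. peval (A i j) v * (g v * s v j)) = 0" if "i < 27" for v i
  using Esec_kernel[OF assms(1) that, of v] by (simp add: mult.left_commute flip: sum_distrib_left)
qed

lemma smult_lift:
 assumes "s \<in> Esec U" "U \<subseteq> X"
 shows "(%v i. a (proj_class v) * s v i) = (%v i. lift a v * s v i)"
proof (intro ext)
 fix v i show "a (proj_class v) * s v i = lift a v * s v i"
  using Esec_out[OF assms(1), of v i] assms(2) by (cases "v \<in> cone X") (auto simp: lift_def)
qed

lemma Esec_smult:
 assumes "zar_open n X U" "a \<in> carrier (reg n X U)" "s \<in> Esec U" shows "(%v i. a (proj_class v) * s v i) \<in> Esec U"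
 unfolding smult_lift[OF assms(3) zar_open_subset[OF assms(1)]]
 by (rule Esec_mult[OF assms(3) reg_hreg[OF assms(1,2)]])

lemma Esec_zero: "zar_open n X U ==> (%_ _. 0) \<in> Esec U"
 by (rule EsecI) (auto intro: hreg_zero)

lemma abelian_group_sections:
 assumes U: "zar_open n X U" shows "abelian_group (sections E U)"
proof (rule abelian_groupI)
 fix s assume s: "s \<in> carrier (sections E U)"
 have "hreg 0 U (%v. if v \<in> cone U then peval (Const (-1)) v else 0)" using hreg_form[OF U forms_Const] by simp
 then have "(%v i. (if v \<in> cone U then peval (Const (-1)) v else 0) * s v i) \<in> Esec U"
  using s by (intro Esec_mult) simp_all
 moreover have "(if v \<in> cone U then peval (Const (-1)) v else 0) * s v i + s v i = 0" for v i
  using Esec_out[of s U v i] s by simp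
 ultimately show "\<exists>t\<in>carrier (sections E U). t \<oplus>\<^bsub>sections E U\<^esub> s = \<zero>\<^bsub>sections E U\<^esub>"
  by (intro bexI[of _ "%v i. (if v \<in> cone U then peval (Const (-1)) v else 0) * s v i"]) (simp_all add: fun_eq_iff)
qed (auto simp: fun_eq_iff Esec_zero[OF U] intro: Esec_add)

lemma module_sections:
 assumes U: "zar_open n X U" shows "Module.module (reg n X U) (sections E U)"
proof (rule moduleI)
 show "\<one>\<^bsub>reg n X U\<^esub> \<odot>\<^bsub>sections E U\<^esub> s = s" if s: "s \<in> carrier (sections E U)" for s
 proof -
  have "restrict0 U (%_. 1) (proj_class v) * s v i = s v i" for v i
   using Esec_out[of s U v i] s class_in[OF zar_open_subset[OF U], of v] by (cases "v \<in> cone U") (auto simp: restrict0_def)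
  then show ?thesis by (simp add: reg_simps fun_eq_iff)
 qed
qed (use Esec_smult[OF U] in \<open>auto simp: cring_reg[OF U] abelian_group_sections[OF U] reg_simps fun_eq_iff algebra_simps\<close>)

lemma Esec_restrict:
 assumes "s \<in> Esec U" "zar_open n X V" "V \<subseteq> U" shows "(%v i. if v \<in> cone V then s v i else 0) \<in> Esec V"
proof (rule EsecI)
 show "(if v \<in> cone V then s v i else 0) = 0" if "27 \<le> i" for v i using Esec_high[OF assms(1) that] by simp
 show "hreg 2 V (%v. if v \<in> cone V then s v i else 0)" if "i < 27" for i
  by (intro hreg_restrict[OF Esec_hreg[OF assms(1) that]] assms)
 show "(\<Sum>j<27. peval (A i j) v * (if v \<in> cone V then s v j else 0)) = 0" if "i < 27" for v i
  using Esec_kernel[OF assms(1) that, of v] by (cases "v \<in> cone V") simp_all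
qed

lemma cone_Int: assumes UV: "U \<subseteq> X" "V \<subseteq> X" shows "cone (U \<inter> V) = cone U \<inter> cone V"
proof (rule Set.set_eqI)
 fix v from UV have "U \<inter> V \<subseteq> X" by blast
 from class_in[OF this, of v] class_in[OF UV(1), of v] class_in[OF UV(2), of v]
 show "v \<in> cone (U \<inter> V) \<longleftrightarrow> v \<in> cone U \<inter> cone V" by auto
qed

lemma cone_mono: "V \<subseteq> U ==> v \<in> cone V ==> v \<in> cone U"
 by (auto simp: cone_def)

theorem module_sheaf_E: "module_sheaf n X E"
proof (rule module_sheaf.intro)
 fix U assume U: "zar_open n X U"
 show "Module.module (reg n X U) (sections E U)" by (rule module_sections[OF U])
next
 fix U V :: "nat point set" and s assume "zar_open n X V" "V \<subseteq> U" "s \<in> carrier (sections E U)"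
 then show "restr E U V s \<in> carrier (sections E V)" using Esec_restrict by simp
next
 fix U V :: "nat point set" and s t
 show "restr E U V (s \<oplus>\<^bsub>sections E U\<^esub> t) = restr E U V s \<oplus>\<^bsub>sections E V\<^esub> restr E U V t"
  by (simp add: fun_eq_iff)
next
 fix U V :: "nat point set" and a s assume V: "zar_open n X V"
 show "restr E U V (a \<odot>\<^bsub>sections E U\<^esub> s) = restrict0 V a \<odot>\<^bsub>sections E V\<^esub> restr E U V s"
  using class_in[OF zar_open_subset[OF V]] by (auto simp: fun_eq_iff restrict0_def)
next
 fix U :: "nat point set" and s assume "s \<in> carrier (sections E U)"
 then show "restr E U U s = s"
  using Esec_out[of s U] by (auto simp: fun_eq_iff)
next
 fix U V W :: "nat point set" and s assume "W \<subseteq> V"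
 then show "restr E V W (restr E U V s) = restr E U W s"
  using cone_mono by (auto simp: fun_eq_iff)
next
 fix C and g :: "nat point set => section_type"
 assume C: "!!U. U \<in> C ==> zar_open n X U" and g: "!!U. U \<in> C ==> g U \<in> carrier (sections E U)"
  and agree: "!!U V. U \<in> C ==> V \<in> C ==> restr E U (U \<inter> V) (g U) = restr E V (U \<inter> V) (g V)"
 have gU: "g U \<in> Esec U" if "U \<in> C" for U using g[OF that] by simp
 have ag: "g U v = g V v" if UV: "U \<in> C" "V \<in> C" "v \<in> cone U" "v \<in> cone V" for U V v
 proof -
  have "v \<in> cone (U \<inter> V)" using cone_Int[OF zar_open_subset[OF C[OF UV(1)]] zar_open_subset[OF C[OF UV(2)]]] UV by blast
  moreover have "(if v \<in> cone (U \<inter> V) then g U v i else 0) = (if v \<in> cone (U \<inter> V) then g V v i else 0)" for i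
   using fun_cong[OF fun_cong[OF agree[OF UV(1,2)], of v], of i] by simp
  ultimately show ?thesis by (simp add: fun_eq_iff)
 qed
 \<comment> \<open>Any member of the cover over which the vector lies; by \<open>ag\<close> the
   glued value is the same for all of them.\<close>
 define pick where "pick v = (SOME U. U \<in> C & v \<in> cone U)" for v
 have pick: "pick v \<in> C" "v \<in> cone (pick v)" if "v \<in> cone (\<Union>C)" for v
 proof -
  have "EX U. U \<in> C & v \<in> cone U" using that by blast
  from someI_ex[OF this] show "pick v \<in> C" "v \<in> cone (pick v)" by (simp_all add: pick_def)
 qed
 define s where "s v i = (if v \<in> cone (\<Union>C) then g (pick v) v i else 0)" for v i
 have s_eq: "s v i = g U v i" if Uv: "U \<in> C" "v \<in> cone U" for U v i
 proof -
  have "v \<in> cone (\<Union>C)" using Uv by blast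
  then show ?thesis using ag[OF pick(1) Uv(1) pick(2) Uv(2)] by (simp add: s_def)
 qed
 have restr_s: "(%v i. if v \<in> cone U then s v i else 0) = g U" if UC: "U \<in> C" for U
  using s_eq[OF UC] Esec_out[OF gU[OF UC]] by (auto simp: fun_eq_iff)
 have sE: "s \<in> Esec (\<Union>C)"
 proof (rule EsecI)
  show "s v i = 0" if "27 \<le> i" for v i using Esec_high[OF gU[OF pick(1)] that] by (simp add: s_def)
  show "(\<Sum>j<27. peval (A i j) v * s v j) = 0" if "i < 27" for v i
   using Esec_kernel[OF gU[OF pick(1)] that] by (cases "v \<in> cone (\<Union>C)") (simp_all add: s_def)
  show "hreg 2 (\<Union>C) (%v. s v i)" if i: "i < 27" for i
  proof (rule hreg_local[OF C])
   show "s v i = 0" if "v \<notin> cone (\<Union>C)" for v using that by (simp add: s_def)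
   fix U assume UC: "U \<in> C"
   have "(%v. if v \<in> cone U then s v i else 0) = (%v. g U v i)"
    using restr_s[OF UC] by (simp add: fun_eq_iff)
   then show "hreg 2 U (%v. if v \<in> cone U then s v i else 0)" using Esec_hreg[OF gU[OF UC] i] by simp
  qed
 qed
 have uniq: "t = s" if t: "t \<in> Esec (\<Union>C)" "\<forall>U\<in>C. (%v i. if v \<in> cone U then t v i else 0) = g U" for t
 proof (intro ext)
  fix v i show "t v i = s v i"
  proof (cases "v \<in> cone (\<Union>C)")
   case True
   have "(if v \<in> cone (pick v) then t v i else 0) = g (pick v) v i"
    using fun_cong[OF fun_cong[OF bspec[OF t(2) pick(1)[OF True]], of v], of i] .
   then show ?thesis using True pick[OF True] by (simp add: s_def)
  qed (use Esec_out[OF t(1), of v i] s_def in simp)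
 qed
 show "\<exists>!s. s \<in> carrier (sections E (\<Union>C)) & (\<forall>U\<in>C. restr E (\<Union>C) U s = g U)"
 proof (rule ex1I[of _ s])
  show "s \<in> carrier (sections E (\<Union>C)) & (\<forall>U\<in>C. restr E (\<Union>C) U s = g U)"
   using sE by (simp add: restr_s)
  fix t assume "t \<in> carrier (sections E (\<Union>C)) & (\<forall>U\<in>C. restr E (\<Union>C) U t = g U)"
  then have "t \<in> Esec (\<Union>C)" "\<forall>U\<in>C. (%v i. if v \<in> cone U then t v i else 0) = g U" by simp_all
  then show "t = s" by (rule uniq)
 qed
qed

lemma lincomb_eval:
 assumes U: "zar_open n X U" and "!!i. i < k ==> a i \<in> carrier (reg n X U)" "!!i. i < k ==> s i \<in> Esec U"
 shows "lincomb (sections E U) k a s v j = (\<Sum>i<k. a i (proj_class v) * s i v j)"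
proof -
 have "lincomb (sections E U) k a s v j = (\<Sum>i<k. (a i \<odot>\<^bsub>sections E U\<^esub> s i) v j)"
  unfolding lincomb_def using abelian_group_sections[OF U] Esec_smult[OF U assms(2,3)]
  by (intro finsum_eval[of "sections E U" "{..<k}" _ "%s. s v j"]) (auto simp: abelian_group_def)
 then show ?thesis by simp
qed

end

context good_cubic
begin

lemma common_denominator_ball:
 assumes "zar_open n X U" "w \<in> cone U" "finite J" "\<forall>i\<in>J. hreg k U (h i)"
 shows "EX d G F. G \<in> forms {..n} d & peval G w ~= 0 & basic G \<subseteq> U &
  (\<forall>i\<in>J. EX e. F i \<in> forms {..n} e & int e = int d + k) & (\<forall>i\<in>J. \<forall>v\<in>cone X. peval (F i) v = peval G v * h i v)"
 by (rule common_denominator[OF assms(1-3)]) (rule assms(4)[rule_format])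

lemma cone_chart: "l \<le> n ==> v \<in> cone (chart n X l) \<longleftrightarrow> v \<in> cone X & v l ~= 0"
proof -
 assume l: "l \<le> n"
 have "Var l \<in> forms {..n} 1" using l by (intro forms_Var) simp
 note form_nonzero_class[OF this, of v]
 moreover have "v \<in> cone (basic (Var l)) \<longleftrightarrow> v \<in> cone X & proj_class v \<in> basic (Var l)"
  by (rule class_in) (auto simp: basic_def)
 moreover have "peval (Var l) v = v l" by (simp add: meval_single del: One_nat_def)
 ultimately show ?thesis unfolding chart_basic[OF l] by auto
qed

text \<open>Each component is divided by its power of \<open>x l\<close>. This admits polynomials
  that are not homogeneous, such as the generators delivered by
  \<open>hilbert_basis\<close>.\<close>

lemma hreg_dehom:
 assumes p: "p \<in> polys {..n}" and l: "l \<le> n"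
 shows "hreg 0 (chart n X l) (%v. if v \<in> cone (chart n X l) then peval p (%i. v i / v l) else 0)"
proof -
 let ?U = "chart n X l" and ?S = "mdeg ` keys p"
 have U: "zar_open n X ?U" by (rule zar_open_chart[OF l])
 have "hreg 0 ?U (%v. \<Sum>e\<in>?S. if v \<in> cone ?U then peval (hcomp e p) v / peval (Var l ^ e) v else 0)"
 proof (rule hreg_sum[OF U])
  fix e
  have "Var l ^ e \<in> forms {..n} e" using forms_power[OF forms_Var, of l "{..n}" e] l by simp
  then show "hreg 0 ?U (%v. if v \<in> cone ?U then peval (hcomp e p) v / peval (Var l ^ e) v else 0)"
   by (intro hreg_quotient[OF U hcomp_forms[OF p]]) (use cone_chart[OF l] in \<open>simp_all add: meval_single del: One_nat_def\<close>)
 qed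
 moreover have "(%v. \<Sum>e\<in>?S. if v \<in> cone ?U then peval (hcomp e p) v / peval (Var l ^ e) v else 0)
  = (%v. if v \<in> cone ?U then peval p (%i. v i / v l) else 0)"
 proof
  fix v :: "nat => complex"
  show "(\<Sum>e\<in>?S. if v \<in> cone ?U then peval (hcomp e p) v / peval (Var l ^ e) v else 0)
   = (if v \<in> cone ?U then peval p (%i. v i / v l) else 0)"
  proof (cases "v \<in> cone ?U")
   case True
   have "peval p (%i. v i / v l) = (\<Sum>e\<in>?S. peval (hcomp e p) (%i. inverse (v l) * v i))"
    by (subst sum_hcomp[of ?S p, symmetric]) (simp_all only: peval_sum finite_imageI finite_keys order_refl divide_inverse mult.commute)
   also have "\<dots> = (\<Sum>e\<in>?S. peval (hcomp e p) v / peval (Var l ^ e) v)"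
    by (intro sum.cong refl, subst peval_scale[OF hcomp_forms[OF p]]) (simp add: meval_single field_simps del: One_nat_def)
   finally show ?thesis using True by simp
  qed simp
 qed
 ultimately show ?thesis by (rule back_subst)
qed

end

context matrix_factorization
begin

definition column :: "nat => section_type" where
 "column k v i = (if i < 27 & v \<in> cone X then peval (B i k) v else 0)"

lemma column_in: "k < 27 ==> column k \<in> Esec X"
proof (rule EsecI)
 assume k: "k < 27"
 show "hreg 2 X (%v. column k v i)" if "i < 27" for i
  using hreg_form[OF zar_open_X B_form, of i k] that by (simp add: column_def)
 show "(\<Sum>j<27. peval (A i j) v * column k v j) = 0" if i: "i < 27" for v i
 proof (cases "v \<in> cone X")
  case True
  have "(\<Sum>j<27. peval (A i j) v * column k v j) = peval (\<Sum>j<27. A i j * B j k) v"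
   unfolding peval_sum using True by (intro sum.cong refl) (simp add: column_def)
  then show ?thesis using AB[OF i k] cone_f[OF True] by simp
 qed (simp add: column_def)
qed (simp add: column_def)

lemma form_kernel_image:
 assumes F: "!!i. i < 27 ==> F i \<in> forms {..n} (d + 2)"
  and van: "!!i v. i < 27 ==> v \<in> cone X ==> (\<Sum>j<27. peval (A i j) v * peval (F j) v) = 0"
 shows "EX q. (ALL k. q k \<in> forms {..n} d) & (\<forall>i<27. F i = mulvec B q i)"
proof -
 have 1: "!!i. i < 27 ==> F i \<in> polys {..n}" using F forms_polys by blast
 have 2: "peval (mulvec A F i) v = 0" if "i < 27" "v \<in> cone X" for i v
  using van[OF that] by (simp add: mulvec_def peval_sum)
 obtain q where q: "ALL k. q k \<in> polys {..n}" "\<forall>i<27. F i = mulvec B q i"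
 proof -
  have "EX q. (ALL k. q k \<in> polys {..n}) & (\<forall>i<27. F i = mulvec B q i)" by (rule kernel_A_image_B[OF 1 2])
  then show thesis using that by (elim exE conjE)
 qed
 have "F i = mulvec B (%k. hcomp d (q k)) i" if i: "i < 27" for i
 proof -
  have "F i = hcomp (2 + d) (F i)" using hcomp_form[OF F[OF i], of "2 + d"] by simp
  also have "\<dots> = hcomp (2 + d) (mulvec B q i)" using q(2) i by simp
  also have "\<dots> = mulvec B (%k. hcomp d (q k)) i" by (rule hcomp_mulvec[OF B_form])
  finally show ?thesis .
 qed
 moreover have "hcomp d (q k) \<in> forms {..n} d" for k by (rule hcomp_forms[OF q(1)[rule_format]])
 ultimately show ?thesis by (intro exI[of _ "%k. hcomp d (q k)"]) simp
qed

text \<open>The columns of \<open>B\<close> generate everywhere: over a common denominator the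
  components of a section become forms annihilated by \<open>A\<close> on the cone, so they are
  \<open>B\<close> times a vector of forms.\<close>

theorem finite_type_E: "finite_type n X E"
 unfolding finite_type_def
proof (intro ballI)
 fix P assume "P \<in> X"
 show "EX U k s. zar_open n X U & P \<in> U & (\<forall>i<k. s i \<in> carrier (sections E U)) &
    (ALL V t Q. zar_open n X V & V \<subseteq> U & t \<in> carrier (sections E V) & Q \<in> V -->
     (EX W a. zar_open n X W & Q \<in> W & W \<subseteq> V & (\<forall>i<k. a i \<in> carrier (reg n X W)) &
       restr E V W t = lincomb (sections E W) k a (%i. restr E U W (s i))))"
 proof (rule exI[of _ X], rule exI[of _ "27 :: nat"], rule exI[of _ column], intro conjI allI impI)
  show "zar_open n X X" "P \<in> X" by (rule zar_open_X) fact
  show "column i \<in> carrier (sections E X)" if "i < 27" for i using column_in[OF that] by simp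
 next
  fix V t Q assume "zar_open n X V & V \<subseteq> X & t \<in> carrier (sections E V) & Q \<in> V"
  then have V: "zar_open n X V" "t \<in> carrier (sections E V)" "Q \<in> V" by blast+
  have t: "t \<in> Esec V" using V(2) by simp
  have VX: "V \<subseteq> X" by (rule zar_open_subset[OF V(1)])
  then obtain w where w: "w \<in> cone X" "Q = proj_class w" using point_cone V(3) by blast
  then have wV: "w \<in> cone V" using class_in[OF VX] V(3) by blast
  have ht: "\<forall>i\<in>{..<27}. hreg 2 V (%v. t v i)" using Esec_hreg[OF t] by simp
  from common_denominator_ball[OF V(1) wV finite_lessThan ht] obtain d G F where *: "G \<in> forms {..n} d" "peval G w ~= 0" "basic G \<subseteq> V"
   "\<forall>i\<in>{..<27}. EX e. F i \<in> forms {..n} e & int e = int d + 2" "\<forall>i\<in>{..<27}. \<forall>v\<in>cone X. peval (F i) v = peval G v * t v i"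
   by (elim exE conjE)
  have F: "F i \<in> forms {..n} (d + 2)" if "i < 27" for i
  proof -
   obtain e where "F i \<in> forms {..n} e" "int e = int d + 2" using *(4) \<open>i < 27\<close> by auto
   moreover from this have "e = d + 2" by linarith
   ultimately show ?thesis by simp
  qed
  have van: "(\<Sum>j<27. peval (A i j) v * peval (F j) v) = 0" if "i < 27" "v \<in> cone X" for i v
  proof -
   have "(\<Sum>j<27. peval (A i j) v * peval (F j) v) = peval G v * (\<Sum>j<27. peval (A i j) v * t v j)"
    unfolding sum_distrib_left using *(5) \<open>v \<in> cone X\<close> by (intro sum.cong refl) simp
   then show ?thesis using Esec_kernel[OF t \<open>i < 27\<close>, of v] by simp
  qed
  obtain q where q: "ALL k. q k \<in> forms {..n} d" "\<forall>i<27. F i = mulvec B q i"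
  proof -
   have "EX q. (ALL k. q k \<in> forms {..n} d) & (\<forall>i<27. F i = mulvec B q i)" by (rule form_kernel_image[OF F van])
   then show thesis using that by (elim exE conjE)
  qed
  define W where "W = basic G"
  have W: "zar_open n X W" unfolding W_def by (rule zar_open_basic[OF *(1)])
  have WX: "W \<subseteq> X" by (rule zar_open_subset[OF W])
  have G0: "peval G v ~= 0" if "v \<in> cone W" for v using that by (auto simp: W_def basic_def)
  define h where "h k v = (if v \<in> cone W then peval (q k) v / peval G v else 0)" for k v
  have h: "hreg 0 W (h k)" for k
   unfolding h_def[abs_def] by (rule hreg_quotient[OF W q(1)[rule_format] *(1)]) (use G0 in simp_all)
  let ?a = "%k. fun_on W (h k)"
  have a: "?a k \<in> carrier (reg n X W)" for k by (rule lift_fun_on(2)[OF W h])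
  have r: "restr E X W (column k) \<in> Esec W" if "k < 27" for k
   using Esec_restrict[OF column_in[OF that] W WX] by simp
  show "EX W a. zar_open n X W & Q \<in> W & W \<subseteq> V & (\<forall>i<27. a i \<in> carrier (reg n X W)) &
       restr E V W t = lincomb (sections E W) 27 a (%i. restr E X W (column i))"
  proof (rule exI[of _ W], rule exI[of _ ?a], intro conjI allI impI a W)
   show "Q \<in> W" unfolding W_def w(2) using form_nonzero_class[OF *(1) w(1)] *(2) by simp
   show "W \<subseteq> V" using *(3) W_def by simp
   show "restr E V W t = lincomb (sections E W) 27 ?a (%i. restr E X W (column i))"
   proof (intro ext)
    fix v i
    have L: "lincomb (sections E W) 27 ?a (%i. restr E X W (column i)) v i = (\<Sum>k<27. ?a k (proj_class v) * restr E X W (column k) v i)"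
     by (rule lincomb_eval[OF W a r])
    show "restr E V W t v i = lincomb (sections E W) 27 ?a (%i. restr E X W (column i)) v i"
    proof (cases "v \<in> cone W & i < 27")
     case True
     then have v: "v \<in> cone W" "v \<in> cone X" "i < 27" using cone_mono[OF WX] by auto
     have av: "?a k (proj_class v) = peval (q k) v / peval G v" for k
      using fun_cong[OF lift_fun_on(1)[OF W h, of k], of v] v by (simp add: lift_def h_def)
     have "peval G v * t v i = peval (F i) v" using *(5) v by simp
     also have "\<dots> = (\<Sum>k<27. peval (B i k) v * peval (q k) v)" using q(2) v(3) by (simp add: mulvec_def peval_sum)
     finally have "t v i = (\<Sum>k<27. peval (B i k) v * peval (q k) v) / peval G v" using G0[OF v(1)] by (simp add: field_simps)
     also have "\<dots> = (\<Sum>k<27. ?a k (proj_class v) * restr E X W (column k) v i)"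
      unfolding sum_divide_distrib av using v by (intro sum.cong refl) (simp add: column_def)
     finally show ?thesis unfolding L using v by simp
    next
     case False
     then have "restr E X W (column k) v i = 0" for k by (auto simp: column_def)
     moreover have "restr E V W t v i = 0" using False Esec_high[OF t, of i v] by auto
     ultimately show ?thesis unfolding L by (simp del: E_simps)
    qed
   qed
  qed
 qed
qed

end

context matrix_factorization
begin

context
 fixes U and m :: nat and s :: "nat => section_type"
 assumes U: "zar_open n X U" and s: "!!i. i < m ==> s i \<in> Esec U"
begin

definition R where "R = relation_sheaf n U E m s"

lemma R_simps:
 "\<zero>\<^bsub>sections R V\<^esub> = (\<lambda>i\<in>{..<m}. %_. 0)"
 "a \<oplus>\<^bsub>sections R V\<^esub> b = (\<lambda>i\<in>{..<m}. %P. a i P + b i P)"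
 "r \<odot>\<^bsub>sections R V\<^esub> a = (\<lambda>i\<in>{..<m}. %P. r P * a i P)"
 "restr R V W a = (\<lambda>i\<in>{..<m}. restrict0 W (a i))"
 by (simp_all add: R_def relation_sheaf_def)

text \<open>An equation between sections is tested at the vectors of the cone over \<open>V\<close>
  in the first 27 coordinates; elsewhere all sections are 0.\<close>

lemma R_carrier:
 assumes V: "zar_open n X V" "V \<subseteq> U"
 shows "a \<in> carrier (sections R V) \<longleftrightarrow> a \<in> {..<m} \<rightarrow>\<^sub>E carrier (reg n X V) &
  (\<forall>v\<in>cone V. \<forall>j<27. (\<Sum>i<m. a i (proj_class v) * s i v j) = 0)"
proof -
 have "lincomb (sections E V) m a (%i. restr E U V (s i)) = \<zero>\<^bsub>sections E V\<^esub> \<longleftrightarrow>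
   (\<forall>v\<in>cone V. \<forall>j<27. (\<Sum>i<m. a i (proj_class v) * s i v j) = 0)"
  if a: "a \<in> {..<m} \<rightarrow>\<^sub>E carrier (reg n X V)"
 proof -
  have ai: "a i \<in> carrier (reg n X V)" if "i < m" for i using a that by auto
  have si: "(%v j. if v \<in> cone V then s i v j else 0) \<in> Esec V" if "i < m" for i
   by (rule Esec_restrict[OF s[OF that] V])
  have L: "lincomb (sections E V) m a (%i. restr E U V (s i)) v j = (\<Sum>i<m. a i (proj_class v) * (if v \<in> cone V then s i v j else 0))" for v j
   using lincomb_eval[OF V(1) ai si] by simp
  have "lincomb (sections E V) m a (%i. restr E U V (s i)) = (%_ _. 0) \<longleftrightarrow>
   (ALL v j. (\<Sum>i<m. a i (proj_class v) * (if v \<in> cone V then s i v j else 0)) = 0)"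
   unfolding fun_eq_iff L ..
  also have "\<dots> \<longleftrightarrow> (\<forall>v\<in>cone V. \<forall>j<27. (\<Sum>i<m. a i (proj_class v) * s i v j) = 0)"
  proof (intro iffI ballI allI impI)
   fix v j assume "ALL v j. (\<Sum>i<m. a i (proj_class v) * (if v \<in> cone V then s i v j else 0)) = 0" "v \<in> cone V"
   from this(1)[rule_format, of v j] this(2) show "(\<Sum>i<m. a i (proj_class v) * s i v j) = 0" by simp
  next
   fix v j assume *: "\<forall>v\<in>cone V. \<forall>j<27. (\<Sum>i<m. a i (proj_class v) * s i v j) = 0"
   show "(\<Sum>i<m. a i (proj_class v) * (if v \<in> cone V then s i v j else 0)) = 0"
   proof (cases "v \<in> cone V & j < 27")
    case True
    then show ?thesis using *[rule_format, of v j] by simp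
   next
    case False
    then have "(if v \<in> cone V then s i v j else 0) = 0" if "i < m" for i using Esec_high[OF s[OF that], of j v] by auto
    then show ?thesis by (intro sum.neutral) simp
   qed
  qed
  finally show ?thesis by simp
 qed
 then show ?thesis by (auto simp: R_def relation_sheaf_def reg_in[OF U V(2)])
qed

lemma R_mem:
 assumes "zar_open n X V" "V \<subseteq> U" "a \<in> carrier (sections R V)"
 shows "i < m ==> a i \<in> carrier (reg n X V)" "\<not> i < m ==> a i = undefined"
  "v \<in> cone V ==> j < 27 ==> (\<Sum>i<m. a i (proj_class v) * s i v j) = 0"
 using assms(3) unfolding R_carrier[OF assms(1,2)] by (auto simp: PiE_def extensional_def)

lemma R_memI:
 assumes V: "zar_open n X V" "V \<subseteq> U" "!!i. i < m ==> a i \<in> carrier (reg n X V)"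
  "!!v j. v \<in> cone V ==> j < 27 ==> (\<Sum>i<m. a i (proj_class v) * s i v j) = 0"
 shows "(\<lambda>i\<in>{..<m}. a i) \<in> carrier (sections R V)"
 unfolding R_carrier[OF V(1,2)] using V(3,4) by auto

lemma R_smult:
 assumes V: "zar_open n X V" "V \<subseteq> U" and r: "r \<in> carrier (reg n X V)" and a: "a \<in> carrier (sections R V)"
 shows "r \<odot>\<^bsub>sections R V\<^esub> a \<in> carrier (sections R V)"
 unfolding R_simps
proof (rule R_memI[OF V])
 show "(%P. r P * a i P) \<in> carrier (reg n X V)" if "i < m" for i
  using cring.cring_simprules(5)[OF cring_reg[OF V(1)] r R_mem(1)[OF V a that]] by (simp add: reg_simps)
 show "(\<Sum>i<m. r (proj_class v) * a i (proj_class v) * s i v j) = 0" if "v \<in> cone V" "j < 27" for v j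
  using R_mem(3)[OF V a that] by (simp add: mult.assoc flip: sum_distrib_left)
qed

lemma R_abelian_monoid:
 assumes V: "zar_open n X V" "V \<subseteq> U" shows "abelian_monoid (sections R V)"
proof (rule abelian_monoidI)
 show "a \<oplus>\<^bsub>sections R V\<^esub> b \<in> carrier (sections R V)" if ab: "a \<in> carrier (sections R V)" "b \<in> carrier (sections R V)" for a b
  unfolding R_simps
 proof (rule R_memI[OF V])
  show "(%P. a i P + b i P) \<in> carrier (reg n X V)" if "i < m" for i
   using cring.cring_simprules(1)[OF cring_reg[OF V(1)] R_mem(1)[OF V ab(1) that] R_mem(1)[OF V ab(2) that]] by (simp add: reg_simps)
  show "(\<Sum>i<m. (a i (proj_class v) + b i (proj_class v)) * s i v j) = 0" if "v \<in> cone V" "j < 27" for v j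
   using R_mem(3)[OF V ab(1) that] R_mem(3)[OF V ab(2) that] by (simp add: distrib_right sum.distrib)
 qed
 show "\<zero>\<^bsub>sections R V\<^esub> \<in> carrier (sections R V)"
  unfolding R_simps by (rule R_memI[OF V]) (use cring.cring_simprules(2)[OF cring_reg[OF V(1)]] in \<open>simp_all add: reg_simps\<close>)
 show "\<zero>\<^bsub>sections R V\<^esub> \<oplus>\<^bsub>sections R V\<^esub> a = a" if "a \<in> carrier (sections R V)" for a
  using R_mem(2)[OF V that] by (auto simp: R_simps fun_eq_iff)
qed (auto simp: R_simps fun_eq_iff)

lemma R_lincomb:
 assumes V: "zar_open n X V" "V \<subseteq> U" and b: "!!g. g < k ==> b g \<in> carrier (reg n X V)"
  and t: "!!g. g < k ==> t g \<in> carrier (sections R V)"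
 shows "lincomb (sections R V) k b t = (\<lambda>i\<in>{..<m}. %P. \<Sum>g<k. b g P * t g i P)"
proof (rule ext)
 fix i
 have c: "b g \<odot>\<^bsub>sections R V\<^esub> t g \<in> carrier (sections R V)" if "g \<in> {..<k}" for g
  using R_smult[OF V b t] that by simp
 show "lincomb (sections R V) k b t i = (\<lambda>i\<in>{..<m}. %P. \<Sum>g<k. b g P * t g i P) i"
 proof (cases "i < m")
  case True
  have "lincomb (sections R V) k b t i P = (\<Sum>g<k. b g P * t g i P)" for P
  proof -
   have "lincomb (sections R V) k b t i P = (\<Sum>g<k. (b g \<odot>\<^bsub>sections R V\<^esub> t g) i P)"
    unfolding lincomb_def
    by (rule finsum_eval[OF R_abelian_monoid[OF V], of "{..<k}" _ "%a. a i P"]) (use c True in \<open>simp_all add: R_simps\<close>)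
   then show ?thesis using True by (simp add: R_simps)
  qed
  then show ?thesis using True by (simp add: fun_eq_iff)
 next
  case False
  \<comment> \<open>Beyond \<open>m\<close> the value is \<open>undefined\<close>; this is read off
    from membership in the carrier.\<close>
  have "lincomb (sections R V) k b t \<in> carrier (sections R V)"
   unfolding lincomb_def by (rule finsum_in[OF R_abelian_monoid[OF V] c])
  then show ?thesis using R_mem(2)[OF V _ False] False by simp
 qed
qed

text \<open>Near a point, the relations between the sections are those between the numerators of their
 components over a common denominator, and the latter form a finitely generated module.\<close>

theorem finite_type_relations: "finite_type n U R"
 unfolding finite_type_def
proof (intro ballI)
 have UX: "U \<subseteq> X" by (rule zar_open_subset[OF U])
 fix P assume P: "P \<in> U"
 then obtain w where w: "w \<in> cone X" "P = proj_class w" using point_cone UX by blast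
 then have wU: "w \<in> cone U" using class_in[OF UX] P by blast
 define J where "J = {..<m} \<times> {..<27::nat}"
 have "finite J" by (simp add: J_def)
 have hs: "\<forall>x\<in>J. hreg 2 U ((%(i, j) v. s i v j) x)"
  using Esec_hreg[OF s] by (auto simp: J_def)
 from common_denominator_ball[OF U wU \<open>finite J\<close> hs] obtain d G F where G: "G \<in> forms {..n} d" "peval G w ~= 0" "basic G \<subseteq> U"
  "\<forall>x\<in>J. EX e. F x \<in> forms {..n} e & int e = int d + 2" "\<forall>x\<in>J. \<forall>v\<in>cone X. peval (F x) v = peval G v * (%(i, j) v. s i v j) x v"
  by (elim exE conjE)
 have F: "F (i, j) \<in> forms {..n} (d + 2)" if ij: "i < m" "j < 27" for i j
 proof -
  have "(i, j) \<in> J" using ij by (simp add: J_def)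
  then obtain e where "F (i, j) \<in> forms {..n} e" "int e = int d + 2" using G(4) by blast
  moreover from this have "e = d + 2" by linarith
  ultimately show ?thesis by simp
 qed
 have Fs: "peval (F (i, j)) v = peval G v * s i v j" if "i < m" "j < 27" "v \<in> cone X" for i j v
  using G(5) that by (auto simp: J_def)
 obtain l where l: "l \<le> n" "w l ~= 0" using w(1) unfolding cone_iff on_cone_def by blast
 define U' where "U' = basic G \<inter> chart n X l"
 have U': "zar_open n X U'" unfolding U'_def by (intro zar_open_Int zar_open_basic[OF G(1)] zar_open_chart l)
 have U'U: "U' \<subseteq> U" using G(3) by (auto simp: U'_def)
 have U'X: "U' \<subseteq> X" using U'U UX by blast
 have PU': "P \<in> U'"
  unfolding U'_def using form_nonzero_class[OF G(1) w(1)] G(2) w l cone_chart[OF l(1), of w]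
   class_in[of "chart n X l" w] by (auto simp: chart_def)
 have U'_cone: "v \<in> cone X" "v l ~= 0" "peval G v ~= 0" if "v \<in> cone U'" for v
  using that by (auto simp: U'_def basic_def chart_def)
 define M where "M = {p. (\<forall>i<m. p i \<in> polys {..n}) & (\<forall>j<27. \<forall>v\<in>cone X. (\<Sum>i<m. peval (p i) v * peval (F (i, j)) v) = 0)}"
 obtain Gs where Gs: "finite Gs" "Gs \<subseteq> M" "!!p. p \<in> M ==> generated n m Gs p"
 proof (rule hilbert_basis[of M m n])
  show "p i \<in> polys {..n}" if "p \<in> M" "i < m" for p i using that by (simp add: M_def)
  fix p q :: "nat => nat mpoly" and c assume *: "p \<in> M" "q \<in> M" "c \<in> polys {..n}"
  show "(%i. p i - c * q i) \<in> M"
   unfolding M_def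
  proof (intro CollectI conjI allI impI ballI)
   show "p i - c * q i \<in> polys {..n}" if "i < m" for i
    using * that by (intro polys_diff polys_mult) (simp_all add: M_def)
   fix j :: nat and v assume jv: "j < 27" "v \<in> cone X"
   have "(\<Sum>i<m. peval (p i - c * q i) v * peval (F (i, j)) v)
    = (\<Sum>i<m. peval (p i) v * peval (F (i, j)) v) - peval c v * (\<Sum>i<m. peval (q i) v * peval (F (i, j)) v)"
    by (simp add: sum_distrib_left sum_subtractf algebra_simps)
   then show "(\<Sum>i<m. peval (p i - c * q i) v * peval (F (i, j)) v) = 0"
    using * jv by (simp add: M_def)
  qed
 next
  fix G assume "finite G" "G \<subseteq> M" "!!p. p \<in> M ==> generated n m G p"
  then show thesis by (rule that)
 qed
 obtain idx where idx: "bij_betw idx {..<card Gs} Gs"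
  using ex_bij_betw_nat_finite[OF Gs(1)] by (auto simp: atLeast0LessThan)
 define k where "k = card Gs"
 have idxM: "idx g \<in> M" if "g < k" for g using idx that Gs(2) by (auto simp: bij_betw_def k_def)
 define hom where "hom W p v = (if v \<in> cone W then peval p (%i. v i / v l) else 0)" for W p and v :: "nat => complex"
 have hom: "hreg 0 W (hom W p)" if W: "zar_open n X W" "W \<subseteq> U'" and p: "p \<in> polys {..n}" for W p
 proof -
  have "W \<subseteq> chart n X l" using W(2) by (auto simp: U'_def)
  from hreg_restrict[OF hreg_dehom[OF p l(1)] W(1) this]
  have "hreg 0 W (%v. if v \<in> cone W then if v \<in> cone (chart n X l) then peval p (%i. v i / v l) else 0 else 0)" .
  moreover have "(%v. if v \<in> cone W then if v \<in> cone (chart n X l) then peval p (%i. v i / v l) else 0 else 0) = hom W p"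
   using cone_mono[OF \<open>W \<subseteq> chart n X l\<close>] by (auto simp: hom_def fun_eq_iff)
  ultimately show ?thesis by simp
 qed
 \<comment> \<open>Dividing the coordinates by \<open>x l\<close> makes the generators functions of
   degree 0 near the point. They remain relations, since all numerators \<open>F (i, j)\<close> have
   the same degree \<open>d + 2\<close> and the equations may be evaluated at the scaled
   vector.\<close>
 define \<sigma> where "\<sigma> g = (\<lambda>i\<in>{..<m}. fun_on U' (hom U' (idx g i)))" for g
 have \<sigma>_eval: "\<sigma> g i (proj_class v) = peval (idx g i) (%j. v j / v l)" if "g < k" "i < m" "v \<in> cone U'" for g i v
 proof -
  have "idx g i \<in> polys {..n}" using idxM that by (simp add: M_def)
  from fun_cong[OF lift_fun_on(1)[OF U' hom[OF U' order_refl this]], of v]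
  show ?thesis using that U'_cone[OF that(3)] by (simp add: lift_def \<sigma>_def hom_def)
 qed
 have \<sigma>: "\<sigma> g \<in> carrier (sections R U')" if g: "g < k" for g
  unfolding \<sigma>_def
 proof (rule R_memI[OF U' U'U])
  show "fun_on U' (hom U' (idx g i)) \<in> carrier (reg n X U')" if "i < m" for i
   using idxM[OF g] that by (intro lift_fun_on(2)[OF U'] hom[OF U']) (simp_all add: M_def)
  fix v and j :: nat assume v: "v \<in> cone U'" and j: "j < 27"
  let ?u = "%i. inverse (v l) * v i"
  have u: "?u \<in> cone X" using U'_cone[OF v] by (intro cone_scale) simp_all
  have "fun_on U' (hom U' (idx g i)) (proj_class v) * s i v j = v l ^ (d + 2) / peval G v * (peval (idx g i) ?u * peval (F (i, j)) ?u)"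
   if i: "i < m" for i
  proof -
   have "fun_on U' (hom U' (idx g i)) (proj_class v) = peval (idx g i) ?u"
    using \<sigma>_eval[OF g i v] i by (simp add: \<sigma>_def field_simps)
   moreover have "peval (F (i, j)) ?u = inverse (v l) ^ (d + 2) * (peval G v * s i v j)"
    using peval_scale[OF F[OF i j], of "inverse (v l)" v] Fs[OF i j U'_cone(1)[OF v]] by simp
   ultimately show ?thesis using U'_cone[OF v] by (simp add: field_simps)
  qed
  then have "(\<Sum>i<m. fun_on U' (hom U' (idx g i)) (proj_class v) * s i v j)
   = v l ^ (d + 2) / peval G v * (\<Sum>i<m. peval (idx g i) ?u * peval (F (i, j)) ?u)"
   unfolding sum_distrib_left by (intro sum.cong refl) simp
  then show "(\<Sum>i<m. fun_on U' (hom U' (idx g i)) (proj_class v) * s i v j) = 0"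
   using idxM[OF g] j u by (simp add: M_def)
 qed
 show "EX V k t. zar_open n U V & P \<in> V & (\<forall>i<k. t i \<in> carrier (sections R V)) &
  (ALL V' a Q. zar_open n U V' & V' \<subseteq> V & a \<in> carrier (sections R V') & Q \<in> V' -->
   (EX W b. zar_open n U W & Q \<in> W & W \<subseteq> V' & (\<forall>i<k. b i \<in> carrier (reg n U W)) &
     restr R V' W a = lincomb (sections R W) k b (%i. restr R V W (t i))))"
 proof (rule exI[of _ U'], rule exI[of _ k], rule exI[of _ \<sigma>], intro conjI allI impI)
  show "zar_open n U U'" using zar_open_in[OF U] U' U'U by blast
  show "P \<in> U'" by (rule PU')
  show "\<sigma> i \<in> carrier (sections R U')" if "i < k" for i by (rule \<sigma>[OF that])
  fix V t Q assume "zar_open n U V & V \<subseteq> U' & t \<in> carrier (sections R V) & Q \<in> V"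
  then have V: "zar_open n X V" "V \<subseteq> U'" and t: "t \<in> carrier (sections R V)" and Q: "Q \<in> V"
   using zar_open_in[OF U] by blast+
  have VU: "V \<subseteq> U" using V(2) U'U by blast
  have VX: "V \<subseteq> X" using VU UX by blast
  obtain z where z: "z \<in> cone X" "Q = proj_class z" using point_cone Q VX by blast
  then have zV: "z \<in> cone V" using class_in[OF VX] Q by blast
  have ht: "\<forall>i\<in>{..<m}. hreg 0 V (lift (t i))" using reg_hreg[OF V(1) R_mem(1)[OF V(1) VU t]] by simp
  from common_denominator_ball[OF V(1) zV finite_lessThan ht] obtain c K H where K: "K \<in> forms {..n} c" "peval K z ~= 0" "basic K \<subseteq> V"
   "\<forall>i\<in>{..<m}. EX e. H i \<in> forms {..n} e & int e = int c + 0" "\<forall>i\<in>{..<m}. \<forall>v\<in>cone X. peval (H i) v = peval K v * lift (t i) v"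
   by (elim exE conjE)
  have H: "H i \<in> forms {..n} c" if "i < m" for i using K(4) that by auto
  have Ht: "peval (H i) v = peval K v * lift (t i) v" if "i < m" "v \<in> cone X" for i v using K(5) that by auto
  have HM: "H \<in> M"
   unfolding M_def
  proof (intro CollectI conjI allI impI ballI)
   show "H i \<in> polys {..n}" if "i < m" for i by (rule forms_polys[OF H[OF that]])
   fix j :: nat and v assume j: "j < 27" and v: "v \<in> cone X"
   have "(\<Sum>i<m. peval (H i) v * peval (F (i, j)) v) = peval K v * peval G v * (\<Sum>i<m. lift (t i) v * s i v j)"
    unfolding sum_distrib_left using Ht[OF _ v] Fs[OF _ j v] by (intro sum.cong refl) (simp add: mult.assoc mult.left_commute)
   moreover have "(\<Sum>i<m. lift (t i) v * s i v j) = 0"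
   proof (cases "v \<in> cone V")
    case True
    then show ?thesis using R_mem(3)[OF V(1) VU t True j] v by (simp add: lift_def)
   next
    case False
    then show ?thesis using hreg_out[OF ht[rule_format] False] by (intro sum.neutral) simp
   qed
   ultimately show "(\<Sum>i<m. peval (H i) v * peval (F (i, j)) v) = 0" by simp
  qed
  from Gs(3)[OF this] obtain cf where cf: "\<forall>g\<in>Gs. cf g \<in> polys {..n}" "\<forall>i<m. H i = (\<Sum>g\<in>Gs. cf g * g i)"
   unfolding generated_def by (elim exE conjE)
  define W where "W = basic K"
  have W: "zar_open n X W" unfolding W_def by (rule zar_open_basic[OF K(1)])
  have WV: "W \<subseteq> V" using K(3) W_def by simp
  have WU': "W \<subseteq> U'" and WU: "W \<subseteq> U" and WX: "W \<subseteq> X" using WV V(2) VU VX by blast+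
  have K0: "peval K v ~= 0" if "v \<in> cone W" for v using that by (auto simp: W_def basic_def)
  \<comment> \<open>\<open>H i\<close> has degree \<open>c\<close>, so \<open>H i v / K v\<close> is
    the value of \<open>H i\<close> at the scaled vector times \<open>v l ^ c / K v\<close>. This
    factor completes the coefficients with respect to the dehomogenized generators.\<close>
  define q where "q v = (if v \<in> cone W then peval (Var l ^ c) v / peval K v else 0)" for v
  have "Var l ^ c \<in> forms {..n} c" using forms_power[OF forms_Var, of l "{..n}" c] l(1) by simp
  then have q: "hreg 0 W q" unfolding q_def[abs_def] by (rule hreg_quotient[OF W _ K(1)]) (use K0 in simp_all)
  define h where "h g v = hom W (cf (idx g)) v * q v" for g v
  have idxG: "idx g \<in> Gs" if "g < k" for g using idx that by (auto simp: bij_betw_def k_def)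
  have h: "hreg 0 W (h g)" if "g < k" for g
   unfolding h_def[abs_def] using hreg_mult[OF hom[OF W WU' cf(1)[rule_format, OF idxG[OF that]]] q] by simp
  let ?b = "%g. fun_on W (h g)"
  have b: "?b g \<in> carrier (reg n X W)" if "g < k" for g by (rule lift_fun_on(2)[OF W h[OF that]])
  have b_eval: "?b g (proj_class v) = peval (cf (idx g)) (%i. v i / v l) * (v l ^ c / peval K v)" if "g < k" "v \<in> cone W" for g v
  proof -
   have "v \<in> cone X" using WX that(2) by blast
   then show ?thesis using fun_cong[OF lift_fun_on(1)[OF W h[OF that(1)]], of v] that(2)
    by (simp add: lift_def h_def hom_def q_def meval_single del: One_nat_def)
  qed
  have \<sigma>W: "restr R U' W (\<sigma> g) \<in> carrier (sections R W)" if g: "g < k" for g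
   unfolding R_simps
  proof (rule R_memI[OF W WU])
   show "restrict0 W (\<sigma> g i) \<in> carrier (reg n X W)" if i: "i < m" for i
   proof (rule regI[OF W hreg_restrict[OF reg_hreg[OF U' R_mem(1)[OF U' U'U \<sigma>[OF g] i]] W WU']])
    show "restrict0 W (\<sigma> g i) (proj_class v) = (if v \<in> cone W then lift (\<sigma> g i) v else 0)" if "v \<in> cone X" for v
     using class_in[OF WX, of v] that by (simp add: restrict0_def lift_def)
   qed (simp add: restrict0_def)
   fix v and j :: nat assume v: "v \<in> cone W" and j: "j < 27"
   have vU': "v \<in> cone U'" by (rule cone_mono[OF WU' v])
   have vW: "proj_class v \<in> W" using class_in[OF WX] v by blast
   show "(\<Sum>i<m. restrict0 W (\<sigma> g i) (proj_class v) * s i v j) = 0"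
    using R_mem(3)[OF U' U'U \<sigma>[OF g] vU' j] vW by (simp add: restrict0_def)
  qed
  show "EX W b. zar_open n U W & Q \<in> W & W \<subseteq> V & (\<forall>i<k. b i \<in> carrier (reg n U W)) &
     restr R V W t = lincomb (sections R W) k b (%i. restr R U' W (\<sigma> i))"
  proof (rule exI[of _ W], rule exI[of _ ?b], intro conjI allI impI)
   show "zar_open n U W" using zar_open_in[OF U] W WU by blast
   show "Q \<in> W" unfolding W_def z(2) using form_nonzero_class[OF K(1) z(1)] K(2) by simp
   show "W \<subseteq> V" by (rule WV)
   show "?b i \<in> carrier (reg n U W)" if "i < k" for i using b[OF that] reg_in[OF U WU] by simp
   show "restr R V W t = lincomb (sections R W) k ?b (%i. restr R U' W (\<sigma> i))"
   proof -
    have L: "lincomb (sections R W) k ?b (%i. restr R U' W (\<sigma> i)) = (\<lambda>i\<in>{..<m}. %P. \<Sum>g<k. ?b g P * restr R U' W (\<sigma> g) i P)"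
     by (rule R_lincomb[OF W WU b \<sigma>W])
    show ?thesis unfolding L unfolding R_simps
   proof (rule restrict_ext)
    fix i assume "i \<in> {..<m}"
    then have i: "i < m" by simp
    show "restrict0 W (t i) = (%P. \<Sum>g<k. ?b g P * (\<lambda>i\<in>{..<m}. restrict0 W (\<sigma> g i)) i P)"
    proof (rule reg_eqI[OF WX])
     show "restrict0 W (t i) P = 0" if "P \<notin> W" for P using that by (simp add: restrict0_def)
     show "(\<Sum>g<k. ?b g P * (\<lambda>i\<in>{..<m}. restrict0 W (\<sigma> g i)) i P) = 0" if "P \<notin> W" for P
      using that i by (simp add: restrict0_def)
     fix v assume v: "v \<in> cone W"
     have vX: "v \<in> cone X" and vU': "v \<in> cone U'" using v WX WU' by blast+
     have vW: "proj_class v \<in> W" using class_in[OF WX] v by blast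
     let ?u = "%i. inverse (v l) * v i"
     have uu: "(%i. v i / v l) = ?u" by (simp add: field_simps)
     have "peval (H i) ?u = inverse (v l) ^ c * (peval K v * t i (proj_class v))"
      using peval_scale[OF H[OF i], of "inverse (v l)" v] Ht[OF i vX] vX by (simp add: lift_def)
     then have "t i (proj_class v) = v l ^ c / peval K v * peval (H i) ?u"
      using K0[OF v] U'_cone(2)[OF vU'] by (simp add: field_simps)
     also have "peval (H i) ?u = (\<Sum>g\<in>Gs. peval (cf g) ?u * peval (g i) ?u)"
      using cf(2) i by (simp add: peval_sum)
     also have "\<dots> = (\<Sum>g<k. peval (cf (idx g)) ?u * peval (idx g i) ?u)"
      unfolding k_def by (rule sum.reindex_bij_betw[OF idx, symmetric])
     finally show "restrict0 W (t i) (proj_class v) = (\<Sum>g<k. ?b g (proj_class v) * (\<lambda>i\<in>{..<m}. restrict0 W (\<sigma> g i)) i (proj_class v))"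
      using vW i by (simp add: restrict0_def b_eval[OF _ v] \<sigma>_eval[OF _ i vU'] uu sum_distrib_left mult_ac)
    qed
   qed
   qed
  qed
 qed
qed

end

theorem coherent_E: "coherent n X E"
 unfolding coherent_def
proof (intro conjI allI impI module_sheaf_E finite_type_E)
 fix U and m :: nat and s assume "zar_open n X U & (\<forall>i<m. s i \<in> carrier (sections E U))"
 then have "zar_open n X U" "!!i. i < m ==> s i \<in> Esec U" by simp_all
 then show "finite_type n U (relation_sheaf n U E m s)" using finite_type_relations[of U m s] R_def[of U m s] by simp
qed

end

section \<open>Twisted sections and the linear resolution\<close>

definition hc :: "int => 'v mpoly => 'v mpoly" where
 "hc d p = (if 0 \<le> d then hcomp (nat d) p else 0)"

lemma hc_of_nat [simp]: "hc (int d) p = hcomp d p"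
 by (simp add: hc_def)

lemma hc_add: "hc d (p + q) = hc d p + hc d q"
 by (simp add: hc_def hcomp_add)

lemma hc_sum: "hc d (sum f A) = (\<Sum>a\<in>A. hc d (f a))"
 by (simp add: hc_def hcomp_sum)

lemma hc_0 [simp]: "hc d 0 = 0"
 by (simp add: hc_def)

lemma hc_forms: "p \<in> polys I ==> 0 \<le> d ==> hc d p \<in> forms I (nat d)"
 by (simp add: hc_def hcomp_forms)

lemma hc_polys: "p \<in> polys I ==> hc d p \<in> polys I"
 by (auto simp: hc_def intro: forms_polys hcomp_forms)

lemma hc_form: "p \<in> forms I e ==> hc d p = (if d = int e then p else 0)"
 by (auto simp: hc_def hcomp_form)

lemma hc_hc: "p \<in> polys I ==> hc d (hc e p) = (if d = e then hc e p else 0)"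
 using hc_form[OF hc_forms[of p I e], of d] by (cases "0 \<le> e") (auto simp: hc_def)

lemma keys_hc: "m \<in> keys (hc d p) ==> int (mdeg m) = d"
 by (auto simp: hc_def keys_hcomp split: if_splits)

lemma hc_eq_0: "(!!m. m \<in> keys p ==> int (mdeg m) ~= d) ==> hc d p = 0"
 by (force simp: hc_def intro!: hcomp_eq_0)

lemma hc_self: "(!!m. m \<in> keys p ==> int (mdeg m) = d) ==> hc d p = p"
proof (cases "0 \<le> d")
 assume *: "!!m. m \<in> keys p ==> int (mdeg m) = d" "0 \<le> d"
 then have "(\<Sum>e\<in>{nat d}. hcomp e p) = p" by (intro sum_hcomp) force+
 then show ?thesis using *(2) by (simp add: hc_def)
next
 assume *: "!!m. m \<in> keys p ==> int (mdeg m) = d" "\<not> 0 \<le> d"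
 then have "keys p = {}" by force
 then show ?thesis by (simp add: hc_def)
qed

lemma hc_mult_form:
 assumes p: "p \<in> forms I d" and q: "q \<in> polys I" shows "hc (int d + j) (p * q) = p * hc j q"
proof (cases "0 \<le> j")
 case True
 then have "nat (int d + j) = d + nat j" by simp
 then show ?thesis using True hcomp_mult_form[OF p, of "nat j" q] by (simp add: hc_def)
next
 case False
 let ?S = "mdeg ` keys q"
 have "p * q = (\<Sum>e\<in>?S. p * hcomp e q)"
  unfolding sum_distrib_left[symmetric] by (subst sum_hcomp) simp_all
 then have "hc (int d + j) (p * q) = (\<Sum>e\<in>?S. hc (int d + j) (p * hcomp e q))" by (simp only: hc_sum)
 also have "\<dots> = 0"
  using False hc_form[OF forms_mult[OF p hcomp_forms[OF q]], of "int d + j"] by (intro sum.neutral) auto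
 finally show ?thesis using False by (simp add: hc_def)
qed

lemma hc_mult:
 assumes p: "p \<in> polys I" and q: "q \<in> polys I"
 shows "hc j (p * q) = (\<Sum>e\<in>mdeg ` keys p. hcomp e p * hc (j - int e) q)"
proof -
 let ?S = "mdeg ` keys p"
 have "p * q = (\<Sum>e\<in>?S. hcomp e p * q)"
  unfolding sum_distrib_right[symmetric] by (subst sum_hcomp) simp_all
 then have "hc j (p * q) = (\<Sum>e\<in>?S. hc (int e + (j - int e)) (hcomp e p * q))" by (simp only: hc_sum) simp
 then show ?thesis by (simp only: hc_mult_form[OF hcomp_forms[OF p] q])
qed

lemma sum_scale: "(\<Sum>j\<in>J. a j * (c * b j)) = c * (\<Sum>j\<in>J. a j * b j :: complex)"
 by (simp add: sum_distrib_left mult.left_commute)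

lemma coord_ring_carrier: "carrier (coord_ring n) = polys {..n}"
 by (simp add: coord_ring_def polys_def)

context good_cubic
begin

lemma hreg_var_powi:
 assumes i: "i \<le> n" shows "hreg d (chart n X i) (%v. if v \<in> cone (chart n X i) then v i powi d else 0)"
proof (cases "0 \<le> d")
 case True
 have "Var i ^ nat d \<in> forms {..n} (nat d)" using forms_power[OF forms_Var, of i "{..n}" "nat d"] i by simp
 from hreg_form[OF zar_open_chart[OF i] this] True show ?thesis
  by (simp add: meval_single power_int_def del: One_nat_def cong: if_cong)
next
 case False
 have "Var i ^ nat (- d) \<in> forms {..n} (nat (- d))" using forms_power[OF forms_Var, of i "{..n}" "nat (- d)"] i by simp
 from hreg_quotient[OF zar_open_chart[OF i] forms_1 this, of d] False cone_chart[OF i] show ?thesis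
  by (simp add: meval_single power_int_def power_inverse inverse_eq_divide power_one_over del: One_nat_def cong: if_cong)
qed

lemma X_chart: "X \<inter> chart n X i = chart n X i"
 by (auto simp: chart_def)

lemma chart_subset: "chart n X i \<subseteq> X"
 by (auto simp: chart_def)

lemma cone_coord: "v \<in> cone X ==> \<exists>i\<le>n. v i ~= 0"
 by (auto simp: cone_iff on_cone_def)

lemma X_charts: "X = (\<Union>i\<in>{..n}. chart n X i)"
proof (intro equalityI subsetI)
 fix P assume P: "P \<in> X"
 then obtain v where v: "v \<in> cone X" "P = proj_class v" using point_cone by blast
 obtain i where i: "i \<le> n" "v i ~= 0" using cone_coord[OF v(1)] by blast
 then have "v \<in> cone (chart n X i)" using cone_chart v by blast
 then have "P \<in> chart n X i" using class_in[OF chart_subset] v by blast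
 then show "P \<in> (\<Union>i\<in>{..n}. chart n X i)" using i by auto
qed (auto simp: chart_def)

end

context matrix_factorization
begin

text \<open>A global section of the twist by \<open>d\<close> in one piece: a vector of functions of
  degree \<open>2 + d\<close> on the whole cone, annihilated by \<open>A\<close>, instead of a
  family over the charts.\<close>

definition Tsec :: "int => section_type set" where
 "Tsec d = {t. (ALL v l. 27 \<le> l --> t v l = 0) & (\<forall>l<27. hreg (2 + d) X (%v. t v l)) &
  (ALL v. \<forall>l<27. (\<Sum>j<27. peval (A l j) v * t v j) = 0)}"

text \<open>On the chart of \<open>x i\<close> the division by \<open>v i\<close> to the power
  \<open>d\<close> brings the degree back to 2, and the quotient of two such factors is the
  transition factor in the definition of the twist.\<close>

definition spread :: "int => section_type => nat => section_type" where
 "spread d t = (\<lambda>i\<in>{..n}. %v l. if v \<in> cone (chart n X i) then v i powi (- d) * t v l else 0)"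

abbreviation G :: "int => (nat point => complex, nat => section_type) module" where
 "G d \<equiv> global_sections n X E d"

lemma G_simps:
 "\<zero>\<^bsub>G d\<^esub> = (\<lambda>i\<in>{..n}. %_ _. 0)"
 "s \<oplus>\<^bsub>G d\<^esub> t = (\<lambda>i\<in>{..n}. %v l. s i v l + t i v l)"
 by (simp_all add: twist_def)

lemma TsecI:
 assumes "!!v l. 27 \<le> l ==> t v l = 0" "!!l. l < 27 ==> hreg (2 + d) X (%v. t v l)"
  "!!v l. l < 27 ==> (\<Sum>j<27. peval (A l j) v * t v j) = 0"
 shows "t \<in> Tsec d"
 using assms by (simp add: Tsec_def)

lemma Tsec_high: "t \<in> Tsec d ==> 27 \<le> l ==> t v l = 0"
 and Tsec_hreg: "t \<in> Tsec d ==> l < 27 ==> hreg (2 + d) X (%v. t v l)"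
 and Tsec_kernel: "t \<in> Tsec d ==> l < 27 ==> (\<Sum>j<27. peval (A l j) v * t v j) = 0"
 by (simp_all add: Tsec_def)

lemma Tsec_out: "t \<in> Tsec d ==> v \<notin> cone X ==> t v l = 0"
 using Tsec_high hreg_out[OF Tsec_hreg] by (cases "l < 27") auto

lemma Tsec_add: assumes "s \<in> Tsec d" "t \<in> Tsec d" shows "(%v l. s v l + t v l) \<in> Tsec d"
proof (rule TsecI)
 show "s v i + t v i = 0" if "27 \<le> i" for v i using Tsec_high[OF assms(1) that] Tsec_high[OF assms(2) that] by simp
 show "hreg (2 + d) X (%v. s v i + t v i)" if "i < 27" for i by (intro hreg_add Tsec_hreg assms that)
 show "(\<Sum>j<27. peval (A i j) v * (s v j + t v j)) = 0" if "i < 27" for v i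
  using Tsec_kernel[OF assms(1) that, of v] Tsec_kernel[OF assms(2) that, of v] by (simp add: distrib_left sum.distrib)
qed

lemma Tsec_zero: "(%_ _. 0) \<in> Tsec d"
 by (rule TsecI) (auto intro: hreg_zero zar_open_X)

lemma Tsec_form:
 assumes t: "t \<in> Tsec d" and F: "F \<in> forms {..n} e" shows "(%v l. peval F v * t v l) \<in> Tsec (d + int e)"
proof (rule TsecI)
 show "peval F v * t v i = 0" if "27 \<le> i" for v i using Tsec_high[OF t that] by simp
 show "(\<Sum>j<27. peval (A i j) v * (peval F v * t v j)) = 0" if "i < 27" for v i
  using Tsec_kernel[OF t that, of v] by (simp add: mult.left_commute flip: sum_distrib_left)
 fix l :: nat assume l: "l < 27"
 have "hreg (int e + (2 + d)) X (%v. (if v \<in> cone X then peval F v else 0) * t v l)"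
  by (intro hreg_mult hreg_form[OF zar_open_X F] Tsec_hreg[OF t l])
 moreover have "(%v. (if v \<in> cone X then peval F v else 0) * t v l) = (%v. peval F v * t v l)"
  using Tsec_out[OF t] by (auto simp: fun_eq_iff)
 ultimately show "hreg (2 + (d + int e)) X (%v. peval F v * t v l)" by (simp add: ac_simps)
qed

lemma fun_on_ratio:
 assumes "i \<le> n" "j \<le> n" "v \<in> cone X" "v i ~= 0" "v j ~= 0"
 shows "fun_on (chart n X i \<inter> chart n X j) (%v. (v j / v i) powi d) (proj_class v) = (v j / v i) powi d"
proof (rule fun_on_eval)
 have "v \<in> cone (chart n X i) \<inter> cone (chart n X j)" using assms cone_chart by blast
 then show "v \<in> cone (chart n X i \<inter> chart n X j)" using cone_Int[OF chart_subset chart_subset] by blast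
qed (use chart_subset in auto)

lemma G_carrier:
 "s \<in> carrier (G d) \<longleftrightarrow> s \<in> (\<Pi>\<^sub>E i\<in>{..n}. Esec (chart n X i)) &
  (\<forall>i\<le>n. \<forall>j\<le>n. \<forall>v\<in>cone X. v i ~= 0 & v j ~= 0 --> (ALL l. s i v l = (v j / v i) powi d * s j v l))"
proof -
 have "(let W = X \<inter> chart n X i \<inter> chart n X j in restr E (X \<inter> chart n X i) W (s i) =
     fun_on W (%v. (v j / v i) powi d) \<odot>\<^bsub>sections E W\<^esub> restr E (X \<inter> chart n X j) W (s j))
  \<longleftrightarrow> (\<forall>v\<in>cone X. v i ~= 0 & v j ~= 0 --> (ALL l. s i v l = (v j / v i) powi d * s j v l))" if ij: "i \<le> n" "j \<le> n" for i j
 proof -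
  let ?W = "chart n X i \<inter> chart n X j"
  have W: "v \<in> cone ?W \<longleftrightarrow> v \<in> cone X & v i ~= 0 & v j ~= 0" for v
   unfolding cone_Int[OF chart_subset chart_subset] using cone_chart[OF ij(1), of v] cone_chart[OF ij(2), of v] by auto
  have "(%v l. if v \<in> cone ?W then s i v l else 0) =
   (%v l. fun_on ?W (%v. (v j / v i) powi d) (proj_class v) * (if v \<in> cone ?W then s j v l else 0))
   \<longleftrightarrow> (\<forall>v\<in>cone ?W. ALL l. s i v l = fun_on ?W (%v. (v j / v i) powi d) (proj_class v) * s j v l)"
   by (auto simp: fun_eq_iff)
  also have "\<dots> \<longleftrightarrow> (\<forall>v\<in>cone ?W. ALL l. s i v l = (v j / v i) powi d * s j v l)"
  proof (intro ball_cong refl)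
   fix v assume "v \<in> cone ?W"
   then have "fun_on ?W (%v. (v j / v i) powi d) (proj_class v) = (v j / v i) powi d"
    using W[of v] by (intro fun_on_ratio[OF ij]) auto
   then show "(ALL l. s i v l = fun_on ?W (%v. (v j / v i) powi d) (proj_class v) * s j v l) \<longleftrightarrow> (ALL l. s i v l = (v j / v i) powi d * s j v l)"
    by (simp only:)
  qed
  finally show ?thesis unfolding Let_def X_chart using W by auto
 qed
 then show ?thesis by (auto simp: twist_def X_chart)
qed

lemma spread_in:
 assumes t: "t \<in> Tsec d" shows "spread d t \<in> carrier (G d)"
 unfolding G_carrier
proof (intro conjI allI impI ballI)
 show "spread d t \<in> (\<Pi>\<^sub>E i\<in>{..n}. Esec (chart n X i))"
  unfolding spread_def
 proof (rule restrict_PiE_iff[THEN iffD2], rule ballI)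
  fix i assume "i \<in> {..n}"
  then have i: "i \<le> n" by simp
  let ?C = "chart n X i"
  show "(%v l. if v \<in> cone ?C then v i powi (- d) * t v l else 0) \<in> Esec ?C"
  proof (rule EsecI)
   show "(if v \<in> cone ?C then v i powi (- d) * t v l else 0) = 0" if "27 \<le> l" for v l using Tsec_high[OF t that] by simp
   show "(\<Sum>j<27. peval (A l j) v * (if v \<in> cone ?C then v i powi (- d) * t v j else 0)) = 0" if "l < 27" for v l
    using Tsec_kernel[OF t that, of v] by (cases "v \<in> cone ?C") (simp_all add: sum_scale)
   fix l :: nat assume l: "l < 27"
   have "hreg (- d + (2 + d)) ?C (%v. (if v \<in> cone ?C then v i powi (- d) else 0) * (if v \<in> cone ?C then t v l else 0))"
    by (intro hreg_mult hreg_var_powi[OF i] hreg_restrict[OF Tsec_hreg[OF t l]] zar_open_chart i chart_subset)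
   moreover have "(%v. (if v \<in> cone ?C then v i powi (- d) else 0) * (if v \<in> cone ?C then t v l else 0))
    = (%v. if v \<in> cone ?C then v i powi (- d) * t v l else 0)" by auto
   ultimately show "hreg 2 ?C (%v. if v \<in> cone ?C then v i powi (- d) * t v l else 0)" by simp
  qed
 qed
 fix i j v l assume *: "i \<le> n" "j \<le> n" "v \<in> cone X" "v i ~= 0 & v j ~= 0"
 have "(v j / v i) powi d * v j powi (- d) = v i powi (- d)"
  using * by (simp add: power_int_divide_distrib power_int_minus field_simps)
 then show "spread d t i v l = (v j / v i) powi d * spread d t j v l"
  using * cone_chart[of i v] cone_chart[of j v] by (simp add: spread_def mult.assoc[symmetric])
qed

lemma spread_surj:
 assumes s: "s \<in> carrier (G d)" shows "\<exists>t\<in>Tsec d. s = spread d t"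
proof -
 note sG = s[unfolded G_carrier, THEN conjunct1] and glue = s[unfolded G_carrier, THEN conjunct2, rule_format]
 have sE: "s i \<in> Esec (chart n X i)" if "i \<le> n" for i using sG that by auto
 \<comment> \<open>A coordinate that is nonzero at the vector. The gluing condition makes the
   product of its power \<open>d\<close> with the section on its chart independent of the
   choice.\<close>
 define c where "c v = (SOME i. i \<le> n & v i ~= 0)" for v :: "nat => complex"
 have c: "c v \<le> n" "v (c v) ~= 0" if "v \<in> cone X" for v
 proof -
  have "EX i. i \<le> n & v i ~= 0" using cone_coord[OF that] by blast
  from someI_ex[OF this] show "c v \<le> n" "v (c v) ~= 0" by (simp_all add: c_def)
 qed
 define t where "t v l = (if v \<in> cone X then v (c v) powi d * s (c v) v l else 0)" for v l
 have t: "t v l = v i powi d * s i v l" if v: "v \<in> cone X" "i \<le> n" "v i ~= 0" for v i l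
 proof -
  have "v i powi d * s i v l = v i powi d * ((v (c v) / v i) powi d * s (c v) v l)"
   using glue[OF v(2) c(1)[OF v(1)] v(1), of l] v(3) c(2)[OF v(1)] by simp
  also have "\<dots> = t v l" using v by (simp add: t_def power_int_divide_distrib)
  finally show ?thesis ..
 qed
 have "t \<in> Tsec d"
 proof (rule TsecI)
  show "t v l = 0" if "27 \<le> l" for v l
   using Esec_high[OF sE[OF c(1)] that, of v v] by (simp add: t_def)
  show "(\<Sum>j<27. peval (A l j) v * t v j) = 0" if "l < 27" for v l
   using Esec_kernel[OF sE[OF c(1)] that, of v v]
   by (cases "v \<in> cone X") (simp_all add: t_def sum_scale)
  fix l :: nat assume l: "l < 27"
  have "hreg (2 + d) (\<Union>(chart n X ` {..n})) (%v. t v l)"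
  proof (rule hreg_local)
   show "zar_open n X U" if "U \<in> chart n X ` {..n}" for U using that zar_open_chart by auto
   show "t v l = 0" if "v \<notin> cone (\<Union>(chart n X ` {..n}))" for v using that X_charts by (simp add: t_def)
   fix U assume "U \<in> chart n X ` {..n}"
   then obtain i where i: "i \<le> n" "U = chart n X i" by auto
   have "hreg (2 + d) U (%v. s i v l * (if v \<in> cone U then v i powi d else 0))"
    unfolding i(2) by (intro hreg_mult Esec_hreg[OF sE[OF i(1)] l] hreg_var_powi i)
   moreover have "(%v. s i v l * (if v \<in> cone U then v i powi d else 0)) = (%v. if v \<in> cone U then t v l else 0)"
    unfolding i(2) using t[OF _ i(1)] cone_chart[OF i(1)] by (auto simp: fun_eq_iff)
   ultimately show "hreg (2 + d) U (%v. if v \<in> cone U then t v l else 0)" by simp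
  qed
  then show "hreg (2 + d) X (%v. t v l)" using X_charts by simp
 qed
 moreover have "s = spread d t"
 proof
  fix i show "s i = spread d t i"
  proof (cases "i \<le> n")
   case True
   show ?thesis
   proof (intro ext)
    fix v l show "s i v l = spread d t i v l"
    proof (cases "v \<in> cone (chart n X i)")
     case v: True
     then have v': "v \<in> cone X" "v i ~= 0" using cone_chart[OF True, of v] by auto
     have "v i powi (- d) * t v l = s i v l" using t[OF v'(1) True v'(2), of l] v'(2) by (simp add: power_int_minus)
     then show ?thesis using v True by (simp add: spread_def)
    next
     case False
     then show ?thesis using Esec_out[OF sE[OF True] False] True by (simp add: spread_def)
    qed
   qed
  next
   case False
   then show ?thesis using sG by (auto simp: spread_def PiE_def extensional_def)
  qed
 qed
 ultimately show ?thesis by blast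
qed

lemma spread_zero: "spread d (%_ _. 0) = \<zero>\<^bsub>G d\<^esub>"
 by (auto simp: spread_def G_simps fun_eq_iff)

lemma spread_add: "spread d s \<oplus>\<^bsub>G d\<^esub> spread d t = spread d (%v l. s v l + t v l)"
 by (auto simp: spread_def G_simps fun_eq_iff algebra_simps)

lemma spread_inject:
 assumes "s \<in> Tsec d" "t \<in> Tsec d" "spread d s = spread d t" shows "s = t"
proof (intro ext)
 fix v l show "s v l = t v l"
 proof (cases "v \<in> cone X")
  case True
  obtain i where i: "i \<le> n" "v i ~= 0" using cone_coord[OF True] by blast
  then have "v \<in> cone (chart n X i)" using cone_chart True by blast
  then show ?thesis using fun_cong[OF fun_cong[OF fun_cong[OF assms(3), of i], of v], of l] i by (simp add: spread_def)
 qed (simp add: Tsec_out[OF assms(1)] Tsec_out[OF assms(2)])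
qed

lemma abelian_monoid_G: "abelian_monoid (G d)"
proof (rule abelian_monoidI)
 show "s \<oplus>\<^bsub>G d\<^esub> t \<in> carrier (G d)" if "s \<in> carrier (G d)" "t \<in> carrier (G d)" for s t
  using spread_surj[OF that(1)] spread_surj[OF that(2)] spread_in[OF Tsec_add] by (auto simp: spread_add)
 show "\<zero>\<^bsub>G d\<^esub> \<in> carrier (G d)" unfolding spread_zero[symmetric] by (rule spread_in[OF Tsec_zero])
 show "\<zero>\<^bsub>G d\<^esub> \<oplus>\<^bsub>G d\<^esub> s = s" if "s \<in> carrier (G d)" for s
  using spread_surj[OF that] by (auto simp: spread_add simp flip: spread_zero)
qed (auto simp: G_simps fun_eq_iff)

lemma finsum_spread:
 assumes "finite S" "!!e. e \<in> S ==> t e \<in> Tsec d"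
 shows "(\<Oplus>\<^bsub>G d\<^esub>e\<in>S. spread d (t e)) = spread d (%v l. \<Sum>e\<in>S. t e v l)"
proof -
 interpret abelian_monoid "G d" by (rule abelian_monoid_G)
 show ?thesis using assms
 proof (induction S rule: finite_induct)
  case empty
  then show ?case by (simp add: spread_zero)
 next
  case (insert a S)
  then have "(%e. spread d (t e)) \<in> S \<rightarrow> carrier (G d)" "spread d (t a) \<in> carrier (G d)" by (auto intro: spread_in)
  from finsum_insert[OF insert.hyps this] insert show ?case by (simp add: spread_add)
 qed
qed

lemma form_mult_spread:
 assumes F: "F \<in> forms {..n} e"
 shows "form_mult n X E e F (spread d t) = spread (d + int e) (%v l. peval F v * t v l)"
proof
 fix i show "form_mult n X E e F (spread d t) i = spread (d + int e) (%v l. peval F v * t v l) i"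
 proof (cases "i \<le> n")
  case True
  show ?thesis
  proof (intro ext)
   fix v l
   show "form_mult n X E e F (spread d t) i v l = spread (d + int e) (%v l. peval F v * t v l) i v l"
   proof (cases "v \<in> cone (chart n X i)")
    case v: True
    then have vi: "v i ~= 0" using cone_chart[OF True, of v] by auto
    have "fun_on (chart n X i) (%v. peval F v / v i ^ e) (proj_class v) = peval F v / v i ^ e"
     by (rule fun_on_eval[OF chart_subset v]) (simp add: peval_scale[OF F] power_mult_distrib)
    moreover have "v i powi (- (d + int e)) = v i powi (- d) / v i ^ e"
     using power_int_diff[of "v i" "- d" "int e"] vi by simp
    ultimately show ?thesis using True v by (simp add: form_mult_def spread_def)
   next
    case False
    then show ?thesis using True by (simp add: form_mult_def spread_def)
   qed
  qed
 qed (simp add: form_mult_def spread_def)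
qed

end

context matrix_factorization
begin

definition Bsec :: "(nat => nat mpoly) => section_type" where
 "Bsec q v l = (if l < 27 & v \<in> cone X then peval (mulvec B q l) v else 0)"

lemma hc_mulvec:
 assumes "!!i j. M i j \<in> forms {..n} d" "!!k. k < 27 ==> q k \<in> polys {..n}"
 shows "hc (int d + e) (mulvec M q i) = mulvec M (%k. hc e (q k)) i"
 unfolding mulvec_def hc_sum using hc_mult_form[OF assms(1) assms(2)] by (intro sum.cong refl) simp

lemma mulvec_sum: "mulvec M (%k. \<Sum>d\<in>D. q d k) i = (\<Sum>d\<in>D. mulvec M (q d) i)"
 unfolding mulvec_def sum_distrib_left by (rule sum.swap)

lemma mulvec_add: "mulvec M (%k. p k + q k) i = mulvec M p i + mulvec M q i"
 by (simp add: mulvec_def distrib_left sum.distrib)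

lemma Bsec_in:
 assumes q: "!!k. k < 27 ==> q k \<in> polys {..n}" shows "Bsec (%k. hc d (q k)) \<in> Tsec d"
proof (cases "0 \<le> d")
 case True
 have fm: "mulvec B (%k. hc d (q k)) l \<in> forms {..n} (2 + nat d)" for l
  by (rule forms_mulvec[OF B_form]) (rule hc_forms[OF q True])
 show ?thesis
 proof (rule TsecI)
  show "hreg (2 + d) X (%v. Bsec (%k. hc d (q k)) v l)" if "l < 27" for l
   using hreg_form[OF zar_open_X fm, of l] that True by (simp add: Bsec_def cong: if_cong)
  show "(\<Sum>j<27. peval (A l j) v * Bsec (%k. hc d (q k)) v j) = 0" if l: "l < 27" for v l
  proof (cases "v \<in> cone X")
   case v: True
   have "(\<Sum>j<27. peval (A l j) v * Bsec (%k. hc d (q k)) v j) = peval (mulvec A (mulvec B (%k. hc d (q k))) l) v"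
    using v by (simp add: Bsec_def mulvec_def[of A] peval_sum)
   then show ?thesis using mulvec_AB[OF l] cone_f[OF v] by simp
  qed (simp add: Bsec_def)
 qed (simp add: Bsec_def)
next
 case False
 then have "Bsec (%k. hc d (q k)) = (%_ _. 0)" by (simp add: Bsec_def hc_def mulvec_def fun_eq_iff)
 then show ?thesis using Tsec_zero by simp
qed

text \<open>The components are forms of degree \<open>2 + d\<close> by \<open>hreg_global\<close>,
  and \<open>kernel_A_image_B\<close> writes them as \<open>B q\<close>; only the component of
  degree \<open>d\<close> of \<open>q\<close> contributes. For negative \<open>d\<close> this
  component is 0, so there are no sections.\<close>

lemma Bsec_surj:
 assumes t: "t \<in> Tsec d" shows "EX q. (ALL k. q k \<in> polys {..n}) & t = Bsec (%k. hc d (q k))"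
proof -
 have "EX p. p \<in> polys {..n} & hc (2 + d) p = p & (l < 27 --> (\<forall>v\<in>cone X. t v l = peval p v))" for l
 proof (cases "l < 27")
  case True
  obtain p where p: "2 + d \<ge> 0 --> p \<in> forms {..n} (nat (2 + d))" "2 + d < 0 --> p = 0" "\<forall>v\<in>cone X. t v l = peval p v"
   using hreg_global[OF Tsec_hreg[OF t True]] by (elim exE conjE)
  show ?thesis
  proof (cases "2 + d \<ge> 0")
   case True
   then have pf: "p \<in> forms {..n} (nat (2 + d))" using p(1) by blast
   show ?thesis using forms_polys[OF pf] hc_form[OF pf, of "2 + d"] True p(3) by (intro exI[of _ p]) simp
  next
   case False
   then show ?thesis using p by (intro exI[of _ 0]) auto
  qed
 qed (auto intro: exI[of _ 0])
 then have "ALL l. EX p. p \<in> polys {..n} & hc (2 + d) p = p & (l < 27 --> (\<forall>v\<in>cone X. t v l = peval p v))" by (rule allI)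
 from choice[OF this] obtain p where p: "ALL l. p l \<in> polys {..n} & hc (2 + d) (p l) = p l & (l < 27 --> (\<forall>v\<in>cone X. t v l = peval (p l) v))"
  by (elim exE)
 have pp: "p l \<in> polys {..n}" "hc (2 + d) (p l) = p l" for l using p by blast+
 have pt: "t v l = peval (p l) v" if "l < 27" "v \<in> cone X" for l v using p that by blast
 have van: "peval (mulvec A p i) v = 0" if "i < 27" "v \<in> cone X" for i v
 proof -
  have "peval (mulvec A p i) v = (\<Sum>j<27. peval (A i j) v * t v j)"
   unfolding mulvec_def peval_sum using pt[OF _ that(2)] by (intro sum.cong refl) simp
  then show ?thesis using Tsec_kernel[OF t that(1)] by simp
 qed
 have "EX q. (ALL k. q k \<in> polys {..n}) & (\<forall>i<27. p i = mulvec B q i)" by (rule kernel_A_image_B[OF pp(1) van])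
 then obtain q where q: "ALL k. q k \<in> polys {..n}" "\<forall>i<27. p i = mulvec B q i" by (elim exE conjE)
 have pB: "p i = mulvec B (%k. hc d (q k)) i" if "i < 27" for i
 proof -
  have "p i = hc (int 2 + d) (p i)" using pp(2) by simp
  also have "\<dots> = hc (int 2 + d) (mulvec B q i)" using q(2) that by simp
  also have "\<dots> = mulvec B (%k. hc d (q k)) i" by (rule hc_mulvec[OF B_form q(1)[rule_format]])
  finally show ?thesis .
 qed
 have "t = Bsec (%k. hc d (q k))"
 proof (intro ext)
  fix v l show "t v l = Bsec (%k. hc d (q k)) v l"
   using pt[of l v] pB[of l] Tsec_high[OF t, of l v] Tsec_out[OF t, of v l] by (auto simp: Bsec_def)
 qed
 then show ?thesis using q(1) by (intro exI[of _ q]) simp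
qed

definition M :: "(nat mpoly, int => nat => section_type) graded_module" where
 "M = twisted_section_module n X E"

text \<open>The summand with index \<open>d\<close> receives the image of the homogeneous components
  of degree \<open>d\<close>, so the grading is respected by construction.\<close>

definition aug :: "(nat => nat mpoly) => int => nat => section_type" where
 "aug q d = spread d (Bsec (%k. hc d (q k)))"

definition diff :: "nat => (nat => nat mpoly) => nat => nat mpoly" where
 "diff _ q = (\<lambda>i\<in>{..<27}. mulvec A q i)"

definition F :: "nat => (nat mpoly, nat => nat mpoly) graded_module" where
 "F i = graded_free n (replicate 27 (int i))"

lemma M_simps:
 "carrier M = {s. (ALL j. s j \<in> carrier (G j)) & finite {j. s j ~= \<zero>\<^bsub>G j\<^esub>}}"
 "\<zero>\<^bsub>M\<^esub> = (%j. \<zero>\<^bsub>G j\<^esub>)"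
 "s \<oplus>\<^bsub>M\<^esub> t = (%j. s j \<oplus>\<^bsub>G j\<^esub> t j)"
 "p \<odot>\<^bsub>M\<^esub> s = (%j. \<Oplus>\<^bsub>G j\<^esub>e\<in>mdeg ` keys p. form_mult n X E e (hcomp e p) (s (j - int e)))"
 "degcomp M d = {s \<in> carrier M. ALL j. j ~= d --> s j = \<zero>\<^bsub>G j\<^esub>}"
 by (simp_all add: M_def twisted_section_module_def Let_def)

lemma F_simps:
 "carrier (F i) = {..<27} \<rightarrow>\<^sub>E polys {..n}"
 "\<zero>\<^bsub>F i\<^esub> = (\<lambda>k\<in>{..<27}. 0)"
 "v \<oplus>\<^bsub>F i\<^esub> w = (\<lambda>k\<in>{..<27}. v k + w k)"
 "p \<odot>\<^bsub>F i\<^esub> v = (\<lambda>k\<in>{..<27}. p * v k)"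
 "degcomp (F i) d = {v \<in> carrier (F i). \<forall>k<27. \<forall>m\<in>keys (v k). int (mdeg m) = d - int i}"
 by (simp_all add: F_def graded_free_def Let_def coord_ring_carrier)

lemma F_polys: "q \<in> carrier (F i) ==> k < 27 ==> q k \<in> polys {..n}"
 by (auto simp: F_simps)

lemma F_eqI: "p \<in> carrier (F i) ==> q \<in> carrier (F i) ==> (!!k. k < 27 ==> p k = q k) ==> p = q"
 unfolding F_simps by (rule PiE_ext) auto

lemma aug_in: assumes "q \<in> carrier (F 0)" shows "aug q d \<in> carrier (G d)"
 unfolding aug_def by (rule spread_in[OF Bsec_in]) (rule F_polys[OF assms])

lemma Bsec_zero: "(!!k. k < 27 ==> q k = 0) ==> Bsec q = (%_ _. 0)"
 by (simp add: Bsec_def mulvec_def fun_eq_iff)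

lemma Bsec_cong: "(!!k. k < 27 ==> p k = q k) ==> Bsec p = Bsec q"
 using mulvec_cong[of p q B] by (simp add: Bsec_def fun_eq_iff)

lemma aug_zero: "(!!k. k < 27 ==> hc d (q k) = 0) ==> aug q d = \<zero>\<^bsub>G d\<^esub>"
 using Bsec_zero[of "%k. hc d (q k)"] by (simp add: aug_def spread_zero)

lemma aug_carrier: assumes q: "q \<in> carrier (F 0)" shows "aug q \<in> carrier M"
proof -
 have "{j. aug q j ~= \<zero>\<^bsub>G j\<^esub>} \<subseteq> (\<Union>k<27. int ` mdeg ` keys (q k))"
 proof
  fix j assume "j \<in> {j. aug q j ~= \<zero>\<^bsub>G j\<^esub>}"
  then obtain k where k: "k < 27" "hc j (q k) ~= 0" using aug_zero[of j q] by blast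
  then obtain m where "m \<in> keys (q k)" "int (mdeg m) = j" using hc_eq_0[of "q k" j] by blast
  then show "j \<in> (\<Union>k<27. int ` mdeg ` keys (q k))" using k(1) by force
 qed
 moreover have "finite (\<Union>k<27. int ` mdeg ` keys (q k))" by simp
 ultimately have "finite {j. aug q j ~= \<zero>\<^bsub>G j\<^esub>}" by (rule finite_subset)
 then show ?thesis using aug_in[OF q] by (simp add: M_simps)
qed

lemma aug_hom: "graded_hom n (F 0) M aug"
 unfolding graded_hom_def coord_ring_carrier
proof (intro conjI ballI allI)
 show "aug \<in> carrier (F 0) \<rightarrow> carrier M" using aug_carrier by blast
next
 fix p q assume "p \<in> carrier (F 0)" "q \<in> carrier (F 0)"
 show "aug (p \<oplus>\<^bsub>F 0\<^esub> q) = aug p \<oplus>\<^bsub>M\<^esub> aug q"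
 proof
  fix j
  have "Bsec (%k. hc j ((p \<oplus>\<^bsub>F 0\<^esub> q) k)) = Bsec (%k. hc j (p k) + hc j (q k))"
   by (rule Bsec_cong) (simp add: F_simps hc_add)
  also have "\<dots> = (%v l. Bsec (%k. hc j (p k)) v l + Bsec (%k. hc j (q k)) v l)"
   by (auto simp: Bsec_def mulvec_add fun_eq_iff)
  finally show "aug (p \<oplus>\<^bsub>F 0\<^esub> q) j = (aug p \<oplus>\<^bsub>M\<^esub> aug q) j"
   unfolding aug_def M_simps spread_add by (simp only:)
 qed
next
 fix p :: "nat mpoly" and q assume p: "p \<in> polys {..n}" and q: "q \<in> carrier (F 0)"
 let ?S = "mdeg ` keys p"
 show "aug (p \<odot>\<^bsub>F 0\<^esub> q) = p \<odot>\<^bsub>M\<^esub> aug q"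
 proof
  fix j
  define t where "t e v l = peval (hcomp e p) v * Bsec (%k. hc (j - int e) (q k)) v l" for e v l
  have t: "t e \<in> Tsec j" for e
   using Tsec_form[OF Bsec_in[of q "j - int e", OF F_polys[OF q]] hcomp_forms[OF p, of e]] by (simp add: t_def[abs_def])
  have fm: "form_mult n X E e (hcomp e p) (aug q (j - int e)) = spread j (t e)" for e
   using form_mult_spread[OF hcomp_forms[OF p, of e], of "j - int e"] by (simp add: aug_def t_def[abs_def])
  have "Bsec (%k. hc j ((p \<odot>\<^bsub>F 0\<^esub> q) k)) = Bsec (%k. \<Sum>e\<in>?S. hcomp e p * hc (j - int e) (q k))"
   by (rule Bsec_cong) (simp add: F_simps hc_mult[OF p F_polys[OF q]])
  also have "\<dots> = (%v l. \<Sum>e\<in>?S. t e v l)"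
   by (auto simp: Bsec_def t_def mulvec_sum mulvec_scale peval_sum fun_eq_iff)
  finally have "aug (p \<odot>\<^bsub>F 0\<^esub> q) j = spread j (%v l. \<Sum>e\<in>?S. t e v l)" by (simp add: aug_def)
  also have "\<dots> = (\<Oplus>\<^bsub>G j\<^esub>e\<in>?S. spread j (t e))"
   using finsum_spread[of ?S t j] t by simp
  finally show "aug (p \<odot>\<^bsub>F 0\<^esub> q) j = (p \<odot>\<^bsub>M\<^esub> aug q) j" unfolding M_simps fm .
 qed
next
 fix d
 show "aug ` degcomp (F 0) d \<subseteq> degcomp M d"
 proof
  fix s assume "s \<in> aug ` degcomp (F 0) d"
  then obtain q where q: "s = aug q" "q \<in> carrier (F 0)" "\<forall>k<27. \<forall>m\<in>keys (q k). int (mdeg m) = d"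
   unfolding F_simps(5) by auto
  have "aug q j = \<zero>\<^bsub>G j\<^esub>" if "j ~= d" for j
   by (rule aug_zero, rule hc_eq_0) (use q(3) that in auto)
  then show "s \<in> degcomp M d" using aug_carrier[OF q(2)] q(1) by (simp add: M_simps(5))
 qed
qed

lemma aug_surj: "aug ` carrier (F 0) = carrier M"
proof (intro equalityI subsetI)
 fix s assume "s \<in> carrier M"
 then have s: "!!j. s j \<in> carrier (G j)" and fin: "finite {j. s j ~= \<zero>\<^bsub>G j\<^esub>}" by (simp_all add: M_simps)
 let ?D = "{j. s j ~= \<zero>\<^bsub>G j\<^esub>}"
 have "EX q. (ALL k. q k \<in> polys {..n}) & s j = spread j (Bsec (%k. hc j (q k)))" for j
 proof -
  obtain t where "t \<in> Tsec j" "s j = spread j t" using spread_surj[OF s] by blast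
  moreover from Bsec_surj[OF this(1)] obtain q where "ALL k. q k \<in> polys {..n}" "t = Bsec (%k. hc j (q k))" by (elim exE conjE)
  ultimately show ?thesis by (intro exI[of _ q]) simp
 qed
 then have "ALL j. EX q. (ALL k. q k \<in> polys {..n}) & s j = spread j (Bsec (%k. hc j (q k)))" by (rule allI)
 from choice[OF this] obtain Q where "ALL j. (ALL k. Q j k \<in> polys {..n}) & s j = spread j (Bsec (%k. hc j (Q j k)))" by (elim exE)
 then have Q: "Q j k \<in> polys {..n}" "s j = spread j (Bsec (%k. hc j (Q j k)))" for j k by blast+
 define q where "q = (\<lambda>k\<in>{..<27::nat}. \<Sum>d\<in>?D. hc d (Q d k))"
 have q: "q \<in> carrier (F 0)" using Q(1) by (auto simp: F_simps q_def intro!: polys_sum hc_polys)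
 have hcq: "hc j (q k) = (if j \<in> ?D then hc j (Q j k) else 0)" if "k < 27" for j k
 proof -
  have "hc j (q k) = (\<Sum>d\<in>?D. if j = d then hc d (Q d k) else 0)"
   using that by (simp add: q_def hc_sum hc_hc[OF Q(1)])
  then show ?thesis using fin by (simp add: sum.delta)
 qed
 have "aug q j = s j" for j
 proof (cases "j \<in> ?D")
  case True
  have "Bsec (%k. hc j (q k)) = Bsec (%k. hc j (Q j k))" by (rule Bsec_cong) (simp only: hcq True if_True)
  then show ?thesis using Q(2)[of j] by (simp add: aug_def)
 next
  case False
  have "aug q j = \<zero>\<^bsub>G j\<^esub>" by (rule aug_zero) (simp only: hcq False if_False)
  then show ?thesis using False by simp
 qed
 then have "aug q = s" by (rule ext)
 then show "s \<in> aug ` carrier (F 0)" using q by blast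
qed (use aug_carrier in auto)

lemma diff_in: assumes "q \<in> carrier (F 1)" shows "diff i q \<in> carrier (F 0)"
 using polys_mulvec[OF A_form F_polys[OF assms]] by (auto simp: diff_def F_simps)

lemma hc_A: assumes "q \<in> carrier (F 1)" shows "hc d (mulvec A q i) = mulvec A (%k. hc (d - 1) (q k)) i"
proof -
 have "hc (int 1 + (d - 1)) (mulvec A q i) = mulvec A (%k. hc (d - 1) (q k)) i"
  by (rule hc_mulvec[OF A_form]) (rule F_polys[OF assms])
 then show ?thesis by simp
qed

lemma diff_hom: "graded_hom n (F 1) (F 0) (diff i)"
 unfolding graded_hom_def coord_ring_carrier
proof (intro conjI ballI allI)
 show "diff i \<in> carrier (F 1) \<rightarrow> carrier (F 0)" using diff_in by blast
next
 fix p q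
 have "mulvec A (p \<oplus>\<^bsub>F 1\<^esub> q) = mulvec A (%k. p k + q k)" by (rule mulvec_cong) (simp add: F_simps)
 then show "diff i (p \<oplus>\<^bsub>F 1\<^esub> q) = diff i p \<oplus>\<^bsub>F 0\<^esub> diff i q" by (auto simp: diff_def F_simps(3) mulvec_add)
next
 fix p q
 have "mulvec A (p \<odot>\<^bsub>F 1\<^esub> q) = mulvec A (%k. p * q k)" by (rule mulvec_cong) (simp add: F_simps)
 then show "diff i (p \<odot>\<^bsub>F 1\<^esub> q) = p \<odot>\<^bsub>F 0\<^esub> diff i q" by (auto simp: diff_def F_simps(4) mulvec_scale)
next
 fix d
 show "diff i ` degcomp (F 1) d \<subseteq> degcomp (F 0) d"
 proof
  fix s assume "s \<in> diff i ` degcomp (F 1) d"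
  then obtain q where q: "s = diff i q" "q \<in> carrier (F 1)" "\<forall>k<27. \<forall>m\<in>keys (q k). int (mdeg m) = d - 1"
   unfolding F_simps(5) by auto
  have "hc d (mulvec A q l) = mulvec A q l" for l
   unfolding hc_A[OF q(2)] by (rule arg_cong[where f = "%g. g l"], rule mulvec_cong, rule hc_self) (use q(3) in auto)
  then have "int (mdeg m) = d" if "m \<in> keys (mulvec A q l)" for m l
   using keys_hc[of m d "mulvec A q l"] that by simp
  then show "s \<in> degcomp (F 0) d" using diff_in[OF q(2), of i] by (simp add: F_simps(5) q(1) diff_def)
 qed
qed

text \<open>All homogeneous components of \<open>B q\<close> vanish on the cone, hence
  \<open>B q\<close> does, and \<open>kernel_B_image_A\<close> applies. Conversely
  \<open>B A = f\<close> vanishes on the cone.\<close>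

lemma kernel_aug: "{q \<in> carrier (F 0). aug q = \<zero>\<^bsub>M\<^esub>} = diff i ` carrier (F 1)"
proof (intro equalityI subsetI)
 fix q assume "q \<in> {q \<in> carrier (F 0). aug q = \<zero>\<^bsub>M\<^esub>}"
 then have q: "q \<in> carrier (F 0)" and a: "aug q d = \<zero>\<^bsub>G d\<^esub>" for d by (auto simp: M_simps fun_eq_iff)
 have B0: "Bsec (%k. hc d (q k)) = (%_ _. 0)" for d
  by (rule spread_inject[OF Bsec_in[OF F_polys[OF q]] Tsec_zero]) (use a[of d] in \<open>simp_all add: aug_def spread_zero\<close>)
 have van: "peval (mulvec B q l) v = 0" if l: "l < 27" and v: "v \<in> cone X" for l v
 proof -
  define T where "T = (\<Union>k<27. mdeg ` keys (q k))"
  have "q k = (\<Sum>d\<in>T. hcomp d (q k))" if "k < 27" for k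
  proof (rule sum_hcomp[symmetric])
   show "finite T" by (simp add: T_def)
   show "mdeg ` keys (q k) \<subseteq> T" using that by (auto simp: T_def)
  qed
  then have "mulvec B q = mulvec B (%k. \<Sum>d\<in>T. hcomp d (q k))" by (rule mulvec_cong)
  then have "peval (mulvec B q l) v = (\<Sum>d\<in>T. peval (mulvec B (%k. hcomp d (q k)) l) v)"
   by (simp add: mulvec_sum peval_sum)
  also have "\<dots> = 0"
  proof (rule sum.neutral, rule ballI)
   fix d show "peval (mulvec B (%k. hcomp d (q k)) l) v = 0"
    using fun_cong[OF fun_cong[OF B0[of "int d"], of v], of l] l v by (simp add: Bsec_def)
  qed
  finally show ?thesis .
 qed
 have "EX r. (ALL k. r k \<in> polys {..n}) & (\<forall>l<27. q l = mulvec A r l)" by (rule kernel_B_image_A[OF F_polys[OF q] van])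
 then obtain r where r: "ALL k. r k \<in> polys {..n}" "\<forall>l<27. q l = mulvec A r l" by (elim exE conjE)
 define r' where "r' = (\<lambda>k\<in>{..<27::nat}. r k)"
 have r': "r' \<in> carrier (F 1)" using r(1) by (auto simp: F_simps r'_def)
 have "mulvec A r' = mulvec A r" by (rule mulvec_cong) (simp add: r'_def)
 then have "q = diff i r'" using r(2) by (intro F_eqI[OF q diff_in[OF r']]) (simp add: diff_def)
 then show "q \<in> diff i ` carrier (F 1)" using r' by blast
next
 fix q assume "q \<in> diff i ` carrier (F 1)"
 then obtain r where r: "r \<in> carrier (F 1)" "q = diff i r" by blast
 have "aug q d = \<zero>\<^bsub>G d\<^esub>" for d
 proof -
  have "Bsec (%k. hc d (q k)) = Bsec (mulvec A (%k. hc (d - 1) (r k)))"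
   by (rule Bsec_cong) (simp add: r(2) diff_def hc_A[OF r(1)])
  also have "\<dots> = (%_ _. 0)" by (auto simp: Bsec_def mulvec_BA cone_f fun_eq_iff)
  finally show ?thesis by (simp add: aug_def spread_zero)
 qed
 then show "q \<in> {q \<in> carrier (F 0). aug q = \<zero>\<^bsub>M\<^esub>}" using diff_in[OF r(1), of i] r(2) by (auto simp: M_simps)
qed

text \<open>\<open>f q = B A q\<close>, and multiplication by \<open>f\<close> is injective.\<close>

lemma kernel_diff: "{q \<in> carrier (F 1). diff i q = \<zero>\<^bsub>F 0\<^esub>} = {\<zero>\<^bsub>F 1\<^esub>}"
proof (intro equalityI subsetI)
 fix q assume "q \<in> {q \<in> carrier (F 1). diff i q = \<zero>\<^bsub>F 0\<^esub>}"
 then have q: "q \<in> carrier (F 1)" and d: "diff i q = (\<lambda>k\<in>{..<27}. 0)" by (auto simp: F_simps(2))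
 have "mulvec A q k = 0" if "k < 27" for k using fun_cong[OF d, of k] that by (simp add: diff_def)
 then have "mulvec B (mulvec A q) = mulvec B (%_. 0)" by (rule mulvec_cong)
 then have "f * q k = 0" if "k < 27" for k using mulvec_BA[OF that, of q] by (simp add: mulvec_def)
 then have "q k = 0" if "k < 27" for k using f_nonzero that by simp
 then have "q = \<zero>\<^bsub>F 1\<^esub>" by (intro F_eqI[OF q]) (auto simp: F_simps)
 then show "q \<in> {\<zero>\<^bsub>F 1\<^esub>}" by simp
next
 fix q assume "q \<in> {\<zero>\<^bsub>F 1\<^esub>}"
 moreover have "mulvec A (\<zero>\<^bsub>F 1\<^esub>) = mulvec A (%_. 0)" by (rule mulvec_cong) (simp add: F_simps)
 ultimately show "q \<in> {q \<in> carrier (F 1). diff i q = \<zero>\<^bsub>F 0\<^esub>}" by (auto simp: F_simps diff_def mulvec_def)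
qed

text \<open>The entries of \<open>A\<close> are linear forms, so the degree 0 component of the image
  comes from degree -1, where there is nothing.\<close>

lemma diff_minimal:
 assumes "q \<in> carrier (F 1)" "k < 27" shows "lookup (diff i q k) 0 = 0"
proof -
 have "hc 0 (mulvec A q k) = mulvec A (%k. hc (- 1) (q k)) k" using hc_A[OF assms(1), of 0] by simp
 also have "\<dots> = 0" by (simp add: hc_def mulvec_def)
 finally have "hcomp 0 (mulvec A q k) = 0" by (simp add: hc_def)
 then have "lookup (hcomp 0 (mulvec A q k)) 0 = 0" by simp
 then show ?thesis using assms(2) by (simp add: diff_def lookup_hcomp mdeg_def)
qed

theorem ulrich_E: "ulrich_sheaf n X 1 E"
proof -
 have "minimal_free_resolution n M 1 (%i. replicate 27 (int i)) aug diff"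
  unfolding minimal_free_resolution_def Let_def F_def[symmetric]
  using aug_hom diff_hom[of 1] aug_surj kernel_aug[of 1] kernel_diff[of 1] diff_minimal[of _ _ 1]
  by simp
 then show ?thesis unfolding ulrich_sheaf_def ulrich_module_def M_def[symmetric]
  using coherent_E by (intro conjI exI[of _ "%i. replicate 27 (int i)"] exI[of _ aug] exI[of _ diff]) auto
qed

end

section \<open>The rank of the kernel sheaf\<close>

lemma form1_add:
 assumes "p \<in> forms I 1" shows "peval p (%i. x i + s * y i) = peval p x + s * peval p y"
proof -
 have "meval m (%i. x i + s * y i) = meval m x + s * meval m y" if "m \<in> keys p" for m
 proof -
  have "mdeg m = 1" using that assms by (auto simp: forms_def monomials_def)
  then have "\<exists>a\<in>keys m. lookup m a = 1 & (\<forall>b\<in>keys m. a ~= b --> lookup m b = 0)"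
   unfolding mdeg_def by (subst (asm) sum_eq_1_iff) simp_all
  then obtain a where a: "a \<in> keys m" "lookup m a = 1" "\<forall>b\<in>keys m. a ~= b --> lookup m b = 0"
   by (elim bexE conjE)
  have "m = single a 1"
   by (rule poly_mapping_eqI) (use a in \<open>auto simp: lookup_single when_def in_keys_iff\<close>)
  then show ?thesis by (simp add: meval_single del: One_nat_def)
 qed
 then show ?thesis
  by (simp add: peval_meval sum_distrib_left sum.distrib[symmetric] algebra_simps)
qed

lemma poly_eq_off_0:
 assumes "!!c :: complex. c ~= 0 ==> poly p c = poly q c" shows "p = q"
proof (rule ccontr)
 assume "p ~= q"
 then have "finite {c. poly (p - q) c = 0}" by (intro poly_roots_finite) simp
 moreover have "UNIV - {0} \<subseteq> {c. poly (p - q) c = 0}" using assms by auto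
 ultimately have "finite (UNIV - {0 :: complex})" by (rule finite_subset[rotated])
 then show False using infinite_UNIV_char_0[where 'a = complex] by (simp add: infinite_remove)
qed

context good_cubic
begin

definition nz :: "nat mpoly => bool" where
 "nz p \<longleftrightarrow> (\<exists>v\<in>cone X. peval p v ~= 0)"

lemma nz_mult:
 assumes p: "p \<in> forms {..n} d" and q: "q \<in> forms {..n} e" and "nz p" "nz q" shows "nz (p * q)"
proof (rule ccontr)
 assume "\<not> nz (p * q)"
 then have *: "peval p v * peval q v = 0" if "v \<in> cone X" for v using that by (simp add: nz_def)
 have pf: "polyfn {..n} (peval p)" "polyfn {..n} (peval q)" by (rule polyfn_peval, rule forms_polys, rule p q)+
 have "peval p v * peval q v = 0" if "on_cone v" for v
  by (rule on_cone_ball[OF polyfn_mult[OF pf] * that])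
 then have "(ALL v. on_cone v --> peval p v = 0) \<or> (ALL v. on_cone v --> peval q v = 0)"
  by (rule cone_domain[OF pf])
 then show False using assms(3,4) cone_iff unfolding nz_def by blast
qed

lemma peval_Var: "peval (Var i) x = x i"
 by (simp add: meval_single del: One_nat_def)

lemma nz_Var0: "nz (Var 0)"
proof -
 obtain v where v: "on_cone v" "v 0 ^ 1 ~= 0" using coordinate_nonzero_on_cone[of 1] by (elim exE conjE)
 have "trunc v 0 = v 0" by (simp add: trunc_def)
 then have "peval (Var 0) (trunc v) ~= 0" unfolding peval_Var using v(2) by simp
 then show ?thesis unfolding nz_def using trunc_cone[OF v(1)] by (intro bexI)
qed

definition en :: "nat => complex" where "en = (%i. if i = n then 1 else 0)"

text \<open>The partial derivative of \<open>f\<close> by \<open>x n\<close>, in terms of the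
  expansion in powers of \<open>x n\<close>.\<close>

definition dfn :: "(nat => complex) => complex" where
 "dfn v = 3 * lc * v n ^ 2 + 2 * part 2 v * v n + part 1 v"

lemma f_line:
 "peval f (%i. v i + s * en i) = peval f v + s * dfn v + s\<^sup>2 * (3 * lc * v n + part 2 v) + s ^ 3 * lc"
proof -
 have "(%i. v i + s * en i) = v(n := v n + s)" by (auto simp: en_def)
 then have "peval f (%i. v i + s * en i) = lc * (v n + s) ^ 3 + part 2 v * (v n + s) ^ 2 + part 1 v * (v n + s) + part 0 v"
  using f_expand_upd[of v "v n + s"] by (simp only:)
 then show ?thesis unfolding f_expand[of v] dfn_def
  by (simp add: algebra_simps power2_eq_square power3_eq_cube)
qed

text \<open>Of degree 2 in \<open>x n\<close>, the derivative is its own remainder modulo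
  \<open>f\<close>, and the coefficient \<open>3 * lc\<close> of that remainder is nonzero.\<close>

lemma dfn_nonzero: "\<exists>v\<in>cone X. dfn v ~= 0"
proof (rule ccontr)
 assume *: "\<not> (\<exists>v\<in>cone X. dfn v ~= 0)"
 have b: "polyfn {..<n} (part 1)" "polyfn {..<n} (%v. 2 * part 2 v)" "polyfn {..<n} (%v. 3 * lc)"
  by (intro polyfn_part polyfn_cmult polyfn_const)+
 have "polyfn {..n} dfn" unfolding dfn_def[abs_def]
  by (intro polyfn_add polyfn_mult polyfn_power polyfn_const polyfn_var base_mono[OF polyfn_part]) auto
 then have "dfn v = 0" if "on_cone v" for v by (rule on_cone_ball) (use * that in auto)
 then have "part 1 v + 2 * part 2 v * v n + 3 * lc * v n ^ 2 = 0" if "on_cone v" for v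
  using that by (simp add: dfn_def algebra_simps)
 from reduced_vanish[OF b, of undefined] this have "3 * lc = 0" by blast
 then show False using lc_nonzero by simp
qed

end

text \<open>The trace of the derivative of \<open>A\<close> times \<open>B\<close> fixes the rank;
  for the factors obtained from \<open>hess\<close> and \<open>cofactor\<close> it is
  \<open>trace_hess_cofactor\<close>.\<close>

locale ranked_factorization = matrix_factorization +
 assumes trace: "!!v. (\<Sum>i<27. \<Sum>k<27. peval (A i k) en * peval (B k i) v) = 9 * dfn v"
begin

text \<open>\<open>B\<close> times the derivative of \<open>A\<close> by \<open>x n\<close>; up to
  the factor \<open>D\<close> this is the projection onto the kernel of \<open>A\<close> along the
  cone.\<close>

definition P :: "nat => nat => nat mpoly" where
 "P i k = (\<Sum>j<27. B i j * Const (peval (A j k) en))"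

text \<open>One ninth of the trace of \<open>P\<close>: a form by construction, with the values of
  the derivative of \<open>f\<close>.\<close>

definition D :: "nat mpoly" where
 "D = Const (1 / 9) * (\<Sum>i<27. P i i)"

lemma P_form: "P i k \<in> forms {..n} 2"
 unfolding P_def
proof (rule forms_sum)
 fix j show "B i j * Const (peval (A j k) en) \<in> forms {..n} 2"
  using forms_mult[OF B_form forms_Const, of i j] by simp
qed

lemma D_form: "D \<in> forms {..n} 2"
 unfolding D_def by (intro forms_cmult forms_sum P_form)

lemma peval_P: "peval (P i k) v = (\<Sum>j<27. peval (B i j) v * peval (A j k) en)"
 by (simp add: P_def peval_sum)

lemma trace_P: "(\<Sum>i<27. peval (P i i) v) = 9 * peval D v"
 by (simp add: D_def peval_sum)

lemma peval_D: "peval D v = dfn v"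
proof -
 have "(\<Sum>i<27. peval (P i i) v) = (\<Sum>i<27. \<Sum>k<27. peval (A i k) en * peval (B k i) v)"
  unfolding peval_P by (subst sum.swap) (simp add: mult.commute)
 then show ?thesis using trace[of v] trace_P[of v] by simp
qed

text \<open>Differentiating \<open>B A = f\<close> in the direction of the last coordinate vector: on the kernel of \<open>A\<close>
 at a point of the cone, \<open>P\<close> is multiplication by the derivative \<open>D\<close> of \<open>f\<close>.\<close>

lemma kernel_P:
 assumes v: "v \<in> cone X" and t: "!!i. i < 27 ==> (\<Sum>j<27. peval (A i j) v * t j) = 0" and i: "i < 27"
 shows "(\<Sum>k<27. peval (P i k) v * t k) = peval D v * t i"
proof -
 define y where "y j = (\<Sum>k<27. peval (A j k) en * t k)" for j
 define u where "u s = (%i. v i + s * en i)" for s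
 have "ALL j. EX Q. ALL s. peval (B i j) (u s) = poly Q s"
 proof
  fix j
  show "EX Q. ALL s. peval (B i j) (u s) = poly Q s"
  proof (rule polyfn_line[OF polyfn_peval[OF forms_polys[OF B_form[of i j]]], of v en])
   fix Q assume "!!s. peval (B i j) (%i. v i + s * en i) = poly Q s"
   then show ?thesis by (intro exI[of _ Q]) (simp add: u_def)
  qed
 qed
 from choice[OF this] obtain Q where Q: "ALL j s. peval (B i j) (u s) = poly (Q j) s" by (elim exE)
 have At: "(\<Sum>k<27. peval (A j k) (u s) * t k) = s * y j" if "j < 27" for j s
 proof -
  have "(\<Sum>k<27. peval (A j k) (u s) * t k) = (\<Sum>k<27. peval (A j k) v * t k) + s * y j"
   unfolding u_def form1_add[OF A_form] y_def by (simp add: sum_distrib_left sum.distrib algebra_simps)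
  then show ?thesis using t[OF that] by simp
 qed
 have BA_u: "peval f (u s) * t i = (\<Sum>j<27. poly (Q j) s * (s * y j))" for s
 proof -
  have "(\<Sum>j<27. poly (Q j) s * (s * y j)) = (\<Sum>j<27. \<Sum>k<27. peval (B i j) (u s) * peval (A j k) (u s) * t k)"
   using At[of _ s] Q by (intro sum.cong refl) (simp add: sum_distrib_left mult.assoc flip: At)
  also have "\<dots> = (\<Sum>k<27. peval (\<Sum>j<27. B i j * A j k) (u s) * t k)"
   by (subst sum.swap) (simp add: peval_sum sum_distrib_right)
  also have "\<dots> = (\<Sum>k<27. if k = i then peval f (u s) * t i else 0)"
   by (intro sum.cong refl) (simp add: BA[OF i])
  finally show ?thesis using i by simp
 qed
 have "[:dfn v * t i, (3 * lc * v n + part 2 v) * t i, lc * t i:] = (\<Sum>j<27. smult (y j) (Q j))"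
 proof (rule poly_eq_off_0)
  fix s :: complex assume s: "s ~= 0"
  have "s * ((dfn v + s * (3 * lc * v n + part 2 v) + s\<^sup>2 * lc) * t i) = peval f (u s) * t i"
   unfolding u_def f_line cone_f[OF v] by (simp add: algebra_simps power2_eq_square power3_eq_cube)
  also have "\<dots> = s * (\<Sum>j<27. y j * poly (Q j) s)" unfolding BA_u by (simp add: sum_distrib_left mult_ac)
  finally have "(dfn v + s * (3 * lc * v n + part 2 v) + s\<^sup>2 * lc) * t i = (\<Sum>j<27. y j * poly (Q j) s)" using s by simp
  then show "poly [:dfn v * t i, (3 * lc * v n + part 2 v) * t i, lc * t i:] s = poly (\<Sum>j<27. smult (y j) (Q j)) s"
   by (simp add: poly_sum algebra_simps power2_eq_square)
 qed
 then have "poly [:dfn v * t i, (3 * lc * v n + part 2 v) * t i, lc * t i:] 0 = poly (\<Sum>j<27. smult (y j) (Q j)) 0" by (simp only:)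
 then have "dfn v * t i = (\<Sum>j<27. y j * poly (Q j) 0)" by (simp add: poly_sum)
 also have "\<dots> = (\<Sum>j<27. peval (B i j) v * y j)"
  using Q[rule_format, of _ 0] by (simp add: u_def mult.commute)
 also have "\<dots> = (\<Sum>j<27. \<Sum>k<27. peval (B i j) v * peval (A j k) en * t k)"
  by (simp add: y_def sum_distrib_left mult.assoc)
 also have "\<dots> = (\<Sum>k<27. peval (P i k) v * t k)"
  unfolding peval_P by (subst sum.swap) (simp add: sum_distrib_right)
 finally show ?thesis by (simp add: peval_D)
qed

lemma A_P:
 assumes "i < 27" "v \<in> cone X" shows "(\<Sum>j<27. peval (A i j) v * peval (P j k) v) = 0"
proof -
 have "(\<Sum>j<27. peval (A i j) v * peval (P j k) v) = (\<Sum>l<27. peval (\<Sum>j<27. A i j * B j l) v * peval (A l k) en)"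
  unfolding peval_P sum_distrib_left peval_sum sum_distrib_right by (subst sum.swap) (simp add: mult.assoc)
 also have "\<dots> = 0"
  using AB[OF assms(1)] cone_f[OF assms(2)] by (intro sum.neutral ballI) simp
 finally show ?thesis .
qed

text \<open>\<open>h P = S T\<close> on the cone, through the coordinates from \<open>Z\<close>. The
  least possible size of \<open>Z\<close> is the rank of \<open>P\<close> over the function field,
  here expressed by forms alone; \<open>\<alpha> + \<beta> = \<epsilon> + 2\<close> says that both
  sides have the same degree.\<close>

definition factors :: "nat set => nat => nat => nat => (nat => nat => nat mpoly) => (nat => nat => nat mpoly) => nat mpoly => bool" where
 "factors Z \<alpha> \<beta> \<epsilon> S T h \<longleftrightarrow> finite Z & (\<forall>i<27. \<forall>k\<in>Z. S i k \<in> forms {..n} \<alpha>) & (\<forall>k\<in>Z. \<forall>j<27. T k j \<in> forms {..n} \<beta>) &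
  h \<in> forms {..n} \<epsilon> & \<alpha> + \<beta> = \<epsilon> + 2 & nz h &
  (\<forall>i<27. \<forall>j<27. \<forall>v\<in>cone X. peval h v * peval (P i j) v = (\<Sum>k\<in>Z. peval (S i k) v * peval (T k j) v))"

lemma factorsD:
 assumes "factors Z \<alpha> \<beta> \<epsilon> S T h"
 shows "finite Z" "!!i k. i < 27 ==> k \<in> Z ==> S i k \<in> forms {..n} \<alpha>" "!!k j. k \<in> Z ==> j < 27 ==> T k j \<in> forms {..n} \<beta>"
  "h \<in> forms {..n} \<epsilon>" "\<alpha> + \<beta> = \<epsilon> + 2" "nz h"
  "!!i j v. i < 27 ==> j < 27 ==> v \<in> cone X ==> peval h v * peval (P i j) v = (\<Sum>k\<in>Z. peval (S i k) v * peval (T k j) v)"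
 using assms unfolding factors_def by auto

lemma factors_trivial: "factors {..<27} 2 0 0 P (%k j. if k = j then 1 else 0) 1"
proof -
 have "(\<Sum>k<27. peval (P i k) v * peval (if k = j then 1 else 0) v) = peval (P i j) v" if "j < 27" for i j v
 proof -
  have "(\<Sum>k<27. peval (P i k) v * peval (if k = j then 1 else 0) v) = (\<Sum>k<27. if k = j then peval (P i j) v else 0)"
   by (intro sum.cong refl) simp
  then show ?thesis using that by simp
 qed
 moreover have "nz 1" using nz_Var0 by (auto simp: nz_def)
 ultimately show ?thesis by (auto simp: factors_def P_form)
qed

text \<open>A factorization through the fewest summands has linearly independent columns and rows:
 a dependency allows to eliminate one summand, after multiplication by one of its coefficients.\<close>

lemma factors_eliminate_column:
 assumes F: "factors Z \<alpha> \<beta> \<epsilon> S T h" and c: "!!k. k \<in> Z ==> c k \<in> forms {..n} \<gamma>"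
  and dep: "!!i v. i < 27 ==> v \<in> cone X ==> (\<Sum>k\<in>Z. peval (S i k) v * peval (c k) v) = 0"
  and k: "k \<in> Z" "nz (c k)"
 shows "factors (Z - {k}) \<alpha> (\<gamma> + \<beta>) (\<gamma> + \<epsilon>) S (%q j. c k * T q j - c q * T k j) (c k * h)"
 unfolding factors_def
proof (intro conjI allI ballI impI)
 note F = factorsD[OF F]
 show "c k * T q j - c q * T k j \<in> forms {..n} (\<gamma> + \<beta>)" if "q \<in> Z - {k}" "j < 27" for q j
  using that k by (intro forms_diff forms_mult c F) auto
 show "c k * h \<in> forms {..n} (\<gamma> + \<epsilon>)" by (intro forms_mult c F k)
 show "nz (c k * h)" by (rule nz_mult[OF c[OF k(1)] F(4) k(2) F(6)])
 fix i j v assume ij: "i < (27::nat)" "j < (27::nat)" and v: "v \<in> cone X"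
 have "(\<Sum>q\<in>Z - {k}. peval (S i q) v * peval (c k * T q j - c q * T k j) v) = (\<Sum>q\<in>Z. peval (S i q) v * peval (c k * T q j - c q * T k j) v)"
  using F(1) k by (simp add: sum.remove[of Z k])
 also have "\<dots> = peval (c k) v * (\<Sum>q\<in>Z. peval (S i q) v * peval (T q j) v) - peval (T k j) v * (\<Sum>q\<in>Z. peval (S i q) v * peval (c q) v)"
  by (simp add: sum_distrib_left sum_subtractf algebra_simps)
 finally show "peval (c k * h) v * peval (P i j) v = (\<Sum>q\<in>Z - {k}. peval (S i q) v * peval (c k * T q j - c q * T k j) v)"
  using F(7)[OF ij v] dep[OF ij(1) v] by (simp add: mult.assoc)
qed (use factorsD[OF F] in auto)

lemma factors_eliminate_row:
 assumes F: "factors Z \<alpha> \<beta> \<epsilon> S T h" and c: "!!k. k \<in> Z ==> c k \<in> forms {..n} \<gamma>"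
  and dep: "!!j v. j < 27 ==> v \<in> cone X ==> (\<Sum>k\<in>Z. peval (c k) v * peval (T k j) v) = 0"
  and k: "k \<in> Z" "nz (c k)"
 shows "factors (Z - {k}) (\<gamma> + \<alpha>) \<beta> (\<gamma> + \<epsilon>) (%i q. c k * S i q - c q * S i k) T (c k * h)"
 unfolding factors_def
proof (intro conjI allI ballI impI)
 note F = factorsD[OF F]
 show "c k * S i q - c q * S i k \<in> forms {..n} (\<gamma> + \<alpha>)" if "i < 27" "q \<in> Z - {k}" for i q
  using that k by (intro forms_diff forms_mult c F) auto
 show "c k * h \<in> forms {..n} (\<gamma> + \<epsilon>)" by (intro forms_mult c F k)
 show "nz (c k * h)" by (rule nz_mult[OF c[OF k(1)] F(4) k(2) F(6)])
 fix i j v assume ij: "i < (27::nat)" "j < (27::nat)" and v: "v \<in> cone X"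
 have "(\<Sum>q\<in>Z - {k}. peval (c k * S i q - c q * S i k) v * peval (T q j) v) = (\<Sum>q\<in>Z. peval (c k * S i q - c q * S i k) v * peval (T q j) v)"
  using F(1) k by (simp add: sum.remove[of Z k])
 also have "\<dots> = peval (c k) v * (\<Sum>q\<in>Z. peval (S i q) v * peval (T q j) v) - peval (S i k) v * (\<Sum>q\<in>Z. peval (c q) v * peval (T q j) v)"
  by (simp add: sum_distrib_left sum_subtractf algebra_simps)
 finally show "peval (c k * h) v * peval (P i j) v = (\<Sum>q\<in>Z - {k}. peval (c k * S i q - c q * S i k) v * peval (T q j) v)"
  using F(7)[OF ij v] dep[OF ij(2) v] by (simp add: mult.assoc)
qed (use factorsD[OF F] in auto)

definition minimal_factors where
 "minimal_factors Z \<alpha> \<beta> \<epsilon> S T h \<longleftrightarrow> factors Z \<alpha> \<beta> \<epsilon> S T h &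
  (\<forall>Z' \<alpha>' \<beta>' \<epsilon>' S' T' h'. factors Z' \<alpha>' \<beta>' \<epsilon>' S' T' h' --> card Z \<le> card Z')"

lemma minimal_factors_exist: "\<exists>Z \<alpha> \<beta> \<epsilon> S T h. minimal_factors Z \<alpha> \<beta> \<epsilon> S T h"
proof -
 let ?Q = "%r. \<exists>Z \<alpha> \<beta> \<epsilon> S T h. factors Z \<alpha> \<beta> \<epsilon> S T h & card Z = r"
 have "factors {..<27} 2 0 0 P (%k j. if k = j then 1 else 0) 1 & card {..<27::nat} = 27"
  using factors_trivial by simp
 then have "?Q 27" by (intro exI)
 then have "?Q (LEAST r. ?Q r)" by (rule LeastI)
 then obtain Z \<alpha> \<beta> \<epsilon> S T h where *: "factors Z \<alpha> \<beta> \<epsilon> S T h" "card Z = (LEAST r. ?Q r)" by (elim exE conjE)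
 have "card Z \<le> card Z'" if "factors Z' \<alpha>' \<beta>' \<epsilon>' S' T' h'" for Z' \<alpha>' \<beta>' \<epsilon>' S' T' h'
 proof -
  have "factors Z' \<alpha>' \<beta>' \<epsilon>' S' T' h' & card Z' = card Z'" using that by simp
  then have "?Q (card Z')" by (intro exI)
  then show ?thesis unfolding *(2) by (rule Least_le)
 qed
 then show ?thesis using *(1) unfolding minimal_factors_def by (intro exI conjI allI impI)
qed

lemma minimal_column:
 assumes m: "minimal_factors Z \<alpha> \<beta> \<epsilon> S T h" and c: "!!k. k \<in> Z ==> c k \<in> forms {..n} \<gamma>"
  and dep: "!!i v. i < 27 ==> v \<in> cone X ==> (\<Sum>k\<in>Z. peval (S i k) v * peval (c k) v) = 0"
  and k: "k \<in> Z" and v: "v \<in> cone X"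
 shows "peval (c k) v = 0"
proof (rule ccontr)
 assume "peval (c k) v ~= 0"
 then have "nz (c k)" using v by (auto simp: nz_def)
 have F: "factors Z \<alpha> \<beta> \<epsilon> S T h" using m by (simp add: minimal_factors_def)
 have "card Z \<le> card (Z - {k})"
  using m[unfolded minimal_factors_def, THEN conjunct2, rule_format, OF factors_eliminate_column[OF F c dep k \<open>nz (c k)\<close>]] .
 then show False using factorsD(1)[OF F] k card_Diff1_less[of Z k] by simp
qed

lemma minimal_row:
 assumes m: "minimal_factors Z \<alpha> \<beta> \<epsilon> S T h" and c: "!!k. k \<in> Z ==> c k \<in> forms {..n} \<gamma>"
  and dep: "!!j v. j < 27 ==> v \<in> cone X ==> (\<Sum>k\<in>Z. peval (c k) v * peval (T k j) v) = 0"
  and k: "k \<in> Z" and v: "v \<in> cone X"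
 shows "peval (c k) v = 0"
proof (rule ccontr)
 assume "peval (c k) v ~= 0"
 then have "nz (c k)" using v by (auto simp: nz_def)
 have F: "factors Z \<alpha> \<beta> \<epsilon> S T h" using m by (simp add: minimal_factors_def)
 have "card Z \<le> card (Z - {k})"
  using m[unfolded minimal_factors_def, THEN conjunct2, rule_format, OF factors_eliminate_row[OF F c dep k \<open>nz (c k)\<close>]] .
 then show False using factorsD(1)[OF F] k card_Diff1_less[of Z k] by simp
qed

lemma sum_mult_sum: "(\<Sum>b\<in>Z. x b * (\<Sum>l\<in>J. y b l * z l)) = (\<Sum>l\<in>J. (\<Sum>b\<in>Z. x b * y b l) * (z l :: complex))"
 by (simp add: sum_distrib_left sum_distrib_right mult.assoc) (rule sum.swap)

context
 fixes Z \<alpha> \<beta> \<epsilon> S T h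
 assumes m: "minimal_factors Z \<alpha> \<beta> \<epsilon> S T h"
begin

lemma F: "factors Z \<alpha> \<beta> \<epsilon> S T h"
 using m by (simp add: minimal_factors_def)

lemmas FD = factorsD[OF F]

text \<open>\<open>A S T = h A P = 0\<close> on the cone, and the rows of \<open>T\<close> are
  independent by minimality, so \<open>A S = 0\<close>.\<close>

lemma minimal_kernel:
 assumes i: "i < 27" and k: "k \<in> Z" and v: "v \<in> cone X"
 shows "(\<Sum>l<27. peval (A i l) v * peval (S l k) v) = 0"
proof -
 have "peval (\<Sum>l<27. A i l * S l k) v = 0"
 proof (rule minimal_row[OF m _ _ k v])
  show "(\<Sum>l<27. A i l * S l k) \<in> forms {..n} (1 + \<alpha>)" if k: "k \<in> Z" for k
  proof (rule forms_sum)
   fix l :: nat assume "l \<in> {..<27}"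
   then show "A i l * S l k \<in> forms {..n} (1 + \<alpha>)" using forms_mult[OF A_form FD(2)[OF _ k], of l i l] by simp
  qed
  fix j v assume j: "j < (27::nat)" and v: "v \<in> cone X"
  have "(\<Sum>k\<in>Z. peval (\<Sum>l<27. A i l * S l k) v * peval (T k j) v) = (\<Sum>l<27. peval (A i l) v * (\<Sum>k\<in>Z. peval (S l k) v * peval (T k j) v))"
   by (simp add: sum_mult_sum peval_sum)
  also have "\<dots> = (\<Sum>l<27. peval (A i l) v * (peval h v * peval (P l j) v))"
   using FD(7)[OF _ j v] by (intro sum.cong refl) simp
  also have "\<dots> = peval h v * (\<Sum>l<27. peval (A i l) v * peval (P l j) v)" by (rule sum_scale)
  finally show "(\<Sum>k\<in>Z. peval (\<Sum>l<27. A i l * S l k) v * peval (T k j) v) = 0" using A_P[OF i v] by simp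
 qed
 then show ?thesis by (simp add: peval_sum)
qed

text \<open>On the cone \<open>P P = D P\<close>, because the columns of \<open>P\<close> lie in the
  kernel of \<open>A\<close>. So \<open>S (T S - h D) T = h h P P - h D h P = 0\<close>; minimality
  allows \<open>S\<close> to be cancelled on the left and \<open>T\<close> on the right.\<close>

lemma minimal_product:
 assumes a: "a \<in> Z" and b: "b \<in> Z" and v: "v \<in> cone X"
 shows "(\<Sum>i<27. peval (T a i) v * peval (S i b) v) = (if a = b then peval h v * peval D v else 0)"
proof -
 define N where "N a b = (\<Sum>i<27. T a i * S i b) - (if a = b then h * D else 0)" for a b
 have N: "N a b \<in> forms {..n} (\<epsilon> + 2)" if ab: "a \<in> Z" "b \<in> Z" for a b
  unfolding N_def
 proof (intro forms_diff forms_sum)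
  show "(if a = b then h * D else 0) \<in> forms {..n} (\<epsilon> + 2)" using forms_mult[OF FD(4) D_form] by simp
  fix i :: nat assume "i \<in> {..<27}"
  then show "T a i * S i b \<in> forms {..n} (\<epsilon> + 2)"
   using forms_mult[OF FD(3)[OF ab(1)] FD(2)[OF _ ab(2)], of i i] FD(5) by (simp add: add.commute)
 qed
 have pN: "peval (N a b) v = (\<Sum>i<27. peval (T a i) v * peval (S i b) v) - (if a = b then peval h v * peval D v else 0)" for a b v
  by (simp add: N_def peval_sum)
 have NT: "peval (\<Sum>b\<in>Z. N a b * T b j) v = 0" if a: "a \<in> Z" and j: "j < 27" and v: "v \<in> cone X" for a j v
 proof (rule minimal_column[OF m _ _ a v])
  show "(\<Sum>b\<in>Z. N a b * T b j) \<in> forms {..n} (\<epsilon> + 2 + \<beta>)" if a: "a \<in> Z" for a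
  proof (rule forms_sum)
   fix b assume b: "b \<in> Z"
   show "N a b * T b j \<in> forms {..n} (\<epsilon> + 2 + \<beta>)" by (rule forms_mult[OF N[OF a b] FD(3)[OF b j]])
  qed
  fix i v assume i: "i < (27::nat)" and v: "v \<in> cone X"
  let ?h = "peval h v" and ?D = "peval D v"
  have NTa: "peval (\<Sum>b\<in>Z. N a b * T b j) v = (\<Sum>l<27. peval (T a l) v * (?h * peval (P l j) v)) - ?h * ?D * peval (T a j) v" if "a \<in> Z" for a
  proof -
   have "peval (\<Sum>b\<in>Z. N a b * T b j) v = (\<Sum>b\<in>Z. (\<Sum>l<27. peval (T a l) v * peval (S l b) v) * peval (T b j) v)
    - (\<Sum>b\<in>Z. (if a = b then ?h * ?D else 0) * peval (T b j) v)"
    by (simp add: peval_sum pN left_diff_distrib sum_subtractf)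
   also have "(\<Sum>b\<in>Z. (if a = b then ?h * ?D else 0) * peval (T b j) v) = (\<Sum>b\<in>Z. if a = b then ?h * ?D * peval (T a j) v else 0)"
    by (intro sum.cong refl) simp
   also have "\<dots> = ?h * ?D * peval (T a j) v" using FD(1) that by simp
   also have "(\<Sum>b\<in>Z. (\<Sum>l<27. peval (T a l) v * peval (S l b) v) * peval (T b j) v) = (\<Sum>l<27. peval (T a l) v * (\<Sum>b\<in>Z. peval (S l b) v * peval (T b j) v))"
    by (rule sum_mult_sum[symmetric])
   also have "\<dots> = (\<Sum>l<27. peval (T a l) v * (?h * peval (P l j) v))"
    using FD(7)[OF _ j v] by (intro sum.cong refl) simp
   finally show ?thesis .
  qed
  have "(\<Sum>k\<in>Z. peval (S i k) v * peval (\<Sum>b\<in>Z. N k b * T b j) v) =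
   (\<Sum>k\<in>Z. peval (S i k) v * (\<Sum>l<27. peval (T k l) v * (?h * peval (P l j) v))) - ?h * ?D * (\<Sum>k\<in>Z. peval (S i k) v * peval (T k j) v)"
  proof -
   have "(\<Sum>k\<in>Z. peval (S i k) v * peval (\<Sum>b\<in>Z. N k b * T b j) v) =
    (\<Sum>k\<in>Z. peval (S i k) v * (\<Sum>l<27. peval (T k l) v * (?h * peval (P l j) v)) - peval (S i k) v * (?h * ?D * peval (T k j) v))"
    by (intro sum.cong refl) (simp only: NTa right_diff_distrib)
   then show ?thesis by (simp only: sum_subtractf sum_scale)
  qed
  also have "(\<Sum>k\<in>Z. peval (S i k) v * (\<Sum>l<27. peval (T k l) v * (?h * peval (P l j) v))) =
   (\<Sum>l<27. (\<Sum>k\<in>Z. peval (S i k) v * peval (T k l) v) * (?h * peval (P l j) v))"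
   by (rule sum_mult_sum)
  also have "\<dots> = (\<Sum>l<27. ?h * peval (P i l) v * (?h * peval (P l j) v))"
   using FD(7)[OF i _ v] by (intro sum.cong refl) simp
  also have "\<dots> = ?h * ?h * (\<Sum>l<27. peval (P i l) v * peval (P l j) v)"
   by (simp add: sum_distrib_left mult_ac)
  also have "(\<Sum>l<27. peval (P i l) v * peval (P l j) v) = ?D * peval (P i j) v"
   by (rule kernel_P[OF v A_P i]) (use v in simp_all)
  also have "(\<Sum>k\<in>Z. peval (S i k) v * peval (T k j) v) = ?h * peval (P i j) v" using FD(7)[OF i j v] by simp
  finally show "(\<Sum>k\<in>Z. peval (S i k) v * peval (\<Sum>b\<in>Z. N k b * T b j) v) = 0" by simp
 qed
 have "peval (N a b) v = 0"
 proof (rule minimal_row[OF m N[OF a] _ b v])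
  show "(\<Sum>b\<in>Z. peval (N a b) v * peval (T b j) v) = 0" if "j < 27" "v \<in> cone X" for j v
   using NT[OF a that] by (simp add: peval_sum)
 qed
 then show ?thesis by (simp add: pN)
qed

lemma nz_hD: "nz (h * D)"
 using dfn_nonzero by (intro nz_mult[OF FD(4) D_form FD(6)]) (simp add: nz_def peval_D)

text \<open>The traces of \<open>S T = h P\<close> and of \<open>T S = h D\<close> times the
  identity agree: \<open>9 h D\<close> equals \<open>card Z\<close> times \<open>h D\<close>, and
  \<open>h D\<close> is nonzero somewhere on the cone.\<close>

lemma minimal_card: "card Z = 9"
proof -
 obtain v where v: "v \<in> cone X" "peval h v * peval D v ~= 0" using nz_hD by (auto simp: nz_def)
 have "peval h v * (9 * peval D v) = (\<Sum>i<27. peval h v * peval (P i i) v)"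
  by (simp add: trace_P[symmetric] sum_distrib_left)
 also have "\<dots> = (\<Sum>i<27. \<Sum>k\<in>Z. peval (T k i) v * peval (S i k) v)"
  using FD(7)[OF _ _ v(1)] by (intro sum.cong refl) (simp add: mult.commute)
 also have "\<dots> = (\<Sum>k\<in>Z. \<Sum>i<27. peval (T k i) v * peval (S i k) v)" by (rule sum.swap)
 also have "\<dots> = (\<Sum>k\<in>Z. peval h v * peval D v)"
  by (intro sum.cong refl) (simp only: minimal_product[OF _ _ v(1)] if_True simp_thms)
 finally have "of_nat (card Z) * (peval h v * peval D v) = 9 * (peval h v * peval D v)" by (simp add: mult_ac)
 then have "of_nat (card Z) = (9 :: complex)" using v(2) by simp
 then have "of_nat (card Z) = (of_nat 9 :: complex)" by simp
 then show ?thesis by (simp only: of_nat_eq_iff)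
qed

end

end

context ranked_factorization
begin

lemma open_form:
 assumes "zar_open n X V" "V ~= {}"
 shows "EX K d. K \<in> forms {..n} d & nz K & basic K \<subseteq> V"
proof -
 obtain Q where "Q \<in> V" using assms(2) by blast
 then obtain K d where K: "K \<in> forms {..n} d" "Q \<in> basic K" "basic K \<subseteq> V"
  using zar_open_basis[OF assms(1)] by blast
 obtain v where "v \<in> cone X" "Q = proj_class v"
  using point_cone zar_open_subset[OF assms(1)] \<open>Q \<in> V\<close> by blast
 then have "nz K" using form_nonzero_class[OF K(1)] K(2) unfolding nz_def by blast
 then show ?thesis using K by blast
qed

context
 fixes Z \<alpha> \<beta> \<epsilon> S T h
 assumes m: "minimal_factors Z \<alpha> \<beta> \<epsilon> S T h"
begin

lemmas FM = factorsD[OF F[OF m]]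

definition idx :: "nat => nat" where "idx = (SOME g. bij_betw g {..<9} Z)"

lemma idx: "bij_betw idx {..<9} Z"
proof -
 have "EX g. bij_betw g {..<9::nat} Z"
  using ex_bij_betw_nat_finite[OF FM(1)] minimal_card[OF m] by (simp add: atLeast0LessThan)
 then show ?thesis unfolding idx_def by (rule someI_ex)
qed

lemma idx_in: "c < 9 ==> idx c \<in> Z"
 using idx by (auto simp: bij_betw_def)

lemma sum_idx: "(\<Sum>c<9. g (idx c)) = (\<Sum>k\<in>Z. g k)"
 by (rule sum.reindex_bij_betw[OF idx])

text \<open>The columns of \<open>S\<close>, of degree \<open>\<alpha>\<close>, brought to the
  degree 2 of sections by powers of \<open>x 0\<close>.\<close>

definition basis :: "nat => section_type" where
 "basis c v l = (if l < 27 & v \<in> cone (chart n X 0) then peval (S l (idx c)) v * v 0 ^ 2 / v 0 ^ \<alpha> else 0)"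

lemma Var0_power: "Var 0 ^ k \<in> forms {..n} k"
 using forms_power[OF forms_Var, of 0 "{..n}" k] by simp

lemma peval_Var0_power: "peval (Var 0 ^ k) v = v 0 ^ k"
 unfolding peval_power peval_Var ..

lemma basis_in: assumes c: "c < 9" shows "basis c \<in> Esec (chart n X 0)"
proof (rule EsecI)
 let ?C = "chart n X 0"
 have C: "zar_open n X ?C" by (rule zar_open_chart) simp
 fix l :: nat assume l: "l < 27"
 have "S l (idx c) * Var 0 ^ 2 \<in> forms {..n} (\<alpha> + 2)" by (rule forms_mult[OF FM(2)[OF l idx_in[OF c]] Var0_power])
 then have "hreg 2 ?C (%v. if v \<in> cone ?C then peval (S l (idx c) * Var 0 ^ 2) v / peval (Var 0 ^ \<alpha>) v else 0)"
  by (rule hreg_quotient[OF C _ Var0_power]) (use cone_chart[of 0] in \<open>simp_all only: peval_Var0_power, simp_all\<close>)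
 moreover have "(%v. if v \<in> cone ?C then peval (S l (idx c) * Var 0 ^ 2) v / peval (Var 0 ^ \<alpha>) v else 0) = (%v. basis c v l)"
  unfolding basis_def peval_mult peval_Var0_power using l by (auto simp: fun_eq_iff)
 ultimately show "hreg 2 ?C (%v. basis c v l)" by simp
next
 fix v and i :: nat assume i: "i < 27"
 show "(\<Sum>j<27. peval (A i j) v * basis c v j) = 0"
 proof (cases "v \<in> cone (chart n X 0)")
  case True
  then have v: "v \<in> cone X" using cone_chart[of 0 v] by simp
  have "(\<Sum>j<27. peval (A i j) v * basis c v j) = (\<Sum>j<27. peval (A i j) v * (v 0 ^ 2 / v 0 ^ \<alpha> * peval (S j (idx c)) v))"
   using True by (intro sum.cong refl) (simp add: basis_def)
  also have "\<dots> = 0" unfolding sum_scale minimal_kernel[OF m i idx_in[OF c] v] by simp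
  finally show ?thesis .
 qed (simp add: basis_def)
qed (simp add: basis_def)

lemma restr_basis: "zar_open n X V ==> V \<subseteq> chart n X 0 ==> c < 9 ==> restr E (chart n X 0) V (basis c) \<in> Esec V"
 using Esec_restrict[OF basis_in] by simp

text \<open>Over a common denominator a relation becomes a dependency between the columns of
  \<open>S\<close> with forms as coefficients, and minimality makes all these forms vanish on the
  cone.\<close>

lemma basis_independent:
 assumes V: "zar_open n X V" "V \<subseteq> chart n X 0" and a: "!!c. c < 9 ==> a c \<in> carrier (reg n X V)"
  and rel: "lincomb (sections E V) 9 a (%c. restr E (chart n X 0) V (basis c)) = \<zero>\<^bsub>sections E V\<^esub>" and c: "c < 9"
 shows "a c = \<zero>\<^bsub>reg n X V\<^esub>"
proof (rule ccontr)
 have VX: "V \<subseteq> X" by (rule zar_open_subset[OF V(1)])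
 assume "a c ~= \<zero>\<^bsub>reg n X V\<^esub>"
 then obtain Q where Q: "a c Q ~= 0" by (auto simp: reg_simps fun_eq_iff)
 then have QV: "Q \<in> V" using reg_out[OF a[OF c]] by blast
 then obtain w where w: "w \<in> cone X" "Q = proj_class w" using point_cone VX by blast
 then have wV: "w \<in> cone V" using class_in[OF VX] QV by blast
 have ha: "\<forall>c\<in>{..<9}. hreg 0 V (lift (a c))" using reg_hreg[OF V(1) a] by simp
 from common_denominator_ball[OF V(1) wV finite_lessThan ha] obtain d K H where K: "K \<in> forms {..n} d" "peval K w ~= 0" "basic K \<subseteq> V"
  "\<forall>c\<in>{..<9}. EX e. H c \<in> forms {..n} e & int e = int d + 0" "\<forall>c\<in>{..<9}. \<forall>v\<in>cone X. peval (H c) v = peval K v * lift (a c) v"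
  by (elim exE conjE)
 have H: "H c \<in> forms {..n} d" if "c < 9" for c using K(4) that by auto
 have Ha: "peval (H c) v = peval K v * lift (a c) v" if "c < 9" "v \<in> cone X" for c v using K(5) that by auto
 let ?i = "inv_into {..<9} idx"
 have inv: "?i (idx c) = c" if "c < 9" for c using idx that by (auto simp: bij_betw_def intro!: inv_into_f_f)
 have inv_lt: "?i k < 9" if "k \<in> Z" for k using bij_betw_inv_into[OF idx] that by (auto simp: bij_betw_def)
 have "peval (H (?i (idx c))) w = 0"
 proof (rule minimal_column[OF m, of "%k. H (?i k)" d])
  show "H (?i k) \<in> forms {..n} d" if "k \<in> Z" for k by (rule H[OF inv_lt[OF that]])
  show "idx c \<in> Z" by (rule idx_in[OF c])
  show "w \<in> cone X" by fact
  fix l v assume l: "l < (27::nat)" and v: "v \<in> cone X"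
  have "(\<Sum>k\<in>Z. peval (S l k) v * peval (H (?i k)) v) = (\<Sum>c<9. peval (S l (idx c)) v * peval (H (?i (idx c))) v)"
   by (rule sum_idx[symmetric])
  also have "\<dots> = peval K v * (\<Sum>c<9. peval (S l (idx c)) v * lift (a c) v)"
   unfolding sum_distrib_left by (intro sum.cong refl) (simp add: inv Ha[OF _ v] mult_ac)
  also have "\<dots> = 0"
  proof (cases "v \<in> cone V")
   case True
   then have v0: "v \<in> cone (chart n X 0)" "v 0 ~= 0" using cone_mono[OF V(2)] cone_chart[of 0 v] by auto
   have "0 = lincomb (sections E V) 9 a (%c. restr E (chart n X 0) V (basis c)) v l" unfolding rel by simp
   also have "\<dots> = (\<Sum>c<9. a c (proj_class v) * restr E (chart n X 0) V (basis c) v l)"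
    by (rule lincomb_eval[OF V(1) a restr_basis[OF V]])
   also have "\<dots> = (\<Sum>c<9. peval (S l (idx c)) v * (v 0 ^ 2 / v 0 ^ \<alpha> * lift (a c) v))"
    using True v v0 l by (intro sum.cong refl) (simp add: basis_def lift_def)
   also have "\<dots> = v 0 ^ 2 / v 0 ^ \<alpha> * (\<Sum>c<9. peval (S l (idx c)) v * lift (a c) v)" by (rule sum_scale)
   finally show ?thesis using v0(2) by simp
  next
   case False
   then have "lift (a c) v = 0" if "c < 9" for c using hreg_out[OF ha[rule_format]] that by simp
   then show ?thesis by simp
  qed
  finally show "(\<Sum>k\<in>Z. peval (S l k) v * peval (H (?i k)) v) = 0" .
 qed
 then have "peval K w * lift (a c) w = 0" using Ha[OF c w(1)] inv[OF c] by simp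
 then show False using K(2) Q w by (simp add: lift_def)
qed

text \<open>On the kernel of \<open>A\<close> the matrix \<open>P\<close> acts as multiplication by
  \<open>D\<close>, so \<open>h D t = h P t = S (T t)\<close>. Where \<open>h D\<close> is nonzero,
  \<open>T t\<close> divided by \<open>h D\<close> gives the coordinates of \<open>t\<close>, up to
  a power of \<open>x 0\<close>.\<close>

lemma basis_generates:
 assumes V: "zar_open n X V" "V ~= {}" and t: "t \<in> Esec V"
 shows "EX W a. zar_open n X W & W ~= {} & W \<subseteq> chart n X 0 \<inter> V & (\<forall>c<9. a c \<in> carrier (reg n X W)) &
  restr E V W t = lincomb (sections E W) 9 a (%c. restr E (chart n X 0) W (basis c))"
proof -
 let ?C = "chart n X 0"
 have C: "zar_open n X ?C" by (rule zar_open_chart) simp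
 have hD: "h * D \<in> forms {..n} (\<epsilon> + 2)" by (rule forms_mult[OF FM(4) D_form])
 define W where "W = V \<inter> ?C \<inter> basic (h * D)"
 have W: "zar_open n X W" unfolding W_def by (intro zar_open_Int V C zar_open_basic[OF hD])
 have WX: "W \<subseteq> X" by (rule zar_open_subset[OF W])
 have WV: "W \<subseteq> V" and WC: "W \<subseteq> ?C" by (auto simp: W_def)
 have Wne: "W ~= {}"
 proof -
  obtain K d where K: "K \<in> forms {..n} d" "nz K" "basic K \<subseteq> V" using open_form[OF V] by blast
  have V0: "Var 0 \<in> forms {..n} 1" by (rule forms_Var) simp
  have "nz (K * (Var 0 * (h * D)))"
   by (rule nz_mult[OF K(1) forms_mult[OF V0 hD] K(2) nz_mult[OF V0 hD nz_Var0 nz_hD[OF m]]])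
  then obtain v where v: "v \<in> cone X" "peval K v * (peval (Var 0) v * peval (h * D) v) ~= 0" by (auto simp: nz_def)
  have "proj_class v \<in> V" using form_nonzero_class[OF K(1) v(1)] v(2) K(3) by auto
  moreover have "proj_class v \<in> ?C" using form_nonzero_class[OF V0 v(1)] v(2) chart_basic[of 0] by auto
  moreover have "proj_class v \<in> basic (h * D)" using form_nonzero_class[OF hD v(1)] v(2) by auto
  ultimately show ?thesis by (auto simp: W_def)
 qed
 have W0: "v \<in> cone X" "v \<in> cone V" "v \<in> cone ?C" "v 0 ~= 0" "peval (h * D) v ~= 0" if "v \<in> cone W" for v
  using that cone_mono[OF WX] cone_mono[OF WV] cone_mono[OF WC] cone_chart[of 0 v] by (auto simp: W_def basic_def)
 \<comment> \<open>Besides dividing by \<open>h D\<close>, the powers of \<open>x 0\<close> undo the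
   normalization of \<open>basis\<close>. Together with the degree \<open>\<beta> + 2\<close> of
   \<open>T t\<close> the total degree is
   \<open>\<alpha> + \<beta> - \<epsilon> - 2 = 0\<close>.\<close>
 define q where "q v = (if v \<in> cone W then peval (Var 0 ^ \<alpha>) v / peval (h * D * Var 0 ^ 2) v else 0)" for v
 define g where "g k v = (\<Sum>j<27. (if v \<in> cone W then peval (T k j) v else 0) * (if v \<in> cone W then t v j else 0))" for k v
 have q: "hreg (int \<alpha> - int (\<epsilon> + 2 + 2)) W q"
  unfolding q_def[abs_def]
  by (rule hreg_quotient[OF W Var0_power forms_mult[OF hD Var0_power]]) (use W0 in \<open>simp_all only: peval_mult peval_Var0_power, simp_all\<close>)
 have g: "hreg (int \<beta> + 2) W (g k)" if k: "k \<in> Z" for k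
  unfolding g_def[abs_def]
 proof (rule hreg_sum[OF W])
  fix j :: nat assume "j \<in> {..<27}"
  then have j: "j < 27" by simp
  show "hreg (int \<beta> + 2) W (%v. (if v \<in> cone W then peval (T k j) v else 0) * (if v \<in> cone W then t v j else 0))"
   by (rule hreg_mult[OF hreg_form[OF W FM(3)[OF k j]] hreg_restrict[OF Esec_hreg[OF t j] W WV]])
 qed
 define b where "b k v = g k v * q v" for k v
 have "int \<beta> + 2 + (int \<alpha> - int (\<epsilon> + 2 + 2)) = 0" using FM(5) by linarith
 then have b: "hreg 0 W (b k)" if "k \<in> Z" for k unfolding b_def[abs_def] using hreg_mult[OF g[OF that] q] by simp
 let ?a = "%c. fun_on W (b (idx c))"
 have a: "?a c \<in> carrier (reg n X W)" if "c < 9" for c by (rule lift_fun_on(2)[OF W b[OF idx_in[OF that]]])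
 have a_eval: "?a c (proj_class v) = b (idx c) v" if "c < 9" "v \<in> cone W" for c v
  using fun_cong[OF lift_fun_on(1)[OF W b[OF idx_in[OF that(1)]]], of v] W0(1)[OF that(2)] by (simp add: lift_def)
 have "restr E V W t = lincomb (sections E W) 9 ?a (%c. restr E ?C W (basis c))"
 proof (intro ext)
  fix v l
  have L: "lincomb (sections E W) 9 ?a (%c. restr E ?C W (basis c)) v l = (\<Sum>c<9. ?a c (proj_class v) * restr E ?C W (basis c) v l)"
   by (rule lincomb_eval[OF W a restr_basis[OF W WC]])
  show "restr E V W t v l = lincomb (sections E W) 9 ?a (%c. restr E ?C W (basis c)) v l"
  proof (cases "v \<in> cone W & l < 27")
   case True
   then have v: "v \<in> cone W" and l: "l < 27" by auto
   note v0 = W0[OF v]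
   let ?hD = "peval h v * peval D v"
   have hD0: "?hD ~= 0" using v0(5) by simp
   have bq: "b k v * (v 0 ^ 2 / v 0 ^ \<alpha>) = (\<Sum>j<27. peval (T k j) v * t v j) / ?hD" for k
    unfolding b_def q_def peval_mult peval_Var0_power using v v0(4) hD0 by (simp add: g_def field_simps)
   have "(\<Sum>c<9. ?a c (proj_class v) * restr E ?C W (basis c) v l) = (\<Sum>c<9. peval (S l (idx c)) v * (b (idx c) v * (v 0 ^ 2 / v 0 ^ \<alpha>)))"
    using v l v0 by (intro sum.cong refl) (simp add: a_eval basis_def)
   also have "\<dots> = (\<Sum>k\<in>Z. peval (S l k) v * (b k v * (v 0 ^ 2 / v 0 ^ \<alpha>)))"
    by (rule sum_idx)
   also have "\<dots> = (\<Sum>k\<in>Z. peval (S l k) v * ((\<Sum>j<27. peval (T k j) v * t v j) / ?hD))"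
    by (simp only: bq)
   also have "\<dots> = (\<Sum>k\<in>Z. peval (S l k) v * (\<Sum>j<27. peval (T k j) v * t v j)) / ?hD"
    unfolding times_divide_eq_right by (rule sum_divide_distrib[symmetric])
   also have "(\<Sum>k\<in>Z. peval (S l k) v * (\<Sum>j<27. peval (T k j) v * t v j)) = (\<Sum>j<27. (\<Sum>k\<in>Z. peval (S l k) v * peval (T k j) v) * t v j)"
    by (rule sum_mult_sum)
   also have "\<dots> = (\<Sum>j<27. peval h v * peval (P l j) v * t v j)"
    using FM(7)[OF l _ v0(1)] by (intro sum.cong refl) simp
   also have "\<dots> = peval h v * (\<Sum>j<27. peval (P l j) v * t v j)" by (simp add: sum_distrib_left mult.assoc)
   also have "(\<Sum>j<27. peval (P l j) v * t v j) = peval D v * t v l"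
    by (rule kernel_P[OF v0(1) Esec_kernel[OF t] l])
   finally show ?thesis unfolding L using v hD0 by simp
  next
   case False
   then have "restr E ?C W (basis c) v l = 0" for c by (auto simp: basis_def)
   moreover have "restr E V W t v l = 0" using False Esec_high[OF t, of l v] by auto
   ultimately show ?thesis unfolding L by (simp del: E_simps)
  qed
 qed
 then show ?thesis using W Wne WV WC a by (intro exI[of _ W] exI[of _ ?a] conjI allI impI) auto
qed

end

theorem has_rank_E: "has_rank n X E 9"
proof -
 obtain Z \<alpha> \<beta> \<epsilon> S T h where m: "minimal_factors Z \<alpha> \<beta> \<epsilon> S T h"
  using minimal_factors_exist by (elim exE)
 let ?s = "basis Z \<alpha> S"
 \<comment> \<open>Applied to the zero section over \<open>X\<close>, \<open>basis_generates\<close>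
   already provides a nonempty open subset of the chart.\<close>
 have "chart n X 0 ~= {}"
  using basis_generates[OF m zar_open_X _ Esec_zero[OF zar_open_X]] nz_Var0
  by (fastforce simp: nz_def)
 show ?thesis
  unfolding has_rank_def
 proof (rule exI[of _ "chart n X 0"], rule exI[of _ ?s], intro conjI allI impI)
  show "zar_open n X (chart n X 0)" by (rule zar_open_chart) simp
  show "chart n X 0 ~= {}" by fact
  show "?s i \<in> carrier (sections E (chart n X 0))" if "i < 9" for i using basis_in[OF m that] by simp
 next
  fix V a i assume *: "zar_open n X V & V ~= {} & V \<subseteq> chart n X 0 & (\<forall>i<9. a i \<in> carrier (reg n X V)) &
   lincomb (sections E V) 9 a (%i. restr E (chart n X 0) V (?s i)) = \<zero>\<^bsub>sections E V\<^esub>" and i: "i < (9::nat)"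
  show "a i = \<zero>\<^bsub>reg n X V\<^esub>"
   by (rule basis_independent[OF m _ _ _ _ i]) (use * in \<open>blast+\<close>)
 next
  fix V t assume *: "zar_open n X V & V ~= {} & t \<in> carrier (sections E V)"
  then have "zar_open n X V" "V ~= {}" "t \<in> Esec V" by simp_all
  from basis_generates[OF m this]
  show "EX W a. zar_open n X W & W ~= {} & W \<subseteq> chart n X 0 \<inter> V & (\<forall>i<9. a i \<in> carrier (reg n X W)) &
   restr E V W t = lincomb (sections E W) 9 a (%i. restr E (chart n X 0) W (?s i))" .
 qed
qed

end

section \<open>Pullback of the factorization to a good cubic\<close>

lemma formfn_obtain: "formfn n d g ==> EX p. p \<in> forms {..n} d & (ALL v. g v = peval p v)"
 by (auto simp: formfn_def)

lemma formfn_zero: "formfn n d (%v. 0)"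
 unfolding formfn_def by (intro bexI[of _ 0]) (auto simp: fun_eq_iff)

lemma formfn_add: "formfn n d g ==> formfn n d h ==> formfn n d (%v. g v + h v)"
proof -
 assume "formfn n d g" "formfn n d h"
 then obtain p q where "p \<in> forms {..n} d" "g = peval p" "q \<in> forms {..n} d" "h = peval q" by (auto simp: formfn_def)
 then show ?thesis unfolding formfn_def by (intro bexI[of _ "p + q"] forms_add) (auto simp: fun_eq_iff)
qed

lemma formfn_mult: "formfn n d g ==> formfn n e h ==> formfn n (d + e) (%v. g v * h v)"
proof -
 assume "formfn n d g" "formfn n e h"
 then obtain p q where "p \<in> forms {..n} d" "g = peval p" "q \<in> forms {..n} e" "h = peval q" by (auto simp: formfn_def)
 then show ?thesis unfolding formfn_def by (intro bexI[of _ "p * q"] forms_mult) (auto simp: fun_eq_iff)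
qed

lemma formfn_cmult: "formfn n d h ==> formfn n d (%v. c * h v)"
proof -
 assume "formfn n d h"
 then obtain q where "q \<in> forms {..n} d" "h = peval q" by (auto simp: formfn_def)
 then show ?thesis unfolding formfn_def by (intro bexI[of _ "Const c * q"] forms_cmult) (auto simp: fun_eq_iff)
qed

lemma formfn_if: "(b ==> formfn n d g) ==> (\<not> b ==> formfn n d h) ==> formfn n d (%v. if b then g v else h v)"
 by (cases b) simp_all

lemma formfn_sum: "(!!a. a \<in> J ==> formfn n d (g a)) ==> formfn n d (%v. \<Sum>a\<in>J. g a v)"
 by (induction J rule: infinite_finite_induct) (auto intro: formfn_add formfn_zero)

lemma formfn_sum_list: "(!!y. y \<in> set ys ==> formfn n d (g y)) ==> formfn n d (%v. \<Sum>y\<leftarrow>ys. g y v)"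
 by (induction ys) (auto intro: formfn_add formfn_zero)

lemma formfn_linmap: "formfn n 1 (%v. linmap n L v k)"
 unfolding linmap_def
proof (intro formfn_sum formfn_cmult)
 fix a assume "a \<in> {..n}"
 then show "formfn n 1 (%v. v a)" unfolding formfn_def
  by (intro bexI[of _ "Var a"] forms_Var) (simp_all add: meval_single fun_eq_iff del: One_nat_def)
qed

lemma formfn_sharp:
 assumes "!!k. formfn n 1 (%v. y v k)" shows "formfn n 2 (%v. sharp (y v) i)"
 unfolding sharp_def
proof (rule formfn_sum_list)
 fix x :: "int \<times> nat \<times> nat \<times> nat"
 obtain e a b c where x: "x = (e, a, b, c)" by (rule prod_cases4)
 have "formfn n 2 (%v. y v j * y v k)" for j k
  using formfn_mult[OF assms assms, of j k] by (simp add: numeral_2_eq_2)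
 then show "formfn n 2 (%v. case x of (e, a, b, c) => of_int e * ((if i = a then y v b * y v c else 0) +
   (if i = b then y v a * y v c else 0) + (if i = c then y v a * y v b else 0)))"
  unfolding x prod.case by (intro formfn_cmult formfn_add formfn_if formfn_zero)
qed

lemma formfn_hess:
 assumes "!!k. formfn n d (%v. y v k)" shows "formfn n d (%v. hess (y v) i j)"
 unfolding hess_def
proof (rule formfn_sum_list)
 fix x :: "int \<times> nat \<times> nat \<times> nat"
 obtain e a b c where x: "x = (e, a, b, c)" by (rule prod_cases4)
 show "formfn n d (%v. case x of (e, a, b, c) => of_int e *
  ((if i = a & j = b \<or> i = b & j = a then y v c else 0) + (if i = a & j = c \<or> i = c & j = a then y v b else 0)
   + (if i = b & j = c \<or> i = c & j = b then y v a else 0)))"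
  unfolding x prod.case by (intro formfn_cmult formfn_add formfn_if formfn_zero assms)
qed

lemma formfn_cofactor:
 assumes "!!k. formfn n 1 (%v. y v k)" shows "formfn n 2 (%v. cofactor (y v) i j)"
proof -
 have "formfn n 2 (%v. hess (sharp (y v)) i j)" by (rule formfn_hess) (rule formfn_sharp[OF assms])
 moreover have "formfn n 2 (%v. (- 1 / 2) * (y v i * y v j))"
  using formfn_mult[OF assms assms, of i j] by (intro formfn_cmult) (simp add: numeral_2_eq_2)
 ultimately have "formfn n 2 (%v. hess (sharp (y v)) i j + (- 1 / 2) * (y v i * y v j))" by (rule formfn_add)
 then show ?thesis by (simp add: cofactor_def)
qed

context good_cubic
begin

text \<open>\<open>f\<close> is \<open>cubic\<close> after the linear map, so the factors of
  \<open>cubic\<close> at the image point, read as matrices of forms, factor \<open>f\<close>. The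
  trace condition is the chain rule: \<open>dfn\<close> is the gradient \<open>sharp\<close> applied
  to the image of \<open>en\<close>, found by comparing linear terms along a line.\<close>

theorem ulrich_sheaf_of_cubic:
 assumes L: "\<forall>m\<in>monomials {..n} 3. lookup f m = trilin n L L L m"
 shows "\<exists>E :: section_type modsheaf. ulrich_sheaf n (zero_locus {..n} f) 1 E & has_rank n (zero_locus {..n} f) E 9"
proof -
 let ?y = "linmap n L"
 have f_eq: "peval f v = cubic (?y v)" for v
 proof -
  have "peval f v = (\<Sum>m\<in>monomials {..n} 3. lookup f m * meval m v)"
   by (simp only: peval_formval[OF form] formval_def)
  also have "\<dots> = (\<Sum>m\<in>monomials {..n} 3. trilin n L L L m * meval m v)"
   by (rule sum.cong[OF refl]) (simp only: L[rule_format])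
  also have "\<dots> = cubic (?y v)" by (rule trilin_eval)
  finally show ?thesis .
 qed
 define A where "A i j = (SOME p. p \<in> forms {..n} 1 & (ALL v. hess (?y v) i j = peval p v))" for i j
 have A: "A i j \<in> forms {..n} 1" "peval (A i j) v = hess (?y v) i j" for i j v
 proof -
  have "EX p. p \<in> forms {..n} 1 & (ALL v. hess (?y v) i j = peval p v)"
   by (rule formfn_obtain[OF formfn_hess[where y = ?y, OF formfn_linmap, of i j]])
  then have *: "A i j \<in> forms {..n} 1 & (ALL v. hess (?y v) i j = peval (A i j) v)" unfolding A_def by (rule someI_ex)
  show "A i j \<in> forms {..n} 1" by (rule *[THEN conjunct1])
  show "peval (A i j) v = hess (?y v) i j" by (rule *[THEN conjunct2, rule_format, symmetric])
 qed
 define B where "B i j = (SOME p. p \<in> forms {..n} 2 & (ALL v. cofactor (?y v) i j = peval p v))" for i j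
 have B: "B i j \<in> forms {..n} 2" "peval (B i j) v = cofactor (?y v) i j" for i j v
 proof -
  have "EX p. p \<in> forms {..n} 2 & (ALL v. cofactor (?y v) i j = peval p v)"
   by (rule formfn_obtain[OF formfn_cofactor[where y = ?y, OF formfn_linmap, of i j]])
  then have *: "B i j \<in> forms {..n} 2 & (ALL v. cofactor (?y v) i j = peval (B i j) v)" unfolding B_def by (rule someI_ex)
  show "B i j \<in> forms {..n} 2" by (rule *[THEN conjunct1])
  show "peval (B i j) v = cofactor (?y v) i j" by (rule *[THEN conjunct2, rule_format, symmetric])
 qed
 have trace: "(\<Sum>i<27. \<Sum>k<27. peval (A i k) en * peval (B k i) v) = 9 * dfn v" for v
 proof -
  have "linmap n L (%i. v i + s * en i) = (%k. ?y v k + s * ?y en k)" for s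
   by (simp add: linmap_def fun_eq_iff sum.distrib sum_distrib_left algebra_simps)
  then have "peval f v + s * dfn v + s\<^sup>2 * (3 * lc * v n + part 2 v) + s ^ 3 * lc + s ^ 4 * 0 =
   cubic (?y v) + s * (\<Sum>i<27. sharp (?y v) i * ?y en i) + s\<^sup>2 * (\<Sum>i<27. sharp (?y en) i * ?y v i) + s ^ 3 * cubic (?y en) + s ^ 4 * 0" for s
   using f_line[of v s] cubic_line[of "?y v" s "?y en"] f_eq[of "%i. v i + s * en i"] by simp
  then have "dfn v = (\<Sum>i<27. sharp (?y v) i * ?y en i)" by (rule linear_coeff_eq)
  then show ?thesis using trace_hess_cofactor[of "?y en" "?y v"] by (simp add: A(2) B(2))
 qed
 interpret ranked_factorization n f A B
 proof unfold_locales
  show "A i j \<in> forms {..n} 1" "B i j \<in> forms {..n} 2" for i j by (rule A(1), rule B(1))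
  fix i j :: nat assume ij: "i < 27" "j < 27"
  show "(\<Sum>k<27. A i k * B k j) = (if i = j then f else 0)"
   by (rule peval_inject) (simp add: peval_sum A(2) B(2) hess_mult_cofactor[OF ij] f_eq)
  show "(\<Sum>k<27. B i k * A k j) = (if i = j then f else 0)"
   by (rule peval_inject) (simp add: peval_sum A(2) B(2) cofactor_mult_hess[OF ij] f_eq)
 qed (rule trace)
 show ?thesis using ulrich_E has_rank_E unfolding X_def by (intro exI[of _ E] conjI)
qed

end

text \<open>Irreducibility belongs to the conclusion because \<open>has_rank\<close> expresses the
  rank by means of the generic stalk, which presupposes an irreducible hypersurface.\<close>

theorem theorem1p1:
  fixes n :: nat
  assumes "2 \<le> n" and "n \<le> 8"
  shows "\<exists>U. openin (zariski (monomials {..n} 3)) U \<and> U \<noteq> {} \<and>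
    (\<forall>f \<in> forms {..n} 3. f \<noteq> 0 \<and> proj_class (Poly_Mapping.lookup f) \<in> U \<longrightarrow>
       irreducible f \<and>
       (\<exists>E :: section_type modsheaf.
          ulrich_sheaf n (zero_locus {..n} f) 1 E \<and>
          has_rank n (zero_locus {..n} f) E 9))"
proof (rule generic_good_cubic[OF assms])
  fix U assume U: "openin (zariski (monomials {..n} 3)) U" "U \<noteq> {}" and good: "\<And>z. proj_class z \<in> U \<Longrightarrow> good n z"
  show ?thesis
  proof (rule exI[of _ U], intro conjI ballI impI U)
    fix f :: "nat mpoly" assume f: "f \<in> forms {..n} 3" and "f \<noteq> 0 \<and> proj_class (Poly_Mapping.lookup f) \<in> U"
    then have g: "good n (Poly_Mapping.lookup f)" using good by blast
    interpret good_cubic n f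
      by unfold_locales (use assms(1) f g in \<open>simp_all add: good_def\<close>)
    show "irreducible f" by (rule irreducible_f)
    obtain L where "\<forall>m\<in>monomials {..n} 3. Poly_Mapping.lookup f m = trilin n L L L m"
      using g unfolding good_def by (elim conjE exE)
    then show "\<exists>E :: section_type modsheaf. ulrich_sheaf n (zero_locus {..n} f) 1 E \<and> has_rank n (zero_locus {..n} f) E 9"
      by (rule ulrich_sheaf_of_cubic)
  qed
qed

end
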